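(* Let $\mathbb{K}$ be a field of characteristic zero. The $\mathbb{K}$-algebra $H_{\mathbb{K}}(M,U):=\mathbb{K}\otimes_{\mathbb{Z}}H(M,U)$ is isomorphic, as a $\mathbb{K}$-algebra, to the Rook Yokonuma--Hecke algebra $\mathcal{RY}_{d,n}(u)$ under the specialization $d=q-1$ and $u=q$.
   Context: Let $q$ be a power of an odd prime and $n\ge 1$. $M$ is the monoid of all $n\times n$ matrices over $\mathbb{F}_q$; $U\subset M$ is the group of upper unitriangular matrices. $\mathcal{Q}\subset M$ is the submonoid of matrices with at most one nonzero entry in each row and each column. In the monoid algebra $\mathbb{Q}[M]$ (where the zero matrix is a basis element), for $\sigma\in\mathcal{Q}$ of rank $r$ put $T_\sigma=q^{\frac{r(1-r)}{2}}\sum_{x\in U\sigma U}x$. The framed rook algebra is $H(M,U)=\bigoplus_{\sigma\in\mathcal{Q}}\mathbb{Z}T_\sigma$, which is a ring under the product of $\mathbb{Q}[M]$, with unit $T_1$. For integers $n,d\ge1$, $\mathcal{RY}_{d,n}(u)$ is the algebra presented by generators $\mathsf{T}_1,\dots,\mathsf{T}_{n-1}$, $\mathsf{F}_1,\dots,\mathsf{F}_n$, $\mathsf{N}$ and relations (indices ranging over all values for which the expressions make sense): - $\mathsf{T}_i\mathsf{T}_j\mathsf{T}_i=\mathsf{T}_j\mathsf{T}_i\mathsf{T}_j$ if $|i-j|=1$; $\mathsf{T}_i\mathsf{T}_j=\mathsf{T}_j\mathsf{T}_i$ if $|i-j|>1$; - $\mathsf{F}_i^d=1$; $\mathsf{F}_i\mathsf{F}_j=\mathsf{F}_j\mathsf{F}_i$;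 - $\mathsf{T}_i^2=u+(u-1)\mathsf{F}_i^{\frac{d^2-d}{2}}\mathsf{E}_i\mathsf{T}_i$; $\mathsf{T}_i\mathsf{F}_j=\mathsf{F}_{js_i}\mathsf{T}_i$, where $js_i$ is the image of $j$ under the transposition $s_i=(i,i+1)$; - $\mathsf{F}_i\mathsf{N}=\mathsf{N}\mathsf{F}_{i+1}$ for $i<n$; $\mathsf{N}\mathsf{F}_1=\mathsf{F}_n\mathsf{N}=\mathsf{N}$; - $\mathsf{N}^{i+1}\mathsf{T}_i=u\mathsf{N}^{i+1}$ and $\mathsf{T}_i\mathsf{N}^{n-i+1}=u\mathsf{N}^{n-i+1}$ for $1\le i\le n-1$; - $\mathsf{T}_i\mathsf{N}=\mathsf{N}\mathsf{T}_{i+1}$ for $1\le i\le n-2$; $\mathsf{N}\mathsf{T}_1\cdots\mathsf{T}_{n-1}\mathsf{N}=u^{n-1}\mathsf{N}$; where $\mathsf{E}_i=\frac1d\sum_{k=0}^{d-1}\mathsf{F}_i^k\mathsf{F}_{i+1}^{-k}$. For $u$ an indeterminate this is a $\mathbb{K}(u)$-algebra; its specialization at $d=q-1$, $u=q$ is the $\mathbb{K}$-algebra given by the same generators and relations with $d=q-1$ and $u$ replaced by $q$. *)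

theory Defs
  imports
    "HOL-Library.Cardinality"
    "HOL-Computational_Algebra.Primes"
    "HOL-Combinatorics.Transposition"
    "HOL-Algebra.QuotRing"
    "Jordan_Normal_Form.DL_Rank"
begin

section \<open>Algebras\<close>

text \<open>A \<open>K\<close>-algebra over a field given as a type \<open>'k\<close> is a HOL-Algebra record of type
  \<open>('k, 'a) module\<close>: a (not necessarily commutative) ring together with a scalar multiplication.\<close>

definition algebra_iso :: "('k, 'a) module \<Rightarrow> ('k, 'b) module \<Rightarrow> ('a \<Rightarrow> 'b) set" where
  "algebra_iso A B =
     {h \<in> ring_iso A B. \<forall>c. \<forall>x \<in> carrier A. h (c \<odot>\<^bsub>A\<^esub> x) = c \<odot>\<^bsub>B\<^esub> h x}"

definition is_algebra_iso :: "('k, 'a) module \<Rightarrow> ('k, 'b) module \<Rightarrow> bool" where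
  "is_algebra_iso A B \<longleftrightarrow> algebra_iso A B \<noteq> {}"

definition basis_elt :: "'a \<Rightarrow> 'a \<Rightarrow> 'k::zero_neq_one" where
  "basis_elt x = (\<lambda>y. if y = x then 1 else 0)"

text \<open>The monoid algebra of a monoid \<open>G\<close>: finitely supported functions on \<open>carrier G\<close>
  (extended by \<open>0\<close>) with convolution as product. A zero of \<open>G\<close>, if there is one, is
  an ordinary basis element.\<close>

definition monoid_algebra :: "('a, 'b) monoid_scheme \<Rightarrow> ('k::comm_ring_1, 'a \<Rightarrow> 'k) module" where
  "monoid_algebra G =
     \<lparr>carrier = {f. finite {x. f x \<noteq> 0} \<and> {x. f x \<noteq> 0} \<subseteq> carrier G},
      mult = (\<lambda>f g z. \<Sum>(x, y) \<in> {(x, y). f x \<noteq> 0 \<and> g y \<noteq> 0 \<and> x \<otimes>\<^bsub>G\<^esub> y = z}. f x * g y),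
      one = basis_elt \<one>\<^bsub>G\<^esub>,
      zero = (\<lambda>_. 0),
      add = (\<lambda>f g x. f x + g x),
      smult = (\<lambda>c f x. c * f x)\<rparr>"

text \<open>The quotient by a two-sided ideal; the scalar multiplication is induced on cosets in the
  same way as \<^const>\<open>rcoset_mult\<close>.\<close>

definition quotient_algebra :: "('k, 'a) module \<Rightarrow> 'a set \<Rightarrow> ('k, 'a set) module" where
  "quotient_algebra A I =
     \<lparr>carrier = carrier (A Quot I), mult = mult (A Quot I), one = one (A Quot I),
      zero = zero (A Quot I), add = add (A Quot I),
      smult = (\<lambda>c X. \<Union>x\<in>X. I +>\<^bsub>A\<^esub> (c \<odot>\<^bsub>A\<^esub> x))\<rparr>"


section \<open>Extension of scalars from the integers\<close>

text \<open>For a ring \<open>H\<close>, the tensor product \<open>K \<otimes> H\<close> over the integers is the free abelian group on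
  \<open>K \<times> H\<close> modulo the relations of biadditivity. The product \<open>(a \<otimes> x)(b \<otimes> y) = ab \<otimes> xy\<close> is
  obtained by regarding this free abelian group as the integral monoid ring of the
  multiplicative monoid \<open>K \<times> H\<close>: as the set of relations is stable under multiplication by basis
  elements, the ideal it generates is the subgroup it generates. The scalar \<open>c\<close> acts as \<open>c \<otimes> 1\<close>.\<close>

definition pair_monoid :: "('h, 'b) ring_scheme \<Rightarrow> ('k::comm_ring_1 \<times> 'h) monoid" where
  "pair_monoid H =
     \<lparr>carrier = UNIV \<times> carrier H, mult = (\<lambda>(a, x) (b, y). (a * b, x \<otimes>\<^bsub>H\<^esub> y)),
      one = (1, \<one>\<^bsub>H\<^esub>)\<rparr>"

definition pair_ring :: "('h, 'b) ring_scheme \<Rightarrow> (int, 'k::comm_ring_1 \<times> 'h \<Rightarrow> int) module" where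
  "pair_ring H = monoid_algebra (pair_monoid H)"

inductive_set biadditivity_relations ::
    "('h, 'b) ring_scheme \<Rightarrow> ('k::comm_ring_1 \<times> 'h \<Rightarrow> int) set"
  for H :: "('h, 'b) ring_scheme" where
  left: "x \<in> carrier H \<Longrightarrow>
    basis_elt (a + b, x) \<ominus>\<^bsub>pair_ring H\<^esub> (basis_elt (a, x) \<oplus>\<^bsub>pair_ring H\<^esub> basis_elt (b, x))
      \<in> biadditivity_relations H"
| right: "x \<in> carrier H \<Longrightarrow> y \<in> carrier H \<Longrightarrow>
    basis_elt (a, x \<oplus>\<^bsub>H\<^esub> y) \<ominus>\<^bsub>pair_ring H\<^esub> (basis_elt (a, x) \<oplus>\<^bsub>pair_ring H\<^esub> basis_elt (a, y))
      \<in> biadditivity_relations H"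

definition tensor_ring ::
    "('h, 'b) ring_scheme \<Rightarrow> ('k::comm_ring_1 \<times> 'h \<Rightarrow> int) set ring" where
  "tensor_ring H = pair_ring H Quot (Idl\<^bsub>pair_ring H\<^esub> (biadditivity_relations H))"

definition pure_tensor ::
    "('h, 'b) ring_scheme \<Rightarrow> 'k::comm_ring_1 \<Rightarrow> 'h \<Rightarrow> ('k \<times> 'h \<Rightarrow> int) set" where
  "pure_tensor H a x =
     (Idl\<^bsub>pair_ring H\<^esub> (biadditivity_relations H)) +>\<^bsub>pair_ring H\<^esub> basis_elt (a, x)"

definition extend_scalars ::
    "('h, 'b) ring_scheme \<Rightarrow> ('k::comm_ring_1, ('k \<times> 'h \<Rightarrow> int) set) module" where
  "extend_scalars H =
     \<lparr>carrier = carrier (tensor_ring H), mult = mult (tensor_ring H), one = one (tensor_ring H),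
      zero = zero (tensor_ring H), add = add (tensor_ring H),
      smult = (\<lambda>c X. pure_tensor H c \<one>\<^bsub>H\<^esub> \<otimes>\<^bsub>tensor_ring H\<^esub> X)\<rparr>"


section \<open>The framed rook algebra\<close>

definition unitriangular_mats :: "nat \<Rightarrow> 'f::field mat set" where
  "unitriangular_mats n =
     {A \<in> carrier_mat n n. upper_triangular A \<and> (\<forall>i<n. A $$ (i, i) = 1)}"

definition framed_rook_mats :: "nat \<Rightarrow> 'f::field mat set" where
  "framed_rook_mats n =
     {A \<in> carrier_mat n n.
        (\<forall>i<n. card {j. j < n \<and> A $$ (i, j) \<noteq> 0} \<le> 1) \<and>
        (\<forall>j<n. card {i. i < n \<and> A $$ (i, j) \<noteq> 0} \<le> 1)}"

definition double_coset :: "nat \<Rightarrow> 'f::field mat \<Rightarrow> 'f mat set" where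
  "double_coset n \<sigma> = {u * \<sigma> * v | u v. u \<in> unitriangular_mats n \<and> v \<in> unitriangular_mats n}"

definition matrix_monoid_algebra :: "nat \<Rightarrow> (rat, 'f::field mat \<Rightarrow> rat) module" where
  "matrix_monoid_algebra n = monoid_algebra (ring_mat TYPE('f) n ())"

definition rook_basis :: "nat \<Rightarrow> 'f::{field,finite} mat \<Rightarrow> 'f mat \<Rightarrow> rat" where
  "rook_basis n \<sigma> =
     (let r = int (vec_space.rank n \<sigma>)
      in (\<lambda>x. if x \<in> double_coset n \<sigma> then of_nat CARD('f) powi (r * (1 - r) div 2) else 0))"

text \<open>The unit is \<open>T\<^sub>1\<close>, which differs from the unit of the ambient monoid algebra if \<open>n \<ge> 2\<close>.\<close>

definition framed_rook_algebra :: "nat \<Rightarrow> ('f::{field,finite} mat \<Rightarrow> rat) ring" where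
  "framed_rook_algebra n =
     \<lparr>carrier = {(\<lambda>x. \<Sum>\<sigma>\<in>framed_rook_mats n. of_int (c \<sigma>) * rook_basis n \<sigma> x) | c. True},
      mult = mult (matrix_monoid_algebra n),
      one = rook_basis n (1\<^sub>m n),
      zero = zero (matrix_monoid_algebra n),
      add = add (matrix_monoid_algebra n)\<rparr>"


section \<open>The Rook Yokonuma--Hecke algebra\<close>

datatype ry_gen = GenT nat | GenF nat | GenN

definition ry_gens :: "nat \<Rightarrow> ry_gen set" where
  "ry_gens n = GenT ` {1..<n} \<union> GenF ` {1..n} \<union> {GenN}"

definition free_monoid :: "'a set \<Rightarrow> 'a list monoid" where
  "free_monoid S = \<lparr>carrier = lists S, mult = (@), one = []\<rparr>"

text \<open>\<open>A\<close> is any algebra with elements \<open>t i\<close>, \<open>f i\<close>, \<open>\<nu>\<close> in place of the generators. As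
  \<open>f (i + 1)\<close> has order dividing \<open>d\<close>, its power with exponent \<open>-k\<close> is written with
  exponent \<open>d - k\<close>.\<close>

definition ry_E :: "nat \<Rightarrow> ('k::field_char_0, 'a) module \<Rightarrow> (nat \<Rightarrow> 'a) \<Rightarrow> nat \<Rightarrow> 'a" where
  "ry_E d A f i =
     (1 / of_nat d) \<odot>\<^bsub>A\<^esub> (\<Oplus>\<^bsub>A\<^esub>k\<in>{..<d}. f i [^]\<^bsub>A\<^esub> k \<otimes>\<^bsub>A\<^esub> f (i + 1) [^]\<^bsub>A\<^esub> (d - k))"

text \<open>A pair \<open>(l, r)\<close> stands for the relation \<open>l = r\<close>. For \<open>n = 1\<close> the last relation is
  \<open>\<nu> \<nu> = \<nu>\<close>.\<close>

inductive_set ry_relations ::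
    "nat \<Rightarrow> nat \<Rightarrow> 'k::field_char_0 \<Rightarrow> ('k, 'a) module
       \<Rightarrow> (nat \<Rightarrow> 'a) \<Rightarrow> (nat \<Rightarrow> 'a) \<Rightarrow> 'a \<Rightarrow> ('a \<times> 'a) set"
  for d n :: nat and u :: "'k::field_char_0" and A :: "('k, 'a) module" (structure)
    and t f :: "nat \<Rightarrow> 'a" and \<nu> :: 'a where
  braid: "i \<in> {1..<n} \<Longrightarrow> j \<in> {1..<n} \<Longrightarrow> \<bar>int i - int j\<bar> = 1 \<Longrightarrow>
    (t i \<otimes> t j \<otimes> t i, t j \<otimes> t i \<otimes> t j) \<in> ry_relations d n u A t f \<nu>"
| T_comm: "i \<in> {1..<n} \<Longrightarrow> j \<in> {1..<n} \<Longrightarrow> \<bar>int i - int j\<bar> > 1 \<Longrightarrow>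
    (t i \<otimes> t j, t j \<otimes> t i) \<in> ry_relations d n u A t f \<nu>"
| F_pow: "i \<in> {1..n} \<Longrightarrow>
    (f i [^] d, \<one>) \<in> ry_relations d n u A t f \<nu>"
| F_comm: "i \<in> {1..n} \<Longrightarrow> j \<in> {1..n} \<Longrightarrow>
    (f i \<otimes> f j, f j \<otimes> f i) \<in> ry_relations d n u A t f \<nu>"
| T_quadratic: "i \<in> {1..<n} \<Longrightarrow>
    (t i \<otimes> t i,
     u \<odot> \<one> \<oplus> (u - 1) \<odot> (f i [^] ((d\<^sup>2 - d) div 2) \<otimes> ry_E d A f i \<otimes> t i))
      \<in> ry_relations d n u A t f \<nu>"
| T_F: "i \<in> {1..<n} \<Longrightarrow> j \<in> {1..n} \<Longrightarrow>
    (t i \<otimes> f j, f (transpose i (i + 1) j) \<otimes> t i) \<in> ry_relations d n u A t f \<nu>"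
| F_N: "i \<in> {1..<n} \<Longrightarrow>
    (f i \<otimes> \<nu>, \<nu> \<otimes> f (i + 1)) \<in> ry_relations d n u A t f \<nu>"
| N_F1: "(\<nu> \<otimes> f 1, \<nu>) \<in> ry_relations d n u A t f \<nu>"
| Fn_N: "(f n \<otimes> \<nu>, \<nu>) \<in> ry_relations d n u A t f \<nu>"
| Npow_T: "i \<in> {1..<n} \<Longrightarrow>
    (\<nu> [^] (i + 1) \<otimes> t i, u \<odot> (\<nu> [^] (i + 1))) \<in> ry_relations d n u A t f \<nu>"
| T_Npow: "i \<in> {1..<n} \<Longrightarrow>
    (t i \<otimes> \<nu> [^] (n - i + 1), u \<odot> (\<nu> [^] (n - i + 1))) \<in> ry_relations d n u A t f \<nu>"
| T_N: "1 \<le> i \<Longrightarrow> i + 2 \<le> n \<Longrightarrow>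
    (t i \<otimes> \<nu>, \<nu> \<otimes> t (i + 1)) \<in> ry_relations d n u A t f \<nu>"
| N_T_N: "(\<nu> \<otimes> foldr (\<lambda>i x. t i \<otimes> x) [1..<n] \<one> \<otimes> \<nu>, (u ^ (n - 1)) \<odot> \<nu>)
      \<in> ry_relations d n u A t f \<nu>"

definition ry_free :: "nat \<Rightarrow> ('k::field_char_0, ry_gen list \<Rightarrow> 'k) module" where
  "ry_free n = monoid_algebra (free_monoid (ry_gens n))"

definition ry_ideal :: "nat \<Rightarrow> nat \<Rightarrow> 'k::field_char_0 \<Rightarrow> (ry_gen list \<Rightarrow> 'k) set" where
  "ry_ideal d n u =
     Idl\<^bsub>ry_free n\<^esub> {l \<ominus>\<^bsub>ry_free n\<^esub> r | l r.
       (l, r) \<in> ry_relations d n u (ry_free n)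
         (\<lambda>i. basis_elt [GenT i]) (\<lambda>i. basis_elt [GenF i]) (basis_elt [GenN])}"

definition rook_yokonuma_hecke ::
    "nat \<Rightarrow> nat \<Rightarrow> 'k::field_char_0 \<Rightarrow> ('k, (ry_gen list \<Rightarrow> 'k) set) module" where
  "rook_yokonuma_hecke d n u = quotient_algebra (ry_free n) (ry_ideal d n u)"

end

(* Both algebras are compared with the K-span of the T_sigma inside the corner T_1 K[M] T_1. There
   the average over U sigma U times the average over U tau U is the average over U sigma tau U as
   soon as sigma U tau is contained in U sigma tau U, and this turns the defining relations into
   computations with monomial matrices.

   In any algebra satisfying the relations, every word in the generators is an integral combination
   of normal words l N^(n-r) w, where l encodes the set of nonzero rows and w the columns and the
   entries of a rook matrix of rank r. The normal words are in bijection with the rook matrices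
   sigma and evaluate to the T_sigma, which are linearly independent because distinct rook matrices
   have disjoint double cosets. Hence the presented algebra embeds with image the span of the
   T_sigma. Integrality of the straightening also shows that H(M,U) is closed under multiplication,
   and a (x) x |-> a x identifies K (x) H(M,U) with the same span, since every tensor is a sum of
   tensors b_sigma (x) T_sigma. *)

theory Submission
  imports
    Defs
    "HOL-Algebra.Multiplicative_Group"
    "HOL-Algebra.Subrings"
    "Jordan_Normal_Form.Column_Operations"
begin

section \<open>Additive subgroups generated by a set, and multiplication acting on them\<close>

section \<open>Integral spans\<close>

text \<open>Three coefficients have to come out right. The power of \<open>q\<close> in
  \<open>T_\<sigma>\<close>: the double coset of \<open>N^(n-r)\<close> has
  \<open>q^(r(r-1)/2)\<close> elements, and every further letter of a normal word enlarges the
  double coset by exactly the coefficient which that letter carries, so no scalar is left over. The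
  exponent \<open>(d^2-d)/2\<close>: a product of two equal reflections involves the 2 by 2 identity
  that factors a lower unipotent matrix with entry \<open>a\<close> into upper, monomial and upper,
  where the torus entries are \<open>-1/a\<close> and \<open>a\<close>; the sign is a power of a
  primitive root because \<open>q\<close> is odd, and \<open>F_i^((d^2-d)/2)\<close> supplies it.
  The denominator of \<open>E_i\<close>: it is cancelled by \<open>u - 1 = d\<close>, which is why
  rewriting stays integral although the relations are stated over a field. Rewriting by itself only
  shows that normal words span; no dimension of the presented algebra is computed. A power of
  \<open>q\<close> has to be cancelled in one place, where the last relation is generalised from
  \<open>N\<close> to powers of \<open>N\<close>. The corner is forced because \<open>T_1\<close> is
  in general not the identity of the monoid algebra.\<close>

inductive_set int_span :: "('a, 'b) ring_scheme \<Rightarrow> 'a set \<Rightarrow> 'a set"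
  for R (structure) and S where
  zero: "\<zero> \<in> int_span R S"
| base: "x \<in> S \<Longrightarrow> x \<in> int_span R S"
| diff: "x \<in> int_span R S \<Longrightarrow> y \<in> int_span R S \<Longrightarrow> x \<ominus> y \<in> int_span R S"

context ring
begin

lemma int_span_closed: "S \<subseteq> carrier R \<Longrightarrow> x \<in> int_span R S \<Longrightarrow> x \<in> carrier R"
  by (rotate_tac 1, induction rule: int_span.induct) auto

lemma int_span_minus:
  assumes "S \<subseteq> carrier R" "x \<in> int_span R S"
  shows "\<ominus> x \<in> int_span R S"
  using int_span.diff[OF int_span.zero assms(2)] int_span_closed[OF assms]
  by (simp add: minus_eq)

lemma int_span_add:
  assumes "S \<subseteq> carrier R" "x \<in> int_span R S" "y \<in> int_span R S"
  shows "x \<oplus> y \<in> int_span R S"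
  using int_span.diff[OF assms(2) int_span_minus[OF assms(1,3)]]
    int_span_closed[OF assms(1,2)] int_span_closed[OF assms(1,3)]
  by (simp add: minus_eq)

lemma int_span_add_pow:
  assumes "S \<subseteq> carrier R" "x \<in> int_span R S"
  shows "[(k::nat)] \<cdot> x \<in> int_span R S"
proof (induction k)
  case 0
  show ?case by (simp add: int_span.zero)
next
  case (Suc k)
  then show ?case
    using int_span_add[OF assms(1)] assms(2) int_span_closed[OF assms] by simp
qed

lemma int_span_subset:
  assumes "S \<subseteq> int_span R S'" "x \<in> int_span R S"
  shows "x \<in> int_span R S'"
  using assms(2) by induction (use assms(1) in \<open>auto intro: int_span.intros\<close>)

lemma int_span_mono: "S \<subseteq> S' \<Longrightarrow> int_span R S \<subseteq> int_span R S'"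
  using int_span_subset[of S S'] int_span.base[of _ S' R] by blast

lemma int_span_finsum:
  assumes "S \<subseteq> carrier R" "finite A" "\<And>a. a \<in> A \<Longrightarrow> h a \<in> int_span R S"
  shows "(\<Oplus>a\<in>A. h a) \<in> int_span R S"
  using assms(2,3)
proof (induction rule: finite_induct)
  case empty
  show ?case by (simp add: int_span.zero)
next
  case (insert a A)
  have "h \<in> insert a A \<rightarrow> carrier R"
    using insert.prems int_span_closed[OF assms(1)] by blast
  then show ?case
    using insert int_span_add[OF assms(1)] by (simp add: Pi_def)
qed

text \<open>An additive map is controlled by the generators of the span. Left and right
  multiplication by a fixed element, below, are the two instances that matter.\<close>

lemma int_span_image:
  assumes "S \<subseteq> carrier R" "x \<in> int_span R S"
    and "h \<zero> = \<zero>" "\<And>x y. x \<in> carrier R \<Longrightarrow> y \<in> carrier R \<Longrightarrow> h (x \<ominus> y) = h x \<ominus> h y"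
    and "\<And>x. x \<in> S \<Longrightarrow> h x \<in> int_span R S'"
  shows "h x \<in> int_span R S'"
  using assms(2)
  by induction (use assms int_span_closed[OF assms(1)] in \<open>auto intro: int_span.intros\<close>)

lemma int_span_mult_left:
  assumes "S \<subseteq> carrier R" "c \<in> carrier R" "x \<in> int_span R S"
    and "\<And>x. x \<in> S \<Longrightarrow> c \<otimes> x \<in> int_span R S'"
  shows "c \<otimes> x \<in> int_span R S'"
  by (rule int_span_image[of S x "\<lambda>x. c \<otimes> x"])
    (use assms in \<open>auto simp: minus_eq r_distr r_minus\<close>)

lemma int_span_mult_right:
  assumes "S \<subseteq> carrier R" "c \<in> carrier R" "x \<in> int_span R S"
    and "\<And>x. x \<in> S \<Longrightarrow> x \<otimes> c \<in> int_span R S'"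
  shows "x \<otimes> c \<in> int_span R S'"
  by (rule int_span_image[of S x "\<lambda>x. x \<otimes> c"])
    (use assms in \<open>auto simp: minus_eq l_distr l_minus\<close>)

end

section \<open>Words in the generators and the candidates for a basis\<close>

section \<open>Normal words\<close>

definition word_eval :: "('a, 'b) monoid_scheme \<Rightarrow> ('g \<Rightarrow> 'a) \<Rightarrow> 'g list \<Rightarrow> 'a" where
  "word_eval G h w = foldr (\<lambda>g x. h g \<otimes>\<^bsub>G\<^esub> x) w \<one>\<^bsub>G\<^esub>"

lemma word_eval_Nil [simp]: "word_eval G h [] = \<one>\<^bsub>G\<^esub>"
  and word_eval_Cons [simp]: "word_eval G h (g # w) = h g \<otimes>\<^bsub>G\<^esub> word_eval G h w"
  by (simp_all add: word_eval_def)

lemma (in monoid) word_eval_closed: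
  "(\<And>g. g \<in> set w \<Longrightarrow> h g \<in> carrier G) \<Longrightarrow> word_eval G h w \<in> carrier G"
  by (induction w) auto

lemma (in monoid) word_eval_append:
  assumes "\<And>g. g \<in> set v \<union> set w \<Longrightarrow> h g \<in> carrier G"
  shows "word_eval G h (v @ w) = word_eval G h v \<otimes> word_eval G h w"
  using assms
proof (induction v)
  case Nil
  then show ?case by (simp add: word_eval_closed)
next
  case (Cons g v)
  then show ?case by (simp add: word_eval_closed m_assoc)
qed

lemma (in monoid) word_eval_replicate:
  assumes "h g \<in> carrier G"
  shows "word_eval G h (replicate k g) = h g [^] k"
  using assms by (induction k) (simp, metis nat_pow_Suc2 replicate_Suc word_eval_Cons)

text \<open>\<open>run m a\<close> is the word \<open>T\<^bsub>m-1\<^esub> \<dots> T\<^sub>a\<close> of a cycle. The words in \<open>left_words m r\<close> are the minimal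
  coset representatives of the permutations of \<open>{1..m}\<close> modulo those which fix \<open>{1..r}\<close> setwise,
  and \<open>left_words m r\<close> corresponds to the set of nonzero rows. A word in \<open>right_words d k j\<close> acts
  on the indices up to \<open>k + j\<close>; its factor \<open>F\<^sub>m\<^sup>b T\<^bsub>m-1\<^esub> \<dots> T\<^sub>a\<close> encodes a nonzero entry in column \<open>a\<close>.\<close>

definition run :: "nat \<Rightarrow> nat \<Rightarrow> ry_gen list" where
  "run m a = map GenT (rev [a..<m])"

fun left_words :: "nat \<Rightarrow> nat \<Rightarrow> ry_gen list set" where
  "left_words 0 0 = {[]}"
| "left_words 0 (Suc r) = {}"
| "left_words (Suc m) 0 = left_words m 0"
| "left_words (Suc m) (Suc r) =
     left_words m (Suc r) \<union> (\<lambda>w. w @ run (Suc m) (Suc r)) ` left_words m r"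

fun right_words :: "nat \<Rightarrow> nat \<Rightarrow> nat \<Rightarrow> ry_gen list set" where
  "right_words d k 0 = {[]}"
| "right_words d k (Suc j) =
     {w @ replicate b (GenF (Suc (k + j))) @ run (Suc (k + j)) a | w a b.
        w \<in> right_words d k j \<and> a \<in> {1..Suc (k + j)} \<and> b < d}"

definition normal_words :: "nat \<Rightarrow> nat \<Rightarrow> ry_gen list set" where
  "normal_words d n =
     {l @ replicate (n - r) GenN @ w | l r w.
        r \<le> n \<and> l \<in> left_words n r \<and> w \<in> right_words d (n - r) r}"

lemma run_same [simp]: "m \<le> a \<Longrightarrow> run m a = []"
  by (simp add: run_def)

lemma run_Suc: "a \<le> m \<Longrightarrow> run (Suc m) a = GenT m # run m a"
  by (simp add: run_def)

lemma run_snoc: "a < m \<Longrightarrow> run m a = run m (Suc a) @ [GenT a]"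
  by (simp add: run_def upt_conv_Cons)

lemma set_run: "set (run m a) = GenT ` {a..<m}"
  by (simp add: run_def)

lemma left_words_mono: "left_words m r \<subseteq> left_words (Suc m) r"
  by (cases r) auto

lemma left_words_Suc:
  "l \<in> left_words (Suc m) r \<longleftrightarrow> l \<in> left_words m r \<or>
    (\<exists>r' l'. r = Suc r' \<and> l' \<in> left_words m r' \<and> l = l' @ run (Suc m) (Suc r'))"
  by (cases r) auto

lemma left_words_le: "l \<in> left_words m r \<Longrightarrow> r \<le> m"
proof (induction m r arbitrary: l rule: left_words.induct)
  case (4 m r)
  then consider "l \<in> left_words m (Suc r)" | l' where "l' \<in> left_words m r" by auto
  then show ?case using 4(1,2) by cases fastforce+
qed auto

lemma set_left_words: "l \<in> left_words m r \<Longrightarrow> set l \<subseteq> GenT ` {1..<m}"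
proof (induction m r arbitrary: l rule: left_words.induct)
  case (3 m)
  have "set l \<subseteq> GenT ` {1..<m}" using 3 by simp
  also have "\<dots> \<subseteq> GenT ` {1..<Suc m}" by auto
  finally show ?case .
next
  case (4 m r)
  have *: "GenT ` {1..<m} \<subseteq> GenT ` {1..<Suc m}" by auto
  from 4(3) consider "l \<in> left_words m (Suc r)"
    | l' where "l' \<in> left_words m r" "l = l' @ run (Suc m) (Suc r)"
    by auto
  then show ?case
  proof cases
    case 1
    then show ?thesis using 4(1) * by blast
  next
    case (2 l')
    then show ?thesis using 4(2)[of l'] * by (auto simp: set_run)
  qed
qed auto

lemma set_right_words:
  "w \<in> right_words d k j \<Longrightarrow> set w \<subseteq> GenF ` {1..k + j} \<union> GenT ` {1..<k + j}"
proof (induction j arbitrary: w)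
  case (Suc j)
  from Suc.prems obtain v a b where v: "v \<in> right_words d k j" "a \<in> {1..Suc (k + j)}"
    "w = v @ replicate b (GenF (Suc (k + j))) @ run (Suc (k + j)) a"
    by auto
  have "set v \<subseteq> GenF ` {1..k + Suc j} \<union> GenT ` {1..<k + Suc j}"
    using Suc.IH[OF v(1)] by (fastforce simp: image_iff)
  then show ?case using v(2,3) by (auto simp: set_run)
qed simp

text \<open>In rank \<open>n\<close> there is no zero row to sort past, so the normal words of full
  rank are bare right words.\<close>

lemma left_words_full: "left_words m m = {[]}"
proof -
  have "left_words m (Suc m) = {}" for m using left_words_le by fastforce
  then show ?thesis by (induction m) auto
qed

section \<open>Rewriting words as integral combinations of normal words\<close>

section \<open>Straightening in an algebra with the Rook Yokonuma--Hecke relations\<close>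

text \<open>What rewriting consumes, with the ground field removed: scalars are natural multiples,
  and the quadratic relation is weakened to membership in an integral span. The trace left by
  characteristic zero is \<open>cancel_q\<close>. The locale is instantiated twice, for the
  presented algebra and for the algebra of matrices.\<close>

locale ry_ring = ring R for R (structure) +
  fixes q d n :: nat and gen :: "ry_gen \<Rightarrow> 'a"
  assumes gen_closed [simp]: "gen g \<in> carrier R"
    and d_pos: "d > 0"
    and cancel_q: "x \<in> carrier R \<Longrightarrow> y \<in> carrier R \<Longrightarrow> [q] \<cdot> x = [q] \<cdot> y \<Longrightarrow> x = y"
    and braid: "1 \<le> i \<Longrightarrow> Suc i < n \<Longrightarrow>
      gen (GenT i) \<otimes> gen (GenT (Suc i)) \<otimes> gen (GenT i) =
        gen (GenT (Suc i)) \<otimes> gen (GenT i) \<otimes> gen (GenT (Suc i))"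
    and T_comm: "1 \<le> i \<Longrightarrow> Suc i < j \<Longrightarrow> j < n \<Longrightarrow>
      gen (GenT i) \<otimes> gen (GenT j) = gen (GenT j) \<otimes> gen (GenT i)"
    and F_pow: "1 \<le> i \<Longrightarrow> i \<le> n \<Longrightarrow> gen (GenF i) [^] d = \<one>"
    and F_comm: "i \<in> {1..n} \<Longrightarrow> j \<in> {1..n} \<Longrightarrow>
      gen (GenF i) \<otimes> gen (GenF j) = gen (GenF j) \<otimes> gen (GenF i)"
    and quadratic: "1 \<le> i \<Longrightarrow> i < n \<Longrightarrow>
      gen (GenT i) \<otimes> gen (GenT i) \<in> int_span R
        (insert \<one> {gen (GenF i) [^] (a::nat) \<otimes> gen (GenF (Suc i)) [^] (b::nat) \<otimes> gen (GenT i) | a b. True})"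
    and T_F: "i \<in> {1..<n} \<Longrightarrow> j \<in> {1..n} \<Longrightarrow>
      gen (GenT i) \<otimes> gen (GenF j) = gen (GenF (transpose i (Suc i) j)) \<otimes> gen (GenT i)"
    and F_N: "1 \<le> i \<Longrightarrow> i < n \<Longrightarrow> gen (GenF i) \<otimes> gen GenN = gen GenN \<otimes> gen (GenF (Suc i))"
    and N_F1: "gen GenN \<otimes> gen (GenF 1) = gen GenN"
    and Fn_N: "gen (GenF n) \<otimes> gen GenN = gen GenN"
    and Npow_T: "1 \<le> i \<Longrightarrow> i < n \<Longrightarrow> gen GenN [^] Suc i \<otimes> gen (GenT i) = [q] \<cdot> (gen GenN [^] Suc i)"
    and T_Npow: "1 \<le> i \<Longrightarrow> i < n \<Longrightarrow>
      gen (GenT i) \<otimes> gen GenN [^] Suc (n - i) = [q] \<cdot> (gen GenN [^] Suc (n - i))"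
    and T_N: "1 \<le> i \<Longrightarrow> Suc (Suc i) \<le> n \<Longrightarrow>
      gen (GenT i) \<otimes> gen GenN = gen GenN \<otimes> gen (GenT (Suc i))"
    and N_T_N: "gen GenN \<otimes> word_eval R gen (map GenT [1..<n]) \<otimes> gen GenN = [(q ^ (n - 1))] \<cdot> gen GenN"
begin

abbreviation t where "t i \<equiv> gen (GenT i)"
abbreviation f where "f i \<equiv> gen (GenF i)"
abbreviation N where "N \<equiv> gen GenN"
abbreviation ev where "ev \<equiv> word_eval R gen"
abbreviation cyc where "cyc m a \<equiv> ev (run m a)"

lemma ev_closed [simp]: "ev w \<in> carrier R"
  by (simp add: word_eval_closed)

lemma ev_append: "ev (v @ w) = ev v \<otimes> ev w"
  by (simp add: word_eval_append)

lemma ev_replicate: "ev (replicate k g) = gen g [^] k"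
  by (simp add: word_eval_replicate)

lemma pow_move:
  assumes "x \<otimes> y = z \<otimes> x" "x \<in> carrier R" "y \<in> carrier R" "z \<in> carrier R"
  shows "x \<otimes> y [^] (k::nat) = z [^] k \<otimes> x"
proof (induction k)
  case (Suc k)
  have "x \<otimes> y [^] Suc k = (x \<otimes> y [^] k) \<otimes> y" using assms by (simp add: m_assoc)
  also have "\<dots> = z [^] k \<otimes> (x \<otimes> y)" using assms Suc by (simp add: m_assoc)
  also have "\<dots> = z [^] Suc k \<otimes> x" using assms by (simp add: m_assoc)
  finally show ?case .
qed (use assms in simp)

section \<open>Commutation rules for the cycles \<open>T_(m-1) ... T_a\<close>\<close>

subsection \<open>Cycles\<close>

lemma cyc_Suc: "a \<le> m \<Longrightarrow> cyc (Suc m) a = t m \<otimes> cyc m a"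
  by (simp add: run_Suc)

lemma cyc_snoc: "a < m \<Longrightarrow> cyc m a = cyc m (Suc a) \<otimes> t a"
  by (subst run_snoc) (simp_all add: ev_append)

lemma T_comm_ev:
  assumes "set w \<subseteq> GenT ` A" "1 \<le> i" "i < n"
    and "\<And>j. j \<in> A \<Longrightarrow> 1 \<le> j \<and> j < n \<and> (Suc i < j \<or> Suc j < i)"
  shows "t i \<otimes> ev w = ev w \<otimes> t i"
  using assms(1)
proof (induction w)
  case (Cons g w)
  then obtain j where j: "g = GenT j" "j \<in> A" by auto
  have "t i \<otimes> t j = t j \<otimes> t i"
    using assms(4)[OF j(2)] T_comm[of i j] T_comm[of j i] assms(2,3) by auto
  then have "t i \<otimes> ev (g # w) = t j \<otimes> (t i \<otimes> ev w)"
    using j by (simp add: m_assoc[symmetric])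
  then show ?case using Cons j by (simp add: m_assoc)
qed simp

lemma cyc_comm:
  assumes "1 \<le> i" "i < n" "1 \<le> a" "m \<le> n" "Suc i < a \<or> m < i"
  shows "t i \<otimes> cyc m a = cyc m a \<otimes> t i"
  by (rule T_comm_ev[where A = "{a..<m}"]) (use assms in \<open>auto simp: set_run\<close>)

text \<open>Coming from the right, \<open>T_i\<close> commutes with
  \<open>T_a, ..., T_(i-2)\<close>; the braid relation turns \<open>T_i T_(i-1) T_i\<close> into
  \<open>T_(i-1) T_i T_(i-1)\<close>; and \<open>T_(i-1)\<close> commutes with the remaining
  factors.\<close>

lemma cyc_shift:
  assumes "1 \<le> a" "a < i" "i < m" "m \<le> n"
  shows "cyc m a \<otimes> t i = t (i - 1) \<otimes> cyc m a"
  using assms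
proof (induction m)
  case (Suc m)
  show ?case
  proof (cases "i = m")
    case False
    have c: "t m \<otimes> t (i - 1) = t (i - 1) \<otimes> t m"
      using T_comm[of "i - 1" m] Suc.prems False by simp
    have "cyc (Suc m) a \<otimes> t i = t m \<otimes> (cyc m a \<otimes> t i)"
      using Suc.prems by (simp add: cyc_Suc m_assoc)
    also have "\<dots> = t m \<otimes> t (i - 1) \<otimes> cyc m a"
      using Suc False by (simp add: m_assoc)
    also have "\<dots> = t (i - 1) \<otimes> cyc (Suc m) a"
      unfolding c using Suc.prems by (simp add: cyc_Suc m_assoc)
    finally show ?thesis .
  next
    case True
    then obtain p where p: "m = Suc p" "a \<le> p" using Suc.prems by (cases m) auto
    have b: "t m \<otimes> t p \<otimes> t m = t p \<otimes> t m \<otimes> t p"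
      using braid[of p] p Suc.prems by simp
    have c: "t m \<otimes> cyc p a = cyc p a \<otimes> t m"
      by (rule cyc_comm) (use p Suc.prems in auto)
    have "cyc (Suc m) a \<otimes> t i = t m \<otimes> t p \<otimes> (cyc p a \<otimes> t m)"
      using p True by (simp add: cyc_Suc m_assoc)
    also have "\<dots> = (t m \<otimes> t p \<otimes> t m) \<otimes> cyc p a"
      by (simp add: c[symmetric] m_assoc)
    also have "\<dots> = t p \<otimes> (t m \<otimes> (t p \<otimes> cyc p a))"
      by (simp add: b m_assoc)
    finally show ?thesis using p True by (simp add: cyc_Suc)
  qed
qed simp

text \<open>The factors of the second cycle cross the first one by one through
  \<open>cyc_shift\<close>. Needed where two consecutive runs meet in a left word.\<close>

lemma cyc_cyc:
  assumes "1 \<le> a" "m' < m" "m \<le> n" "a \<le> m'"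
  shows "cyc m a \<otimes> cyc (Suc m') (Suc a) = cyc m' a \<otimes> cyc m a"
  using assms
proof (induction m')
  case (Suc m')
  show ?case
  proof (cases "a = Suc m'")
    case False
    then have a: "a \<le> m'" using Suc by simp
    have "cyc m a \<otimes> cyc (Suc (Suc m')) (Suc a) = (cyc m a \<otimes> t (Suc m')) \<otimes> cyc (Suc m') (Suc a)"
      using a by (simp add: cyc_Suc m_assoc)
    also have "\<dots> = t m' \<otimes> (cyc m a \<otimes> cyc (Suc m') (Suc a))"
      using a Suc.prems by (subst cyc_shift) (simp_all add: m_assoc)
    also have "\<dots> = cyc (Suc m') a \<otimes> cyc m a"
      using a Suc by (simp add: cyc_Suc m_assoc)
    finally show ?thesis .
  qed simp
qed simp

lemma cyc_F:
  assumes "1 \<le> a" "a \<le> m" "m \<le> n" "1 \<le> j" "j \<le> n"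
  shows "cyc m a \<otimes> f j = f (if j = a then m else if a < j \<and> j \<le> m then j - 1 else j) \<otimes> cyc m a"
  using assms
proof (induction m)
  case (Suc m)
  show ?case
  proof (cases "a = Suc m")
    case False
    define j' where "j' = (if j = a then m else if a < j \<and> j \<le> m then j - 1 else j)"
    have j': "j' \<in> {1..n}" using Suc.prems False by (auto simp: j'_def)
    have "cyc (Suc m) a \<otimes> f j = t m \<otimes> (cyc m a \<otimes> f j)"
      using False Suc.prems by (simp add: cyc_Suc m_assoc)
    also have "\<dots> = (t m \<otimes> f j') \<otimes> cyc m a"
      using Suc False by (simp add: j'_def m_assoc)
    also have "\<dots> = f (transpose m (Suc m) j') \<otimes> cyc (Suc m) a"
      using Suc.prems False j' by (subst T_F) (simp_all add: cyc_Suc m_assoc)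
    also have "transpose m (Suc m) j' =
        (if j = a then Suc m else if a < j \<and> j \<le> Suc m then j - 1 else j)"
      using Suc.prems False by (auto simp: j'_def transpose_def)
    finally show ?thesis .
  qed (use Suc.prems in auto)
qed simp

lemma F_cyc:
  assumes "1 \<le> a" "a \<le> m" "m \<le> n" "1 \<le> j" "j \<le> n"
  shows "\<exists>j'\<in>{1..n}. f j \<otimes> cyc m a = cyc m a \<otimes> f j'"
proof -
  \<comment> \<open>The inverse of the index permutation in \<open>cyc_F\<close>.\<close>
  define j' where "j' = (if j = m then a else if a \<le> j \<and> j < m then Suc j else j)"
  have "j' \<in> {1..n}" "cyc m a \<otimes> f j' = f j \<otimes> cyc m a"
    using assms cyc_F[of a m j'] by (auto simp: j'_def split: if_splits)
  then show ?thesis by metis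
qed

section \<open>Right words behind a power of \<open>N\<close>: stability under right
  multiplication\<close>

subsection \<open>The right factor\<close>

text \<open>The power of \<open>N\<close> is kept in front because it disposes of what the words
  cannot absorb: for small indices \<open>N^k F_i = N^k\<close> and
  \<open>N^k T_i = q N^k\<close>.\<close>

definition right_span where
  "right_span k j = int_span R ((\<lambda>w. N [^] k \<otimes> ev w) ` right_words d k j)"

lemma right_span_closed [simp]: "x \<in> right_span k j \<Longrightarrow> x \<in> carrier R"
  unfolding right_span_def by (rule int_span_closed) auto

lemma right_span_add_pow: "x \<in> right_span k j \<Longrightarrow> [(c::nat)] \<cdot> x \<in> right_span k j"
  unfolding right_span_def by (rule int_span_add_pow) auto

lemma right_span_mult:
  assumes "x \<in> right_span k j" "c \<in> carrier R"
    and "\<And>w. w \<in> right_words d k j \<Longrightarrow> N [^] k \<otimes> ev w \<otimes> c \<in> right_span k j'"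
  shows "x \<otimes> c \<in> right_span k j'"
  using assms unfolding right_span_def by (intro int_span_mult_right[of _ c x]) auto

lemma F_mod: "i \<in> {1..n} \<Longrightarrow> f i [^] (b::nat) = f i [^] (b mod d)"
proof -
  assume i: "i \<in> {1..n}"
  have "f i [^] (d * (b div d) + b mod d) = (f i [^] d) [^] (b div d) \<otimes> f i [^] (b mod d)"
    by (simp only: nat_pow_mult[symmetric] nat_pow_pow gen_closed)
  then show ?thesis using i by (simp add: F_pow)
qed

text \<open>The exponent \<open>b\<close> is arbitrary, so that reduction modulo \<open>d\<close> is
  dealt with here once and for all.\<close>

lemma right_span_step:
  assumes "x \<in> right_span k j" "a \<in> {1..Suc (k + j)}" "Suc (k + j) \<le> n"
  shows "x \<otimes> (f (Suc (k + j)) [^] (b::nat) \<otimes> cyc (Suc (k + j)) a) \<in> right_span k (Suc j)"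
proof (rule right_span_mult[OF assms(1)])
  fix w assume w: "w \<in> right_words d k j"
  let ?w = "w @ replicate (b mod d) (GenF (Suc (k + j))) @ run (Suc (k + j)) a"
  have "?w \<in> right_words d k (Suc j)"
    using w assms(2) mod_less_divisor[OF d_pos, of b] unfolding right_words.simps by blast
  then have "N [^] k \<otimes> ev ?w \<in> right_span k (Suc j)"
    unfolding right_span_def by (intro int_span.base imageI)
  moreover have "f (Suc (k + j)) [^] b = f (Suc (k + j)) [^] (b mod d)"
    using assms by (intro F_mod) simp
  ultimately show "N [^] k \<otimes> ev w \<otimes> (f (Suc (k + j)) [^] b \<otimes> cyc (Suc (k + j)) a)
      \<in> right_span k (Suc j)"
    by (simp add: ev_append ev_replicate m_assoc)
qed simp

text \<open>Moving left through an \<open>N\<close> lowers the index of \<open>F_i\<close> by one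
  until \<open>F_1\<close> is reached, which \<open>N\<close> absorbs.\<close>

lemma Npow_F: "1 \<le> i \<Longrightarrow> i \<le> k \<Longrightarrow> k \<le> n \<Longrightarrow> N [^] k \<otimes> f i = N [^] k"
proof (induction k arbitrary: i)
  case (Suc k)
  show ?case
  proof (cases "i = 1")
    case True
    then show ?thesis using N_F1 by (simp add: m_assoc)
  next
    case False
    then obtain i' where i': "i = Suc i'" "1 \<le> i'" using Suc.prems by (cases i) auto
    have "N [^] Suc k \<otimes> f i = N [^] k \<otimes> (N \<otimes> f i)" by (simp add: m_assoc)
    also have "\<dots> = (N [^] k \<otimes> f i') \<otimes> N"
      using F_N[of i'] i' Suc.prems by (simp add: m_assoc)
    also have "\<dots> = N [^] Suc k" using Suc i' by simp
    finally show ?thesis .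
  qed
qed simp

lemma Npow_T_less:
  assumes "1 \<le> i" "i < k" "k \<le> n"
  shows "N [^] k \<otimes> t i = [q] \<cdot> (N [^] k)"
proof -
  have "N [^] k = N [^] (k - Suc i) \<otimes> N [^] Suc i"
    using assms by (simp only: nat_pow_mult gen_closed) simp
  then show ?thesis
    using assms Npow_T[of i] by (simp add: m_assoc add_pow_rdistr del: nat_pow_Suc)
qed

text \<open>A right word ends with a coset representative \<open>F_m^b T_(m-1) ... T_a\<close> of
  the top level \<open>m\<close>. A generator multiplied from the right either crosses this factor
  and becomes a generator of the level below, which the induction on \<open>j\<close> handles, or it
  changes \<open>a\<close> or \<open>b\<close>, or it squares the last reflection
  \<open>T_a\<close>.\<close>

lemma right_span_generators:
  assumes "x \<in> right_span k j" "k + j \<le> n"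
  shows "i \<in> {1..k + j} \<Longrightarrow> x \<otimes> f i \<in> right_span k j"
    and "i \<in> {1..<k + j} \<Longrightarrow> x \<otimes> t i \<in> right_span k j"
proof -
  \<comment> \<open>One induction for both kinds of generators, since expanding a square of
    \<open>T_a\<close> leaves powers of \<open>F\<close>.\<close>
  have "(\<forall>x\<in>right_span k j. \<forall>i\<in>{1..k + j}. x \<otimes> f i \<in> right_span k j) \<and>
    (\<forall>x\<in>right_span k j. \<forall>i\<in>{1..<k + j}. x \<otimes> t i \<in> right_span k j)"
    using assms(2)
  proof (induction j)
    case 0
    have base: "N [^] k \<in> right_span k 0"
      unfolding right_span_def by (rule int_span.base) simp
    show ?case
    proof (intro conjI ballI)
      fix x i assume x: "x \<in> right_span k 0" and i: "i \<in> {1..k + 0}"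
      show "x \<otimes> f i \<in> right_span k 0"
        by (rule right_span_mult[OF x]) (use 0 base i in \<open>simp_all add: Npow_F\<close>)
    next
      fix x i assume x: "x \<in> right_span k 0" and i: "i \<in> {1..<k + 0}"
      show "x \<otimes> t i \<in> right_span k 0"
        by (rule right_span_mult[OF x])
          (use 0 base i in \<open>simp_all add: Npow_T_less right_span_add_pow\<close>)
    qed
  next
    case (Suc j)
    define m where "m = Suc (k + j)"
    have m: "k + j = m - 1" "k + Suc j = m" "1 \<le> m" "m \<le> n" using Suc.prems by (auto simp: m_def)
    have IHf: "x \<otimes> f i \<in> right_span k j" if "x \<in> right_span k j" "i \<in> {1..m - 1}" for x i
      using Suc that m by auto
    have IHt: "x \<otimes> t i \<in> right_span k j" if "x \<in> right_span k j" "i \<in> {1..<m - 1}" for x i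
      using Suc that m by auto
    have IHfp: "x \<otimes> f i [^] (p::nat) \<in> right_span k j"
      if "x \<in> right_span k j" "i \<in> {1..m - 1}" for x i p
    proof (induction p)
      case (Suc p)
      then show ?case
        using IHf[OF Suc that(2)] that(1) by (simp add: m_assoc)
    qed (use that in simp)
    have step: "x \<otimes> (f m [^] (b::nat) \<otimes> cyc m a) \<in> right_span k (Suc j)"
      if "x \<in> right_span k j" "a \<in> {1..m}" for x a b
      using right_span_step[of x k j a b] that m(4) unfolding m_def by simp
    have base: "\<exists>v\<in>right_span k j. \<exists>a\<in>{1..m}. \<exists>b. N [^] k \<otimes> ev w = v \<otimes> (f m [^] (b::nat) \<otimes> cyc m a)"
      if "w \<in> right_words d k (Suc j)" for w
    proof -
      from that obtain w' a b where w': "w' \<in> right_words d k j" "a \<in> {1..m}"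
        "w = w' @ replicate b (GenF m) @ run m a"
        by (auto simp: m_def)
      have "N [^] k \<otimes> ev w' \<in> right_span k j"
        unfolding right_span_def using w'(1) by (intro int_span.base imageI)
      moreover have "N [^] k \<otimes> ev w = N [^] k \<otimes> ev w' \<otimes> (f m [^] b \<otimes> cyc m a)"
        by (simp add: w'(3) ev_append ev_replicate m_assoc)
      ultimately show ?thesis using w'(2) by blast
    qed
    have F: "v \<otimes> (f m [^] (b::nat) \<otimes> cyc m a) \<otimes> f i \<in> right_span k (Suc j)"
      if v: "v \<in> right_span k j" and a: "a \<in> {1..m}" and i: "i \<in> {1..m}" for v a b i
    proof -
      define i' where "i' = (if i = a then m else if a < i \<and> i \<le> m then i - 1 else i)"
      have i': "i' \<in> {1..m}" "i = a \<Longrightarrow> i' = m" "i \<noteq> a \<Longrightarrow> i' \<in> {1..m - 1}"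
        using a i by (auto simp: i'_def)
      have "cyc m a \<otimes> f i = f i' \<otimes> cyc m a"
        using cyc_F[of a m i] a i m by (simp add: i'_def)
      then have eq: "v \<otimes> (f m [^] b \<otimes> cyc m a) \<otimes> f i = v \<otimes> (f m [^] b \<otimes> f i' \<otimes> cyc m a)"
        using v by (simp add: m_assoc)
      show ?thesis
      proof (cases "i = a")
        case True
        then show ?thesis
          using step[OF v a, of "Suc b"] eq i'(2) by simp
      next
        case False
        have "f m [^] b \<otimes> f i' = f i' \<otimes> f m [^] b"
          using F_comm[of i' m] i' m by (intro pow_move[symmetric]) auto
        then have "v \<otimes> (f m [^] b \<otimes> f i' \<otimes> cyc m a) = v \<otimes> f i' \<otimes> (f m [^] b \<otimes> cyc m a)"
          using v by (simp add: m_assoc)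
        then show ?thesis
          using step[OF IHf[OF v i'(3)[OF False]] a] eq by simp
      qed
    qed
    have T: "v \<otimes> (f m [^] (b::nat) \<otimes> cyc m a) \<otimes> t i \<in> right_span k (Suc j)"
      if v: "v \<in> right_span k j" and a: "a \<in> {1..m}" and i: "i \<in> {1..<m}" for v a b i
    proof -
      \<comment> \<open>The reflection crosses the cycle, stays below \<open>m - 1\<close> and
        commutes with \<open>F_m\<close>, so the induction hypothesis takes it.\<close>
      have low: ?thesis if "i' \<in> {1..<m - 1}" "cyc m a \<otimes> t i = t i' \<otimes> cyc m a" for i'
      proof -
        have c: "f m [^] b \<otimes> t i' = t i' \<otimes> f m [^] b"
          using T_F[of i' m] that m by (intro pow_move[symmetric]) (auto simp: transpose_def)
        have "v \<otimes> (f m [^] b \<otimes> cyc m a) \<otimes> t i = v \<otimes> ((f m [^] b \<otimes> t i') \<otimes> cyc m a)"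
          using v that(2) by (simp add: m_assoc)
        also have "\<dots> = v \<otimes> t i' \<otimes> (f m [^] b \<otimes> cyc m a)"
          using v by (simp add: c m_assoc)
        finally show ?thesis using step[OF IHt[OF v that(1)] a] by simp
      qed
      consider "Suc i < a" | "Suc i = a" | "i = a" | "a < i" by linarith
      then show ?thesis
      proof cases
        case 1
        then show ?thesis using low[of i] cyc_comm[of i a m] i a m by auto
      next
        case 2
        have "cyc m a \<otimes> t i = cyc m i" using 2 a cyc_snoc[of i m] by simp
        then show ?thesis using step[OF v, of i b] v i by (simp add: m_assoc)
      next
        case 4
        have "cyc m a \<otimes> t i = t (i - 1) \<otimes> cyc m a" using cyc_shift[of a i m] 4 a i m by auto
        moreover have "i - 1 \<in> {1..<m - 1}" using 4 a i by auto
        ultimately show ?thesis using low[of "i - 1"] by blast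
      next
        case 3
        \<comment> \<open>The cycle with its last factor \<open>T_a\<close> split off, so that one
          more \<open>T_a\<close> produces the square.\<close>
        define y where "y = v \<otimes> (f m [^] b \<otimes> cyc m (Suc a))"
        have y: "y \<in> carrier R" using v by (simp add: y_def)
        have a': "1 \<le> a" "a < m" "Suc a \<in> {1..m}" "a \<in> {1..m - 1}" using 3 i by auto
        have "y \<otimes> (t a \<otimes> t a) \<in> right_span k (Suc j)"
          unfolding right_span_def
        proof (rule int_span_mult_left[OF _ y quadratic])
          show "insert \<one> {f a [^] (p::nat) \<otimes> f (Suc a) [^] (r::nat) \<otimes> t a |p r. True} \<subseteq> carrier R"
            by auto
          show "1 \<le> a" "a < n" using a' m by auto
          fix z assume "z \<in> insert \<one> {f a [^] (p::nat) \<otimes> f (Suc a) [^] (r::nat) \<otimes> t a |p r. True}"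
          then consider "z = \<one>" | p r :: nat where "z = f a [^] p \<otimes> f (Suc a) [^] r \<otimes> t a" by auto
          then have "y \<otimes> z \<in> right_span k (Suc j)"
          proof cases
            case 1
            then show ?thesis using step[OF v a'(3)] v by (simp add: y_def)
          next
            case (2 p r)
            \<comment> \<open>Of the two powers of \<open>F\<close> released by the square, that of
              \<open>F_a\<close> passes to the level below, while that of \<open>F_(a+1)\<close>
              becomes a power of \<open>F_m\<close> and is added to the exponent
              \<open>b\<close>.\<close>
            have c1: "cyc m (Suc a) \<otimes> f a [^] p = f a [^] p \<otimes> cyc m (Suc a)"
              by (rule pow_move) (use cyc_F[of "Suc a" m a] a' m in auto)
            have c2: "cyc m (Suc a) \<otimes> f (Suc a) [^] r = f m [^] r \<otimes> cyc m (Suc a)"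
              by (rule pow_move) (use cyc_F[of "Suc a" m "Suc a"] a' m in auto)
            have c3: "f m [^] b \<otimes> f a [^] p = f a [^] p \<otimes> f m [^] b"
            proof (rule pow_move)
              have "f a \<otimes> f m = f m \<otimes> f a" using F_comm[of a m] a' m by auto
              then show "f m [^] b \<otimes> f a = f a \<otimes> f m [^] b"
                by (rule pow_move[symmetric]) auto
            qed auto
            have "y \<otimes> z = v \<otimes> (f m [^] b \<otimes> (cyc m (Suc a) \<otimes> f a [^] p) \<otimes> f (Suc a) [^] r \<otimes> t a)"
              using v by (simp add: y_def 2 m_assoc)
            also have "\<dots> = v \<otimes> ((f m [^] b \<otimes> f a [^] p) \<otimes> (cyc m (Suc a) \<otimes> f (Suc a) [^] r) \<otimes> t a)"
              using v by (simp add: c1 m_assoc)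
            also have "\<dots> = (v \<otimes> f a [^] p) \<otimes> ((f m [^] b \<otimes> f m [^] r) \<otimes> (cyc m (Suc a) \<otimes> t a))"
              using v by (simp add: c2 c3 m_assoc)
            also have "\<dots> = (v \<otimes> f a [^] p) \<otimes> (f m [^] (b + r) \<otimes> cyc m a)"
              using a' by (simp add: nat_pow_mult cyc_snoc[symmetric])
            finally show ?thesis using step[OF IHfp[OF v a'(4)] a] by simp
          qed
          then show "y \<otimes> z \<in> int_span R ((\<lambda>w. N [^] k \<otimes> ev w) ` right_words d k (Suc j))"
            by (simp add: right_span_def)
        qed
        moreover have "y \<otimes> (t a \<otimes> t a) = v \<otimes> (f m [^] b \<otimes> cyc m a) \<otimes> t i"
          using v 3 a' cyc_snoc[of a m] by (simp add: y_def m_assoc)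
        ultimately show ?thesis by simp
      qed
    qed
    show ?case
    proof (intro conjI ballI)
      fix x i assume x: "x \<in> right_span k (Suc j)" and i: "i \<in> {1..k + Suc j}"
      show "x \<otimes> f i \<in> right_span k (Suc j)"
      proof (rule right_span_mult[OF x])
        fix w assume "w \<in> right_words d k (Suc j)"
        from base[OF this] obtain v a b where v: "v \<in> right_span k j" "a \<in> {1..m}"
          "N [^] k \<otimes> ev w = v \<otimes> (f m [^] (b::nat) \<otimes> cyc m a)" by blast
        show "N [^] k \<otimes> ev w \<otimes> f i \<in> right_span k (Suc j)"
          unfolding v(3) by (rule F[OF v(1,2)]) (use i m in simp)
      qed simp
    next
      fix x i assume x: "x \<in> right_span k (Suc j)" and i: "i \<in> {1..<k + Suc j}"
      show "x \<otimes> t i \<in> right_span k (Suc j)"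
      proof (rule right_span_mult[OF x])
        fix w assume "w \<in> right_words d k (Suc j)"
        from base[OF this] obtain v a b where v: "v \<in> right_span k j" "a \<in> {1..m}"
          "N [^] k \<otimes> ev w = v \<otimes> (f m [^] (b::nat) \<otimes> cyc m a)" by blast
        show "N [^] k \<otimes> ev w \<otimes> t i \<in> right_span k (Suc j)"
          unfolding v(3) by (rule T[OF v(1,2)]) (use i m in simp)
      qed simp
    qed
  qed
  then show "i \<in> {1..k + j} \<Longrightarrow> x \<otimes> f i \<in> right_span k j"
    and "i \<in> {1..<k + j} \<Longrightarrow> x \<otimes> t i \<in> right_span k j"
    using assms(1) by auto
qed

lemma right_span_ev:
  assumes "x \<in> right_span k j" "k + j \<le> n"
    and "set w \<subseteq> GenF ` {1..k + j} \<union> GenT ` {1..<k + j}"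
  shows "x \<otimes> ev w \<in> right_span k j"
  using assms(1,3)
proof (induction w arbitrary: x)
  case (Cons g w)
  have "x \<otimes> gen g \<in> right_span k j"
    using Cons.prems right_span_generators[OF Cons.prems(1) assms(2)] by auto
  then have "x \<otimes> gen g \<otimes> ev w \<in> right_span k j" using Cons by simp
  then show ?case using Cons.prems by (simp add: m_assoc)
qed simp

section \<open>Left multiplication of coset representatives by reflections and torus
  generators\<close>

subsection \<open>The left factor\<close>

text \<open>The generators of the Young subgroup of \<open>{1..r}\<close> and \<open>{r+1..m}\<close>, together with the torus.\<close>

definition young_gens :: "nat \<Rightarrow> nat \<Rightarrow> ry_gen set" where
  "young_gens m r = GenF ` {1..n} \<union> GenT ` ({1..<m} - {r})"

text \<open>The word \<open>y\<close> is left unreduced: the power of \<open>N\<close> that follows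
  it turns it into part of the right factor, by \<open>young_gens_right_span\<close>.\<close>

definition left_span where
  "left_span m r = int_span R {ev l \<otimes> ev y | l y. l \<in> left_words m r \<and> set y \<subseteq> young_gens m r}"

lemma left_spanI:
  "l \<in> left_words m r \<Longrightarrow> set y \<subseteq> young_gens m r \<Longrightarrow> ev l \<otimes> ev y \<in> left_span m r"
  unfolding left_span_def by (rule int_span.base) blast

lemma left_span_closed [simp]: "x \<in> left_span m r \<Longrightarrow> x \<in> carrier R"
  unfolding left_span_def by (rule int_span_closed) auto

lemma left_span_mult_right:
  assumes "x \<in> left_span m r" "c \<in> carrier R"
    and "\<And>l y. l \<in> left_words m r \<Longrightarrow> set y \<subseteq> young_gens m r \<Longrightarrow>
      ev l \<otimes> (ev y \<otimes> c) \<in> left_span m' r'"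
  shows "x \<otimes> c \<in> left_span m' r'"
  unfolding left_span_def
  by (rule int_span_mult_right[OF _ assms(2) assms(1)[unfolded left_span_def]])
    (use assms(2,3) in \<open>auto simp: m_assoc left_span_def\<close>)

text \<open>The cycle leaves \<open>T_j\<close> with \<open>j < r\<close> alone and raises the index
  of \<open>T_j\<close> with \<open>r < j\<close> by one, so the gap at \<open>r\<close> becomes the
  gap at \<open>r + 1\<close>. The letters \<open>F\<close> are merely permuted.\<close>

lemma young_gens_cyc:
  assumes "set y \<subseteq> young_gens m r" "r \<le> m" "m < n"
  shows "\<exists>y'. set y' \<subseteq> young_gens (Suc m) (Suc r) \<and>
    ev y \<otimes> cyc (Suc m) (Suc r) = cyc (Suc m) (Suc r) \<otimes> ev y'"
  using assms(1)
proof (induction y)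
  case Nil
  show ?case by (rule exI[of _ "[]"]) simp
next
  case (Cons g y)
  then obtain y' where y': "set y' \<subseteq> young_gens (Suc m) (Suc r)"
    "ev y \<otimes> cyc (Suc m) (Suc r) = cyc (Suc m) (Suc r) \<otimes> ev y'" by auto
  have "\<exists>g'\<in>young_gens (Suc m) (Suc r).
      gen g \<otimes> cyc (Suc m) (Suc r) = cyc (Suc m) (Suc r) \<otimes> gen g'"
  proof -
    consider j where "g = GenF j" "j \<in> {1..n}" | j where "g = GenT j" "1 \<le> j" "j < r"
      | j where "g = GenT j" "r < j" "j < m"
      using Cons.prems by (fastforce simp: young_gens_def)
    then show ?thesis
    proof cases
      case (1 j)
      then show ?thesis
        using F_cyc[of "Suc r" "Suc m" j] assms by (fastforce simp: young_gens_def)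
    next
      case (2 j)
      then have "gen g \<otimes> cyc (Suc m) (Suc r) = cyc (Suc m) (Suc r) \<otimes> gen g"
        using cyc_comm[of j "Suc r" "Suc m"] assms by simp
      moreover have "g \<in> young_gens (Suc m) (Suc r)"
        using 2 assms by (auto simp: young_gens_def)
      ultimately show ?thesis by blast
    next
      case (3 j)
      then have "gen g \<otimes> cyc (Suc m) (Suc r) = cyc (Suc m) (Suc r) \<otimes> gen (GenT (Suc j))"
        using cyc_shift[of "Suc r" "Suc j" "Suc m"] assms by simp
      moreover have "GenT (Suc j) \<in> young_gens (Suc m) (Suc r)"
        using 3 by (auto simp: young_gens_def)
      ultimately show ?thesis by blast
    qed
  qed
  then obtain g' where g': "g' \<in> young_gens (Suc m) (Suc r)"
    "gen g \<otimes> cyc (Suc m) (Suc r) = cyc (Suc m) (Suc r) \<otimes> gen g'" by blast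
  have "ev (g # y) \<otimes> cyc (Suc m) (Suc r) = (gen g \<otimes> cyc (Suc m) (Suc r)) \<otimes> ev y'"
    by (simp add: m_assoc y'(2))
  also have "\<dots> = cyc (Suc m) (Suc r) \<otimes> ev (g' # y')"
    by (simp add: m_assoc g'(2))
  finally show ?case using g'(1) y'(1) by (intro exI[of _ "g' # y'"]) auto
qed

lemma left_span_cyc:
  assumes "x \<in> left_span m r" "r \<le> m" "m < n"
  shows "x \<otimes> cyc (Suc m) (Suc r) \<in> left_span (Suc m) (Suc r)"
proof (rule left_span_mult_right[OF assms(1)])
  fix l y assume l: "l \<in> left_words m r" and y: "set y \<subseteq> young_gens m r"
  obtain y' where y': "set y' \<subseteq> young_gens (Suc m) (Suc r)"
    "ev y \<otimes> cyc (Suc m) (Suc r) = cyc (Suc m) (Suc r) \<otimes> ev y'"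
    using young_gens_cyc[OF y assms(2,3)] by blast
  have "l @ run (Suc m) (Suc r) \<in> left_words (Suc m) (Suc r)" using l by simp
  from left_spanI[OF this y'(1)]
  show "ev l \<otimes> (ev y \<otimes> cyc (Suc m) (Suc r)) \<in> left_span (Suc m) (Suc r)"
    by (simp add: y'(2) ev_append m_assoc)
qed simp

lemma left_span_mono: "x \<in> left_span m r \<Longrightarrow> x \<in> left_span (Suc m) r"
proof -
  assume x: "x \<in> left_span m r"
  have "young_gens m r \<subseteq> young_gens (Suc m) r" by (auto simp: young_gens_def)
  then have "{ev l \<otimes> ev y | l y. l \<in> left_words m r \<and> set y \<subseteq> young_gens m r}
    \<subseteq> {ev l \<otimes> ev y | l y. l \<in> left_words (Suc m) r \<and> set y \<subseteq> young_gens (Suc m) r}"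
    using left_words_mono[of m r] by blast
  from int_span_mono[OF this] x show ?thesis unfolding left_span_def by blast
qed

text \<open>A reflection times a minimal coset representative is another representative, or the same
  one times a reflection of the Young subgroup, or calls for the quadratic relation. By induction
  only the top reflection is new, and it depends only on the two highest levels of the word.\<close>

lemma T_left_words:
  assumes "l \<in> left_words m r" "1 \<le> i" "i < m" "m \<le> n"
  shows "t i \<otimes> ev l \<in> left_span m r"
  using assms
proof (induction m arbitrary: r l)
  case (Suc m)
  show ?case
  proof (cases "i < m")
    case True
    from Suc.prems(1) consider "l \<in> left_words m r"
      | r' l' where "r = Suc r'" "l' \<in> left_words m r'" "l = l' @ run (Suc m) (Suc r')"
      unfolding left_words_Suc by blast
    then show ?thesis
    proof cases
      case 1
      then show ?thesis using Suc True by (intro left_span_mono) auto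
    next
      case (2 r' l')
      have "t i \<otimes> ev l' \<in> left_span m r'" using Suc True 2 by auto
      from left_span_cyc[OF this left_words_le[OF 2(2)]] show ?thesis
        using 2 Suc.prems by (simp add: ev_append m_assoc)
    qed
  next
    case False
    define p where "p = m - 1"
    have m: "m = Suc p" and i: "i = Suc p" using Suc.prems False by (auto simp: p_def)
    have pn: "Suc p < n" using Suc.prems m by simp
    have comm: "t i \<otimes> ev l0 = ev l0 \<otimes> t i" if "l0 \<in> left_words p r0" for l0 r0
      by (rule T_comm_ev[where A = "{1..<p}"])
        (use set_left_words[OF that] i pn in auto)
    have sub: "left_words p r0 \<subseteq> left_words m r0" for r0
      using left_words_mono m by simp
    \<comment> \<open>\<open>T_i\<close> exchanges the two top rows, \<open>p + 1\<close> and
      \<open>p + 2\<close>. The cases say which of them are nonzero: neither, the lower index only,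
      the higher index only, both.\<close>
    from Suc.prems(1) consider
        (a) "l \<in> left_words p r"
      | (b) r' l0 where "r = Suc r'" "l0 \<in> left_words p r'" "l = l0 @ run (Suc p) (Suc r')"
      | (c) r' l0 where "r = Suc r'" "l0 \<in> left_words p r'" "l = l0 @ run (Suc m) (Suc r')"
      | (d) r' l0 where "r = Suc (Suc r')" "l0 \<in> left_words p r'"
          "l = l0 @ run (Suc p) (Suc r') @ run (Suc m) (Suc (Suc r'))"
      unfolding m left_words_Suc by fastforce
    then show ?thesis
    proof cases
      case a
      have "set [GenT i] \<subseteq> young_gens (Suc m) r"
        using left_words_le[OF a] m i by (auto simp: young_gens_def)
      then have "ev l \<otimes> ev [GenT i] \<in> left_span (Suc m) r"
        using Suc.prems(1) by (intro left_spanI)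
      then show ?thesis using comm[OF a] by simp
    next
      case (b r' l0)
      have "l0 @ run (Suc m) (Suc r') \<in> left_words (Suc m) r" using b sub by auto
      from left_spanI[OF this, of "[]"]
      have "ev l0 \<otimes> cyc (Suc m) (Suc r') \<in> left_span (Suc m) r" by (simp add: ev_append)
      moreover have "t i \<otimes> ev l = (t i \<otimes> ev l0) \<otimes> cyc (Suc p) (Suc r')"
        using b by (simp add: ev_append m_assoc)
      moreover have "\<dots> = ev l0 \<otimes> cyc (Suc m) (Suc r')"
        using comm[OF b(2)] left_words_le[OF b(2)] m i by (simp add: cyc_Suc m_assoc)
      ultimately show ?thesis by simp
    next
      case (c r' l0)
      have r': "r' \<le> p" using left_words_le[OF c(2)] .
      have "t i \<otimes> ev l = (t i \<otimes> ev l0) \<otimes> cyc (Suc m) (Suc r')"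
        using c by (simp add: ev_append m_assoc)
      \<comment> \<open>The one case with a square. Its constant part leads to the word of case (b);
        the rest returns to \<open>l\<close> with powers of \<open>F\<close> inserted before the
        run.\<close>
      also have "\<dots> = ev l0 \<otimes> (t i \<otimes> t i) \<otimes> cyc (Suc p) (Suc r')"
        using comm[OF c(2)] r' m i by (simp add: cyc_Suc m_assoc)
      also have "\<dots> \<in> left_span (Suc m) r"
        unfolding left_span_def
      proof (rule int_span_mult_right)
        show "ev l0 \<otimes> (t i \<otimes> t i) \<in> int_span R ((\<lambda>z. ev l0 \<otimes> z) `
            (insert \<one> {f i [^] (a::nat) \<otimes> f (Suc i) [^] (b::nat) \<otimes> t i | a b. True}))"
          by (rule int_span_mult_left[OF _ _ quadratic]) (use i pn in \<open>auto intro: int_span.base\<close>)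
        fix x assume "x \<in> (\<lambda>z. ev l0 \<otimes> z) `
            (insert \<one> {f i [^] (a::nat) \<otimes> f (Suc i) [^] (b::nat) \<otimes> t i | a b. True})"
        then consider "x = ev l0" | a b :: nat where "x = ev l0 \<otimes> (f i [^] a \<otimes> f (Suc i) [^] b \<otimes> t i)"
          by auto
        then have "x \<otimes> cyc (Suc p) (Suc r') \<in> left_span (Suc m) r"
        proof cases
          case 1
          have "l0 @ run (Suc p) (Suc r') \<in> left_words m r" using c m by simp
          then have "l0 @ run (Suc p) (Suc r') \<in> left_words (Suc m) r" using left_words_mono by blast
          from left_spanI[OF this, of "[]"] show ?thesis using 1 by (simp add: ev_append)
        next
          case (2 a b)
          let ?y = "replicate a (GenF i) @ replicate b (GenF (Suc i))"
          have "set ?y \<subseteq> young_gens m r'" using i pn by (auto simp: young_gens_def)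
          then have "ev l0 \<otimes> ev ?y \<in> left_span m r'" using c(2) sub by (intro left_spanI) auto
          from left_span_cyc[OF this] have "ev l0 \<otimes> ev ?y \<otimes> cyc (Suc m) (Suc r') \<in> left_span (Suc m) r"
            using r' m pn c(1) by simp
          moreover have "x \<otimes> cyc (Suc p) (Suc r') = ev l0 \<otimes> ev ?y \<otimes> cyc (Suc m) (Suc r')"
            using r' m i by (simp add: 2 ev_append ev_replicate cyc_Suc m_assoc)
          ultimately show ?thesis by simp
        qed
        then show "x \<otimes> cyc (Suc p) (Suc r') \<in> int_span R
            {ev l \<otimes> ev y | l y. l \<in> left_words (Suc m) r \<and> set y \<subseteq> young_gens (Suc m) r}"
          by (simp add: left_span_def)
      qed auto
      finally show ?thesis .
    next
      case (d r' l0)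
      have r': "r' \<le> p" using left_words_le[OF d(2)] .
      have l: "l \<in> left_words (Suc m) r" "set [GenT (Suc r')] \<subseteq> young_gens (Suc m) r"
        using Suc.prems(1) d(1) r' m by (auto simp: young_gens_def)
      have "t i \<otimes> ev l = (t i \<otimes> ev l0) \<otimes> cyc (Suc p) (Suc r') \<otimes> cyc (Suc m) (Suc (Suc r'))"
        using d by (simp add: ev_append m_assoc)
      also have "\<dots> = ev l0 \<otimes> (cyc (Suc m) (Suc r') \<otimes> cyc (Suc m) (Suc (Suc r')))"
        using comm[OF d(2)] r' m i by (simp add: cyc_Suc m_assoc)
      \<comment> \<open>The reflection reappears on the right as \<open>T_(r'+1)\<close>, which
        belongs to the Young subgroup because here \<open>r = r' + 2\<close>.\<close>
      also have "cyc (Suc m) (Suc r') \<otimes> cyc (Suc m) (Suc (Suc r')) = cyc m (Suc r') \<otimes> cyc (Suc m) (Suc r')"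
        using r' m pn by (intro cyc_cyc) auto
      also have "\<dots> = cyc m (Suc r') \<otimes> (cyc (Suc m) (Suc (Suc r')) \<otimes> t (Suc r'))"
        using r' m cyc_snoc[of "Suc r'" "Suc m"] by simp
      also have "ev l0 \<otimes> \<dots> = ev l \<otimes> ev [GenT (Suc r')]"
        using d m by (simp add: ev_append m_assoc)
      finally show ?thesis using left_spanI[OF l] by simp
    qed
  qed
qed simp

lemma F_left:
  assumes "set l \<subseteq> GenT ` {1..<n}" "j \<in> {1..n}"
  shows "\<exists>j'\<in>{1..n}. f j \<otimes> ev l = ev l \<otimes> f j'"
  using assms
proof (induction l arbitrary: j)
  case (Cons g l)
  then obtain i where i: "g = GenT i" "i \<in> {1..<n}" by auto
  define j0 where "j0 = transpose i (Suc i) j"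
  have j0: "j0 \<in> {1..n}" using i Cons.prems by (auto simp: j0_def transpose_def)
  obtain j' where j': "j' \<in> {1..n}" "f j0 \<otimes> ev l = ev l \<otimes> f j'"
    using Cons.IH[OF _ j0] Cons.prems(1) by auto
  have "t i \<otimes> f j0 = f j \<otimes> t i"
    using T_F[OF i(2) j0] by (simp add: j0_def)
  then have "f j \<otimes> ev (g # l) = t i \<otimes> (f j0 \<otimes> ev l)"
    using i(1) by (simp add: m_assoc[symmetric])
  also have "\<dots> = ev (g # l) \<otimes> f j'" using i(1) j'(2) by (simp add: m_assoc)
  finally show ?case using j'(1) by blast
qed auto

lemma F_left_span: "l \<in> left_words n r \<Longrightarrow> j \<in> {1..n} \<Longrightarrow> f j \<otimes> ev l \<in> left_span n r"
proof -
  assume l: "l \<in> left_words n r" and j: "j \<in> {1..n}"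
  obtain j' where j': "j' \<in> {1..n}" "f j \<otimes> ev l = ev l \<otimes> ev [GenF j']"
    using F_left[OF set_left_words[OF l] j] by auto
  have "set [GenF j'] \<subseteq> young_gens n r" using j' by (simp add: young_gens_def)
  from left_spanI[OF l this] j'(2) show ?thesis by simp
qed

lemma T_Npow_shift: "1 \<le> j \<Longrightarrow> j + k < n \<Longrightarrow> t j \<otimes> N [^] k = N [^] k \<otimes> t (j + k)"
proof (induction k)
  case (Suc k)
  have "t j \<otimes> N [^] Suc k = (t j \<otimes> N [^] k) \<otimes> N" by (simp add: m_assoc)
  also have "\<dots> = N [^] k \<otimes> (t (j + k) \<otimes> N)" using Suc by (simp add: m_assoc)
  also have "\<dots> = N [^] Suc k \<otimes> t (j + Suc k)" using T_N[of "j + k"] Suc by (simp add: m_assoc)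
  finally show ?case .
qed simp

lemma F_Npow_shift: "1 \<le> j \<Longrightarrow> j + k \<le> n \<Longrightarrow> f j \<otimes> N [^] k = N [^] k \<otimes> f (j + k)"
proof (induction k)
  case (Suc k)
  have "f j \<otimes> N [^] Suc k = (f j \<otimes> N [^] k) \<otimes> N" by (simp add: m_assoc)
  also have "\<dots> = N [^] k \<otimes> (f (j + k) \<otimes> N)" using Suc by (simp add: m_assoc)
  also have "\<dots> = N [^] Suc k \<otimes> f (j + Suc k)" using F_N[of "j + k"] Suc by (simp add: m_assoc)
  finally show ?case .
qed simp

lemma T_Npow_greater:
  assumes "1 \<le> j" "j < n" "n - j < k"
  shows "t j \<otimes> N [^] k = [q] \<cdot> (N [^] k)"
proof -
  have "N [^] k = N [^] Suc (n - j) \<otimes> N [^] (k - Suc (n - j))"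
    using assms by (simp only: nat_pow_mult gen_closed) simp
  then show ?thesis
    using assms T_Npow[of j]
    by (simp add: m_assoc[symmetric] add_pow_ldistr del: nat_pow_Suc)
qed

text \<open>After \<open>n - j\<close> steps \<open>F_j\<close> has become \<open>F_n\<close>, and
  at least one \<open>N\<close> is left to absorb it.\<close>

lemma F_Npow_greater:
  assumes "1 \<le> j" "j \<le> n" "n < j + k"
  shows "f j \<otimes> N [^] k = N [^] k"
proof -
  have "k = (n - j) + Suc (k - Suc (n - j))" using assms by simp
  then have k: "N [^] k = N [^] (n - j) \<otimes> (N \<otimes> N [^] (k - Suc (n - j)))"
    by (metis nat_pow_mult nat_pow_Suc2 gen_closed)
  have "f j \<otimes> N [^] k = N [^] (n - j) \<otimes> (f n \<otimes> N) \<otimes> N [^] (k - Suc (n - j))"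
    using assms F_Npow_shift[of j "n - j"] by (simp add: k m_assoc[symmetric])
  then show ?thesis by (simp add: Fn_N k m_assoc)
qed

lemma Npow_right_span:
  assumes "set w \<subseteq> GenF ` {1..k + j} \<union> GenT ` {1..<k + j}" "k + j \<le> n"
  shows "N [^] k \<otimes> ev w \<in> right_span k j"
proof -
  have "[] \<in> right_words d k j"
  proof (induction j)
    case (Suc j)
    show ?case
      unfolding right_words.simps
      by (rule CollectI, rule exI[of _ "[]"], rule exI[of _ "Suc (k + j)"], rule exI[of _ 0])
        (use Suc d_pos in simp)
  qed simp
  then have "N [^] k \<otimes> ev [] \<in> right_span k j"
    unfolding right_span_def by (intro int_span.base imageI)
  then have "N [^] k \<in> right_span k j" by simp
  from right_span_ev[OF this assms(2,1)] show ?thesis .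
qed

text \<open>\<open>N^(n-r)\<close> raises the indices of \<open>F_j\<close> with
  \<open>j \<le> r\<close> and of \<open>T_j\<close> with \<open>j < r\<close> by
  \<open>n - r\<close>, and it reduces the remaining letters to 1 or \<open>q\<close>. Neither rule
  would apply to \<open>T_r\<close>, which is why \<open>young_gens\<close> leaves it out.\<close>

lemma young_gens_right_span:
  assumes g: "g \<in> young_gens n r" and z: "z \<in> right_span (n - r) r" and r: "r \<le> n"
  shows "gen g \<otimes> z \<in> right_span (n - r) r"
  unfolding right_span_def
proof (rule int_span_mult_left[OF _ _ z[unfolded right_span_def]])
  fix x assume "x \<in> (\<lambda>w. N [^] (n - r) \<otimes> ev w) ` right_words d (n - r) r"
  then obtain w where w: "w \<in> right_words d (n - r) r" "x = N [^] (n - r) \<otimes> ev w" by auto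
  have set_w: "set w \<subseteq> GenF ` {1..n - r + r} \<union> GenT ` {1..<n - r + r}"
    using set_right_words[OF w(1)] .
  consider (same) "gen g \<otimes> N [^] (n - r) = N [^] (n - r)"
    | (scalar) "gen g \<otimes> N [^] (n - r) = [q] \<cdot> (N [^] (n - r))"
    | (shift) g' where "g' \<in> GenF ` {1..n} \<union> GenT ` {1..<n}"
      "gen g \<otimes> N [^] (n - r) = N [^] (n - r) \<otimes> gen g'"
  proof -
    from g consider j where "g = GenF j" "j \<in> {1..n}" "j \<le> r"
      | j where "g = GenF j" "j \<in> {1..n}" "r < j"
      | j where "g = GenT j" "1 \<le> j" "j < r"
      | j where "g = GenT j" "r < j" "j < n"
      unfolding young_gens_def by (fastforce simp: not_le)
    then show thesis
    proof cases
      case (1 j)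
      then show thesis using F_Npow_shift[of j "n - r"] r by (intro shift[of "GenF (j + (n - r))"]) (auto intro!: imageI)
    next
      case (2 j)
      then show thesis using F_Npow_greater[of j "n - r"] r by (intro same) auto
    next
      case (3 j)
      then show thesis using T_Npow_shift[of j "n - r"] r by (intro shift[of "GenT (j + (n - r))"]) (auto intro!: imageI)
    next
      case (4 j)
      then show thesis using T_Npow_greater[of j "n - r"] r by (intro scalar) auto
    qed
  qed
  then have "gen g \<otimes> x \<in> right_span (n - r) r"
  proof cases
    case same
    then have "gen g \<otimes> x = x" by (simp add: w(2) m_assoc[symmetric])
    then show ?thesis using Npow_right_span[OF set_w] w(2) r by simp
  next
    case scalar
    then have "gen g \<otimes> x = [q] \<cdot> x" by (simp add: w(2) m_assoc[symmetric] add_pow_ldistr)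
    then show ?thesis using Npow_right_span[OF set_w] w(2) r by (simp add: right_span_add_pow)
  next
    case (shift g')
    then have "gen g \<otimes> x = N [^] (n - r) \<otimes> gen g' \<otimes> ev w"
      by (simp add: w(2) m_assoc[symmetric])
    then have "gen g \<otimes> x = N [^] (n - r) \<otimes> ev (g' # w)" by (simp add: m_assoc)
    moreover have "set (g' # w) \<subseteq> GenF ` {1..n - r + r} \<union> GenT ` {1..<n - r + r}"
      using shift(1) set_w r by auto
    ultimately show ?thesis using Npow_right_span[of "g' # w"] r by simp
  qed
  then show "gen g \<otimes> x \<in> int_span R ((\<lambda>w. N [^] (n - r) \<otimes> ev w) ` right_words d (n - r) r)"
    by (simp add: right_span_def)
qed auto

lemma left_span_right_span:
  assumes x: "x \<in> left_span n r" and z: "z \<in> right_span (n - r) r" and r: "r \<le> n"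
  shows "x \<otimes> z \<in> int_span R (ev ` normal_words d n)"
proof (rule int_span_mult_right[OF _ _ x[unfolded left_span_def]])
  fix x assume "x \<in> {ev l \<otimes> ev y | l y. l \<in> left_words n r \<and> set y \<subseteq> young_gens n r}"
  then obtain l y where l: "l \<in> left_words n r" and y: "set y \<subseteq> young_gens n r"
    and x: "x = ev l \<otimes> ev y" by blast
  have "ev y \<otimes> z \<in> right_span (n - r) r"
    using y
  proof (induction y)
    case (Cons g y)
    then show ?case using z young_gens_right_span[of g r] r by (simp add: m_assoc)
  qed (use z in simp)
  then have "ev l \<otimes> (ev y \<otimes> z) \<in> int_span R (ev ` normal_words d n)"
    unfolding right_span_def
  proof (rule int_span_mult_left[rotated 2])
    fix x assume "x \<in> (\<lambda>w. N [^] (n - r) \<otimes> ev w) ` right_words d (n - r) r"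
    then obtain w where w: "w \<in> right_words d (n - r) r" "x = N [^] (n - r) \<otimes> ev w" by auto
    have "l @ replicate (n - r) GenN @ w \<in> normal_words d n"
      unfolding normal_words_def using l w r by blast
    then have "ev (l @ replicate (n - r) GenN @ w) \<in> int_span R (ev ` normal_words d n)"
      by (intro int_span.base imageI)
    then show "ev l \<otimes> x \<in> int_span R (ev ` normal_words d n)"
      by (simp add: w(2) ev_append ev_replicate)
  qed auto
  then show "x \<otimes> z \<in> int_span R (ev ` normal_words d n)"
    using z by (simp add: x m_assoc)
qed (use z in auto)

section \<open>Left multiplication by \<open>N\<close>: the rows move up and the first is
  lost\<close>

subsection \<open>The nilpotent generator\<close>

abbreviation ascend where "ascend r \<equiv> ev (map GenT [1..<Suc r])"

lemma N_cyc:
  assumes "1 \<le> a" "a \<le> m" "m < n"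
  shows "N \<otimes> cyc (Suc m) (Suc a) = cyc m a \<otimes> N"
  using assms
proof (induction m)
  case (Suc m)
  show ?case
  proof (cases "a = Suc m")
    case False
    have "N \<otimes> cyc (Suc (Suc m)) (Suc a) = (N \<otimes> t (Suc m)) \<otimes> cyc (Suc m) (Suc a)"
      using Suc.prems False by (simp add: cyc_Suc m_assoc)
    also have "\<dots> = t m \<otimes> (N \<otimes> cyc (Suc m) (Suc a))"
      using T_N[of m] Suc.prems False by (simp add: m_assoc[symmetric])
    also have "\<dots> = cyc (Suc m) a \<otimes> N"
      using Suc False by (simp add: cyc_Suc m_assoc)
    finally show ?thesis .
  qed simp
qed simp

lemma ascend_cyc:
  assumes "r < m" "m \<le> n"
  shows "ascend r \<otimes> cyc m (Suc (Suc r)) = cyc m (Suc (Suc r)) \<otimes> ascend r"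
proof -
  have "ev w \<otimes> x = x \<otimes> ev w"
    if "x \<in> carrier R" "\<And>g. g \<in> set w \<Longrightarrow> gen g \<otimes> x = x \<otimes> gen g" for w x
    using that(2)
  proof (induction w)
    case (Cons g w)
    have IH: "ev w \<otimes> x = x \<otimes> ev w" using Cons by simp
    have g: "gen g \<otimes> x = x \<otimes> gen g" using Cons.prems by simp
    have "ev (g # w) \<otimes> x = gen g \<otimes> x \<otimes> ev w" using that(1) by (simp add: m_assoc IH)
    then show ?case using that(1) by (simp add: m_assoc g)
  qed (use that(1) in simp)
  from this[of "cyc m (Suc (Suc r))" "map GenT [1..<Suc r]"] show ?thesis
    using cyc_comm assms by (fastforce simp del: upt_Suc)
qed

text \<open>\<open>N\<close> passes the runs of a left word with indices lowered by one. If the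
  first row is zero, the rank is kept and \<open>T_1 ... T_r\<close> remains behind
  \<open>N\<close>; if it is not, the rank falls by one and a bare \<open>N\<close> remains.\<close>

lemma N_left_words:
  assumes "l \<in> left_words (Suc m) r" "m < n"
  shows "(\<exists>l'\<in>left_words m r. N \<otimes> ev l = ev l' \<otimes> (N \<otimes> ascend r)) \<or>
    (\<exists>r' l'. r = Suc r' \<and> l' \<in> left_words m r' \<and> N \<otimes> ev l = ev l' \<otimes> N)"
  using assms
proof (induction m arbitrary: r l)
  case 0
  then consider "r = 0" "l = []" | "r = 1" "l = []" by (cases r; cases "r - 1") auto
  then show ?case by cases auto
next
  case (Suc m)
  from Suc.prems(1) consider (a) "l \<in> left_words (Suc m) r"
    | (b) r0 l0 where "r = Suc r0" "l0 \<in> left_words (Suc m) r0" "l = l0 @ run (Suc (Suc m)) (Suc r0)"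
    unfolding left_words_Suc[of _ "Suc m"] by blast
  then show ?case
  proof cases
    case a
    then show ?thesis using Suc left_words_mono by (meson Suc_lessD subsetD)
  next
    case (b r0 l0)
    have Nl: "N \<otimes> ev l = (N \<otimes> ev l0) \<otimes> cyc (Suc (Suc m)) (Suc r0)"
      by (simp add: b(3) ev_append m_assoc)
    from Suc.IH[OF b(2)] Suc.prems(2)
    consider (c) l' where "l' \<in> left_words m r0" "N \<otimes> ev l0 = ev l' \<otimes> (N \<otimes> ascend r0)"
      | (d) r1 l' where "r0 = Suc r1" "l' \<in> left_words m r1" "N \<otimes> ev l0 = ev l' \<otimes> N"
      by auto
    then show ?thesis
    proof cases
      case (c l')
      have r0: "r0 \<le> m" using left_words_le[OF c(1)] .
      \<comment> \<open>The last factor \<open>T_(r0+1)\<close> of the run is split off to lengthen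
        the product left behind \<open>N\<close>; what is left of the run commutes with that product
        and then passes \<open>N\<close>.\<close>
      have "N \<otimes> ev l = ev l' \<otimes> N \<otimes> (ascend r0 \<otimes> cyc (Suc (Suc m)) (Suc (Suc r0))) \<otimes> t (Suc r0)"
        using r0 cyc_snoc[of "Suc r0" "Suc (Suc m)"] by (simp add: Nl c(2) m_assoc)
      also have "\<dots> = ev l' \<otimes> (N \<otimes> cyc (Suc (Suc m)) (Suc (Suc r0))) \<otimes> (ascend r0 \<otimes> t (Suc r0))"
        using r0 Suc.prems by (subst ascend_cyc) (simp_all add: m_assoc)
      also have "N \<otimes> cyc (Suc (Suc m)) (Suc (Suc r0)) = cyc (Suc m) (Suc r0) \<otimes> N"
        using r0 Suc.prems by (intro N_cyc) auto
      also have "ascend r0 \<otimes> t (Suc r0) = ascend r" using b(1) by (simp add: ev_append)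
      also have "ev l' \<otimes> (cyc (Suc m) (Suc r0) \<otimes> N) \<otimes> ascend r =
          ev (l' @ run (Suc m) (Suc r0)) \<otimes> (N \<otimes> ascend r)"
        by (simp add: ev_append m_assoc)
      finally have "N \<otimes> ev l = ev (l' @ run (Suc m) (Suc r0)) \<otimes> (N \<otimes> ascend r)" .
      moreover have "l' @ run (Suc m) (Suc r0) \<in> left_words (Suc m) r" using c(1) b(1) by simp
      ultimately show ?thesis by blast
    next
      case (d r1 l')
      have r1: "r1 \<le> m" using left_words_le[OF d(2)] .
      have "N \<otimes> ev l = ev l' \<otimes> (N \<otimes> cyc (Suc (Suc m)) (Suc r0))"
        by (simp add: Nl d(3) m_assoc)
      also have "N \<otimes> cyc (Suc (Suc m)) (Suc r0) = cyc (Suc m) r0 \<otimes> N"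
        using r1 d(1) Suc.prems by (intro N_cyc) auto
      finally have "N \<otimes> ev l = ev (l' @ run (Suc m) r0) \<otimes> N"
        by (simp add: ev_append m_assoc)
      moreover have "l' @ run (Suc m) r0 \<in> left_words (Suc m) r0" using d by simp
      ultimately show ?thesis using b(1) by blast
    qed
  qed
qed

lemma cancel_q_pow:
  "x \<in> carrier R \<Longrightarrow> y \<in> carrier R \<Longrightarrow> [(q ^ j)] \<cdot> x = [(q ^ j)] \<cdot> y \<Longrightarrow> x = y"
proof (induction j)
  case (Suc j)
  have "[q] \<cdot> ([(q ^ j)] \<cdot> x) = [q] \<cdot> ([(q ^ j)] \<cdot> y)"
    using Suc.prems by (simp add: add.nat_pow_pow mult.commute)
  then have "[(q ^ j)] \<cdot> x = [(q ^ j)] \<cdot> y"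
    by (rule cancel_q[rotated 2]) (use Suc.prems in simp_all)
  then show ?case by (rule Suc.IH[OF Suc.prems(1,2)])
qed simp

text \<open>The defining relation is the case \<open>r = n - 1\<close>. In general the missing
  factors \<open>T_(r+1), ..., T_(n-1)\<close> act on \<open>N^(n-r)\<close> as \<open>q\<close>
  each, so inserting them proves the claim up to a power of \<open>q\<close>, which is then
  cancelled.\<close>

lemma N_ascend_Npow:
  assumes "r < n"
  shows "N \<otimes> ascend r \<otimes> N [^] (n - r) = [(q ^ r)] \<cdot> (N [^] (n - r))"
proof -
  have tail: "ev (map GenT [n - j..<n]) \<otimes> N [^] (n - r) = [(q ^ j)] \<cdot> (N [^] (n - r))"
    if "j < n - r" for j
    using that
  proof (induction j)
    case (Suc j)
    have "[n - Suc j..<n] = (n - Suc j) # [n - j..<n]"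
      using Suc.prems by (simp add: upt_conv_Cons Suc_diff_Suc)
    then show ?case
      using Suc T_Npow_greater[of "n - Suc j" "n - r"]
      by (simp add: m_assoc add_pow_rdistr add.nat_pow_pow mult.commute)
  qed simp
  have "[1..<n] = [1..<Suc r] @ [Suc r..<n]"
    using assms upt_add_eq_append[of 1 "Suc r" "n - Suc r"] by simp
  then have split: "ev (map GenT [1..<n]) = ascend r \<otimes> ev (map GenT [Suc r..<n])"
    by (simp only: map_append ev_append)
  have pow: "N [^] (n - r) = N \<otimes> N [^] (n - Suc r)"
    using assms by (simp flip: nat_pow_Suc2 add: Suc_diff_Suc)
  have "[(q ^ (n - Suc r))] \<cdot> (N \<otimes> ascend r \<otimes> N [^] (n - r)) =
      N \<otimes> ascend r \<otimes> (ev (map GenT [Suc r..<n]) \<otimes> N [^] (n - r))"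
    using tail[of "n - Suc r"] assms by (simp add: add_pow_rdistr)
  also have "\<dots> = (N \<otimes> ev (map GenT [1..<n]) \<otimes> N) \<otimes> N [^] (n - Suc r)"
    by (simp only: split pow m_assoc m_closed gen_closed ev_closed nat_pow_closed)
  also have "\<dots> = [(q ^ (n - 1))] \<cdot> (N [^] (n - r))"
    by (simp only: N_T_N pow add_pow_ldistr gen_closed nat_pow_closed)
  also have "\<dots> = [(q ^ (n - Suc r))] \<cdot> ([(q ^ r)] \<cdot> (N [^] (n - r)))"
    using assms by (simp add: add.nat_pow_pow flip: power_add)
  finally show ?thesis by (rule cancel_q_pow[rotated 2]) simp_all
qed

lemma generator_normal_words:
  assumes "g \<in> ry_gens n" "x \<in> int_span R (ev ` normal_words d n)" "n \<ge> 1"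
  shows "gen g \<otimes> x \<in> int_span R (ev ` normal_words d n)"
proof (rule int_span_mult_left[OF _ _ assms(2)])
  fix x assume "x \<in> ev ` normal_words d n"
  then obtain l r w where w: "r \<le> n" "l \<in> left_words n r" "w \<in> right_words d (n - r) r"
    and x: "x = ev l \<otimes> (N [^] (n - r) \<otimes> ev w)"
    unfolding normal_words_def by (auto simp: ev_append ev_replicate)
  have z: "N [^] (n - r) \<otimes> ev w \<in> right_span (n - r) r"
    unfolding right_span_def using w(3) by (intro int_span.base imageI)
  from assms(1) consider i where "g = GenT i" "i \<in> {1..<n}" | i where "g = GenF i" "i \<in> {1..n}" | "g = GenN"
    unfolding ry_gens_def by blast
  then show "gen g \<otimes> x \<in> int_span R (ev ` normal_words d n)"
  proof cases
    case (1 i)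
    then have "t i \<otimes> ev l \<in> left_span n r" using T_left_words[OF w(2)] by simp
    from left_span_right_span[OF this z w(1)] show ?thesis by (simp add: 1 x m_assoc)
  next
    case (2 i)
    then have "f i \<otimes> ev l \<in> left_span n r" using F_left_span[OF w(2)] by simp
    from left_span_right_span[OF this z w(1)] show ?thesis by (simp add: 2 x m_assoc)
  next
    case 3
    define m where "m = n - 1"
    have n: "n = Suc m" using assms(3) by (simp add: m_def)
    have left: "ev l' \<in> left_span n r'" if "l' \<in> left_words m r'" for l' r'
      using left_spanI[of l' n r' "[]"] that left_words_mono[of m] n by auto
    have "l \<in> left_words (Suc m) r" "m < n" using w(2) n by auto
    from N_left_words[OF this] consider
        (c) l' where "l' \<in> left_words m r" "N \<otimes> ev l = ev l' \<otimes> (N \<otimes> ascend r)"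
      | (d) r' l' where "r = Suc r'" "l' \<in> left_words m r'" "N \<otimes> ev l = ev l' \<otimes> N"
      by blast
    then show ?thesis
    proof cases
      case (c l')
      have r: "r < n" using left_words_le[OF c(1)] n by simp
      have "N \<otimes> x = (N \<otimes> ev l) \<otimes> (N [^] (n - r) \<otimes> ev w)" by (simp add: x m_assoc)
      also have "\<dots> = ev l' \<otimes> (N \<otimes> ascend r \<otimes> N [^] (n - r) \<otimes> ev w)"
        by (simp only: c(2)) (simp add: m_assoc)
      also have "\<dots> = ev l' \<otimes> [(q ^ r)] \<cdot> (N [^] (n - r) \<otimes> ev w)"
        by (simp only: N_ascend_Npow[OF r] add_pow_ldistr nat_pow_closed gen_closed ev_closed)
      finally show ?thesis
        using left_span_right_span[OF left[OF c(1)] right_span_add_pow[OF z] w(1)] 3 by simp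
    next
      case (d r' l')
      have k: "n - r' = Suc (n - r)" using d(1) w(1) by simp
      have "N \<otimes> x = (N \<otimes> ev l) \<otimes> (N [^] (n - r) \<otimes> ev w)" by (simp add: x m_assoc)
      also have "\<dots> = ev l' \<otimes> ((N \<otimes> N [^] (n - r)) \<otimes> ev w)"
        by (simp only: d(3)) (simp add: m_assoc)
      also have "N \<otimes> N [^] (n - r) = N [^] (n - r')"
        unfolding k by (rule nat_pow_Suc2[symmetric]) simp
      finally have eq: "N \<otimes> x = ev l' \<otimes> (N [^] (n - r') \<otimes> ev w)" .
      \<comment> \<open>\<open>w\<close> was normal behind \<open>N^(n-r)\<close>; behind one more
        \<open>N\<close> it has to be straightened again.\<close>
      have "N [^] (n - r') \<otimes> ev w \<in> right_span (n - r') r'"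
        using set_right_words[OF w(3)] w(1) d(1) by (intro Npow_right_span) auto
      from left_span_right_span[OF left[OF d(2)] this] show ?thesis
        using eq 3 w(1) d(1) by simp
    qed
  qed
qed auto

theorem ev_normal_words:
  assumes "n \<ge> 1" "set w \<subseteq> ry_gens n"
  shows "ev w \<in> int_span R (ev ` normal_words d n)"
  using assms(2)
proof (induction w)
  case Nil
  have "[] \<in> left_words n n" by (simp add: left_words_full)
  from left_spanI[OF this, of "[]"] have "\<one> \<in> left_span n n" by simp
  moreover have "\<one> \<in> right_span (n - n) n" using Npow_right_span[of "[]" 0 n] by simp
  ultimately show ?case using left_span_right_span[of \<one> n \<one>] by simp
next
  case (Cons g w)
  then show ?case using generator_normal_words[of g "ev w"] assms(1) by simp
qed

end

section \<open>Unital algebras with a scalar action, and corners at an idempotent\<close>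

section \<open>Algebras over a field\<close>

locale k_algebra = ring A for A :: "('k::field, 'a) module" (structure) +
  assumes smult_closed [simp, intro]: "x \<in> carrier A \<Longrightarrow> c \<odot> x \<in> carrier A"
    and smult_l_distr: "x \<in> carrier A \<Longrightarrow> (a + b) \<odot> x = a \<odot> x \<oplus> b \<odot> x"
    and smult_r_distr: "x \<in> carrier A \<Longrightarrow> y \<in> carrier A \<Longrightarrow> a \<odot> (x \<oplus> y) = a \<odot> x \<oplus> a \<odot> y"
    and smult_smult: "x \<in> carrier A \<Longrightarrow> a \<odot> (b \<odot> x) = (a * b) \<odot> x"
    and smult_one: "x \<in> carrier A \<Longrightarrow> 1 \<odot> x = x"
    and smult_mult_left: "x \<in> carrier A \<Longrightarrow> y \<in> carrier A \<Longrightarrow> (a \<odot> x) \<otimes> y = a \<odot> (x \<otimes> y)"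
    and smult_mult_right: "x \<in> carrier A \<Longrightarrow> y \<in> carrier A \<Longrightarrow> x \<otimes> (a \<odot> y) = a \<odot> (x \<otimes> y)"
begin

lemma smult_zero_left: "x \<in> carrier A \<Longrightarrow> 0 \<odot> x = \<zero>"
  using smult_l_distr[of x 0 0] by (simp add: local.add.l_cancel_one)

lemma smult_zero_right: "a \<odot> \<zero> = \<zero>"
  using smult_r_distr[of \<zero> \<zero> a] by (simp add: local.add.l_cancel_one)

lemma smult_of_nat: "x \<in> carrier A \<Longrightarrow> of_nat k \<odot> x = [k] \<cdot> x"
  by (induction k) (simp_all add: smult_zero_left smult_l_distr smult_one add.m_comm)

lemma smult_minus: "x \<in> carrier A \<Longrightarrow> a \<odot> (\<ominus> x) = \<ominus> (a \<odot> x)"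
proof -
  assume x: "x \<in> carrier A"
  have "a \<odot> (\<ominus> x) \<oplus> a \<odot> x = \<zero>"
    using x by (simp add: smult_r_distr[symmetric] l_neg smult_zero_right)
  then show ?thesis using x by (metis minus_equality smult_closed add.inv_closed)
qed

end

text \<open>Records that share the five ring components but differ in type or in further fields are
  different terms; this carries the axioms across.\<close>

lemma ring_carrier_cong:
  assumes "ring R" "carrier S = carrier R" "mult S = mult R" "one S = one R" "zero S = zero R" "add S = add R"
  shows "ring S"
proof -
  interpret ring R by fact
  have "abelian_group S"
    by (rule abelian_groupI) (use assms l_neg in \<open>auto simp: a_assoc intro: a_comm\<close>)
  moreover have "monoid S"
    by (rule monoidI) (use assms in \<open>auto simp: m_assoc\<close>)
  ultimately show ?thesis
    by (rule ringI) (use assms in \<open>auto simp: l_distr r_distr\<close>)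
qed

text \<open>This is \<open>e A e\<close> for an idempotent \<open>e\<close>, written through fixed
  point conditions so that membership asks for no preimage.\<close>

definition corner :: "('k, 'a) module \<Rightarrow> 'a \<Rightarrow> ('k, 'a) module" where
  "corner A e = A\<lparr>carrier := {x \<in> carrier A. e \<otimes>\<^bsub>A\<^esub> x = x \<and> x \<otimes>\<^bsub>A\<^esub> e = x}, one := e\<rparr>"

lemma (in k_algebra) corner_k_algebra:
  assumes e: "e \<in> carrier A" "e \<otimes> e = e"
  shows "k_algebra (corner A e)"
proof -
  have mult: "x \<otimes> y \<in> {x \<in> carrier A. e \<otimes> x = x \<and> x \<otimes> e = x}"
    if "x \<in> carrier A" "y \<in> carrier A" "e \<otimes> x = x" "y \<otimes> e = y" for x y
    using that e by (simp add: m_assoc) (metis m_assoc)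
  have neg: "\<exists>y. (y \<in> carrier A \<and> e \<otimes> y = y \<and> y \<otimes> e = y) \<and> y \<oplus> x = \<zero>"
    if "x \<in> carrier A" "e \<otimes> x = x" "x \<otimes> e = x" for x
    using that e by (intro exI[of _ "\<ominus> x"]) (simp add: r_minus l_minus l_neg)
  have r: "ring (corner A e)"
  proof (rule ringI)
    show "abelian_group (corner A e)"
      by (rule abelian_groupI)
        (use e neg in \<open>auto simp: corner_def r_distr l_distr a_assoc intro: a_comm\<close>)
    show "monoid (corner A e)"
      by (rule monoidI) (use e mult in \<open>auto simp: corner_def m_assoc\<close>)
  qed (auto simp: corner_def l_distr r_distr)
  show ?thesis
    by (rule k_algebra.intro[OF r], unfold_locales)
      (use e in \<open>auto simp: corner_def smult_l_distr smult_r_distr smult_smult smult_one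
        smult_mult_left smult_mult_right\<close>)
qed

section \<open>Convolution algebras of monoids\<close>

section \<open>Monoid algebras\<close>

lemma monoid_algebra_simps:
  "carrier (monoid_algebra G) = {f. finite {x. f x \<noteq> 0} \<and> {x. f x \<noteq> 0} \<subseteq> carrier G}"
  "one (monoid_algebra G) = basis_elt \<one>\<^bsub>G\<^esub>"
  "zero (monoid_algebra G) = (\<lambda>_. 0)"
  "add (monoid_algebra G) f g = (\<lambda>x. f x + g x)"
  "smult (monoid_algebra G) c f = (\<lambda>x. c * f x)"
  by (simp_all add: monoid_algebra_def)

lemma basis_elt_apply: "basis_elt x y = (if y = x then 1 else 0)"
  by (simp add: basis_elt_def)

lemma basis_elt_closed: "x \<in> carrier G \<Longrightarrow> basis_elt x \<in> carrier (monoid_algebra G)"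
  by (auto simp: monoid_algebra_simps basis_elt_apply)

text \<open>Any finite sets containing the supports may be summed over, so that several products can
  share one index set.\<close>

lemma monoid_algebra_mult:
  assumes "finite X" "finite Y" "{x. f x \<noteq> 0} \<subseteq> X" "{y. g y \<noteq> 0} \<subseteq> Y"
  shows "(f \<otimes>\<^bsub>monoid_algebra G\<^esub> g) z =
    (\<Sum>x\<in>X. \<Sum>y\<in>Y. if x \<otimes>\<^bsub>G\<^esub> y = z then f x * g y else 0)"
proof -
  let ?S = "{(x, y). f x \<noteq> 0 \<and> g y \<noteq> 0 \<and> x \<otimes>\<^bsub>G\<^esub> y = z}"
  have "(f \<otimes>\<^bsub>monoid_algebra G\<^esub> g) z = (\<Sum>(x, y)\<in>?S. f x * g y)"
    by (simp add: monoid_algebra_def)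
  also have "\<dots> = (\<Sum>(x, y)\<in>?S. if x \<otimes>\<^bsub>G\<^esub> y = z then f x * g y else 0)"
    by (rule sum.cong) auto
  also have "\<dots> = (\<Sum>(x, y)\<in>X \<times> Y. if x \<otimes>\<^bsub>G\<^esub> y = z then f x * g y else 0)"
    by (rule sum.mono_neutral_left) (use assms in \<open>auto split: if_splits\<close>)
  also have "\<dots> = (\<Sum>x\<in>X. \<Sum>y\<in>Y. if x \<otimes>\<^bsub>G\<^esub> y = z then f x * g y else 0)"
    by (rule sum.cartesian_product[symmetric])
  finally show ?thesis .
qed

text \<open>Testing a product against a function \<phi> only involves the values of \<phi> at
  products of monoid elements. With a suitable \<phi>, associativity and the multiplicativity of
  linear extensions become exchanges of finite sums; \<kappa> allows the two sides to have different
  coefficients.\<close>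

lemma monoid_algebra_pairing:
  fixes \<kappa> :: "'c::comm_ring_1 \<Rightarrow> 'k::comm_ring_1"
  assumes "comm_ring_hom \<kappa>"
    and "finite X" "finite Y" "{x. f x \<noteq> 0} \<subseteq> X" "{y. g y \<noteq> 0} \<subseteq> Y"
    and "finite W" "\<And>x y. x \<in> X \<Longrightarrow> y \<in> Y \<Longrightarrow> x \<otimes>\<^bsub>G\<^esub> y \<in> W"
  shows "(\<Sum>w\<in>W. \<kappa> ((f \<otimes>\<^bsub>monoid_algebra G\<^esub> g) w) * \<phi> w) =
    (\<Sum>x\<in>X. \<Sum>y\<in>Y. \<kappa> (f x) * \<kappa> (g y) * \<phi> (x \<otimes>\<^bsub>G\<^esub> y))"
proof -
  interpret \<kappa>: comm_ring_hom \<kappa> by fact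
  have *: "\<kappa> (if P then f x * g y else 0) = (if P then \<kappa> (f x) * \<kappa> (g y) else 0)" for P x y
    by (simp add: \<kappa>.hom_mult)
  have "(\<Sum>w\<in>W. \<kappa> ((f \<otimes>\<^bsub>monoid_algebra G\<^esub> g) w) * \<phi> w) =
      (\<Sum>w\<in>W. \<Sum>x\<in>X. \<Sum>y\<in>Y. (if x \<otimes>\<^bsub>G\<^esub> y = w then \<kappa> (f x) * \<kappa> (g y) else 0) * \<phi> w)"
    by (simp only: monoid_algebra_mult[OF assms(2-5)] \<kappa>.hom_sum * sum_distrib_right)
  also have "\<dots> = (\<Sum>x\<in>X. \<Sum>y\<in>Y. \<Sum>w\<in>W. (if x \<otimes>\<^bsub>G\<^esub> y = w then \<kappa> (f x) * \<kappa> (g y) else 0) * \<phi> w)"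
    by (subst sum.swap, rule sum.cong[OF refl], rule sum.swap)
  also have "\<dots> = (\<Sum>x\<in>X. \<Sum>y\<in>Y. \<kappa> (f x) * \<kappa> (g y) * \<phi> (x \<otimes>\<^bsub>G\<^esub> y))"
  proof (intro sum.cong refl)
    fix x y assume xy: "x \<in> X" "y \<in> Y"
    have "(\<Sum>w\<in>W. (if x \<otimes>\<^bsub>G\<^esub> y = w then \<kappa> (f x) * \<kappa> (g y) else 0) * \<phi> w) =
        (\<Sum>w\<in>W. if w = x \<otimes>\<^bsub>G\<^esub> y then \<kappa> (f x) * \<kappa> (g y) * \<phi> w else 0)"
      by (rule sum.cong) auto
    then show "(\<Sum>w\<in>W. (if x \<otimes>\<^bsub>G\<^esub> y = w then \<kappa> (f x) * \<kappa> (g y) else 0) * \<phi> w) =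
        \<kappa> (f x) * \<kappa> (g y) * \<phi> (x \<otimes>\<^bsub>G\<^esub> y)"
      using assms(6,7) xy by simp
  qed
  finally show ?thesis .
qed

lemma comm_ring_hom_id: "comm_ring_hom (\<lambda>x::'c::comm_ring_1. x)"
  by unfold_locales auto

lemma monoid_algebra_support:
  fixes G (structure)
  assumes "f \<in> carrier (monoid_algebra G)" "g \<in> carrier (monoid_algebra G)" "monoid G"
  defines "W \<equiv> (\<lambda>(x, y). x \<otimes>\<^bsub>G\<^esub> y) ` ({x. f x \<noteq> 0} \<times> {y. g y \<noteq> 0})"
  shows "finite W" "W \<subseteq> carrier G" "{z. (f \<otimes>\<^bsub>monoid_algebra G\<^esub> g) z \<noteq> 0} \<subseteq> W"
proof -
  interpret monoid G by fact
  show "finite W" "W \<subseteq> carrier G" using assms(1,2) by (auto simp: W_def monoid_algebra_simps)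
  show "{z. (f \<otimes>\<^bsub>monoid_algebra G\<^esub> g) z \<noteq> 0} \<subseteq> W"
  proof (rule subsetI, rule ccontr)
    fix z assume z: "z \<in> {z. (f \<otimes>\<^bsub>monoid_algebra G\<^esub> g) z \<noteq> 0}" "z \<notin> W"
    have "(f \<otimes>\<^bsub>monoid_algebra G\<^esub> g) z = (\<Sum>(x, y)\<in>{(x, y). f x \<noteq> 0 \<and> g y \<noteq> 0 \<and> x \<otimes> y = z}. f x * g y)"
      by (simp add: monoid_algebra_def)
    also have "{(x, y). f x \<noteq> 0 \<and> g y \<noteq> 0 \<and> x \<otimes> y = z} = {}"
      using z(2) by (auto simp: W_def)
    finally show False using z(1) by simp
  qed
qed

lemma monoid_algebra_ring:
  fixes G (structure)
  assumes "monoid G"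
  shows "ring (monoid_algebra G :: ('k::comm_ring_1, 'a \<Rightarrow> 'k) module)"
    (is "ring ?A")
proof (rule ringI)
  interpret monoid G by fact
  have fin: "finite {x. f x \<noteq> 0}" if "f \<in> carrier ?A" for f using that by (simp add: monoid_algebra_simps)
  have carr: "x \<in> carrier G" if "f \<in> carrier ?A" "f x \<noteq> 0" for f x
    using that by (auto simp: monoid_algebra_simps)
  have add_closed: "f \<oplus>\<^bsub>?A\<^esub> g \<in> carrier ?A" if "f \<in> carrier ?A" "g \<in> carrier ?A" for f g
  proof -
    have "{x. f x + g x \<noteq> 0} \<subseteq> {x. f x \<noteq> 0} \<union> {x. g x \<noteq> 0}" by auto
    then show ?thesis using that by (auto simp: monoid_algebra_simps intro: finite_subset)
  qed
  show "abelian_group ?A"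
  proof (rule abelian_groupI)
    fix f assume "f \<in> carrier ?A"
    then have "(\<lambda>x. - f x) \<in> carrier ?A" by (simp add: monoid_algebra_simps)
    then show "\<exists>g\<in>carrier ?A. g \<oplus>\<^bsub>?A\<^esub> f = \<zero>\<^bsub>?A\<^esub>"
      by (rule bexI[rotated]) (simp add: monoid_algebra_simps)
  qed (use add_closed in \<open>auto simp: monoid_algebra_simps add_ac\<close>)
  show "monoid ?A"
  proof (rule monoidI)
    fix f g assume "f \<in> carrier ?A" "g \<in> carrier ?A"
    from monoid_algebra_support[OF this assms] show "f \<otimes>\<^bsub>?A\<^esub> g \<in> carrier ?A"
      using finite_subset by (fastforce simp: monoid_algebra_simps)
  next
    show "\<one>\<^bsub>?A\<^esub> \<in> carrier ?A" by (auto simp: monoid_algebra_simps basis_elt_apply)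
  next
    fix f g h assume c: "f \<in> carrier ?A" "g \<in> carrier ?A" "h \<in> carrier ?A"
    let ?F = "{x. f x \<noteq> 0}" and ?G = "{x. g x \<noteq> 0}" and ?H = "{x. h x \<noteq> 0}"
    define FG where "FG = (\<lambda>(x, y). x \<otimes> y) ` (?F \<times> ?G)"
    define GH where "GH = (\<lambda>(x, y). x \<otimes> y) ` (?G \<times> ?H)"
    note FG = monoid_algebra_support[OF c(1,2) assms, folded FG_def]
    note GH = monoid_algebra_support[OF c(2,3) assms, folded GH_def]
    show "(f \<otimes>\<^bsub>?A\<^esub> g) \<otimes>\<^bsub>?A\<^esub> h = f \<otimes>\<^bsub>?A\<^esub> (g \<otimes>\<^bsub>?A\<^esub> h)"
    proof
      fix z
      have "((f \<otimes>\<^bsub>?A\<^esub> g) \<otimes>\<^bsub>?A\<^esub> h) z =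
          (\<Sum>w\<in>FG. (f \<otimes>\<^bsub>?A\<^esub> g) w * (\<Sum>c\<in>?H. if w \<otimes> c = z then h c else 0))"
        by (subst monoid_algebra_mult[OF FG(1) fin[OF c(3)] FG(3) order_refl])
          (auto simp: sum_distrib_left intro!: sum.cong)
      also have "\<dots> = (\<Sum>a\<in>?F. \<Sum>b\<in>?G. f a * g b * (\<Sum>c\<in>?H. if a \<otimes> b \<otimes> c = z then h c else 0))"
        by (rule monoid_algebra_pairing[OF comm_ring_hom_id]) (use c fin FG in \<open>auto simp: FG_def\<close>)
      also have "\<dots> = (\<Sum>a\<in>?F. \<Sum>b\<in>?G. \<Sum>c\<in>?H. g b * h c * (if a \<otimes> (b \<otimes> c) = z then f a else 0))"
        using c carr by (auto simp: sum_distrib_left m_assoc intro!: sum.cong)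
      also have "\<dots> = (\<Sum>a\<in>?F. \<Sum>w\<in>GH. (g \<otimes>\<^bsub>?A\<^esub> h) w * (if a \<otimes> w = z then f a else 0))"
        by (intro sum.cong[OF refl], rule monoid_algebra_pairing[OF comm_ring_hom_id, symmetric])
          (use c fin GH in \<open>auto simp: GH_def\<close>)
      also have "\<dots> = (f \<otimes>\<^bsub>?A\<^esub> (g \<otimes>\<^bsub>?A\<^esub> h)) z"
        by (subst monoid_algebra_mult[OF fin[OF c(1)] GH(1) order_refl GH(3)])
          (auto intro!: sum.cong)
      finally show "((f \<otimes>\<^bsub>?A\<^esub> g) \<otimes>\<^bsub>?A\<^esub> h) z = (f \<otimes>\<^bsub>?A\<^esub> (g \<otimes>\<^bsub>?A\<^esub> h)) z" .
    qed
  next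
    fix f assume f: "f \<in> carrier ?A"
    have one: "{x. basis_elt \<one> x \<noteq> (0::'k)} \<subseteq> {\<one>}" by (auto simp: basis_elt_apply)
    show "\<one>\<^bsub>?A\<^esub> \<otimes>\<^bsub>?A\<^esub> f = f"
    proof
      fix z
      have "(\<one>\<^bsub>?A\<^esub> \<otimes>\<^bsub>?A\<^esub> f) z = (\<Sum>y\<in>{x. f x \<noteq> 0}. if y = z then f y else 0)"
        unfolding monoid_algebra_simps(2)
        by (subst monoid_algebra_mult[OF _ fin[OF f] one order_refl])
          (use carr[OF f] in \<open>auto simp: basis_elt_apply intro!: sum.cong\<close>)
      then show "(\<one>\<^bsub>?A\<^esub> \<otimes>\<^bsub>?A\<^esub> f) z = f z" using fin[OF f] by simp
    qed
    show "f \<otimes>\<^bsub>?A\<^esub> \<one>\<^bsub>?A\<^esub> = f"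
    proof
      fix z
      have "(f \<otimes>\<^bsub>?A\<^esub> \<one>\<^bsub>?A\<^esub>) z = (\<Sum>y\<in>{x. f x \<noteq> 0}. if y = z then f y else 0)"
        unfolding monoid_algebra_simps(2)
        by (subst monoid_algebra_mult[OF fin[OF f] _ order_refl one])
          (use carr[OF f] in \<open>auto simp: basis_elt_apply intro!: sum.cong\<close>)
      then show "(f \<otimes>\<^bsub>?A\<^esub> \<one>\<^bsub>?A\<^esub>) z = f z" using fin[OF f] by simp
    qed
  qed
next
  fix f g h assume c: "f \<in> carrier ?A" "g \<in> carrier ?A" "h \<in> carrier ?A"
  have fin: "finite {x. f x \<noteq> 0}" if "f \<in> carrier ?A" for f using that by (simp add: monoid_algebra_simps)
  let ?X = "{x. f x \<noteq> 0} \<union> {x. g x \<noteq> 0}" and ?Y = "{x. h x \<noteq> 0}"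
  have X: "finite ?X" and Y: "finite ?Y" using c fin by auto
  show "(f \<oplus>\<^bsub>?A\<^esub> g) \<otimes>\<^bsub>?A\<^esub> h = f \<otimes>\<^bsub>?A\<^esub> h \<oplus>\<^bsub>?A\<^esub> g \<otimes>\<^bsub>?A\<^esub> h"
  proof
    fix z
    have "((f \<oplus>\<^bsub>?A\<^esub> g) \<otimes>\<^bsub>?A\<^esub> h) z = (\<Sum>x\<in>?X. \<Sum>y\<in>?Y. if x \<otimes>\<^bsub>G\<^esub> y = z then (f x + g x) * h y else 0)"
      by (subst monoid_algebra_mult[OF X Y]) (auto simp: monoid_algebra_simps cong: if_cong)
    also have "\<dots> = (\<Sum>x\<in>?X. \<Sum>y\<in>?Y. if x \<otimes>\<^bsub>G\<^esub> y = z then f x * h y else 0) +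
        (\<Sum>x\<in>?X. \<Sum>y\<in>?Y. if x \<otimes>\<^bsub>G\<^esub> y = z then g x * h y else 0)"
      by (unfold sum.distrib[symmetric], intro sum.cong refl) (simp add: distrib_right)
    also have "\<dots> = (f \<otimes>\<^bsub>?A\<^esub> h \<oplus>\<^bsub>?A\<^esub> g \<otimes>\<^bsub>?A\<^esub> h) z"
      by (auto simp: monoid_algebra_simps monoid_algebra_mult[OF X Y])
    finally show "((f \<oplus>\<^bsub>?A\<^esub> g) \<otimes>\<^bsub>?A\<^esub> h) z = (f \<otimes>\<^bsub>?A\<^esub> h \<oplus>\<^bsub>?A\<^esub> g \<otimes>\<^bsub>?A\<^esub> h) z" .
  qed
  show "h \<otimes>\<^bsub>?A\<^esub> (f \<oplus>\<^bsub>?A\<^esub> g) = h \<otimes>\<^bsub>?A\<^esub> f \<oplus>\<^bsub>?A\<^esub> h \<otimes>\<^bsub>?A\<^esub> g"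
  proof
    fix z
    have "(h \<otimes>\<^bsub>?A\<^esub> (f \<oplus>\<^bsub>?A\<^esub> g)) z = (\<Sum>y\<in>?Y. \<Sum>x\<in>?X. if y \<otimes>\<^bsub>G\<^esub> x = z then h y * (f x + g x) else 0)"
      by (subst monoid_algebra_mult[OF Y X]) (auto simp: monoid_algebra_simps cong: if_cong)
    also have "\<dots> = (\<Sum>y\<in>?Y. \<Sum>x\<in>?X. if y \<otimes>\<^bsub>G\<^esub> x = z then h y * f x else 0) +
        (\<Sum>y\<in>?Y. \<Sum>x\<in>?X. if y \<otimes>\<^bsub>G\<^esub> x = z then h y * g x else 0)"
      by (unfold sum.distrib[symmetric], intro sum.cong refl) (simp add: distrib_left)
    also have "\<dots> = (h \<otimes>\<^bsub>?A\<^esub> f \<oplus>\<^bsub>?A\<^esub> h \<otimes>\<^bsub>?A\<^esub> g) z"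
      by (auto simp: monoid_algebra_simps monoid_algebra_mult[OF Y X])
    finally show "(h \<otimes>\<^bsub>?A\<^esub> (f \<oplus>\<^bsub>?A\<^esub> g)) z = (h \<otimes>\<^bsub>?A\<^esub> f \<oplus>\<^bsub>?A\<^esub> h \<otimes>\<^bsub>?A\<^esub> g) z" .
  qed
qed

lemma monoid_algebra_k_algebra:
  assumes "monoid G"
  shows "k_algebra (monoid_algebra G :: ('k::field, 'a \<Rightarrow> 'k) module)" (is "k_algebra ?A")
proof (rule k_algebra.intro[OF monoid_algebra_ring[OF assms]], unfold_locales)
  fix f g :: "'a \<Rightarrow> 'k" and a b :: 'k
  assume f: "f \<in> carrier ?A"
  then have fin: "finite {x. f x \<noteq> 0}" by (simp add: monoid_algebra_simps)
  have sub: "{x. a * f x \<noteq> 0} \<subseteq> {x. f x \<noteq> 0}" by auto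
  then show "a \<odot>\<^bsub>?A\<^esub> f \<in> carrier ?A"
    using f fin by (auto simp: monoid_algebra_simps intro: finite_subset)
  show "(a + b) \<odot>\<^bsub>?A\<^esub> f = a \<odot>\<^bsub>?A\<^esub> f \<oplus>\<^bsub>?A\<^esub> b \<odot>\<^bsub>?A\<^esub> f" "a \<odot>\<^bsub>?A\<^esub> (b \<odot>\<^bsub>?A\<^esub> f) = (a * b) \<odot>\<^bsub>?A\<^esub> f"
    "1 \<odot>\<^bsub>?A\<^esub> f = f"
    by (simp_all add: monoid_algebra_simps algebra_simps)
  assume g: "g \<in> carrier ?A"
  then have fin': "finite {x. g x \<noteq> 0}" by (simp add: monoid_algebra_simps)
  have sub': "{x. a * g x \<noteq> 0} \<subseteq> {x. g x \<noteq> 0}" by auto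
  show "a \<odot>\<^bsub>?A\<^esub> (f \<oplus>\<^bsub>?A\<^esub> g) = a \<odot>\<^bsub>?A\<^esub> f \<oplus>\<^bsub>?A\<^esub> a \<odot>\<^bsub>?A\<^esub> g"
    by (simp add: monoid_algebra_simps algebra_simps)
  show "a \<odot>\<^bsub>?A\<^esub> f \<otimes>\<^bsub>?A\<^esub> g = a \<odot>\<^bsub>?A\<^esub> (f \<otimes>\<^bsub>?A\<^esub> g)"
    unfolding monoid_algebra_simps
    by (rule ext) (auto simp: monoid_algebra_mult[OF fin fin' sub order_refl]
        monoid_algebra_mult[OF fin fin' order_refl order_refl] sum_distrib_left mult.assoc intro!: sum.cong)
  show "f \<otimes>\<^bsub>?A\<^esub> (a \<odot>\<^bsub>?A\<^esub> g) = a \<odot>\<^bsub>?A\<^esub> (f \<otimes>\<^bsub>?A\<^esub> g)"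
    unfolding monoid_algebra_simps
    by (rule ext) (auto simp: monoid_algebra_mult[OF fin fin' order_refl sub']
        monoid_algebra_mult[OF fin fin' order_refl order_refl] sum_distrib_left mult_ac intro!: sum.cong)
qed

lemma monoid_algebra_a_inv:
  assumes "monoid G" "f \<in> carrier (monoid_algebra G)"
  shows "\<ominus>\<^bsub>monoid_algebra G\<^esub> f = (\<lambda>x. - f x)"
proof -
  interpret ring "monoid_algebra G" by (rule monoid_algebra_ring) fact
  show ?thesis
    by (rule minus_equality[symmetric, THEN sym]) (use assms(2) in \<open>auto simp: monoid_algebra_simps\<close>)
qed

lemma monoid_algebra_minus:
  assumes "monoid G" "f \<in> carrier (monoid_algebra G)" "g \<in> carrier (monoid_algebra G)"
  shows "f \<ominus>\<^bsub>monoid_algebra G\<^esub> g = (\<lambda>x. f x - g x)"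
  using monoid_algebra_a_inv[OF assms(1,3)] by (simp add: a_minus_def monoid_algebra_simps)

lemma basis_elt_mult:
  "basis_elt x \<otimes>\<^bsub>monoid_algebra G\<^esub> basis_elt y = basis_elt (x \<otimes>\<^bsub>G\<^esub> y)"
  by (rule ext, subst monoid_algebra_mult[of "{x}" "{y}"]) (auto simp: basis_elt_apply)

section \<open>Linear extension of monoid homomorphisms\<close>

subsection \<open>The universal property\<close>

text \<open>Targets are rings of functions, so the linear extension can be written pointwise. Two
  choices of \<kappa> occur: the identity of the field for words, and the embedding of the integers
  for tensors.\<close>

definition lift_hom :: "('c::comm_ring_1 \<Rightarrow> 'k::comm_ring_1) \<Rightarrow> ('g \<Rightarrow> 'a \<Rightarrow> 'k) \<Rightarrow> ('g \<Rightarrow> 'c) \<Rightarrow> 'a \<Rightarrow> 'k" where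
  "lift_hom \<kappa> \<phi> f = (\<lambda>z. \<Sum>x | f x \<noteq> 0. \<kappa> (f x) * \<phi> x z)"

lemma lift_hom_eq:
  assumes "comm_ring_hom \<kappa>" "finite X" "{x. f x \<noteq> 0} \<subseteq> X"
  shows "lift_hom \<kappa> \<phi> f z = (\<Sum>x\<in>X. \<kappa> (f x) * \<phi> x z)"
proof -
  interpret comm_ring_hom \<kappa> by fact
  show ?thesis
    unfolding lift_hom_def by (rule sum.mono_neutral_left) (use assms(2,3) in auto)
qed

lemma lift_hom_basis:
  assumes "comm_ring_hom \<kappa>"
  shows "lift_hom \<kappa> \<phi> (basis_elt x) = \<phi> x"
proof -
  interpret comm_ring_hom \<kappa> by fact
  show ?thesis
    by (rule ext, subst lift_hom_eq[OF assms, of "{x}"]) (auto simp: basis_elt_apply)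
qed

text \<open>\<open>B\<close> shares its operations with a monoid algebra but may have another unit
  and a smaller carrier, so that a corner is admissible as a target.\<close>

lemma lift_hom_ring_hom:
  fixes \<kappa> :: "'c::comm_ring_1 \<Rightarrow> 'k::field" and G :: "('g, 'm) monoid_scheme"
    and B :: "('k, 'a \<Rightarrow> 'k) module" and G' :: "('a, 'b) monoid_scheme"
  assumes \<kappa>: "comm_ring_hom \<kappa>" and G: "monoid G" and B: "k_algebra B"
    and mult_B: "mult B = mult (monoid_algebra G')"
    and add_B: "add B = add (monoid_algebra G')"
    and zero_B: "zero B = zero (monoid_algebra G')"
    and smult_B: "smult B = smult (monoid_algebra G')"
    and carrier_B: "carrier B \<subseteq> carrier (monoid_algebra G')"
    and \<phi>: "\<And>x. x \<in> carrier G \<Longrightarrow> \<phi> x \<in> carrier B"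
    and \<phi>_mult: "\<And>x y. x \<in> carrier G \<Longrightarrow> y \<in> carrier G \<Longrightarrow> \<phi> (x \<otimes>\<^bsub>G\<^esub> y) = \<phi> x \<otimes>\<^bsub>B\<^esub> \<phi> y"
    and \<phi>_one: "\<phi> \<one>\<^bsub>G\<^esub> = \<one>\<^bsub>B\<^esub>"
  shows "lift_hom \<kappa> \<phi> \<in> Ring.ring_hom (monoid_algebra G) B"
proof (rule ring_hom_memI)
  interpret \<kappa>: comm_ring_hom \<kappa> by fact
  interpret B: k_algebra B by fact
  let ?A = "monoid_algebra G :: ('c, 'g \<Rightarrow> 'c) module"
  have fin: "finite {x. f x \<noteq> 0}" if "f \<in> carrier ?A" for f using that by (simp add: monoid_algebra_simps)
  have carr: "x \<in> carrier G" if "f \<in> carrier ?A" "f x \<noteq> 0" for f x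
    using that by (auto simp: monoid_algebra_simps)
  have sum_B: "(\<lambda>z. \<Sum>x\<in>X. c x * \<phi> x z) \<in> carrier B" if "finite X" "X \<subseteq> carrier G" for X c
    using that
  proof (induction rule: finite_induct)
    case empty
    show ?case using B.zero_closed by (simp add: zero_B monoid_algebra_simps)
  next
    case (insert x X)
    then have "c x \<odot>\<^bsub>B\<^esub> \<phi> x \<oplus>\<^bsub>B\<^esub> (\<lambda>z. \<Sum>x\<in>X. c x * \<phi> x z) \<in> carrier B"
      using \<phi> by (intro B.a_closed B.smult_closed) auto
    then show ?case using insert by (simp add: smult_B add_B monoid_algebra_simps)
  qed
  show closed: "lift_hom \<kappa> \<phi> f \<in> carrier B" if f: "f \<in> carrier ?A" for f
    unfolding lift_hom_def by (rule sum_B[OF fin[OF f]]) (use carr[OF f] in auto)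
  show "lift_hom \<kappa> \<phi> \<one>\<^bsub>?A\<^esub> = \<one>\<^bsub>B\<^esub>"
    by (simp add: monoid_algebra_simps lift_hom_basis[OF \<kappa>] \<phi>_one)
  fix f g assume f: "f \<in> carrier ?A" and g: "g \<in> carrier ?A"
  let ?F = "{x. f x \<noteq> 0}" and ?G = "{x. g x \<noteq> 0}"
  show "lift_hom \<kappa> \<phi> (f \<oplus>\<^bsub>?A\<^esub> g) = lift_hom \<kappa> \<phi> f \<oplus>\<^bsub>B\<^esub> lift_hom \<kappa> \<phi> g"
  proof
    fix z
    have X: "finite (?F \<union> ?G)" using f g fin by blast
    show "lift_hom \<kappa> \<phi> (f \<oplus>\<^bsub>?A\<^esub> g) z = (lift_hom \<kappa> \<phi> f \<oplus>\<^bsub>B\<^esub> lift_hom \<kappa> \<phi> g) z"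
      unfolding add_B monoid_algebra_simps
      by (subst (1 2 3) lift_hom_eq[OF \<kappa> X])
        (auto simp: \<kappa>.hom_add distrib_right sum.distrib)
  qed
  define W where "W = (\<lambda>(x, y). x \<otimes>\<^bsub>G\<^esub> y) ` (?F \<times> ?G)"
  note W = monoid_algebra_support[OF f g G, folded W_def]
  show "lift_hom \<kappa> \<phi> (f \<otimes>\<^bsub>?A\<^esub> g) = lift_hom \<kappa> \<phi> f \<otimes>\<^bsub>B\<^esub> lift_hom \<kappa> \<phi> g"
  proof
    fix z
    define X where "X = (\<Union>a\<in>?F. {x. \<phi> a x \<noteq> 0})"
    define Y where "Y = (\<Union>b\<in>?G. {x. \<phi> b x \<noteq> 0})"
    have fin_\<phi>: "finite {x. \<phi> a x \<noteq> 0}" if "a \<in> carrier G" for a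
      using \<phi>[OF that] carrier_B by (auto simp: monoid_algebra_simps)
    have X: "finite X" and Y: "finite Y"
      using fin[OF f] fin[OF g] carr[OF f] carr[OF g] fin_\<phi> by (auto simp: X_def Y_def)
    have supp: "{x. lift_hom \<kappa> \<phi> f x \<noteq> 0} \<subseteq> X" "{x. lift_hom \<kappa> \<phi> g x \<noteq> 0} \<subseteq> Y"
      unfolding lift_hom_def X_def Y_def by (auto elim!: sum.not_neutral_contains_not_neutral)
    have \<phi>\<phi>: "\<phi> (a \<otimes>\<^bsub>G\<^esub> b) z = (\<Sum>x\<in>X. \<Sum>y\<in>Y. if x \<otimes>\<^bsub>G'\<^esub> y = z then \<phi> a x * \<phi> b y else 0)"
      if "a \<in> ?F" "b \<in> ?G" for a b
    proof -
      have "\<phi> (a \<otimes>\<^bsub>G\<^esub> b) = \<phi> a \<otimes>\<^bsub>monoid_algebra G'\<^esub> \<phi> b"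
        using \<phi>_mult[of a b] carr[OF f] carr[OF g] that by (simp add: mult_B)
      then have "\<phi> (a \<otimes>\<^bsub>G\<^esub> b) z = (\<phi> a \<otimes>\<^bsub>monoid_algebra G'\<^esub> \<phi> b) z" by simp
      also have "(\<phi> a \<otimes>\<^bsub>monoid_algebra G'\<^esub> \<phi> b) z = (\<Sum>x\<in>X. \<Sum>y\<in>Y. if x \<otimes>\<^bsub>G'\<^esub> y = z then \<phi> a x * \<phi> b y else 0)"
        by (rule monoid_algebra_mult[OF X Y]) (use that in \<open>auto simp: X_def Y_def\<close>)
      finally show ?thesis .
    qed
    have "lift_hom \<kappa> \<phi> (f \<otimes>\<^bsub>?A\<^esub> g) z = (\<Sum>w\<in>W. \<kappa> ((f \<otimes>\<^bsub>?A\<^esub> g) w) * \<phi> w z)"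
      by (rule lift_hom_eq[OF \<kappa> W(1,3)])
    also have "\<dots> = (\<Sum>a\<in>?F. \<Sum>b\<in>?G. \<kappa> (f a) * \<kappa> (g b) * \<phi> (a \<otimes>\<^bsub>G\<^esub> b) z)"
      by (rule monoid_algebra_pairing[OF \<kappa>]) (use fin f g W in \<open>auto simp: W_def\<close>)
    also have "\<dots> = (\<Sum>a\<in>?F. \<Sum>b\<in>?G. \<Sum>x\<in>X. \<Sum>y\<in>Y.
        if x \<otimes>\<^bsub>G'\<^esub> y = z then (\<kappa> (f a) * \<phi> a x) * (\<kappa> (g b) * \<phi> b y) else 0)"
      by (intro sum.cong refl) (auto simp: \<phi>\<phi> sum_distrib_left mult_ac intro!: sum.cong)
    also have "\<dots> = (\<Sum>a\<in>?F. \<Sum>x\<in>X. \<Sum>b\<in>?G. \<Sum>y\<in>Y.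
        if x \<otimes>\<^bsub>G'\<^esub> y = z then (\<kappa> (f a) * \<phi> a x) * (\<kappa> (g b) * \<phi> b y) else 0)"
      by (rule sum.cong[OF refl], rule sum.swap)
    also have "\<dots> = (\<Sum>x\<in>X. \<Sum>a\<in>?F. \<Sum>b\<in>?G. \<Sum>y\<in>Y.
        if x \<otimes>\<^bsub>G'\<^esub> y = z then (\<kappa> (f a) * \<phi> a x) * (\<kappa> (g b) * \<phi> b y) else 0)"
      by (rule sum.swap)
    also have "\<dots> = (\<Sum>x\<in>X. \<Sum>a\<in>?F. \<Sum>y\<in>Y. \<Sum>b\<in>?G.
        if x \<otimes>\<^bsub>G'\<^esub> y = z then (\<kappa> (f a) * \<phi> a x) * (\<kappa> (g b) * \<phi> b y) else 0)"
      by (rule sum.cong[OF refl], rule sum.cong[OF refl], rule sum.swap)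
    also have "\<dots> = (\<Sum>x\<in>X. \<Sum>y\<in>Y. \<Sum>a\<in>?F. \<Sum>b\<in>?G.
        if x \<otimes>\<^bsub>G'\<^esub> y = z then (\<kappa> (f a) * \<phi> a x) * (\<kappa> (g b) * \<phi> b y) else 0)"
      by (rule sum.cong[OF refl], rule sum.swap)
    also have "\<dots> = (\<Sum>x\<in>X. \<Sum>y\<in>Y.
        if x \<otimes>\<^bsub>G'\<^esub> y = z then lift_hom \<kappa> \<phi> f x * lift_hom \<kappa> \<phi> g y else 0)"
      by (intro sum.cong refl) (auto simp: lift_hom_def sum_product)
    also have "\<dots> = (lift_hom \<kappa> \<phi> f \<otimes>\<^bsub>B\<^esub> lift_hom \<kappa> \<phi> g) z"
      unfolding mult_B by (rule monoid_algebra_mult[OF X Y supp, symmetric])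
    finally show "lift_hom \<kappa> \<phi> (f \<otimes>\<^bsub>?A\<^esub> g) z = (lift_hom \<kappa> \<phi> f \<otimes>\<^bsub>B\<^esub> lift_hom \<kappa> \<phi> g) z" .
  qed
qed

section \<open>Transport of the defining relations along algebra homomorphisms\<close>

section \<open>The defining relations under homomorphisms\<close>

locale k_algebra_hom = A: k_algebra A + B: k_algebra B
  for A :: "('k::field_char_0, 'a) module" and B :: "('k, 'b) module" +
  fixes h
  assumes ring_hom: "h \<in> Ring.ring_hom A B"
    and smult_hom: "x \<in> carrier A \<Longrightarrow> h (c \<odot>\<^bsub>A\<^esub> x) = c \<odot>\<^bsub>B\<^esub> h x"

sublocale k_algebra_hom \<subseteq> ring_hom_ring A B h
  by (rule ring_hom_ringI2[OF A.ring_axioms B.ring_axioms ring_hom])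

context k_algebra_hom
begin

context
  fixes n :: nat and gen :: "ry_gen \<Rightarrow> 'a"
  assumes n: "n \<ge> 1" and gen: "\<And>g. g \<in> ry_gens n \<Longrightarrow> gen g \<in> carrier A"
begin

lemma gens_closed:
  "i \<in> {1..<n} \<Longrightarrow> gen (GenT i) \<in> carrier A"
  "i \<in> {1..n} \<Longrightarrow> gen (GenF i) \<in> carrier A"
  "gen GenN \<in> carrier A"
  by (rule gen, simp add: ry_gens_def)+

lemma ry_E_hom:
  assumes "i \<in> {1..<n}"
  shows "ry_E d A (\<lambda>i. gen (GenF i)) i \<in> carrier A"
    and "h (ry_E d A (\<lambda>i. gen (GenF i)) i) = ry_E d B (\<lambda>i. h (gen (GenF i))) i"
proof -
  have c: "gen (GenF i) \<in> carrier A" "gen (GenF (i + 1)) \<in> carrier A"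
    using assms by (auto intro!: gens_closed)
  have p: "(\<lambda>k. gen (GenF i) [^]\<^bsub>A\<^esub> k \<otimes>\<^bsub>A\<^esub> gen (GenF (i + 1)) [^]\<^bsub>A\<^esub> (d - k)) \<in> {..<d} \<rightarrow> carrier A"
    using c by auto
  show "ry_E d A (\<lambda>i. gen (GenF i)) i \<in> carrier A"
    unfolding ry_E_def using p by (intro A.smult_closed A.finsum_closed) auto
  show "h (ry_E d A (\<lambda>i. gen (GenF i)) i) = ry_E d B (\<lambda>i. h (gen (GenF i))) i"
    unfolding ry_E_def using p c
    by (subst smult_hom) (auto simp: hom_nat_pow intro!: A.finsum_closed arg_cong[of _ _ "smult B _"] B.finsum_cong')
qed

lemma foldr_hom:
  "set xs \<subseteq> {1..<n} \<Longrightarrow> foldr (\<lambda>i x. gen (GenT i) \<otimes>\<^bsub>A\<^esub> x) xs \<one>\<^bsub>A\<^esub> \<in> carrier A \<and>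
    h (foldr (\<lambda>i x. gen (GenT i) \<otimes>\<^bsub>A\<^esub> x) xs \<one>\<^bsub>A\<^esub>) =
      foldr (\<lambda>i x. h (gen (GenT i)) \<otimes>\<^bsub>B\<^esub> x) xs \<one>\<^bsub>B\<^esub>"
  by (induction xs) (auto intro: gens_closed(1) simp: gens_closed)

text \<open>Used to see that a homomorphism from the free algebra kills the relators once the images
  of the generators satisfy the relations.\<close>

lemma ry_relations_hom:
  assumes "(l, r) \<in> ry_relations d n u A (\<lambda>i. gen (GenT i)) (\<lambda>i. gen (GenF i)) (gen GenN)"
  shows "l \<in> carrier A \<and> r \<in> carrier A \<and>
    (h l, h r) \<in> ry_relations d n u B (\<lambda>i. h (gen (GenT i))) (\<lambda>i. h (gen (GenF i))) (h (gen GenN))"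
    (is "_ \<and> _ \<and> _ \<in> ?R")
proof -
  note [simp] = gens_closed[simplified] hom_nat_pow smult_hom ry_E_hom[simplified]
  have tr: "transpose i (Suc i) j \<in> {1..n}" if "i \<in> {1..<n}" "j \<in> {1..n}" for i j
    using that by (auto simp: transpose_def)
  from assms show ?thesis
  proof (cases rule: ry_relations.cases)
    case (braid i j)
    then show ?thesis using ry_relations.braid[of i n j] by simp
  next
    case (T_comm i j)
    then show ?thesis using ry_relations.T_comm[of i n j] by simp
  next
    case (F_pow i)
    then show ?thesis using ry_relations.F_pow[where A = B and i = i and f = "\<lambda>i. h (gen (GenF i))"] by simp
  next
    case (F_comm i j)
    then show ?thesis using ry_relations.F_comm[of i n j] by simp
  next
    case (T_quadratic i)
    then show ?thesis
      using ry_relations.T_quadratic[where i = i and A = B and t = "\<lambda>i. h (gen (GenT i))" and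
          f = "\<lambda>i. h (gen (GenF i))"]
      by simp
  next
    case (T_F i j)
    then show ?thesis using ry_relations.T_F[of i n j] tr[of i j] by simp
  next
    case (F_N i)
    then show ?thesis using ry_relations.F_N[of i n] by simp
  next
    case N_F1
    then show ?thesis using ry_relations.N_F1 n by simp
  next
    case Fn_N
    then show ?thesis using ry_relations.Fn_N n by simp
  next
    case (Npow_T i)
    then show ?thesis
      using ry_relations.Npow_T[where i = i and A = B and t = "\<lambda>i. h (gen (GenT i))" and \<nu> = "h (gen GenN)"] by simp
  next
    case (T_Npow i)
    then show ?thesis
      using ry_relations.T_Npow[where i = i and A = B and t = "\<lambda>i. h (gen (GenT i))" and \<nu> = "h (gen GenN)"] by simp
  next
    case (T_N i)
    then show ?thesis using ry_relations.T_N[of i n] by simp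
  next
    case N_T_N
    then show ?thesis
      using ry_relations.N_T_N[where A = B and t = "\<lambda>i. h (gen (GenT i))" and \<nu> = "h (gen GenN)"] foldr_hom[of "[1..<n]"]
      by simp
  qed
qed

text \<open>For the presented algebra: its relations are images of relations between free
  generators, hence hold because the corresponding differences lie in the ideal.\<close>

lemma ry_relations_hom_preimage:
  assumes "(X, Y) \<in> ry_relations d n u B (\<lambda>i. h (gen (GenT i))) (\<lambda>i. h (gen (GenF i))) (h (gen GenN))"
  shows "\<exists>l r. (l, r) \<in> ry_relations d n u A (\<lambda>i. gen (GenT i)) (\<lambda>i. gen (GenF i)) (gen GenN) \<and>
    X = h l \<and> Y = h r"
proof -
  note [simp] = gens_closed[simplified] hom_nat_pow smult_hom ry_E_hom[simplified]
  have tr: "transpose i (Suc i) j \<in> {1..n}" if "i \<in> {1..<n}" "j \<in> {1..n}" for i j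
    using that by (auto simp: transpose_def)
  from assms show ?thesis
  proof (cases rule: ry_relations.cases)
    case (braid i j)
    show ?thesis
      by (rule exI, rule exI, rule conjI, rule ry_relations.braid[where i = i and j = j])
        (use braid in simp_all)
  next
    case (T_comm i j)
    show ?thesis
      by (rule exI, rule exI, rule conjI, rule ry_relations.T_comm[where i = i and j = j])
        (use T_comm in simp_all)
  next
    case (F_pow i)
    show ?thesis
      by (rule exI, rule exI, rule conjI, rule ry_relations.F_pow[where i = i])
        (use F_pow in simp_all)
  next
    case (F_comm i j)
    show ?thesis
      by (rule exI, rule exI, rule conjI, rule ry_relations.F_comm[where i = i and j = j])
        (use F_comm in simp_all)
  next
    case (T_quadratic i)
    show ?thesis
      by (rule exI, rule exI, rule conjI, rule ry_relations.T_quadratic[where i = i])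
        (use T_quadratic in simp_all)
  next
    case (T_F i j)
    show ?thesis
      by (rule exI, rule exI, rule conjI, rule ry_relations.T_F[where i = i and j = j])
        (use T_F tr[of i j] in simp_all)
  next
    case (F_N i)
    show ?thesis
      by (rule exI, rule exI, rule conjI, rule ry_relations.F_N[where i = i])
        (use F_N in simp_all)
  next
    case N_F1
    show ?thesis
      by (rule exI, rule exI, rule conjI, rule ry_relations.N_F1)
        (use N_F1 n in simp_all)
  next
    case Fn_N
    show ?thesis
      by (rule exI, rule exI, rule conjI, rule ry_relations.Fn_N)
        (use Fn_N n in simp_all)
  next
    case (Npow_T i)
    show ?thesis
      by (rule exI, rule exI, rule conjI, rule ry_relations.Npow_T[where i = i])
        (use Npow_T in simp_all)
  next
    case (T_Npow i)
    show ?thesis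
      by (rule exI, rule exI, rule conjI, rule ry_relations.T_Npow[where i = i])
        (use T_Npow in simp_all)
  next
    case (T_N i)
    show ?thesis
      by (rule exI, rule exI, rule conjI, rule ry_relations.T_N[where i = i])
        (use T_N in simp_all)
  next
    case N_T_N
    show ?thesis
      by (rule exI, rule exI, rule conjI, rule ry_relations.N_T_N)
        (use N_T_N foldr_hom[of "[1..<n]"] in simp_all)
  qed
qed

end

end

text \<open>The locale \<open>ry_ring\<close> wants a value for every letter, so the letters whose index is out of range
  are sent to the unit.\<close>

definition total_gen :: "('k, 'a) module \<Rightarrow> nat \<Rightarrow> (ry_gen \<Rightarrow> 'a) \<Rightarrow> ry_gen \<Rightarrow> 'a" where
  "total_gen A n gen g = (if g \<in> ry_gens n then gen g else \<one>\<^bsub>A\<^esub>)"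

lemma total_gen_simps [simp]:
  "1 \<le> i \<Longrightarrow> i < n \<Longrightarrow> total_gen A n gen (GenT i) = gen (GenT i)"
  "1 \<le> i \<Longrightarrow> i \<le> n \<Longrightarrow> total_gen A n gen (GenF i) = gen (GenF i)"
  "total_gen A n gen GenN = gen GenN"
  by (auto simp: total_gen_def ry_gens_def)

lemma word_eval_cong: "(\<And>g. g \<in> set w \<Longrightarrow> h g = h' g) \<Longrightarrow> word_eval G h w = word_eval G h' w"
  by (induction w) auto

text \<open>The quadratic relation is the only one with a denominator. For \<open>d = q - 1\<close>
  and \<open>u = q\<close> the factor \<open>u - 1\<close> cancels the \<open>1 / d\<close> in
  \<open>E_i\<close>, and what remains is an integral combination of the monomials allowed in
  \<open>ry_ring\<close>.\<close>

lemma ry_ringI: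
  fixes A :: "('k::field_char_0, 'a) module" and gen :: "ry_gen \<Rightarrow> 'a" and q n :: nat
  assumes A: "k_algebra A" and q: "q \<ge> 2" and n: "n \<ge> 1"
    and gen: "\<And>g. g \<in> ry_gens n \<Longrightarrow> gen g \<in> carrier A"
    and rel: "\<And>X Y. (X, Y) \<in> ry_relations (q - 1) n (of_nat q) A
      (\<lambda>i. gen (GenT i)) (\<lambda>i. gen (GenF i)) (gen GenN) \<Longrightarrow> X = Y"
  shows "ry_ring A q (q - 1) n (total_gen A n gen)"
proof -
  interpret k_algebra A by (rule A)
  let ?h = "total_gen A n gen"
  have closed: "?h g \<in> carrier A" for g by (simp add: total_gen_def gen)
  have cl: "1 \<le> i \<Longrightarrow> i < n \<Longrightarrow> gen (GenT i) \<in> carrier A"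
    "1 \<le> i \<Longrightarrow> i \<le> n \<Longrightarrow> gen (GenF i) \<in> carrier A" "gen GenN \<in> carrier A" for i
    by (rule gen, simp add: ry_gens_def)+
  have nat: "of_nat q \<odot>\<^bsub>A\<^esub> x = [q] \<cdot>\<^bsub>A\<^esub> x" "of_nat q ^ (n - 1) \<odot>\<^bsub>A\<^esub> x = [(q ^ (n - 1))] \<cdot>\<^bsub>A\<^esub> x"
    if "x \<in> carrier A" for x
    using smult_of_nat[OF that, of q] smult_of_nat[OF that, of "q ^ (n - 1)"] by simp_all
  have quad: "?h (GenT i) \<otimes>\<^bsub>A\<^esub> ?h (GenT i) \<in> int_span A (insert \<one>\<^bsub>A\<^esub>
      {?h (GenF i) [^]\<^bsub>A\<^esub> (a::nat) \<otimes>\<^bsub>A\<^esub> ?h (GenF (Suc i)) [^]\<^bsub>A\<^esub> (b::nat) \<otimes>\<^bsub>A\<^esub> ?h (GenT i) | a b. True})"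
    (is "_ \<in> int_span A ?S") if i: "1 \<le> i" "i < n" for i
  proof -
    define e where "e = ((q - 1)\<^sup>2 - (q - 1)) div 2"
    define f where "f = gen (GenF i)"
    define f' where "f' = gen (GenF (i + 1))"
    define t where "t = gen (GenT i)"
    have c [simp]: "f \<in> carrier A" "f' \<in> carrier A" "t \<in> carrier A"
      using i cl by (simp_all add: f_def f'_def t_def)
    define s where "s k = f [^]\<^bsub>A\<^esub> k \<otimes>\<^bsub>A\<^esub> f' [^]\<^bsub>A\<^esub> (q - 1 - k)" for k :: nat
    have s [simp]: "s k \<in> carrier A" for k by (simp add: s_def)
    have S: "?S \<subseteq> carrier A" using closed by auto
    define c where "c = (1 / of_nat (q - 1) :: 'k)"
    have u: "(of_nat q - 1) * c = 1"
      using q by (simp add: c_def of_nat_diff)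
    define S where "S = (\<Oplus>\<^bsub>A\<^esub>k\<in>{..<q - 1}. s k)"
    have S_closed: "S \<in> carrier A" by (simp add: S_def)
    have "t \<otimes>\<^bsub>A\<^esub> t = of_nat q \<odot>\<^bsub>A\<^esub> \<one>\<^bsub>A\<^esub> \<oplus>\<^bsub>A\<^esub> (of_nat q - 1) \<odot>\<^bsub>A\<^esub>
        (f [^]\<^bsub>A\<^esub> e \<otimes>\<^bsub>A\<^esub> ry_E (q - 1) A (\<lambda>i. gen (GenF i)) i \<otimes>\<^bsub>A\<^esub> t)"
      unfolding e_def f_def t_def by (rule rel, rule ry_relations.T_quadratic) (use i in simp)
    also have "ry_E (q - 1) A (\<lambda>i. gen (GenF i)) i = c \<odot>\<^bsub>A\<^esub> S"
      by (simp add: ry_E_def s_def f_def f'_def S_def c_def)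
    also have "(of_nat q - 1) \<odot>\<^bsub>A\<^esub> (f [^]\<^bsub>A\<^esub> e \<otimes>\<^bsub>A\<^esub> (c \<odot>\<^bsub>A\<^esub> S) \<otimes>\<^bsub>A\<^esub> t) =
        f [^]\<^bsub>A\<^esub> e \<otimes>\<^bsub>A\<^esub> S \<otimes>\<^bsub>A\<^esub> t"
      using S_closed by (simp add: smult_mult_left smult_mult_right smult_smult u smult_one)
    also have "\<dots> = (\<Oplus>\<^bsub>A\<^esub>k\<in>{..<q - 1}. f [^]\<^bsub>A\<^esub> e \<otimes>\<^bsub>A\<^esub> s k \<otimes>\<^bsub>A\<^esub> t)"
      by (simp add: S_def finsum_rdistr finsum_ldistr)
    finally have tt: "t \<otimes>\<^bsub>A\<^esub> t = [q] \<cdot>\<^bsub>A\<^esub> \<one>\<^bsub>A\<^esub> \<oplus>\<^bsub>A\<^esub> (\<Oplus>\<^bsub>A\<^esub>k\<in>{..<q - 1}. f [^]\<^bsub>A\<^esub> e \<otimes>\<^bsub>A\<^esub> s k \<otimes>\<^bsub>A\<^esub> t)"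
      by (simp add: nat)
    have "f [^]\<^bsub>A\<^esub> e \<otimes>\<^bsub>A\<^esub> s k \<otimes>\<^bsub>A\<^esub> t \<in> ?S" for k
    proof -
      have "f [^]\<^bsub>A\<^esub> e \<otimes>\<^bsub>A\<^esub> s k \<otimes>\<^bsub>A\<^esub> t = f [^]\<^bsub>A\<^esub> (e + k) \<otimes>\<^bsub>A\<^esub> f' [^]\<^bsub>A\<^esub> (q - 1 - k) \<otimes>\<^bsub>A\<^esub> t"
        by (simp add: s_def nat_pow_mult[symmetric] m_assoc)
      then show ?thesis using i by (auto simp: f_def f'_def t_def)
    qed
    then have "f [^]\<^bsub>A\<^esub> e \<otimes>\<^bsub>A\<^esub> s k \<otimes>\<^bsub>A\<^esub> t \<in> int_span A ?S" for k
      by (rule int_span.base)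
    moreover have "\<one>\<^bsub>A\<^esub> \<in> int_span A ?S" by (rule int_span.base) simp
    ultimately have "t \<otimes>\<^bsub>A\<^esub> t \<in> int_span A ?S"
      unfolding tt
      by (intro int_span_add[OF S] int_span_add_pow[OF S] int_span_finsum[OF S]) simp_all
    then show ?thesis using i by (simp add: t_def)
  qed
  have ev: "word_eval A ?h (map GenT [1..<n]) = foldr (\<lambda>i x. gen (GenT i) \<otimes>\<^bsub>A\<^esub> x) [1..<n] \<one>\<^bsub>A\<^esub>"
    unfolding word_eval_def foldr_map by (rule foldr_cong) auto
  show ?thesis
  proof
    show "q - 1 > 0" using q by simp
  next
    fix x y assume x: "x \<in> carrier A" "y \<in> carrier A" "[q] \<cdot>\<^bsub>A\<^esub> x = [q] \<cdot>\<^bsub>A\<^esub> y"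
    then have "(1 / of_nat q) \<odot>\<^bsub>A\<^esub> (of_nat q \<odot>\<^bsub>A\<^esub> x) = (1 / of_nat q) \<odot>\<^bsub>A\<^esub> (of_nat q \<odot>\<^bsub>A\<^esub> y)"
      by (simp add: nat)
    then show "x = y" using x q by (simp add: smult_smult smult_one)
  next
    fix i assume "1 \<le> i" "Suc i < n"
    then show "?h (GenT i) \<otimes>\<^bsub>A\<^esub> ?h (GenT (Suc i)) \<otimes>\<^bsub>A\<^esub> ?h (GenT i) =
        ?h (GenT (Suc i)) \<otimes>\<^bsub>A\<^esub> ?h (GenT i) \<otimes>\<^bsub>A\<^esub> ?h (GenT (Suc i))"
      using rel[OF ry_relations.braid[of i n "Suc i"]] by simp
  next
    fix i j assume "1 \<le> i" "Suc i < j" "j < n"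
    then show "?h (GenT i) \<otimes>\<^bsub>A\<^esub> ?h (GenT j) = ?h (GenT j) \<otimes>\<^bsub>A\<^esub> ?h (GenT i)"
      using rel[OF ry_relations.T_comm[of i n j]] by simp
  next
    fix i assume "1 \<le> i" "i \<le> n"
    then show "?h (GenF i) [^]\<^bsub>A\<^esub> (q - 1) = \<one>\<^bsub>A\<^esub>"
      using rel[OF ry_relations.F_pow[of i n]] by simp
  next
    fix i j assume "i \<in> {1..n}" "j \<in> {1..n}"
    then show "?h (GenF i) \<otimes>\<^bsub>A\<^esub> ?h (GenF j) = ?h (GenF j) \<otimes>\<^bsub>A\<^esub> ?h (GenF i)"
      using rel[OF ry_relations.F_comm[of i n j]] by simp
  next
    fix i j assume ij: "i \<in> {1..<n}" "j \<in> {1..n}"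
    then have "transpose i (Suc i) j \<in> {1..n}" by (auto simp: transpose_def)
    then show "?h (GenT i) \<otimes>\<^bsub>A\<^esub> ?h (GenF j) = ?h (GenF (transpose i (Suc i) j)) \<otimes>\<^bsub>A\<^esub> ?h (GenT i)"
      using rel[OF ry_relations.T_F[of i n j]] ij by simp
  next
    fix i assume "1 \<le> i" "i < n"
    then show "?h (GenF i) \<otimes>\<^bsub>A\<^esub> ?h GenN = ?h GenN \<otimes>\<^bsub>A\<^esub> ?h (GenF (Suc i))"
      using rel[OF ry_relations.F_N[of i n]] by simp
  next
    show "?h GenN \<otimes>\<^bsub>A\<^esub> ?h (GenF 1) = ?h GenN"
      using rel[OF ry_relations.N_F1] n by simp
  next
    show "?h (GenF n) \<otimes>\<^bsub>A\<^esub> ?h GenN = ?h GenN"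
      using rel[OF ry_relations.Fn_N] n by simp
  next
    fix i assume "1 \<le> i" "i < n"
    then show "?h GenN [^]\<^bsub>A\<^esub> Suc i \<otimes>\<^bsub>A\<^esub> ?h (GenT i) = [q] \<cdot>\<^bsub>A\<^esub> (?h GenN [^]\<^bsub>A\<^esub> Suc i)"
      using rel[OF ry_relations.Npow_T[of i n]] cl by (simp add: nat)
  next
    fix i assume "1 \<le> i" "i < n"
    then show "?h (GenT i) \<otimes>\<^bsub>A\<^esub> ?h GenN [^]\<^bsub>A\<^esub> Suc (n - i) = [q] \<cdot>\<^bsub>A\<^esub> (?h GenN [^]\<^bsub>A\<^esub> Suc (n - i))"
      using rel[OF ry_relations.T_Npow[of i n]] cl by (simp add: nat)
  next
    fix i assume "1 \<le> i" "Suc (Suc i) \<le> n"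
    then show "?h (GenT i) \<otimes>\<^bsub>A\<^esub> ?h GenN = ?h GenN \<otimes>\<^bsub>A\<^esub> ?h (GenT (Suc i))"
      using rel[OF ry_relations.T_N[of i n]] by simp
  next
    show "?h GenN \<otimes>\<^bsub>A\<^esub> word_eval A ?h (map GenT [1..<n]) \<otimes>\<^bsub>A\<^esub> ?h GenN = [(q ^ (n - 1))] \<cdot>\<^bsub>A\<^esub> ?h GenN"
      unfolding ev total_gen_simps using rel[OF ry_relations.N_T_N] cl(3) nat(2) by metis
  qed (use closed quad in auto)
qed

section \<open>The unitriangular group \<open>U\<close>, its double cosets and their
  averages\<close>

section \<open>Double cosets of the unitriangular group\<close>

lemma finite_carrier_mat: "finite (carrier_mat n m :: 'f::finite mat set)"
proof (rule finite_subset)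
  show "carrier_mat n m \<subseteq> (\<lambda>h. mat n m h) ` (({..<n} \<times> {..<m}) \<rightarrow>\<^sub>E (UNIV :: 'f set))"
  proof
    fix A :: "'f mat" assume "A \<in> carrier_mat n m"
    then have "A = mat n m (restrict (\<lambda>ij. A $$ ij) ({..<n} \<times> {..<m}))"
      by (intro eq_matI) auto
    then show "A \<in> (\<lambda>h. mat n m h) ` (({..<n} \<times> {..<m}) \<rightarrow>\<^sub>E UNIV)"
      by (rule image_eqI[where x = "restrict (\<lambda>ij. A $$ ij) ({..<n} \<times> {..<m})"]) auto
  qed
  show "finite ((\<lambda>h. mat n m h) ` (({..<n} \<times> {..<m}) \<rightarrow>\<^sub>E (UNIV :: 'f set)))"
    by (intro finite_imageI finite_PiE) auto
qed

lemma mat_mult_index: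
  assumes "A \<in> carrier_mat n n" "B \<in> carrier_mat n n" "i < n" "j < n"
  shows "(A * B) $$ (i, j) = (\<Sum>k<n. A $$ (i, k) * B $$ (k, j))"
  using assms by (auto simp: scalar_prod_def lessThan_atLeast0 intro!: sum.cong)

lemma mat_closed: "A \<in> carrier_mat n n \<Longrightarrow> B \<in> carrier_mat n n \<Longrightarrow> A * B \<in> carrier_mat n n"
  by simp

lemma mat_assoc:
  "A \<in> carrier_mat n n \<Longrightarrow> B \<in> carrier_mat n n \<Longrightarrow> C \<in> carrier_mat n n \<Longrightarrow> A * B * C = A * (B * C)"
  by (rule assoc_mult_mat)

lemma mat_mult_cancel:
  fixes A :: "'a::comm_ring_1 mat"
  assumes "A \<in> carrier_mat n n" "B \<in> carrier_mat n n" "C \<in> carrier_mat n n" "A * B = 1\<^sub>m n"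
  shows "A * (B * C) = C"
proof -
  have "A * (B * C) = A * B * C" using assms mat_assoc[of A n B C] by simp
  then show ?thesis by (simp only: assms(4) left_mult_one_mat[OF assms(3)])
qed

context
  fixes n :: nat
begin

abbreviation U :: "'f::field mat set" where "U \<equiv> unitriangular_mats n"
abbreviation dc :: "'f::field mat \<Rightarrow> 'f mat set" where "dc \<equiv> double_coset n"

lemma U_carrier: "u \<in> U \<Longrightarrow> u \<in> carrier_mat n n"
  by (simp add: unitriangular_mats_def)

lemma U_iff:
  "u \<in> U \<longleftrightarrow> u \<in> carrier_mat n n \<and> (\<forall>i<n. \<forall>j<i. u $$ (i, j) = 0) \<and> (\<forall>i<n. u $$ (i, i) = 1)"
  by (auto simp: unitriangular_mats_def)

lemma finite_U: "finite (U :: 'f::{field,finite} mat set)"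
  by (rule finite_subset[OF _ finite_carrier_mat[of n n]]) (auto simp: U_carrier)

lemma one_U: "1\<^sub>m n \<in> U"
  by (auto simp: U_iff)

lemma mult_U:
  assumes "u \<in> U" "v \<in> U"
  shows "u * v \<in> U"
proof -
  have c: "u \<in> carrier_mat n n" "v \<in> carrier_mat n n" using assms by (auto simp: U_carrier)
  have "(u * v) $$ (i, j) = 0" if "i < n" "j < i" for i j
    unfolding mat_mult_index[OF c that(1) order.strict_trans[OF that(2,1)]]
  proof (rule sum.neutral, rule ballI)
    fix k assume "k \<in> {..<n}"
    then show "u $$ (i, k) * v $$ (k, j) = 0"
      using assms that unfolding U_iff by (cases "k < i") auto
  qed
  moreover have "(u * v) $$ (i, i) = 1" if i: "i < n" for i
  proof -
    have "(u * v) $$ (i, i) = (\<Sum>k<n. if k = i then 1 else 0)"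
      unfolding mat_mult_index[OF c i i]
    proof (rule sum.cong[OF refl])
      fix k assume "k \<in> {..<n}"
      then show "u $$ (i, k) * v $$ (k, i) = (if k = i then 1 else 0)"
        using assms i unfolding U_iff by (cases k i rule: linorder_cases) auto
    qed
    then show ?thesis using i by simp
  qed
  ultimately show ?thesis using c by (auto simp: U_iff)
qed

lemma U_left_inj:
  assumes "u \<in> U" "v \<in> carrier_mat n n" "w \<in> carrier_mat n n" "u * v = u * w"
  shows "v = w"
proof -
  have u: "u \<in> carrier_mat n n" "upper_triangular u" "\<forall>i<n. u $$ (i, i) = 1"
    using assms(1) by (auto simp: unitriangular_mats_def)
  have "prod_list (diag_mat u) = (\<Prod>i\<leftarrow>[0..<n]. u $$ (i, i))"
    using u(1) by (simp add: diag_mat_def)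
  also have "\<dots> = (\<Prod>i\<leftarrow>[0..<n]. 1)"
    using u(3) by (intro arg_cong[of _ _ prod_list] map_cong) auto
  also have "\<dots> = 1" by (induction n) auto
  finally have "det u \<noteq> 0" using det_upper_triangular[OF u(2,1)] by simp
  from det_non_zero_imp_unit[OF u(1) this, of "()"]
  obtain B where "B \<in> carrier_mat n n" "B * u = 1\<^sub>m n"
    by (auto simp: Units_def ring_mat_simps)
  then show ?thesis using mat_mult_cancel[of B n u] assms u(1) by metis
qed

text \<open>Left multiplication by \<open>u\<close> is injective on the finite set \<open>U\<close>,
  hence onto, and a preimage of 1 is the inverse. That the inverse is unitriangular thus takes no
  computation.\<close>

lemma U_inverse:
  assumes "u \<in> (U :: 'f::{field,finite} mat set)"
  obtains v where "v \<in> U" "u * v = 1\<^sub>m n" "v * u = 1\<^sub>m n"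
proof -
  have "inj_on ((*) u) U" using U_left_inj[OF assms] by (auto simp: inj_on_def U_carrier)
  then have "(*) u ` U = U"
    using assms by (intro endo_inj_surj finite_U) (auto simp: mult_U)
  then obtain v where "v \<in> U" "u * v = 1\<^sub>m n" using one_U by (metis imageE)
  then show thesis
    using that mat_mult_left_right_inverse[of u n v] assms by (auto simp: U_carrier)
qed

lemma bij_U_left:
  assumes "u \<in> (U :: 'f::{field,finite} mat set)"
  shows "bij_betw ((*) u) U U"
proof -
  have "inj_on ((*) u) U" using U_left_inj[OF assms] by (auto simp: inj_on_def U_carrier)
  moreover from this have "(*) u ` U = U"
    using assms by (intro endo_inj_surj finite_U) (auto simp: mult_U)
  ultimately show ?thesis by (simp add: bij_betw_def)
qed

lemma bij_U_right:
  assumes "u \<in> (U :: 'f::{field,finite} mat set)"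
  shows "bij_betw (\<lambda>v. v * u) U U"
proof -
  obtain w where w: "w \<in> U" "u * w = 1\<^sub>m n" "w * u = 1\<^sub>m n" using U_inverse[OF assms] .
  show ?thesis
    by (rule bij_betw_byWitness[where f' = "\<lambda>v. v * w"])
      (use w assms in \<open>auto simp: mult_U mat_assoc[of _ n] mat_closed[of _ n] U_carrier
        right_mult_one_mat[of _ n n]\<close>)
qed

lemma sum_U_left: "u \<in> U \<Longrightarrow> (\<Sum>v\<in>U. F (u * v)) = (\<Sum>v\<in>(U :: 'f::{field,finite} mat set). F v)"
  by (rule sum.reindex_bij_betw[OF bij_U_left])

lemma sum_U_right: "u \<in> U \<Longrightarrow> (\<Sum>v\<in>U. F (v * u)) = (\<Sum>v\<in>(U :: 'f::{field,finite} mat set). F v)"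
  by (rule sum.reindex_bij_betw[OF bij_U_right])

lemma card_U_pos: "card (U :: 'f::{field,finite} mat set) > 0"
  using one_U finite_U by (auto simp: card_gt_0_iff)

lemma dcI: "u \<in> U \<Longrightarrow> v \<in> U \<Longrightarrow> x = u * \<sigma> * v \<Longrightarrow> x \<in> dc \<sigma>"
  by (auto simp: double_coset_def)

lemma dcE:
  assumes "x \<in> dc \<sigma>"
  obtains u v where "u \<in> U" "v \<in> U" "x = u * \<sigma> * v"
  using assms by (auto simp: double_coset_def)

lemma dc_self: "\<sigma> \<in> carrier_mat n n \<Longrightarrow> \<sigma> \<in> dc \<sigma>"
  by (rule dcI[OF one_U one_U]) auto

lemma dc_carrier: "\<sigma> \<in> carrier_mat n n \<Longrightarrow> x \<in> dc \<sigma> \<Longrightarrow> x \<in> carrier_mat n n"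
  by (auto elim!: dcE simp: U_carrier mat_closed[of _ n])

lemma finite_dc: "\<sigma> \<in> carrier_mat n n \<Longrightarrow> finite (dc (\<sigma> :: 'f::{field,finite} mat))"
  by (rule finite_subset[OF _ finite_carrier_mat[of n n]]) (auto simp: dc_carrier)

lemma card_dc_pos: "\<sigma> \<in> carrier_mat n n \<Longrightarrow> card (dc (\<sigma> :: 'f::{field,finite} mat)) > 0"
  using finite_dc dc_self by (auto simp: card_gt_0_iff)

lemma dc_mult:
  assumes "\<sigma> \<in> carrier_mat n n" "x \<in> dc \<sigma>" "u \<in> U" "v \<in> U"
  shows "u * x * v \<in> dc \<sigma>"
proof -
  obtain u' v' where x: "u' \<in> U" "v' \<in> U" "x = u' * \<sigma> * v'" using assms(2) by (rule dcE)
  have "u * x * v = (u * u') * \<sigma> * (v' * v)"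
    unfolding x using assms x(1,2) by (simp add: mat_assoc[of _ n] mat_closed[of _ n] U_carrier)
  then show ?thesis using assms x(1,2) by (intro dcI[of "u * u'" "v' * v"] mult_U)
qed

lemma dc_sym:
  assumes "\<sigma> \<in> carrier_mat n n" "(x :: 'f::{field,finite} mat) \<in> dc \<sigma>"
  shows "\<sigma> \<in> dc x"
proof -
  obtain u v where x: "u \<in> U" "v \<in> U" "x = u * \<sigma> * v" using assms(2) by (rule dcE)
  obtain u' where u': "u' \<in> U" "u * u' = 1\<^sub>m n" "u' * u = 1\<^sub>m n" using U_inverse[OF x(1)] .
  obtain v' where v': "v' \<in> U" "v * v' = 1\<^sub>m n" "v' * v = 1\<^sub>m n" using U_inverse[OF x(2)] .
  have "u' * x * v' = (u' * u) * \<sigma> * (v * v')"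
    unfolding x using assms x(1,2) u'(1) v'(1) by (simp add: mat_assoc[of _ n] mat_closed[of _ n] U_carrier)
  then have "\<sigma> = u' * x * v'" using assms u'(3) v'(2) by simp
  with u'(1) v'(1) show ?thesis by (rule dcI)
qed

lemma dc_trans:
  assumes "\<sigma> \<in> carrier_mat n n" "x \<in> dc \<sigma>" "y \<in> dc x"
  shows "y \<in> dc \<sigma>"
  using assms(3) by (rule dcE) (use dc_mult[OF assms(1,2)] in auto)

lemma dc_eq:
  assumes "\<sigma> \<in> carrier_mat n n" "(x :: 'f::{field,finite} mat) \<in> dc \<sigma>"
  shows "dc x = dc \<sigma>"
  using dc_trans[OF assms] dc_sym[OF assms] dc_trans[OF dc_carrier[OF assms]] by blast

section \<open>A double coset contains at most one rook matrix\<close>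

subsection \<open>Uniqueness in the Bruhat decomposition\<close>

lemma rook_iff:
  "\<sigma> \<in> framed_rook_mats n \<longleftrightarrow> \<sigma> \<in> carrier_mat n n \<and>
    (\<forall>i<n. \<forall>j<n. \<forall>j'<n. \<sigma> $$ (i, j) \<noteq> 0 \<longrightarrow> \<sigma> $$ (i, j') \<noteq> 0 \<longrightarrow> j = j') \<and>
    (\<forall>j<n. \<forall>i<n. \<forall>i'<n. \<sigma> $$ (i, j) \<noteq> 0 \<longrightarrow> \<sigma> $$ (i', j) \<noteq> 0 \<longrightarrow> i = i')"
proof -
  have le1: "card {k. k < n \<and> P k} \<le> 1 \<longleftrightarrow> (\<forall>k<n. \<forall>l<n. P k \<longrightarrow> P l \<longrightarrow> k = l)" for P
    using card_le_Suc0_iff_eq[of "{k. k < n \<and> P k}"] by auto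
  show ?thesis unfolding framed_rook_mats_def mem_Collect_eq le1 by (rule refl)
qed

lemma rook_carrier: "\<sigma> \<in> framed_rook_mats n \<Longrightarrow> \<sigma> \<in> carrier_mat n n"
  by (simp add: framed_rook_mats_def)

lemma finite_rook: "finite (framed_rook_mats n :: 'f::{field,finite} mat set)"
  by (rule finite_subset[OF _ finite_carrier_mat[of n n]]) (auto simp: rook_carrier)

text \<open>A nonzero entry of \<open>\<sigma>\<close> in row \<open>i\<close> forces one of \<open>\<tau>\<close> in row \<open>i\<close> weakly to the left, and that
  one forces a nonzero entry of \<open>\<sigma>\<close> weakly below; downward induction on \<open>i\<close> leaves no room.\<close>

lemma bruhat_entries:
  fixes \<sigma> \<tau> :: "'f::field mat"
  assumes \<sigma>: "\<sigma> \<in> framed_rook_mats n" and \<tau>: "\<tau> \<in> framed_rook_mats n"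
    and u: "u \<in> U" and v: "v \<in> U" and eq: "u * \<sigma> = \<tau> * v"
  shows "i < n \<Longrightarrow> j < n \<Longrightarrow> \<sigma> $$ (i, j) \<noteq> 0 \<Longrightarrow> \<tau> $$ (i, j) = \<sigma> $$ (i, j)"
proof (induction "n - i" arbitrary: i j rule: less_induct)
  case less
  note c = rook_carrier[OF \<sigma>] rook_carrier[OF \<tau>] U_carrier[OF u] U_carrier[OF v]
  have u\<sigma>: "(u * \<sigma>) $$ (i, j) = (\<Sum>k<n. u $$ (i, k) * \<sigma> $$ (k, j))" if "i < n" "j < n" for i j
    using mat_mult_index c that by blast
  have \<tau>v: "(u * \<sigma>) $$ (i, j) = (\<Sum>k<n. \<tau> $$ (i, k) * v $$ (k, j))" if "i < n" "j < n" for i j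
    unfolding eq using mat_mult_index c that by blast
  \<comment> \<open>Column \<open>j\<close> of \<sigma> has its only nonzero entry in row
    \<open>i\<close>, and the diagonal of \<open>u\<close> consists of ones.\<close>
  have "(u * \<sigma>) $$ (i, j) = (\<Sum>k<n. if k = i then \<sigma> $$ (i, j) else 0)"
    unfolding u\<sigma>[OF less(2,3)] using \<sigma> u less(2-4) unfolding rook_iff U_iff by (intro sum.cong) auto
  then have e1: "(u * \<sigma>) $$ (i, j) = \<sigma> $$ (i, j)" using less(2) by simp
  then have "(\<Sum>k<n. \<tau> $$ (i, k) * v $$ (k, j)) \<noteq> 0" using \<tau>v less(2-4) by simp
  then obtain j' where j': "j' < n" "\<tau> $$ (i, j') \<noteq> 0" "v $$ (j', j) \<noteq> 0"
    by (auto elim!: sum.not_neutral_contains_not_neutral)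
  have row: "(u * \<sigma>) $$ (i, l) = \<tau> $$ (i, j') * v $$ (j', l)" if "l < n" for l
  proof -
    have "(u * \<sigma>) $$ (i, l) = (\<Sum>k<n. if k = j' then \<tau> $$ (i, j') * v $$ (j', l) else 0)"
      unfolding \<tau>v[OF less(2) that] using \<tau> j' less(2) unfolding rook_iff by (intro sum.cong) auto
    then show ?thesis using j'(1) by simp
  qed
  have "(u * \<sigma>) $$ (i, j') \<noteq> 0" using row[OF j'(1)] j' v unfolding U_iff by simp
  then have "(\<Sum>k<n. u $$ (i, k) * \<sigma> $$ (k, j')) \<noteq> 0" using u\<sigma> less(2) j'(1) by simp
  then obtain i' where i': "i' < n" "u $$ (i, i') \<noteq> 0" "\<sigma> $$ (i', j') \<noteq> 0"
    by (auto elim!: sum.not_neutral_contains_not_neutral)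
  have "i \<le> i'" using i' u less(2) unfolding U_iff by (meson not_le)
  \<comment> \<open>If the entry found lies strictly below row \<open>i\<close>, the induction
    hypothesis puts a second nonzero entry of \<tau> into column \<open>j'\<close>.\<close>
  show ?case
  proof (cases "i' = i")
    case True
    then have "j' = j" using i' less(2-4) j'(1) \<sigma> unfolding rook_iff by metis
    then show ?thesis using row[OF less(3)] e1 v less(3) unfolding U_iff by simp
  next
    case False
    then have "\<tau> $$ (i', j') \<noteq> 0"
      using less(1)[of i' j'] \<open>i \<le> i'\<close> i' j'(1) less(2) by simp
    then show ?thesis using False i'(1) j' less(2) \<tau> unfolding rook_iff by metis
  qed
qed

text \<open>\<open>bruhat_entries\<close> speaks only about the nonzero entries of its first matrix,
  so it is applied in both directions, each time after inverting one unitriangular factor.\<close>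

lemma bruhat_unique:
  fixes \<sigma> \<tau> :: "'f::{field,finite} mat"
  assumes \<sigma>: "\<sigma> \<in> framed_rook_mats n" and \<tau>: "\<tau> \<in> framed_rook_mats n" and "\<tau> \<in> dc \<sigma>"
  shows "\<tau> = \<sigma>"
proof -
  obtain u v where uv: "u \<in> U" "v \<in> U" "\<tau> = u * \<sigma> * v" using assms(3) by (rule dcE)
  obtain u' where u': "u' \<in> U" "u * u' = 1\<^sub>m n" "u' * u = 1\<^sub>m n" using U_inverse[OF uv(1)] .
  obtain v' where v': "v' \<in> U" "v * v' = 1\<^sub>m n" "v' * v = 1\<^sub>m n" using U_inverse[OF uv(2)] .
  note c = rook_carrier[OF \<sigma>] U_carrier[OF uv(1)] U_carrier[OF uv(2)] U_carrier[OF u'(1)] U_carrier[OF v'(1)]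
  have "\<tau> * v' = u * \<sigma> * (v * v')"
    unfolding uv(3) using c by (simp add: mat_assoc[of _ n] mat_closed[of _ n])
  then have e1: "u * \<sigma> = \<tau> * v'" using c by (simp add: v'(2))
  have "u' * \<tau> = (u' * u) * \<sigma> * v"
    unfolding uv(3) using c by (simp add: mat_assoc[of _ n] mat_closed[of _ n])
  then have e2: "u' * \<tau> = \<sigma> * v" using c by (simp add: u'(3))
  show ?thesis
  proof (rule eq_matI)
    fix i j assume "i < dim_row \<sigma>" "j < dim_col \<sigma>"
    then have ij: "i < n" "j < n" using c by auto
    show "\<tau> $$ (i, j) = \<sigma> $$ (i, j)"
      using bruhat_entries[OF \<sigma> \<tau> uv(1) v'(1) e1 ij] bruhat_entries[OF \<tau> \<sigma> u'(1) uv(2) e2 ij] by metis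
  qed (use rook_carrier[OF \<sigma>] rook_carrier[OF \<tau>] in auto)
qed

lemma rook_mult:
  assumes \<sigma>: "\<sigma> \<in> framed_rook_mats n" and \<tau>: "\<tau> \<in> framed_rook_mats n"
  shows "\<sigma> * \<tau> \<in> framed_rook_mats n"
proof -
  note c = rook_carrier[OF \<sigma>] rook_carrier[OF \<tau>]
  have ex: "\<exists>k<n. \<sigma> $$ (i, k) \<noteq> 0 \<and> \<tau> $$ (k, j) \<noteq> 0" if "i < n" "j < n" "(\<sigma> * \<tau>) $$ (i, j) \<noteq> 0" for i j
    using that(3) unfolding mat_mult_index[OF c that(1,2)]
    by (auto elim!: sum.not_neutral_contains_not_neutral)
  show ?thesis
    unfolding rook_iff
  proof (intro conjI allI impI)
    show "\<sigma> * \<tau> \<in> carrier_mat n n" using c by simp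
  next
    fix i j j' assume a: "i < n" "j < n" "j' < n" "(\<sigma> * \<tau>) $$ (i, j) \<noteq> 0" "(\<sigma> * \<tau>) $$ (i, j') \<noteq> 0"
    from ex[OF a(1,2,4)] ex[OF a(1,3,5)] show "j = j'"
      using \<sigma> \<tau> a(1-3) unfolding rook_iff by metis
  next
    fix i i' j assume a: "i < n" "i' < n" "j < n" "(\<sigma> * \<tau>) $$ (i, j) \<noteq> 0" "(\<sigma> * \<tau>) $$ (i', j) \<noteq> 0"
    from ex[OF a(1,3,4)] ex[OF a(2,3,5)] show "i = i'"
      using \<sigma> \<tau> a(1-3) unfolding rook_iff by metis
  qed
qed

end

section \<open>Convolution of averages over double cosets\<close>

subsection \<open>Averages over double cosets\<close>

abbreviation mat_algebra :: "nat \<Rightarrow> ('k::field, 'f::field mat \<Rightarrow> 'k) module" where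
  "mat_algebra n \<equiv> monoid_algebra (ring_mat TYPE('f) n ())"

lemma mat_monoid: "monoid (ring_mat TYPE('f::field) n ())"
  using ring_mat[where 'a = 'f, of n "()"] by (simp add: ring_def)

text \<open>This is \<open>e \<sigma> e\<close> for the idempotent \<open>e\<close> that averages
  over \<open>U\<close>. With this normalisation a compatible product carries no power of the field
  size; the powers come back through the sizes of double cosets.\<close>

definition average :: "nat \<Rightarrow> 'f::{field,finite} mat \<Rightarrow> 'f mat \<Rightarrow> 'k::field_char_0" where
  "average n \<sigma> = (\<lambda>x. if x \<in> double_coset n \<sigma> then 1 / of_nat (card (double_coset n \<sigma>)) else 0)"

context
  fixes n :: nat
begin

text \<open>All fibres of \<open>(u, v) \<mapsto> u \<sigma> v\<close> over the double coset have
  the same size, being translates of the fibre over \<sigma>. Hence averaging over the double coset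
  is the same as averaging over \<open>U \<times> U\<close>.\<close>

lemma average_pairing:
  fixes \<phi> :: "'f::{field,finite} mat \<Rightarrow> 'k::field_char_0"
  assumes \<sigma>: "\<sigma> \<in> carrier_mat n n"
  shows "(\<Sum>x\<in>carrier_mat n n. average n \<sigma> x * \<phi> x) =
    (\<Sum>u\<in>U n. \<Sum>v\<in>U n. \<phi> (u * \<sigma> * v)) / of_nat (card (U n :: 'f mat set)) ^ 2"
proof -
  \<comment> \<open>The size of the fibre over \<open>x\<close>, as an element of the field.\<close>
  define c where "c x = (\<Sum>u\<in>U n. \<Sum>v\<in>U n. if u * \<sigma> * v = x then 1 else 0 :: 'k)" for x
  have outside: "c x = 0" if "x \<notin> dc n \<sigma>" for x
    unfolding c_def using that by (intro sum.neutral ballI) (auto intro: dcI)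
  have const: "c (u0 * \<sigma> * v0) = c \<sigma>" if uv: "u0 \<in> U n" "v0 \<in> U n" for u0 v0
  proof -
    have inj: "(u0 * u) * \<sigma> * (v * v0) = u0 * \<sigma> * v0 \<longleftrightarrow> u * \<sigma> * v = \<sigma>" if "u \<in> U n" "v \<in> U n" for u v
    proof -
      obtain v1 where v1: "v1 \<in> U n" "v0 * v1 = 1\<^sub>m n" using U_inverse[OF uv(2)] by metis
      have e: "(u0 * u) * \<sigma> * (v * v0) = u0 * ((u * \<sigma> * v) * v0)"
        using \<sigma> that uv by (simp add: mat_assoc[of _ n] mat_closed[of _ n] U_carrier)
      have e': "u0 * \<sigma> * v0 = u0 * (\<sigma> * v0)"
        using \<sigma> uv by (simp add: mat_assoc[of _ n] mat_closed[of _ n] U_carrier)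
      show ?thesis
      proof
        assume "(u0 * u) * \<sigma> * (v * v0) = u0 * \<sigma> * v0"
        then have "(u * \<sigma> * v) * v0 = \<sigma> * v0"
          using \<sigma> that uv U_left_inj[OF uv(1), of "u * \<sigma> * v * v0" "\<sigma> * v0"]
          by (simp add: e e' mat_closed[of _ n] U_carrier)
        then have "(u * \<sigma> * v) * (v0 * v1) = \<sigma> * (v0 * v1)"
          using \<sigma> that uv v1(1) mat_assoc[of "u * \<sigma> * v" n v0 v1] mat_assoc[of \<sigma> n v0 v1]
          by (simp add: mat_closed[of _ n] U_carrier)
        then show "u * \<sigma> * v = \<sigma>" using \<sigma> that v1(2)
          by (simp add: mat_closed[of _ n] U_carrier right_mult_one_mat[of _ n n])
      qed (simp only: e e')
    qed
    have "c (u0 * \<sigma> * v0) = (\<Sum>u\<in>U n. \<Sum>v\<in>U n. if (u0 * u) * \<sigma> * (v * v0) = u0 * \<sigma> * v0 then 1 else 0)"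
      unfolding c_def
      by (subst sum_U_left[OF uv(1), symmetric], intro sum.cong refl sum_U_right[OF uv(2), symmetric])
    also have "\<dots> = c \<sigma>"
      unfolding c_def by (intro sum.cong refl) (auto simp: inj)
    finally show ?thesis .
  qed
  have total: "(\<Sum>x\<in>carrier_mat n n. c x * \<psi> x) = (\<Sum>u\<in>U n. \<Sum>v\<in>U n. \<psi> (u * \<sigma> * v))" for \<psi>
  proof -
    have "(\<Sum>x\<in>carrier_mat n n. c x * \<psi> x) =
        (\<Sum>x\<in>carrier_mat n n. \<Sum>u\<in>U n. \<Sum>v\<in>U n. if x = u * \<sigma> * v then \<psi> x else 0)"
      unfolding c_def sum_distrib_right by (intro sum.cong refl) auto
    also have "\<dots> = (\<Sum>u\<in>U n. \<Sum>v\<in>U n. \<Sum>x\<in>carrier_mat n n. if x = u * \<sigma> * v then \<psi> x else 0)"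
      by (subst sum.swap, rule sum.cong[OF refl], rule sum.swap)
    also have "\<dots> = (\<Sum>u\<in>U n. \<Sum>v\<in>U n. \<psi> (u * \<sigma> * v))"
      using \<sigma> by (intro sum.cong refl) (simp add: finite_carrier_mat U_carrier mat_closed[of _ n])
    finally show ?thesis .
  qed
  have dc_sub: "dc n \<sigma> \<subseteq> carrier_mat n n" using dc_carrier[OF \<sigma>] by blast
  have "of_nat (card (U n :: 'f mat set)) ^ 2 = (\<Sum>u\<in>(U n :: 'f mat set). \<Sum>v\<in>(U n :: 'f mat set). 1 :: 'k)"
    by (simp add: power2_eq_square)
  also have "\<dots> = (\<Sum>x\<in>carrier_mat n n. c x)" using total[of "\<lambda>_. 1"] by simp
  also have "\<dots> = (\<Sum>x\<in>dc n \<sigma>. c x)"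
    by (rule sum.mono_neutral_right) (use outside finite_carrier_mat dc_sub in auto)
  also have "\<dots> = (\<Sum>x\<in>dc n \<sigma>. c \<sigma>)"
    by (rule sum.cong) (auto elim!: dcE simp: const)
  finally have card: "of_nat (card (U n :: 'f mat set)) ^ 2 = of_nat (card (dc n \<sigma>)) * c \<sigma>" by simp
  have "average n \<sigma> x = c x / of_nat (card (U n :: 'f mat set)) ^ 2" for x
  proof (cases "x \<in> dc n \<sigma>")
    case True
    then have "c x = c \<sigma>" by (auto elim!: dcE simp: const)
    moreover have "c \<sigma> \<noteq> 0" using card card_U_pos[of n, where 'f = 'f] by auto
    ultimately show ?thesis
      using True card_dc_pos[OF \<sigma>] by (simp add: average_def card)
  qed (simp add: average_def outside)
  then have "(\<Sum>x\<in>carrier_mat n n. average n \<sigma> x * \<phi> x) =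
      (\<Sum>x\<in>carrier_mat n n. c x * \<phi> x) / of_nat (card (U n :: 'f mat set)) ^ 2"
    by (simp add: sum_divide_distrib)
  then show ?thesis by (simp add: total)
qed

lemma average_support: "\<sigma> \<in> carrier_mat n n \<Longrightarrow> {x. average n \<sigma> x \<noteq> 0} \<subseteq> carrier_mat n n"
  using dc_carrier[of \<sigma> n] by (auto simp: average_def split: if_splits)

lemma average_closed:
  "\<sigma> \<in> carrier_mat n n \<Longrightarrow> average n (\<sigma> :: 'f::{field,finite} mat) \<in> carrier (mat_algebra n)"
  using average_support[of \<sigma>] finite_subset[OF _ finite_carrier_mat[of n n]]
  by (auto simp: monoid_algebra_simps ring_mat_simps)

lemma average_cong:
  assumes "\<sigma> \<in> carrier_mat n n" "(x :: 'f::{field,finite} mat) \<in> dc n \<sigma>"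
  shows "average n x = average n \<sigma>"
  unfolding average_def dc_eq[OF assms] ..

text \<open>In terms of the idempotent \<open>e\<close> this is
  \<open>(e \<sigma> e) (e \<tau> e) = e \<sigma> e \<tau> e\<close>, with the middle
  \<open>e\<close> written out as an average over \<open>w\<close>.\<close>

lemma average_mult:
  fixes \<sigma> \<tau> :: "'f::{field,finite} mat"
  assumes \<sigma>: "\<sigma> \<in> carrier_mat n n" and \<tau>: "\<tau> \<in> carrier_mat n n"
  shows "(average n \<sigma> \<otimes>\<^bsub>mat_algebra n\<^esub> average n \<tau>) z =
    (\<Sum>w\<in>U n. average n (\<sigma> * w * \<tau>) z :: 'k::field_char_0) / of_nat (card (U n :: 'f mat set))"
proof -
  let ?c = "of_nat (card (U n :: 'f mat set)) :: 'k"
  have c: "?c \<noteq> 0" using card_U_pos[of n, where 'f = 'f] by simp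
  define \<delta> where "\<delta> x = (if x = z then 1 else 0 :: 'k)" for x
  have inner: "(\<Sum>u\<in>U n. \<Sum>v'\<in>U n. \<delta> (u * (\<sigma> * w * \<tau>) * v')) = ?c ^ 2 * average n (\<sigma> * w * \<tau>) z"
    if "w \<in> U n" for w
  proof -
    have cw: "\<sigma> * w * \<tau> \<in> carrier_mat n n" using \<sigma> \<tau> U_carrier[OF that] by (intro mat_closed)
    have "average n (\<sigma> * w * \<tau>) z = (\<Sum>x\<in>carrier_mat n n. average n (\<sigma> * w * \<tau>) x * \<delta> x)"
    proof (cases "z \<in> carrier_mat n n")
      case True
      then show ?thesis by (simp add: \<delta>_def finite_carrier_mat if_distrib cong: if_cong)
    next
      case False
      then have "average n (\<sigma> * w * \<tau>) z = (0 :: 'k)" using average_support[OF cw] by blast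
      moreover have "(\<Sum>x\<in>carrier_mat n n. average n (\<sigma> * w * \<tau>) x * \<delta> x) = 0"
        using False by (intro sum.neutral) (auto simp: \<delta>_def)
      ultimately show ?thesis by simp
    qed
    then show ?thesis unfolding average_pairing[OF cw] using c by simp
  qed
  have "(average n \<sigma> \<otimes>\<^bsub>mat_algebra n\<^esub> average n \<tau>) z =
      (\<Sum>x\<in>carrier_mat n n. average n \<sigma> x * (\<Sum>y\<in>carrier_mat n n. average n \<tau> y * \<delta> (x * y)))"
    unfolding monoid_algebra_mult[OF finite_carrier_mat finite_carrier_mat
        average_support[OF \<sigma>] average_support[OF \<tau>]]
    by (auto simp: ring_mat_simps \<delta>_def sum_distrib_left intro!: sum.cong)
  also have "\<dots> = (\<Sum>u\<in>U n. \<Sum>v\<in>U n. (\<Sum>u'\<in>U n. \<Sum>v'\<in>U n. \<delta> (u * \<sigma> * v * (u' * \<tau> * v'))) / ?c ^ 2) / ?c ^ 2"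
    by (simp only: average_pairing[OF \<sigma>] average_pairing[OF \<tau>])
  also have "\<dots> = (\<Sum>u\<in>U n. \<Sum>v\<in>U n. \<Sum>u'\<in>U n. \<Sum>v'\<in>U n. \<delta> (u * (\<sigma> * (v * u') * \<tau>) * v')) / ?c ^ 4"
    using \<sigma> \<tau> by (simp add: sum_divide_distrib[symmetric] mat_assoc[of _ n] mat_closed[of _ n] U_carrier
        power_add[symmetric] cong: sum.cong)
  \<comment> \<open>Only the product of the two inner unitriangular factors matters. Substituting
    \<open>w\<close> for it leaves a free sum over \<open>v\<close>.\<close>
  also have "(\<Sum>u\<in>U n. \<Sum>v\<in>U n. \<Sum>u'\<in>U n. \<Sum>v'\<in>U n. \<delta> (u * (\<sigma> * (v * u') * \<tau>) * v')) =
      (\<Sum>u\<in>U n. \<Sum>v\<in>(U n :: 'f mat set). \<Sum>w\<in>U n. \<Sum>v'\<in>U n. \<delta> (u * (\<sigma> * w * \<tau>) * v'))"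
    by (intro sum.cong refl sum_U_left)
  also have "\<dots> = ?c * (\<Sum>w\<in>U n. \<Sum>u\<in>U n. \<Sum>v'\<in>U n. \<delta> (u * (\<sigma> * w * \<tau>) * v'))"
    by (subst sum.swap[of _ "U n" "U n"]) (simp add: sum_distrib_left, subst sum.swap[of _ "U n" "U n"], simp)
  also have "(\<Sum>w\<in>U n. \<Sum>u\<in>U n. \<Sum>v'\<in>U n. \<delta> (u * (\<sigma> * w * \<tau>) * v')) =
      (\<Sum>w\<in>U n. ?c ^ 2 * average n (\<sigma> * w * \<tau>) z)"
    by (rule sum.cong[OF refl inner])
  also have "?c * \<dots> / ?c ^ 4 = (\<Sum>w\<in>U n. average n (\<sigma> * w * \<tau>) z) / ?c"
    using c by (simp add: sum_distrib_left[symmetric] field_simps power2_eq_square power4_eq_xxxx)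
  finally show ?thesis .
qed

definition compatible :: "'f::field mat \<Rightarrow> 'f mat \<Rightarrow> bool" where
  "compatible \<sigma> \<tau> \<longleftrightarrow> (\<forall>w\<in>U n. \<sigma> * w * \<tau> \<in> dc n (\<sigma> * \<tau>))"

lemma average_mult_compatible:
  fixes \<sigma> \<tau> :: "'f::{field,finite} mat"
  assumes \<sigma>: "\<sigma> \<in> carrier_mat n n" and \<tau>: "\<tau> \<in> carrier_mat n n" and "compatible \<sigma> \<tau>"
  shows "average n \<sigma> \<otimes>\<^bsub>mat_algebra n\<^esub> average n \<tau> = (average n (\<sigma> * \<tau>) :: 'f mat \<Rightarrow> 'k::field_char_0)"
proof
  fix z
  have "(\<Sum>w\<in>U n. average n (\<sigma> * w * \<tau>) z) = (\<Sum>w\<in>(U n :: 'f mat set). average n (\<sigma> * \<tau>) z :: 'k)"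
    using assms by (intro sum.cong refl fun_cong[OF average_cong]) (auto simp: compatible_def)
  then show "(average n \<sigma> \<otimes>\<^bsub>mat_algebra n\<^esub> average n \<tau>) z = (average n (\<sigma> * \<tau>) z :: 'k)"
    unfolding average_mult[OF \<sigma> \<tau>] using card_U_pos[of n, where 'f = 'f] by simp
qed

end

section \<open>Multiplication by a transposition: compatibility and the growth of double
  cosets\<close>

section \<open>Multiplication by simple reflections\<close>

context
  fixes n :: nat
begin

abbreviation sw :: "nat \<Rightarrow> 'f::field mat" where "sw k \<equiv> swaprows_mat n k (Suc k)"
abbreviation ad :: "'f::field \<Rightarrow> nat \<Rightarrow> 'f mat" where "ad b k \<equiv> addrow_mat n b k (Suc k)"

lemmas matn_assoc = mat_assoc[of _ n]
lemmas matn_closed = mat_closed[of _ n]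

lemma rook_row:
  assumes "\<sigma> \<in> framed_rook_mats n" "i < n" "j < n" "j' < n" "\<sigma> $$ (i, j) \<noteq> 0" "\<sigma> $$ (i, j') \<noteq> 0"
  shows "j = j'"
  using assms(1)[unfolded rook_iff, THEN conjunct2, THEN conjunct1, rule_format, OF assms(2-6)] .

lemma rook_col:
  assumes "\<sigma> \<in> framed_rook_mats n" "j < n" "i < n" "i' < n" "\<sigma> $$ (i, j) \<noteq> 0" "\<sigma> $$ (i', j) \<noteq> 0"
  shows "i = i'"
  using assms(1)[unfolded rook_iff, THEN conjunct2, THEN conjunct2, rule_format, OF assms(2-6)] .

lemma sw_left:
  "A \<in> carrier_mat n n \<Longrightarrow> Suc k < n \<Longrightarrow> sw k * A = swaprows k (Suc k) A"
  by (rule swaprows_mat[symmetric]) auto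

lemma sw_right:
  "A \<in> carrier_mat n n \<Longrightarrow> Suc k < n \<Longrightarrow> A * sw k = swapcols k (Suc k) A"
  by (rule swapcols_mat[symmetric]) auto

lemma ad_left:
  "A \<in> carrier_mat n n \<Longrightarrow> l < n \<Longrightarrow> addrow_mat n b k l * A = addrow b k l A"
  by (rule addrow_mat[symmetric]) auto

lemma ad_right:
  "A \<in> carrier_mat n n \<Longrightarrow> k < n \<Longrightarrow> A * addrow_mat n (b :: 'f::field) k l = addcol b l k A"
  by (rule addcol_mat[symmetric]) auto

lemma torus_left: "A \<in> carrier_mat n n \<Longrightarrow> multrow_mat n k a * A = multrow k a A"
  by (rule multrow_mat[symmetric]) auto

lemma torus_right:
  "A \<in> carrier_mat n n \<Longrightarrow> A * multrow_mat n k (a :: 'f::field) = multcol k a A"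
  by (rule multcol_mat[symmetric]) auto

lemma sw_sw: "Suc k < n \<Longrightarrow> sw k * sw k = (1\<^sub>m n :: 'f::field mat)"
  by (rule swaprows_mat_inv) auto

lemma sw_cancel:
  "Suc k < n \<Longrightarrow> A \<in> carrier_mat n n \<Longrightarrow> sw k * (sw k * A) = (A :: 'f::field mat)"
  by (rule mat_mult_cancel[of _ n]) (auto simp: sw_sw)

lemma ad_U: "k < l \<Longrightarrow> l < n \<Longrightarrow> addrow_mat n b k l \<in> U n"
  by (auto simp: U_iff)

lemma ad_ad: "Suc k < n \<Longrightarrow> ad a k * ad b k = (ad (a + b) k :: 'f::field mat)"
  by (subst ad_left) (auto intro!: eq_matI)

lemma ad_zero: "ad 0 k = (1\<^sub>m n :: 'f::field mat)"
  by (rule eq_matI) auto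

text \<open>The entry at \<open>(k, k+1)\<close> is the only one that the exchange would carry below
  the diagonal.\<close>

lemma U_conj_sw:
  assumes "u \<in> U n" "u $$ (k, Suc k) = 0" "Suc k < n"
  shows "sw k * u * sw k \<in> U n"
proof -
  have c: "u \<in> carrier_mat n n" using assms(1) by (rule U_carrier)
  have "(sw k * u * sw k) $$ (i, j) = u $$ (transpose k (Suc k) i, transpose k (Suc k) j)"
    if "i < n" "j < n" for i j
    using c assms(3) that by (simp add: sw_left sw_right transpose_def)
  moreover have "transpose k (Suc k) i < n" if "i < n" for i
    using that assms(3) by (auto simp: transpose_def)
  moreover have "u $$ (transpose k (Suc k) i, transpose k (Suc k) j) = 0" if "i < n" "j < i" for i j
    using assms that unfolding U_iff by (auto simp: transpose_def)
  ultimately show ?thesis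
    using c assms(1) unfolding U_iff by (auto simp: matn_closed)
qed

text \<open>The root subgroup at \<open>(k, k+1)\<close> is split off; the complementary factor has
  a zero at that place and is conjugated into \<open>U\<close> by the reflection.\<close>

lemma U_decomp_left:
  assumes "u \<in> U n" "Suc k < n"
  obtains b w where "w \<in> U n" "u * sw k = ad b k * (sw k * w)"
proof -
  define b where "b = u $$ (k, Suc k)"
  define u' where "u' = ad (- b) k * u"
  have c: "u \<in> carrier_mat n n" using assms(1) by (rule U_carrier)
  have u': "u' \<in> U n" unfolding u'_def using assms by (intro mult_U ad_U) auto
  have "u' $$ (k, Suc k) = 0"
  proof -
    have "u' $$ (k, Suc k) = - b * u $$ (Suc k, Suc k) + u $$ (k, Suc k)"
      using c assms(2) by (simp add: u'_def ad_left)
    moreover have "u $$ (Suc k, Suc k) = 1" using assms unfolding U_iff by blast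
    ultimately show ?thesis by (simp add: b_def)
  qed
  then have w: "sw k * u' * sw k \<in> U n" using u' assms by (intro U_conj_sw)
  have "ad b k * u' = ad b k * ad (- b) k * u"
    using c by (simp add: u'_def matn_assoc)
  then have "u = ad b k * u'" using c assms by (simp add: ad_ad ad_zero)
  then have "u * sw k = ad b k * (sw k * (sw k * u' * sw k))"
    using assms u' by (simp add: matn_assoc matn_closed U_carrier sw_cancel)
  then show thesis using that w by blast
qed

text \<open>The mirror image of the previous splitting. The parameter of the root element stays
  visible because \<open>avg_sw_square\<close> sums over it.\<close>

lemma U_decomp_right:
  assumes "u \<in> U n" "Suc k < n"
  shows "\<exists>w\<in>U n. sw k * u = w * (sw k * ad (u $$ (k, Suc k)) k)"
proof -
  define b where "b = u $$ (k, Suc k)"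
  define u' where "u' = u * ad (- b) k"
  have c: "u \<in> carrier_mat n n" using assms(1) by (rule U_carrier)
  have u': "u' \<in> U n" unfolding u'_def using assms by (intro mult_U ad_U) auto
  have "u' $$ (k, Suc k) = 0"
  proof -
    have "u' $$ (k, Suc k) = - b * u $$ (k, k) + u $$ (k, Suc k)"
      using c assms(2) by (simp add: u'_def ad_right)
    moreover have "u $$ (k, k) = 1" using assms unfolding U_iff by (meson Suc_lessD)
    ultimately show ?thesis by (simp add: b_def)
  qed
  then have w: "sw k * u' * sw k \<in> U n" using u' assms by (intro U_conj_sw)
  have "u' * ad b k = u * (ad (- b) k * ad b k)"
    using c by (simp add: u'_def matn_assoc)
  then have "u = u' * ad b k" using c assms by (simp add: ad_ad ad_zero right_mult_one_mat[of _ n n])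
  then have "sw k * u = (sw k * u' * sw k) * (sw k * ad b k)"
    using assms u' by (simp add: matn_assoc matn_closed U_carrier sw_cancel)
  then show ?thesis using w unfolding b_def by blast
qed

text \<open>For \<open>\<sigma>\<close> invertible, this is the condition that left multiplication by the reflection increases
  the length.\<close>

definition good :: "nat \<Rightarrow> 'f::field mat \<Rightarrow> bool" where
  "good k \<sigma> \<longleftrightarrow> (\<forall>c'<n. \<sigma> $$ (Suc k, c') \<noteq> 0 \<longrightarrow> (\<exists>c<c'. \<sigma> $$ (k, c) \<noteq> 0))"

text \<open>When the entry of row \<open>k\<close> stands to the left of the entry of row
  \<open>k + 1\<close>, adding a multiple of the lower row to the upper one has the same effect as
  adding a multiple of the left column to the right one, and the latter is right multiplication by
  an element of \<open>U\<close>.\<close>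

lemma good_ad:
  assumes "good k \<sigma>" "\<sigma> \<in> framed_rook_mats n" "Suc k < n"
  shows "\<exists>v\<in>U n. ad b k * \<sigma> = \<sigma> * v"
proof (cases "\<exists>c'<n. \<sigma> $$ (Suc k, c') \<noteq> 0")
  case False
  have "ad b k * \<sigma> = \<sigma>"
    using False assms rook_carrier[OF assms(2)] by (intro eq_matI) (auto simp: ad_left)
  then show ?thesis
    using rook_carrier[OF assms(2)] by (intro bexI[OF _ one_U]) (simp add: right_mult_one_mat[of _ n n])
next
  case True
  then obtain c' where c': "c' < n" "\<sigma> $$ (Suc k, c') \<noteq> 0" by blast
  then obtain c where c: "c < c'" "\<sigma> $$ (k, c) \<noteq> 0" using assms(1) by (auto simp: good_def)
  \<comment> \<open>Scaled so that the column operation creates the entry \<open>b\<close> times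
    \<open>\<sigma> $$ (Suc k, c')\<close> at position \<open>(k, c')\<close>.\<close>
  let ?a = "b * \<sigma> $$ (Suc k, c') / \<sigma> $$ (k, c)"
  have z: "\<sigma> $$ (Suc k, j) = 0" if "j < n" "j \<noteq> c'" for j
    using assms(2,3) c' that unfolding rook_iff by metis
  have z': "\<sigma> $$ (i, c) = 0" if "i < n" "i \<noteq> k" for i
    using assms(2,3) c c' that unfolding rook_iff by (metis Suc_lessD order.strict_trans)
  have "ad b k * \<sigma> = \<sigma> * addrow_mat n ?a c c'"
    using assms rook_carrier[OF assms(2)] c c' z z'
    by (intro eq_matI) (auto simp: ad_left ad_right)
  then show ?thesis using ad_U[OF c(1) c'(1)] by blast
qed

text \<open>The root element that cannot cross the reflection crosses \<sigma> instead and joins the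
  right unitriangular factor.\<close>

lemma compatible_good:
  assumes "good k \<sigma>" "\<sigma> \<in> framed_rook_mats n" "Suc k < n"
  shows "compatible n (sw k) (\<sigma> :: 'f::field mat)"
  unfolding compatible_def
proof
  fix u :: "'f mat" assume u: "u \<in> U n"
  obtain w where w: "w \<in> U n" "sw k * u = w * (sw k * ad (u $$ (k, Suc k)) k)"
    using U_decomp_right[OF u assms(3)] by blast
  obtain v where v: "v \<in> U n" "ad (u $$ (k, Suc k)) k * \<sigma> = \<sigma> * v"
    using good_ad[OF assms] by blast
  have "sw k * u * \<sigma> = w * (sw k * (ad (u $$ (k, Suc k)) k * \<sigma>))"
    using w rook_carrier[OF assms(2)] by (simp add: matn_assoc matn_closed U_carrier)
  also have "\<dots> = w * (sw k * \<sigma>) * v"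
    using v w rook_carrier[OF assms(2)] by (simp add: matn_assoc matn_closed U_carrier)
  finally show "sw k * u * \<sigma> \<in> dc n (sw k * \<sigma>)" by (rule dcI[OF w(1) v(1)])
qed

text \<open>The 2 by 2 identity that factors a lower unipotent matrix into upper unipotent, monomial
  and upper unipotent. Since \<open>sw\<close> is a permutation matrix without sign, the sign
  appears in the torus entry \<open>-1/a\<close>.\<close>

lemma sw_ad_sw:
  assumes "a \<noteq> (0 :: 'f::field)" "Suc k < n"
  shows "sw k * (ad a k * sw k) =
    ad (1 / a) k * (multrow_mat n k (- 1 / a) * (multrow_mat n (Suc k) a * (sw k * ad (1 / a) k)))"
  using assms by (intro eq_matI) (auto simp: sw_left ad_left torus_left)

lemma torus_inverse:
  assumes "a \<noteq> (0 :: 'f::field)" "j < n"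
  shows "multrow_mat n j a * multrow_mat n j (1 / a) = 1\<^sub>m n"
    and "multrow_mat n j (1 / a) * multrow_mat n j a = 1\<^sub>m n"
  using assms by (auto simp: torus_left intro!: eq_matI)

lemma U_torus:
  assumes "a \<noteq> (0 :: 'f::field)" "j < n" "u \<in> U n"
  shows "multrow_mat n j a * u * multrow_mat n j (1 / a) \<in> U n"
  using assms U_carrier[OF assms(3)]
  by (auto simp: U_iff torus_left torus_right)

lemma torus_dc:
  assumes "a \<noteq> (0 :: 'f::field)" "j < n" "\<sigma> \<in> carrier_mat n n" "x \<in> dc n \<sigma>"
  shows "multrow_mat n j a * x \<in> dc n (multrow_mat n j a * \<sigma>)"
proof -
  obtain u v where x: "u \<in> U n" "v \<in> U n" "x = u * \<sigma> * v" using assms(4) by (rule dcE)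
  let ?D = "multrow_mat n j a" and ?E = "multrow_mat n j (1 / a)"
  have "?D * x = (?D * u) * (?E * ?D) * \<sigma> * v"
    using x assms by (simp add: torus_inverse matn_assoc matn_closed U_carrier)
  also have "\<dots> = (?D * u * ?E) * (?D * \<sigma>) * v"
    using x assms by (simp add: matn_assoc matn_closed U_carrier)
  finally show ?thesis using U_torus[OF assms(1,2) x(1)] x(2) by (rule dcI[rotated 2])
qed

lemma compatible_torus:
  assumes "a \<noteq> (0 :: 'f::field)" "j < n" "\<sigma> \<in> carrier_mat n n"
  shows "compatible n (multrow_mat n j a) \<sigma>"
  unfolding compatible_def
proof
  fix w :: "'f mat" assume w: "w \<in> U n"
  have "w * \<sigma> \<in> dc n \<sigma>"
    by (rule dcI[OF w one_U]) (use assms w in \<open>simp add: right_mult_one_mat[of _ n n] matn_closed U_carrier\<close>)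
  from torus_dc[OF assms this] show "multrow_mat n j a * w * \<sigma> \<in> dc n (multrow_mat n j a * \<sigma>)"
    using assms w by (simp add: matn_assoc U_carrier)
qed

lemma rook_sw: "Suc k < n \<Longrightarrow> sw k \<in> framed_rook_mats n"
  by (auto simp: rook_iff split: if_splits)

lemma rook_torus: "multrow_mat n j a \<in> framed_rook_mats n"
  by (auto simp: rook_iff split: if_splits)

text \<open>The root subgroup at \<open>(k, k+1)\<close> cuts the double coset of
  \<open>sw k * \<sigma>\<close> into translates of the reflected double coset of \<sigma>, one for
  each field element. The nonzero entry in row \<open>k\<close> is what keeps the translates
  disjoint.\<close>

lemma card_dc_sw:
  fixes \<sigma> :: "'f::{field,finite} mat"
  assumes good: "good k \<sigma>" and \<sigma>: "\<sigma> \<in> framed_rook_mats n" and k: "Suc k < n"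
    and row: "c < n" "\<sigma> $$ (k, c) \<noteq> 0"
  shows "card (dc n (sw k * \<sigma>)) = CARD('f) * card (dc n \<sigma>)"
proof -
  note c\<sigma> = rook_carrier[OF \<sigma>]
  have s\<sigma>: "sw k * \<sigma> \<in> carrier_mat n n" using c\<sigma> by (simp add: matn_closed)
  define F where "F b = (\<lambda>x. ad b k * (sw k * x)) ` dc n \<sigma>" for b :: 'f
  have adU: "ad b k \<in> U n" for b :: 'f using k by (intro ad_U) auto
  have sw_dc: "sw k * x \<in> dc n (sw k * \<sigma>)" if hx: "x \<in> dc n \<sigma>" for x
  proof -
    obtain u v where x: "u \<in> U n" "v \<in> U n" "x = u * \<sigma> * v" using hx by (rule dcE)
    have "sw k * u * \<sigma> \<in> dc n (sw k * \<sigma>)"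
      using compatible_good[OF good \<sigma> k] x(1) by (simp add: compatible_def)
    from dc_mult[OF s\<sigma> this one_U x(2)] show ?thesis
      using x c\<sigma> by (simp add: matn_assoc matn_closed U_carrier)
  qed
  have "dc n (sw k * \<sigma>) = (\<Union>b. F b)"
  proof
    show "dc n (sw k * \<sigma>) \<subseteq> (\<Union>b. F b)"
    proof
      fix y assume "y \<in> dc n (sw k * \<sigma>)"
      then obtain u v where y: "u \<in> U n" "v \<in> U n" "y = u * (sw k * \<sigma>) * v" by (rule dcE)
      obtain b w where w: "w \<in> U n" "u * sw k = ad b k * (sw k * w)"
        using U_decomp_left[OF y(1) k] .
      have "y = (u * sw k) * \<sigma> * v" using y c\<sigma> by (simp add: matn_assoc matn_closed U_carrier)
      also have "\<dots> = ad b k * (sw k * (w * \<sigma> * v))"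
        unfolding w(2) using w(1) y(2) c\<sigma> by (simp add: matn_assoc matn_closed U_carrier)
      finally show "y \<in> (\<Union>b. F b)" unfolding F_def using dcI[OF w(1) y(2) refl] by blast
    qed
    show "(\<Union>b. F b) \<subseteq> dc n (sw k * \<sigma>)"
    proof
      fix y assume "y \<in> (\<Union>b. F b)"
      then obtain b x where y: "x \<in> dc n \<sigma>" "y = ad b k * (sw k * x)" by (auto simp: F_def)
      have "ad b k * (sw k * x) * 1\<^sub>m n \<in> dc n (sw k * \<sigma>)"
        by (rule dc_mult[OF s\<sigma> sw_dc[OF y(1)] adU one_U])
      then show "y \<in> dc n (sw k * \<sigma>)"
        using dc_carrier[OF c\<sigma> y(1)] by (simp add: y(2) right_mult_one_mat[of _ n n] matn_closed)
    qed
  qed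
  moreover have "card (F b) = card (dc n \<sigma>)" for b
    unfolding F_def
  proof (rule card_image, rule inj_onI)
    fix x y assume x: "x \<in> dc n \<sigma>" "y \<in> dc n \<sigma>" "ad b k * (sw k * x) = ad b k * (sw k * y)"
    note cxy = dc_carrier[OF c\<sigma> x(1)] dc_carrier[OF c\<sigma> x(2)]
    have "sw k * x = sw k * y"
      by (rule U_left_inj[OF adU[of b] _ _ x(3)]) (use cxy in \<open>auto simp: matn_closed\<close>)
    then have "sw k * (sw k * x) = sw k * (sw k * y)" by simp
    then show "x = y" using cxy k by (simp add: sw_cancel)
  qed
  moreover have "F b \<inter> F b' = {}" if "b \<noteq> b'" for b b'
  proof (rule ccontr)
    assume "F b \<inter> F b' \<noteq> {}"
    then obtain x y where x: "x \<in> dc n \<sigma>" "y \<in> dc n \<sigma>" "ad b k * (sw k * x) = ad b' k * (sw k * y)"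
      by (auto simp: F_def)
    note cxy = dc_carrier[OF c\<sigma> x(1)] dc_carrier[OF c\<sigma> x(2)]
    \<comment> \<open>Two translates that meet give \<open>y = sw k * (ad a k * (sw k * x))\<close>
      with nonzero \<open>a\<close>. By \<open>sw_ad_sw\<close> this places \<open>y\<close>, and
      hence \<sigma>, in the double coset of a torus multiple of
      \<open>sw k * \<sigma>\<close>.\<close>
    define a where "a = b - b'"
    have a: "a \<noteq> 0" using that by (simp add: a_def)
    let ?D = "multrow_mat n k (- 1 / a) :: 'f mat" and ?E = "multrow_mat n (Suc k) a :: 'f mat"
    have "ad (- b') k * (ad b k * (sw k * x)) = ad (- b') k * (ad b' k * (sw k * y))" using x(3) by simp
    then have "(ad (- b') k * ad b k) * (sw k * x) = (ad (- b') k * ad b' k) * (sw k * y)"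
      using cxy by (simp add: matn_assoc matn_closed)
    then have "ad a k * (sw k * x) = sw k * y"
      using k cxy by (simp add: ad_ad ad_zero a_def matn_closed)
    then have "y = sw k * (ad a k * (sw k * x))" using k cxy by (simp add: sw_cancel)
    also have "\<dots> = (sw k * (ad a k * sw k)) * x" using cxy by (simp add: matn_assoc matn_closed)
    also have "\<dots> = ad (1 / a) k * (?D * (?E * (sw k * (ad (1 / a) k * x))))"
      unfolding sw_ad_sw[OF a k] using cxy by (simp add: matn_assoc matn_closed)
    finally have y: "y = ad (1 / a) k * (?D * (?E * (sw k * (ad (1 / a) k * x))))" .
    have "ad (1 / a) k * x \<in> dc n \<sigma>"
      using dc_mult[OF c\<sigma> x(1) adU[of "1 / a"] one_U] cxy
      by (simp add: right_mult_one_mat[of _ n n] matn_closed)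
    then have "?D * (?E * (sw k * (ad (1 / a) k * x))) \<in> dc n (?D * (?E * (sw k * \<sigma>)))"
      using a k s\<sigma> by (intro torus_dc sw_dc) (auto simp: matn_closed)
    then have "ad (1 / a) k * (?D * (?E * (sw k * (ad (1 / a) k * x)))) * 1\<^sub>m n \<in> dc n (?D * (?E * (sw k * \<sigma>)))"
      using s\<sigma> by (intro dc_mult adU one_U) (auto simp: matn_closed)
    then have "y \<in> dc n (?D * (?E * (sw k * \<sigma>)))"
      using cxy by (simp add: y right_mult_one_mat[of _ n n] matn_closed)
    moreover have "?D * (?E * (sw k * \<sigma>)) \<in> carrier_mat n n"
      using c\<sigma> by (intro matn_closed) auto
    ultimately have "\<sigma> \<in> dc n (?D * (?E * (sw k * \<sigma>)))"
      using dc_sym[OF c\<sigma> x(2)] dc_trans by blast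
    moreover have "?D * (?E * (sw k * \<sigma>)) \<in> framed_rook_mats n"
      by (intro rook_mult[OF rook_torus] rook_mult[OF rook_sw[OF k]] \<sigma>)
    \<comment> \<open>Equality of these rook matrices would put entries into both rows
      \<open>k\<close> and \<open>k + 1\<close> of column \<open>c\<close>.\<close>
    ultimately have "\<sigma> = ?D * (?E * (sw k * \<sigma>))"
      using bruhat_unique[OF _ \<sigma>] by blast
    then have "\<sigma> $$ (k, c) = (?D * (?E * (sw k * \<sigma>))) $$ (k, c)" by simp
    also have "\<dots> = - 1 / a * \<sigma> $$ (Suc k, c)"
      using c\<sigma> k row by (simp add: torus_left sw_left)
    finally have "\<sigma> $$ (Suc k, c) \<noteq> 0" using row by auto
    then have "k = Suc k" using \<sigma> k row unfolding rook_iff by (meson Suc_lessD)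
    then show False by simp
  qed
  moreover have "finite (F b)" for b unfolding F_def by (intro finite_imageI finite_dc c\<sigma>)
  ultimately show ?thesis by (simp add: card_UN_disjoint)
qed

section \<open>Passage from left to right multiplication\<close>

subsection \<open>Reflection in the antidiagonal\<close>

text \<open>The transpose conjugated by the order reversing permutation. It reverses products and
  preserves \<open>U\<close>, so each statement about left multiplication yields one about right
  multiplication.\<close>

definition anti :: "'f::field mat \<Rightarrow> 'f mat" where
  "anti A = mat n n (\<lambda>(i, j). A $$ (n - 1 - j, n - 1 - i))"

lemma anti_carrier: "anti A \<in> carrier_mat n n"
  by (simp add: anti_def)

lemma anti_index: "i < n \<Longrightarrow> j < n \<Longrightarrow> anti A $$ (i, j) = A $$ (n - 1 - j, n - 1 - i)"
  by (simp add: anti_def)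

lemma anti_anti: "A \<in> carrier_mat n n \<Longrightarrow> anti (anti A) = A"
  by (rule eq_matI) (auto simp: anti_def)

lemma anti_mult:
  assumes "A \<in> carrier_mat n n" "B \<in> carrier_mat n n"
  shows "anti (A * B) = anti B * anti A"
proof (rule eq_matI)
  fix i j assume "i < dim_row (anti B * anti A)" "j < dim_col (anti B * anti A)"
  then have ij: "i < n" "j < n" by (auto simp: anti_def)
  have "anti (A * B) $$ (i, j) = (\<Sum>k<n. A $$ (n - 1 - j, k) * B $$ (k, n - 1 - i))"
    using ij by (simp add: anti_index) (subst mat_mult_index[OF assms], auto)
  also have "\<dots> = (\<Sum>k<n. A $$ (n - 1 - j, n - 1 - k) * B $$ (n - 1 - k, n - 1 - i))"
    by (rule sum.reindex_bij_witness[of _ "\<lambda>k. n - 1 - k" "\<lambda>k. n - 1 - k"]) auto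
  also have "\<dots> = (anti B * anti A) $$ (i, j)"
    by (subst mat_mult_index[OF anti_carrier anti_carrier ij], rule sum.cong[OF refl])
      (use ij in \<open>simp add: anti_index mult.commute\<close>)
  finally show "anti (A * B) $$ (i, j) = (anti B * anti A) $$ (i, j)" .
qed (auto simp: anti_def)

lemma anti_U: "u \<in> U n \<Longrightarrow> anti u \<in> U n"
  by (auto simp: U_iff anti_carrier anti_index)

lemma anti_rook: "\<sigma> \<in> framed_rook_mats n \<Longrightarrow> anti \<sigma> \<in> framed_rook_mats n"
proof -
  assume \<sigma>: "\<sigma> \<in> framed_rook_mats n"
  have eq: "i = j" if "n - 1 - i = n - 1 - j" "i < n" "j < n" for i j using that by linarith
  have lt: "n - 1 - i < n" if "i < n" for i using that by linarith
  show ?thesis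
    unfolding rook_iff
  proof (intro conjI allI impI)
    fix i j j' assume a: "i < n" "j < n" "j' < n" "anti \<sigma> $$ (i, j) \<noteq> 0" "anti \<sigma> $$ (i, j') \<noteq> 0"
    then have "\<sigma> $$ (n - 1 - j, n - 1 - i) \<noteq> 0" "\<sigma> $$ (n - 1 - j', n - 1 - i) \<noteq> 0"
      by (simp_all add: anti_index)
    then have "n - 1 - j = n - 1 - j'"
      by (rule rook_col[OF \<sigma> lt[OF a(1)] lt[OF a(2)] lt[OF a(3)]])
    then show "j = j'" using eq a by blast
  next
    fix j i i' assume a: "j < n" "i < n" "i' < n" "anti \<sigma> $$ (i, j) \<noteq> 0" "anti \<sigma> $$ (i', j) \<noteq> 0"
    then have "\<sigma> $$ (n - 1 - j, n - 1 - i) \<noteq> 0" "\<sigma> $$ (n - 1 - j, n - 1 - i') \<noteq> 0"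
      by (simp_all add: anti_index)
    then have "n - 1 - i = n - 1 - i'"
      by (rule rook_row[OF \<sigma> lt[OF a(1)] lt[OF a(2)] lt[OF a(3)]])
    then show "i = i'" using eq a by blast
  qed (rule anti_carrier)
qed

text \<open>With indices starting at 0, the reversal carries the pair \<open>(k, k+1)\<close> to
  \<open>(n-2-k, n-1-k)\<close>.\<close>

lemma anti_sw:
  assumes "Suc k < n"
  shows "anti (sw (n - 2 - k)) = sw k"
proof (rule eq_matI)
  fix i j assume "i < dim_row (sw k)" "j < dim_col (sw k)"
  then have ij: "i < n" "j < n" by simp_all
  have e: "n - 2 - k = n - 1 - x \<longleftrightarrow> Suc k = x" "Suc (n - 2 - k) = n - 1 - x \<longleftrightarrow> k = x"
    "n - 1 - x < n" if "x < n" for x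
    using that assms by linarith+
  have e': "n - 1 - j = n - 1 - i \<longleftrightarrow> i = j" using ij by linarith
  show "anti (sw (n - 2 - k)) $$ (i, j) = sw k $$ (i, j)"
    unfolding anti_index[OF ij] index_mat_swaprows_mat(1)[OF e(3)[OF ij(2)] e(3)[OF ij(1)]]
      index_mat_swaprows_mat(1)[OF ij]
    unfolding e(1,2)[OF ij(1)] e(1,2)[OF ij(2)] eq_commute[of _ "n - 2 - k"]
      eq_commute[of _ "Suc (n - 2 - k)"] e'
    by auto
qed (auto simp: anti_def)

lemma anti_torus:
  assumes "k < n"
  shows "anti (multrow_mat n k a) = multrow_mat n (n - 1 - k) a"
proof (rule eq_matI)
  fix i j assume "i < dim_row (multrow_mat n (n - 1 - k) a)" "j < dim_col (multrow_mat n (n - 1 - k) a)"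
  then have ij: "i < n" "j < n" by simp_all
  have e: "k = n - 1 - x \<longleftrightarrow> n - 1 - k = x" "n - 1 - x < n" if "x < n" for x
    using that assms by linarith+
  have e': "n - 1 - j = n - 1 - i \<longleftrightarrow> i = j" using ij by linarith
  show "anti (multrow_mat n k a) $$ (i, j) = multrow_mat n (n - 1 - k) a $$ (i, j)"
    unfolding anti_index[OF ij] index_mat_multrow_mat(1)[OF e(2)[OF ij(2)] e(2)[OF ij(1)]]
      index_mat_multrow_mat(1)[OF ij] e(1)[OF ij(1)] e(1)[OF ij(2)] e'
    by auto
qed (auto simp: anti_def)

lemma anti_dc:
  assumes "\<sigma> \<in> carrier_mat n n" "x \<in> dc n \<sigma>"
  shows "anti x \<in> dc n (anti \<sigma>)"
proof -
  obtain u v where x: "u \<in> U n" "v \<in> U n" "x = u * \<sigma> * v" using assms(2) by (rule dcE)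
  have "anti x = anti v * anti \<sigma> * anti u"
    using x assms(1) by (simp add: anti_mult matn_assoc matn_closed U_carrier anti_carrier)
  then show ?thesis using x anti_U by (intro dcI[of "anti v" n "anti u"])
qed

lemma card_dc_anti:
  assumes "\<sigma> \<in> carrier_mat n n"
  shows "card (dc n (anti \<sigma>)) = card (dc n \<sigma>)"
proof (rule bij_betw_same_card[symmetric])
  show "bij_betw anti (dc n \<sigma>) (dc n (anti \<sigma>))"
    by (rule bij_betw_byWitness[where f' = anti])
      (use assms anti_dc[OF assms] anti_dc[OF anti_carrier, of _ \<sigma>] dc_carrier[OF assms]
        dc_carrier[OF anti_carrier, of _ \<sigma>] in \<open>auto simp: anti_anti\<close>)
qed

lemma compatible_anti:
  assumes "compatible n (anti \<tau>) (anti \<sigma>)" "\<sigma> \<in> carrier_mat n n" "\<tau> \<in> carrier_mat n n"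
  shows "compatible n \<sigma> \<tau>"
  unfolding compatible_def
proof
  fix w :: "'a mat" assume w: "w \<in> U n"
  have "anti \<tau> * anti w * anti \<sigma> \<in> dc n (anti (\<sigma> * \<tau>))"
    using assms anti_U[OF w] by (simp add: compatible_def anti_mult)
  from anti_dc[OF anti_carrier this] show "\<sigma> * w * \<tau> \<in> dc n (\<sigma> * \<tau>)"
    using assms w by (simp add: anti_mult anti_anti anti_carrier matn_assoc matn_closed U_carrier)
qed

lemma compatible_torus_right:
  assumes "a \<noteq> 0" "j < n" "\<sigma> \<in> carrier_mat n n"
  shows "compatible n \<sigma> (multrow_mat n j a)"
  by (rule compatible_anti) (use assms in \<open>auto simp: anti_torus anti_carrier intro: compatible_torus\<close>)

text \<open>The condition \<open>good\<close> carried over by \<open>anti\<close>; see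
  \<open>good_anti\<close>.\<close>

definition good_right :: "nat \<Rightarrow> 'f::field mat \<Rightarrow> bool" where
  "good_right k \<sigma> \<longleftrightarrow> (\<forall>r<n. \<sigma> $$ (r, k) \<noteq> 0 \<longrightarrow> (\<exists>r'>r. r' < n \<and> \<sigma> $$ (r', Suc k) \<noteq> 0))"

lemma good_anti:
  assumes "good_right k \<sigma>" "Suc k < n"
  shows "good (n - 2 - k) (anti \<sigma>)"
  unfolding good_def
proof (intro allI impI)
  fix c' assume c': "c' < n" "anti \<sigma> $$ (Suc (n - 2 - k), c') \<noteq> 0"
  have e: "n - 1 - Suc (n - 2 - k) = k" "n - 1 - (n - 2 - k) = Suc k"
    "Suc (n - 2 - k) < n" "n - 2 - k < n" "n - 1 - c' < n"
    using assms(2) c'(1) by linarith+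
  have "\<sigma> $$ (n - 1 - c', k) \<noteq> 0" using c'(2) unfolding anti_index[OF e(3) c'(1)] e(1) .
  then obtain r' where r': "r' > n - 1 - c'" "r' < n" "\<sigma> $$ (r', Suc k) \<noteq> 0"
    using assms(1) e(5) unfolding good_right_def by blast
  have e': "n - 1 - r' < n" "n - 1 - (n - 1 - r') = r'" "n - 1 - r' < c'" using r' c'(1) by linarith+
  have "anti \<sigma> $$ (n - 2 - k, n - 1 - r') \<noteq> 0"
    unfolding anti_index[OF e(4) e'(1)] e'(2) e(2) by (rule r'(3))
  then show "\<exists>c<c'. anti \<sigma> $$ (n - 2 - k, c) \<noteq> 0" using e'(3) by blast
qed

lemma compatible_good_right:
  assumes "good_right k \<sigma>" "\<sigma> \<in> framed_rook_mats n" "Suc k < n"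
  shows "compatible n (\<sigma> :: 'f::field mat) (sw k)"
proof (rule compatible_anti)
  have "n - 2 - (n - 2 - k) = k" "Suc (n - 2 - k) < n" using assms(3) by linarith+
  then have "anti (sw k) = (sw (n - 2 - k) :: 'f mat)" using anti_sw[of "n - 2 - k"] by simp
  then show "compatible n (anti (sw k)) (anti \<sigma>)"
    using compatible_good[OF good_anti[OF assms(1,3)] anti_rook[OF assms(2)]] assms(3) by simp
qed (use rook_carrier[OF assms(2)] in auto)

lemma card_dc_sw_right:
  fixes \<sigma> :: "'f::{field,finite} mat"
  assumes good: "good_right k \<sigma>" and \<sigma>: "\<sigma> \<in> framed_rook_mats n" and k: "Suc k < n"
    and col: "r < n" "\<sigma> $$ (r, Suc k) \<noteq> 0"
  shows "card (dc n (\<sigma> * sw k)) = CARD('f) * card (dc n \<sigma>)"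
proof -
  note c\<sigma> = rook_carrier[OF \<sigma>]
  have e: "n - 2 - (n - 2 - k) = k" "Suc (n - 2 - k) < n" "n - 2 - k < n" "n - 1 - r < n"
    "n - 1 - (n - 2 - k) = Suc k" "n - 1 - (n - 1 - r) = r"
    using k col(1) by linarith+
  have "anti (\<sigma> * sw k) = sw (n - 2 - k) * anti \<sigma>"
    using anti_mult[OF c\<sigma> swaprows_mat_carrier] anti_sw[OF e(2), where ?'a = 'f] unfolding e(1) by simp
  moreover have "anti \<sigma> $$ (n - 2 - k, n - 1 - r) \<noteq> 0"
    unfolding anti_index[OF e(3,4)] e(5,6) by (rule col(2))
  ultimately have "card (dc n (anti (\<sigma> * sw k))) = CARD('f) * card (dc n (anti \<sigma>))"
    using card_dc_sw[OF good_anti[OF good k] anti_rook[OF \<sigma>] e(2,4)] by simp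
  then show ?thesis using c\<sigma> by (simp add: card_dc_anti matn_closed)
qed

end

section \<open>Weighted partial permutations, and the double cosets of the powers of
  \<open>N\<close>\<close>

section \<open>Monomial matrices and the nilpotent generator\<close>

text \<open>A zero weight encodes an empty row; there \<pi> is arbitrary and may leave the index
  range. In this way total functions describe singular matrices such as the powers of
  \<open>N\<close>.\<close>

definition monom_mat :: "nat \<Rightarrow> (nat \<Rightarrow> nat) \<Rightarrow> (nat \<Rightarrow> 'f::field) \<Rightarrow> 'f mat" where
  "monom_mat n \<pi> \<alpha> = mat n n (\<lambda>(i, j). if \<pi> i = j then \<alpha> i else 0)"

definition shift_mat :: "nat \<Rightarrow> nat \<Rightarrow> 'f::field mat" where
  "shift_mat n k = mat n n (\<lambda>(i, j). if i + k = j then 1 else 0)"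

context
  fixes n :: nat
begin

abbreviation monom :: "(nat \<Rightarrow> nat) \<Rightarrow> (nat \<Rightarrow> 'f::field) \<Rightarrow> 'f mat" where "monom \<equiv> monom_mat n"

lemma monom_carrier [simp]: "monom \<pi> \<alpha> \<in> carrier_mat n n"
  by (simp add: monom_mat_def)

lemma monom_index: "i < n \<Longrightarrow> j < n \<Longrightarrow> monom \<pi> \<alpha> $$ (i, j) = (if \<pi> i = j then \<alpha> i else 0)"
  by (simp add: monom_mat_def)

lemma monom_cong:
  "(\<And>i. i < n \<Longrightarrow> \<alpha> i = \<beta> i \<and> (\<alpha> i \<noteq> 0 \<longrightarrow> \<pi> i = \<rho> i)) \<Longrightarrow> monom \<pi> \<alpha> = monom \<rho> \<beta>"
proof (rule eq_matI)
  fix i j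
  assume a: "\<And>i. i < n \<Longrightarrow> \<alpha> i = \<beta> i \<and> (\<alpha> i \<noteq> 0 \<longrightarrow> \<pi> i = \<rho> i)"
    and "i < dim_row (monom \<rho> \<beta>)" "j < dim_col (monom \<rho> \<beta>)"
  then have "i < n" "j < n" by (auto simp: monom_mat_def)
  then show "monom \<pi> \<alpha> $$ (i, j) = monom \<rho> \<beta> $$ (i, j)"
    using a[of i] by (cases "\<alpha> i = 0") (auto simp: monom_index)
qed (auto simp: monom_mat_def)

lemma monom_mult_index:
  assumes "A \<in> carrier_mat n n" "i < n" "j < n" "\<alpha> i \<noteq> 0 \<Longrightarrow> \<pi> i < n"
  shows "(monom \<pi> \<alpha> * A) $$ (i, j) = \<alpha> i * A $$ (\<pi> i, j)"
proof -
  have "(monom \<pi> \<alpha> * A) $$ (i, j) = (\<Sum>k<n. if k = \<pi> i then \<alpha> i * A $$ (\<pi> i, j) else 0)"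
    unfolding mat_mult_index[OF monom_carrier assms(1-3)]
    by (rule sum.cong) (use assms in \<open>auto simp: monom_index\<close>)
  then show ?thesis using assms(4) by (cases "\<alpha> i = 0") auto
qed

lemma monom_mult:
  assumes "\<And>i. i < n \<Longrightarrow> \<alpha> i \<noteq> 0 \<Longrightarrow> \<pi> i < n"
  shows "monom \<pi> \<alpha> * monom \<rho> \<beta> = monom (\<lambda>i. \<rho> (\<pi> i)) (\<lambda>i. \<alpha> i * \<beta> (\<pi> i))"
proof (rule eq_matI)
  fix i j assume "i < dim_row (monom (\<lambda>i. \<rho> (\<pi> i)) (\<lambda>i. \<alpha> i * \<beta> (\<pi> i)))"
    "j < dim_col (monom (\<lambda>i. \<rho> (\<pi> i)) (\<lambda>i. \<alpha> i * \<beta> (\<pi> i)))"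
  then have ij: "i < n" "j < n" by (auto simp: monom_mat_def)
  show "(monom \<pi> \<alpha> * monom \<rho> \<beta>) $$ (i, j) = monom (\<lambda>i. \<rho> (\<pi> i)) (\<lambda>i. \<alpha> i * \<beta> (\<pi> i)) $$ (i, j)"
  proof -
    have "(monom \<pi> \<alpha> * monom \<rho> \<beta>) $$ (i, j) = \<alpha> i * monom \<rho> \<beta> $$ (\<pi> i, j)"
      by (rule monom_mult_index) (use ij assms in auto)
    then show ?thesis
      using assms[OF ij(1)] ij by (cases "\<alpha> i = 0") (simp_all add: monom_index)
  qed
qed (auto simp: monom_mat_def)

lemma monom_rook:
  assumes "\<And>i j. i < n \<Longrightarrow> j < n \<Longrightarrow> \<alpha> i \<noteq> 0 \<Longrightarrow> \<alpha> j \<noteq> 0 \<Longrightarrow> \<pi> i = \<pi> j \<Longrightarrow> i = j"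
  shows "monom \<pi> \<alpha> \<in> framed_rook_mats n"
  unfolding rook_iff
proof (intro conjI allI impI)
  fix i j j' assume "i < n" "j < n" "j' < n" "monom \<pi> \<alpha> $$ (i, j) \<noteq> 0" "monom \<pi> \<alpha> $$ (i, j') \<noteq> 0"
  then show "j = j'" by (simp add: monom_index split: if_splits)
next
  fix j i i' assume "j < n" "i < n" "i' < n" "monom \<pi> \<alpha> $$ (i, j) \<noteq> 0" "monom \<pi> \<alpha> $$ (i', j) \<noteq> 0"
  then show "i = i'" using assms[of i i'] by (simp add: monom_index split: if_splits)
qed simp

lemma good_monom:
  assumes "Suc k < n" "\<alpha> (Suc k) \<noteq> 0 \<Longrightarrow> \<pi> (Suc k) < n \<Longrightarrow> \<alpha> k \<noteq> 0 \<and> \<pi> k < \<pi> (Suc k)"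
  shows "good n k (monom \<pi> \<alpha>)"
  unfolding good_def
proof (intro allI impI)
  fix c' assume c': "c' < n" "monom \<pi> \<alpha> $$ (Suc k, c') \<noteq> 0"
  then have "\<alpha> (Suc k) \<noteq> 0" "\<pi> (Suc k) = c'" using assms(1) by (auto simp: monom_index split: if_splits)
  then show "\<exists>c<c'. monom \<pi> \<alpha> $$ (k, c) \<noteq> 0"
    using assms c'(1) by (intro exI[of _ "\<pi> k"]) (auto simp: monom_index)
qed

lemma good_right_monom:
  assumes "Suc k < n" "\<And>r. r < n \<Longrightarrow> \<alpha> r \<noteq> 0 \<Longrightarrow> \<pi> r = k \<Longrightarrow> \<exists>r'>r. r' < n \<and> \<alpha> r' \<noteq> 0 \<and> \<pi> r' = Suc k"
  shows "good_right n k (monom \<pi> \<alpha>)"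
  unfolding good_right_def
proof (intro allI impI)
  fix r assume r: "r < n" "monom \<pi> \<alpha> $$ (r, k) \<noteq> 0"
  then have "\<alpha> r \<noteq> 0" "\<pi> r = k" using assms(1) by (auto simp: monom_index split: if_splits)
  from assms(2)[OF r(1) this] obtain r' where "r' > r" "r' < n" "\<alpha> r' \<noteq> 0" "\<pi> r' = Suc k" by blast
  then show "\<exists>r'>r. r' < n \<and> monom \<pi> \<alpha> $$ (r', Suc k) \<noteq> 0"
    using assms(1) by (intro exI[of _ r']) (auto simp: monom_index)
qed

lemma one_monom: "1\<^sub>m n = monom (\<lambda>i. i) (\<lambda>_. 1)"
  by (rule eq_matI) (auto simp: monom_mat_def)

lemma sw_monom: "Suc k < n \<Longrightarrow> sw n k = monom (transpose k (Suc k)) (\<lambda>_. 1)"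
  by (rule eq_matI) (auto simp: monom_mat_def transpose_def)

lemma torus_monom: "multrow_mat n j a = monom (\<lambda>i. i) (\<lambda>i. if i = j then a else 1)"
  by (rule eq_matI) (auto simp: monom_mat_def)

lemma shift_monom: "shift_mat n k = monom (\<lambda>i. i + k) (\<lambda>i. if i + k < n then 1 else 0)"
  by (rule eq_matI) (auto simp: monom_mat_def shift_mat_def)

lemma transpose_less: "Suc k < n \<Longrightarrow> i < n \<Longrightarrow> transpose k (Suc k) i < n"
  by (simp add: transpose_def)

lemma shift_rook: "shift_mat n k \<in> framed_rook_mats n"
  unfolding shift_monom by (rule monom_rook) simp

lemma shift_carrier [simp]: "shift_mat n k \<in> carrier_mat n n"
  by (simp add: shift_mat_def)

lemma shift_shift: "shift_mat n k * shift_mat n l = (shift_mat n (k + l) :: 'f::field mat)"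
  unfolding shift_monom by (subst monom_mult) (auto intro!: monom_cong split: if_splits)

lemma shift_zero: "shift_mat n 0 = 1\<^sub>m n"
  by (rule eq_matI) (auto simp: shift_mat_def)

text \<open>The reason is \<open>N w = w' N\<close> with \<open>w'\<close> again in
  \<open>U\<close>: every unitriangular factor crosses \<open>N\<close> to the left, whatever matrix
  follows.\<close>

lemma compatible_shift:
  assumes "\<tau> \<in> carrier_mat n n"
  shows "compatible n (shift_mat n 1) (\<tau> :: 'f::field mat)"
  unfolding compatible_def
proof
  fix w :: "'f mat" assume w: "w \<in> U n"
  \<comment> \<open>\<open>w\<close> without its first row and column, moved one step up the
    diagonal; a unit row and column fill the end.\<close>
  define w' where "w' = mat n n (\<lambda>(i, j). if Suc i < n \<and> Suc j < n then w $$ (Suc i, Suc j)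
    else if i = j then 1 else 0)"
  have w': "w' \<in> U n" using w unfolding U_iff w'_def by auto
  have "shift_mat n 1 * w = w' * shift_mat n 1"
  proof (rule eq_matI)
    fix i j assume "i < dim_row (w' * shift_mat n 1)" "j < dim_col (w' * shift_mat n 1)"
    then have ij: "i < n" "j < n" by (auto simp: w'_def shift_mat_def)
    have "(shift_mat n 1 * w) $$ (i, j) = (if Suc i < n then w $$ (Suc i, j) else 0)"
      unfolding shift_monom using ij U_carrier[OF w] by (subst monom_mult_index) (auto split: if_splits)
    moreover have "(w' * shift_mat n 1) $$ (i, j) = (\<Sum>k<n. if k = j - 1 then if j = 0 then 0 else w' $$ (i, j - 1) else 0)"
      unfolding mat_mult_index[OF U_carrier[OF w'] shift_carrier ij]
      by (rule sum.cong) (use ij in \<open>auto simp: shift_mat_def\<close>)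
    then have "(w' * shift_mat n 1) $$ (i, j) = (if j = 0 then 0 else w' $$ (i, j - 1))"
      using ij by simp
    ultimately show "(shift_mat n 1 * w) $$ (i, j) = (w' * shift_mat n 1) $$ (i, j)"
      using ij w unfolding U_iff by (auto simp: w'_def)
  qed (use U_carrier[OF w] in \<open>auto simp: w'_def shift_mat_def\<close>)
  then have "shift_mat n 1 * w * \<tau> = w' * (shift_mat n 1 * \<tau>) * 1\<^sub>m n"
    using assms U_carrier[OF w'] by (simp add: matn_assoc matn_closed right_mult_one_mat[of _ n n])
  then show "shift_mat n 1 * w * \<tau> \<in> dc n (shift_mat n 1 * \<tau>)"
    by (rule dcI[OF w' one_U])
qed

lemma anti_shift: "anti n (shift_mat n 1) = shift_mat n 1"
  by (rule eq_matI) (auto simp: anti_def shift_mat_def)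

lemma compatible_shift_right:
  "\<tau> \<in> carrier_mat n n \<Longrightarrow> compatible n (\<tau> :: 'f::field mat) (shift_mat n 1)"
  by (rule compatible_anti, unfold anti_shift, rule compatible_shift, rule anti_carrier) simp_all

text \<open>The columns of \<open>x\<close> from \<open>k\<close> on can be read as the first
  columns of a unitriangular \<open>u\<close> with \<open>x = u N^k\<close>, so one unitriangular
  factor already produces the whole double coset. In this explicit form its elements can be
  counted.\<close>

lemma dc_shift:
  "dc n (shift_mat n k :: 'f::field mat) = {x \<in> carrier_mat n n.
    (\<forall>i<n. \<forall>j<n. j < i + k \<longrightarrow> x $$ (i, j) = 0) \<and> (\<forall>i. i + k < n \<longrightarrow> x $$ (i, i + k) = 1)}"
    (is "_ = ?X")
proof
  show "dc n (shift_mat n k) \<subseteq> ?X"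
  proof
    fix x :: "'f mat" assume "x \<in> dc n (shift_mat n k)"
    then obtain u v where x: "u \<in> U n" "v \<in> U n" "x = u * shift_mat n k * v" by (rule dcE)
    note c = U_carrier[OF x(1)] U_carrier[OF x(2)]
    have sv: "(shift_mat n k * v) $$ (l, j) = (if l + k < n then v $$ (l + k, j) else 0)"
      if "l < n" "j < n" for l j
      unfolding shift_monom using c that by (subst monom_mult_index) (auto split: if_splits)
    have idx: "x $$ (i, j) = (\<Sum>l<n. u $$ (i, l) * (if l + k < n then v $$ (l + k, j) else 0))"
      if "i < n" "j < n" for i j
    proof -
      have "x = u * (shift_mat n k * v)" using x(3) c by (simp add: matn_assoc)
      then have "x $$ (i, j) = (\<Sum>l<n. u $$ (i, l) * (shift_mat n k * v) $$ (l, j))"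
        using mat_mult_index[OF c(1) _ that] c(2) by (simp add: matn_closed)
      then show ?thesis using sv that by simp
    qed
    have "x $$ (i, j) = 0" if "i < n" "j < n" "j < i + k" for i j
      unfolding idx[OF that(1,2)]
    proof (rule sum.neutral, rule ballI)
      fix l assume "l \<in> {..<n}"
      then show "u $$ (i, l) * (if l + k < n then v $$ (l + k, j) else 0) = 0"
        using x(1,2) that unfolding U_iff by (cases "l < i") auto
    qed
    moreover have "x $$ (i, i + k) = 1" if "i + k < n" for i
    proof -
      have "x $$ (i, i + k) = (\<Sum>l<n. if l = i then 1 else 0)"
        unfolding idx[OF add_lessD1[OF that] that]
      proof (rule sum.cong[OF refl])
        fix l assume "l \<in> {..<n}"
        then show "u $$ (i, l) * (if l + k < n then v $$ (l + k, i + k) else 0) = (if l = i then 1 else 0)"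
          using x(1,2) that unfolding U_iff by (cases l i rule: linorder_cases) auto
      qed
      then show ?thesis using that by simp
    qed
    ultimately show "x \<in> ?X" using x(3) c by (auto simp: matn_closed)
  qed
  show "?X \<subseteq> dc n (shift_mat n k)"
  proof
    fix x assume x: "x \<in> ?X"
    define u where "u = mat n n (\<lambda>(i, l). if l + k < n then x $$ (i, l + k) else if i = l then 1 else 0)"
    have u: "u \<in> U n" using x unfolding U_iff u_def by auto
    have "u * shift_mat n k = x"
    proof (rule eq_matI)
      fix i j assume "i < dim_row x" "j < dim_col x"
      then have ij: "i < n" "j < n" using x by auto
      have "(u * shift_mat n k) $$ (i, j) = (\<Sum>l<n. if l = j - k then if k \<le> j then x $$ (i, j) else 0 else 0)"
        unfolding mat_mult_index[OF U_carrier[OF u] shift_carrier ij]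
        by (rule sum.cong) (use ij in \<open>auto simp: shift_mat_def u_def\<close>)
      then show "(u * shift_mat n k) $$ (i, j) = x $$ (i, j)" using ij x by auto
    qed (use x in \<open>auto simp: u_def shift_mat_def\<close>)
    then have "x = u * shift_mat n k * 1\<^sub>m n" using x by (auto simp: right_mult_one_mat[of _ n n])
    then show "x \<in> dc n (shift_mat n k)" by (rule dcI[OF u one_U])
  qed
qed

text \<open>The free entries are those strictly above the \<open>k\<close>-th superdiagonal. For
  \<open>k = n - r\<close> there are \<open>r (r - 1) / 2\<close> of them, which matches the
  exponent in the normalisation of \<open>T_\<sigma>\<close>.\<close>

lemma card_dc_shift:
  assumes "k \<le> n"
  shows "card (dc n (shift_mat n k :: 'f::{field,finite} mat)) = CARD('f) ^ ((n - k) * (n - k - 1) div 2)"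
proof -
  define P where "P = (SIGMA i:{..<n}. {i + k<..<n})"
  have P: "finite P" by (simp add: P_def)
  have "card P = (\<Sum>i<n. n - Suc (i + k))" by (simp add: P_def)
  also have "\<dots> = (\<Sum>i<n - k. n - Suc (i + k))"
    by (rule sum.mono_neutral_right) auto
  also have "\<dots> = (\<Sum>i<n - k. i)"
    by (rule sum.reindex_bij_witness[of _ "\<lambda>i. n - k - Suc i" "\<lambda>i. n - k - Suc i"]) auto
  also have "\<dots> = (n - k) * (n - k - 1) div 2"
    by (simp add: lessThan_atLeast0 Sum_Ico_nat)
  finally have cP: "card P = (n - k) * (n - k - 1) div 2" .
  have "bij_betw (\<lambda>x. restrict (\<lambda>ij. x $$ ij) P) (dc n (shift_mat n k :: 'f mat)) (P \<rightarrow>\<^sub>E UNIV)"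
  proof (rule bij_betw_byWitness[where f' = "\<lambda>h. mat n n (\<lambda>(i, j). if j < i + k then 0
      else if j = i + k then 1 else h (i, j))"])
    show "\<forall>x\<in>dc n (shift_mat n k :: 'f mat). mat n n (\<lambda>(i, j). if j < i + k then 0
        else if j = i + k then 1 else restrict (\<lambda>ij. x $$ ij) P (i, j)) = x"
      unfolding dc_shift by (auto intro!: eq_matI simp: P_def)
    show "\<forall>h\<in>P \<rightarrow>\<^sub>E (UNIV :: 'f set). restrict (\<lambda>ij. mat n n (\<lambda>(i, j). if j < i + k then 0
        else if j = i + k then 1 else h (i, j)) $$ ij) P = h"
      by (auto intro!: ext simp: P_def PiE_def extensional_def restrict_def)
    show "(\<lambda>x. restrict (\<lambda>ij. x $$ ij) P) ` dc n (shift_mat n k :: 'f mat) \<subseteq> P \<rightarrow>\<^sub>E UNIV"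
      by auto
    show "(\<lambda>h. mat n n (\<lambda>(i, j). if j < i + k then 0 else if j = i + k then 1 else h (i, j))) `
        (P \<rightarrow>\<^sub>E UNIV) \<subseteq> dc n (shift_mat n k :: 'f mat)"
      unfolding dc_shift by auto
  qed
  from bij_betw_same_card[OF this] show ?thesis
    using P cP by (simp add: card_PiE)
qed

text \<open>A torus element normalises \<open>U\<close>, so multiplying by it on the left is a
  bijection between double cosets; \<open>anti\<close> transfers this to the right.\<close>

lemma card_dc_torus:
  fixes \<sigma> :: "'f::{field,finite} mat"
  assumes "a \<noteq> 0" "j < n" "\<sigma> \<in> carrier_mat n n"
  shows "card (dc n (\<sigma> * multrow_mat n j a)) = card (dc n \<sigma>)"
proof -
  have left: "card (dc n (multrow_mat n l a * \<tau>)) = card (dc n \<tau>)"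
    if "l < n" "\<tau> \<in> carrier_mat n n" for l and \<tau> :: "'f mat"
  proof (rule bij_betw_same_card[symmetric])
    let ?D = "multrow_mat n l a" and ?E = "multrow_mat n l (1 / a)"
    have c: "?D * \<tau> \<in> carrier_mat n n" using that by (simp add: matn_closed)
    have ED: "?E * (?D * x) = x" "?D * (?E * x) = x" if "x \<in> carrier_mat n n" for x
      using that \<open>l < n\<close> assms(1) torus_inverse[of a l n] by (auto intro!: mat_mult_cancel[of _ n])
    have "?E * x \<in> dc n \<tau>" if "x \<in> dc n (?D * \<tau>)" for x
    proof -
      have "?E * x \<in> dc n (?E * (?D * \<tau>))"
        using torus_dc[of "1 / a" l n "?D * \<tau>" x] assms(1) \<open>l < n\<close> c that by simp
      then show ?thesis using ED \<open>\<tau> \<in> _\<close> by simp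
    qed
    then show "bij_betw ((*) ?D) (dc n \<tau>) (dc n (?D * \<tau>))"
      using torus_dc[OF assms(1) \<open>l < n\<close> \<open>\<tau> \<in> _\<close>] dc_carrier[OF c] dc_carrier[OF \<open>\<tau> \<in> _\<close>] ED
      by (intro bij_betw_byWitness[where f' = "(*) ?E"]) auto
  qed
  have "anti n (\<sigma> * multrow_mat n j a) = multrow_mat n (n - 1 - j) a * anti n \<sigma>"
    using assms by (simp add: anti_mult anti_torus)
  then have "card (dc n (anti n (\<sigma> * multrow_mat n j a))) = card (dc n (anti n \<sigma>))"
    using left[of "n - 1 - j" "anti n \<sigma>"] assms(2) by (simp add: anti_carrier)
  then show ?thesis using assms by (simp add: card_dc_anti matn_closed)
qed

end

section \<open>The multiplicative group of a finite field\<close>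

section \<open>Primitive roots\<close>

text \<open>Multiplication by \<open>x\<close> permutes the nonzero elements and so preserves their
  product.\<close>

lemma finite_field_power_card:
  fixes x :: "'f::{field,finite}"
  assumes "x \<noteq> 0"
  shows "x ^ (CARD('f) - 1) = 1"
proof -
  let ?S = "UNIV - {0 :: 'f}"
  have "(\<Prod>y\<in>?S. y) = (\<Prod>y\<in>?S. x * y)"
    by (rule prod.reindex_bij_witness[of _ "\<lambda>y. x * y" "\<lambda>y. y / x"]) (use assms in auto)
  also have "\<dots> = x ^ (CARD('f) - 1) * (\<Prod>y\<in>?S. y)"
    by (simp add: prod.distrib)
  finally show ?thesis by simp
qed

definition primitive :: "'f::{field,finite} \<Rightarrow> bool" where
  "primitive g \<longleftrightarrow> bij_betw (\<lambda>k. g ^ k) {..<CARD('f) - 1} (UNIV - {0})"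

lemma primitive_exists: "\<exists>g :: 'f::{field,finite}. primitive g"
proof -
  have pow: "a [^]\<^bsub>class_ring\<^esub> (i::nat) = a ^ i" for a :: 'f and i
    by (induction i) (simp_all add: nat_pow_def mult.commute)
  have "finite (carrier (class_ring :: 'f ring))" by simp
  from field.finite_field_mult_group_has_gen[OF class_field this]
  obtain g :: 'f where g: "g \<noteq> 0" "UNIV - {0} = {g ^ i | i. i \<in> (UNIV :: nat set)}"
    by (auto simp: carrier_mult_of nat_pow_mult_of pow)
  let ?d = "CARD('f) - 1"
  have "card {0, 1 :: 'f} \<le> CARD('f)" by (rule card_mono) auto
  then have d: "?d > 0" by simp
  have mod: "g ^ i = g ^ (i mod ?d)" for i
  proof -
    have "g ^ (?d * (i div ?d) + i mod ?d) = g ^ (i mod ?d)"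
      unfolding power_add power_mult finite_field_power_card[OF g(1)] by simp
    then show ?thesis by simp
  qed
  have img: "(\<lambda>k. g ^ k) ` {..<?d} = UNIV - {0}"
  proof
    show "UNIV - {0} \<subseteq> (\<lambda>k. g ^ k) ` {..<?d}"
      unfolding g(2) using mod mod_less_divisor[OF d] by blast
  qed (use g(1) in auto)
  then have "inj_on (\<lambda>k. g ^ k) {..<?d}"
    by (intro eq_card_imp_inj_on) (simp_all add: card_Diff_subset)
  then show ?thesis using img unfolding primitive_def bij_betw_def by blast
qed

text \<open>With \<open>d = 2 h\<close> the exponent is \<open>h (d - 1)\<close>, where
  \<open>g ^ h = - 1\<close> and \<open>d - 1\<close> is odd. This is the sign demanded by
  \<open>sw_ad_sw\<close>.\<close>

lemma primitive_half:
  fixes g :: "'f::{field,finite}"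
  assumes g: "primitive g" and odd: "odd (CARD('f))" and d: "d = CARD('f) - 1"
  shows "g ^ ((d\<^sup>2 - d) div 2) = - 1"
proof -
  have "card {0, 1 :: 'f} \<le> CARD('f)" by (rule card_mono) auto
  then have "CARD('f) \<ge> 2" by simp
  then have "d > 0" using d by simp
  moreover have "even d" using odd d by simp
  ultimately obtain h where h: "d = 2 * h" "h > 0" by (auto elim!: evenE)
  have inj: "inj_on (\<lambda>k. g ^ k) {..<d}" using g by (simp add: primitive_def bij_betw_def d)
  have "g \<noteq> 0"
  proof
    assume "g = 0"
    have "1 \<in> {..<d}" using h by simp
    then have "g ^ 1 \<noteq> 0" using g unfolding primitive_def bij_betw_def d by blast
    then show False using \<open>g = 0\<close> by simp
  qed
  then have "g ^ d = 1" using finite_field_power_card d by simp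
  then have "(g ^ h) ^ 2 = 1" by (simp add: h(1) power_mult[symmetric] mult.commute)
  moreover have "g ^ h \<noteq> g ^ 0"
    using inj_onD[OF inj, of h 0] h by auto
  ultimately have gh: "g ^ h = - 1" by (simp add: power2_eq_1_iff)
  have "(d\<^sup>2 - d) div 2 = h * (d - 1)"
    by (simp add: h(1) power2_eq_square algebra_simps diff_mult_distrib2)
  then have "g ^ ((d\<^sup>2 - d) div 2) = (- 1) ^ (d - 1)" by (simp add: power_mult gh)
  also have "\<dots> = - 1" using h by simp
  finally show ?thesis .
qed

section \<open>Verification of the defining relations inside the corner\<close>

section \<open>The relations hold among double coset averages\<close>

text \<open>The primitive root \<open>g\<close> identifies the powers of each \<open>F_i\<close>
  with the diagonal matrices that differ from 1 in one place. \<open>K\<close> pins down the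
  coefficients: the rationals for the ring structure of \<open>H(M,U)\<close>, the ground field for
  the isomorphism.\<close>

locale framed_rook =
  fixes n :: nat and g :: "'f::{field,finite}" and K :: "'k::field_char_0 itself"
  assumes n: "n \<ge> 1" and g: "primitive g" and odd_card: "odd (CARD('f))"
begin

abbreviation avg :: "'f mat \<Rightarrow> 'f mat \<Rightarrow> 'k" where "avg \<equiv> average n"

definition dc_algebra :: "('k, 'f mat \<Rightarrow> 'k) module" where
  "dc_algebra = corner (mat_algebra n) (avg (1\<^sub>m n))"

text \<open>These are the elements \<open>T_\<sigma>\<close> themselves. As a multiple of the
  average, \<open>T_\<sigma>\<close> has the coefficient \<open>q^(r(1-r)/2)\<close> times the size
  of the double coset, which is \<open>q\<close> for a reflection and 1 for a torus element or
  \<open>N\<close>.\<close>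

fun alg_gen :: "ry_gen \<Rightarrow> 'f mat \<Rightarrow> 'k" where
  "alg_gen (GenT i) = of_nat CARD('f) \<odot>\<^bsub>dc_algebra\<^esub> avg (sw n (i - 1))"
| "alg_gen (GenF i) = avg (multrow_mat n (i - 1) g)"
| "alg_gen GenN = avg (shift_mat n 1)"

lemma q_ge_2: "CARD('f) \<ge> 2"
proof -
  have "card {0, 1 :: 'f} \<le> CARD('f)" by (rule card_mono) auto
  then show ?thesis by simp
qed

lemma avg_mult_mat:
  "\<sigma> \<in> carrier_mat n n \<Longrightarrow> \<tau> \<in> carrier_mat n n \<Longrightarrow> compatible n \<sigma> \<tau> \<Longrightarrow>
    avg \<sigma> \<otimes>\<^bsub>mat_algebra n\<^esub> avg \<tau> = avg (\<sigma> * \<tau>)"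
  by (rule average_mult_compatible)

lemma compatible_one:
  assumes "\<sigma> \<in> carrier_mat n n"
  shows "compatible n (1\<^sub>m n) \<sigma>" "compatible n \<sigma> (1\<^sub>m n :: 'f mat)"
  using compatible_torus[of 1 0 n \<sigma>] compatible_torus_right[of 1 0 n \<sigma>] assms n
  by (simp_all add: torus_monom one_monom[symmetric])

lemma dc_algebra_simps:
  "mult dc_algebra = mult (mat_algebra n)" "add dc_algebra = add (mat_algebra n)"
  "zero dc_algebra = zero (mat_algebra n)" "smult dc_algebra = smult (mat_algebra n)"
  "one dc_algebra = avg (1\<^sub>m n)"
  by (simp_all add: dc_algebra_def corner_def)

lemma dc_algebra_k_algebra: "k_algebra dc_algebra"
proof -
  interpret M: k_algebra "mat_algebra n :: ('k, 'f mat \<Rightarrow> 'k) module"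
    by (rule monoid_algebra_k_algebra[OF mat_monoid])
  show ?thesis
    unfolding dc_algebra_def
    by (rule M.corner_k_algebra[OF average_closed]) (simp_all add: avg_mult_mat compatible_one)
qed

sublocale B: k_algebra dc_algebra
  by (rule dc_algebra_k_algebra)

lemma avg_closed [simp]: "\<sigma> \<in> carrier_mat n n \<Longrightarrow> avg \<sigma> \<in> carrier dc_algebra"
  using avg_mult_mat[OF _ _ compatible_one(1)] avg_mult_mat[OF _ _ compatible_one(2)] average_closed
  by (auto simp: dc_algebra_def corner_def right_mult_one_mat[of _ n n])

lemma avg_mult:
  "\<sigma> \<in> carrier_mat n n \<Longrightarrow> \<tau> \<in> carrier_mat n n \<Longrightarrow> compatible n \<sigma> \<tau> \<Longrightarrow>
    avg \<sigma> \<otimes>\<^bsub>dc_algebra\<^esub> avg \<tau> = avg (\<sigma> * \<tau>)"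
  by (simp add: avg_mult_mat dc_algebra_simps)

lemma dc_algebra_carrier: "carrier dc_algebra \<subseteq> carrier (mat_algebra n)"
  by (auto simp: dc_algebra_def corner_def)

lemma alg_gen_closed [simp]: "alg_gen x \<in> carrier dc_algebra"
  by (cases x) auto

lemma g_nonzero: "g \<noteq> 0"
proof
  assume "g = 0"
  have "CARD('f) - 1 \<noteq> 1" using odd_card q_ge_2 by (metis One_nat_def Suc_1 even_Suc le_add_diff_inverse odd_one one_le_numeral order_trans plus_1_eq_Suc)
  then have "1 \<in> {..<CARD('f) - 1}" using q_ge_2 by auto
  then have "g ^ 1 \<noteq> 0" using g unfolding primitive_def bij_betw_def by blast
  then show False using \<open>g = 0\<close> by simp
qed

lemma torus_torus: "multrow_mat n j a * multrow_mat n j b = (multrow_mat n j (a * b) :: 'f mat)"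
  unfolding torus_monom by (subst monom_mult) (auto intro!: monom_cong)

lemma avg_torus_pow:
  assumes "a \<noteq> 0" "j < n"
  shows "avg (multrow_mat n j a) [^]\<^bsub>dc_algebra\<^esub> (k::nat) = avg (multrow_mat n j (a ^ k))"
proof (induction k)
  case 0
  show ?case by (simp add: dc_algebra_simps torus_monom one_monom[symmetric])
next
  case (Suc k)
  then show ?case
    using assms by (simp add: avg_mult compatible_torus_right torus_torus mult.commute)
qed

lemma avg_shift_pow: "avg (shift_mat n 1) [^]\<^bsub>dc_algebra\<^esub> (k::nat) = avg (shift_mat n k)"
proof (induction k)
  case 0
  show ?case by (simp add: dc_algebra_simps shift_zero)
next
  case (Suc k)
  then have "avg (shift_mat n 1) [^]\<^bsub>dc_algebra\<^esub> Suc k = avg (shift_mat n k) \<otimes>\<^bsub>dc_algebra\<^esub> avg (shift_mat n 1)"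
    by simp
  also have "\<dots> = avg (shift_mat n k * shift_mat n 1)"
    by (intro avg_mult compatible_shift_right) simp_all
  also have "\<dots> = avg (shift_mat n (Suc k))" unfolding shift_shift by simp
  finally show ?case .
qed

lemma sw_monom_mult:
  "Suc k < n \<Longrightarrow> sw n k * monom n \<pi> \<alpha> =
    (monom n (\<lambda>i. \<pi> (transpose k (Suc k) i)) (\<lambda>i. \<alpha> (transpose k (Suc k) i)) :: 'f mat)"
  by (subst sw_monom, simp, subst monom_mult) (auto simp: transpose_less)

lemma avg_sw_monom:
  assumes "Suc k < n" "\<And>i j. i < n \<Longrightarrow> j < n \<Longrightarrow> \<alpha> i \<noteq> 0 \<Longrightarrow> \<alpha> j \<noteq> 0 \<Longrightarrow> \<pi> i = \<pi> j \<Longrightarrow> i = j"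
    "\<alpha> (Suc k) \<noteq> 0 \<Longrightarrow> \<pi> (Suc k) < n \<Longrightarrow> \<alpha> k \<noteq> 0 \<and> \<pi> k < \<pi> (Suc k)"
  shows "avg (sw n k) \<otimes>\<^bsub>dc_algebra\<^esub> avg (monom n \<pi> \<alpha>) =
    avg (monom n (\<lambda>i. \<pi> (transpose k (Suc k) i)) (\<lambda>i. \<alpha> (transpose k (Suc k) i)))"
proof -
  have "good n k (monom n \<pi> \<alpha>)" by (rule good_monom) (use assms in auto)
  moreover have "monom n \<pi> \<alpha> \<in> framed_rook_mats n" by (rule monom_rook) (use assms in auto)
  ultimately have "compatible n (sw n k) (monom n \<pi> \<alpha>)" using assms(1) by (rule compatible_good)
  then show ?thesis using assms(1) by (simp add: avg_mult sw_monom_mult)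
qed

lemma avg_sw_sw:
  assumes "Suc k < n" "Suc l < n" "k \<noteq> l"
  shows "avg (sw n k) \<otimes>\<^bsub>dc_algebra\<^esub> avg (sw n l) =
    avg (monom n (\<lambda>i. transpose l (Suc l) (transpose k (Suc k) i)) (\<lambda>_. 1))"
  unfolding sw_monom[OF assms(2)]
  by (subst avg_sw_monom[OF assms(1)]) (use assms in \<open>auto simp: transpose_def split: if_splits\<close>)

lemma finsum_dc_algebra:
  "finite I \<Longrightarrow> (\<And>i. i \<in> I \<Longrightarrow> h i \<in> carrier dc_algebra) \<Longrightarrow>
    finsum dc_algebra h I = (\<lambda>z. \<Sum>i\<in>I. h i z)"
proof (induction rule: finite_induct)
  case empty
  show ?case by (simp add: dc_algebra_simps monoid_algebra_simps)
next
  case (insert i I)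
  have "h \<in> I \<rightarrow> carrier dc_algebra" "h i \<in> carrier dc_algebra" using insert.prems by auto
  then show ?case
    using insert by (simp add: B.finsum_insert) (simp add: dc_algebra_simps monoid_algebra_simps)
qed

text \<open>Up to factors in \<open>U\<close>, the product \<open>s w s\<close> depends only on the
  entry of \<open>w\<close> at \<open>(k, k+1)\<close>, and over \<open>U\<close> this entry is
  equidistributed in the field. The value 0 gives the identity; the other values are rewritten by
  \<open>sw_ad_sw\<close>.\<close>

lemma avg_sw_square:
  assumes k: "Suc k < n"
  shows "of_nat CARD('f) \<odot>\<^bsub>dc_algebra\<^esub> (avg (sw n k) \<otimes>\<^bsub>dc_algebra\<^esub> avg (sw n k)) =
    avg (1\<^sub>m n) \<oplus>\<^bsub>dc_algebra\<^esub> finsum dc_algebra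
      (\<lambda>a. avg (multrow_mat n k (- 1 / a) * (multrow_mat n (Suc k) a * sw n k))) (UNIV - {0})"
proof
  fix z
  let ?s = "sw n k :: 'f mat"
  define G where "G b = avg (?s * (ad n b k * ?s)) z" for b
  let ?U = "U n :: 'f mat set"
  have cU: "(of_nat (card ?U) :: 'k) \<noteq> 0" using card_U_pos[of n, where 'f = 'f] by simp
  have swU: "avg (?s * w * ?s) z = G (w $$ (k, Suc k))" if w: "w \<in> ?U" for w
  proof -
    obtain w' where w': "w' \<in> ?U" "?s * w = w' * (?s * ad n (w $$ (k, Suc k)) k)"
      using U_decomp_right[OF w k] by blast
    have "?s * w * ?s = w' * (?s * (ad n (w $$ (k, Suc k)) k * ?s)) * 1\<^sub>m n"
      using w' by (simp add: mat_assoc[of _ n] mat_closed[of _ n] U_carrier right_mult_one_mat[of _ n n])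
    then have "?s * w * ?s \<in> dc n (?s * (ad n (w $$ (k, Suc k)) k * ?s))"
      by (rule dcI[OF w'(1) one_U])
    then show ?thesis unfolding G_def by (subst average_cong) (auto simp: mat_closed[of _ n])
  qed
  \<comment> \<open>Equidistribution: multiplying \<open>w\<close> by the root element with
    parameter \<open>b\<close> permutes \<open>U\<close> and adds \<open>b\<close> to the entry, so
    summing over \<open>b\<close> as well replaces the entry by a free parameter.\<close>
  have "of_nat CARD('f) * (\<Sum>w\<in>?U. G (w $$ (k, Suc k))) = (\<Sum>b\<in>(UNIV :: 'f set). \<Sum>w\<in>?U. G (w $$ (k, Suc k)))"
    by simp
  also have "\<dots> = (\<Sum>b\<in>(UNIV :: 'f set). \<Sum>w\<in>?U. G (b + w $$ (k, Suc k)))"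
  proof (rule sum.cong[OF refl])
    fix b :: 'f
    have "(\<Sum>w\<in>?U. G (w $$ (k, Suc k))) = (\<Sum>w\<in>?U. G ((ad n b k * w) $$ (k, Suc k)))"
      by (rule sum_U_left[symmetric]) (use k in \<open>auto intro: ad_U\<close>)
    also have "\<dots> = (\<Sum>w\<in>?U. G (b + w $$ (k, Suc k)))"
    proof (rule sum.cong[OF refl])
      fix w assume w: "w \<in> ?U"
      have "(ad n b k * w) $$ (k, Suc k) = b * w $$ (Suc k, Suc k) + w $$ (k, Suc k)"
        using U_carrier[OF w] k by (simp add: ad_left)
      moreover have "w $$ (Suc k, Suc k) = 1" using w k unfolding U_iff by blast
      ultimately show "G ((ad n b k * w) $$ (k, Suc k)) = G (b + w $$ (k, Suc k))" by simp
    qed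
    finally show "(\<Sum>w\<in>?U. G (w $$ (k, Suc k))) = (\<Sum>w\<in>?U. G (b + w $$ (k, Suc k)))" .
  qed
  also have "\<dots> = (\<Sum>w\<in>?U. \<Sum>b\<in>(UNIV :: 'f set). G (b + w $$ (k, Suc k)))" by (rule sum.swap)
  also have "\<dots> = (\<Sum>w\<in>?U. \<Sum>b\<in>(UNIV :: 'f set). G b)"
  proof (rule sum.cong[OF refl])
    fix w :: "'f mat"
    show "(\<Sum>b\<in>(UNIV :: 'f set). G (b + w $$ (k, Suc k))) = (\<Sum>b\<in>(UNIV :: 'f set). G b)"
      by (rule sum.reindex_bij_witness[of _ "\<lambda>b. b - w $$ (k, Suc k)" "\<lambda>b. b + w $$ (k, Suc k)"]) auto
  qed
  also have "\<dots> = of_nat (card ?U) * (G 0 + (\<Sum>a\<in>UNIV - {0}. G a))"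
    by (simp add: sum.remove[of UNIV 0])
  finally have main: "of_nat CARD('f) * (\<Sum>w\<in>?U. G (w $$ (k, Suc k))) =
    of_nat (card ?U) * (G 0 + (\<Sum>a\<in>UNIV - {0}. G a))" .
  have G0: "G 0 = avg (1\<^sub>m n) z" using k by (simp add: G_def ad_zero sw_sw)
  have Ga: "G a = avg (multrow_mat n k (- 1 / a) * (multrow_mat n (Suc k) a * ?s)) z" if a: "a \<noteq> 0" for a
  proof -
    let ?h = "multrow_mat n k (- 1 / a) * (multrow_mat n (Suc k) a * ?s)"
    have "?s * (ad n a k * ?s) = ad n (1 / a) k * ?h * ad n (1 / a) k"
      unfolding sw_ad_sw[OF a k] by (simp add: mat_assoc[of _ n] mat_closed[of _ n])
    then have "?s * (ad n a k * ?s) \<in> dc n ?h"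
      by (rule dcI[rotated 2]) (use k in \<open>auto intro: ad_U\<close>)
    then show ?thesis unfolding G_def by (subst average_cong) (auto simp: mat_closed[of _ n])
  qed
  have "(of_nat CARD('f) \<odot>\<^bsub>dc_algebra\<^esub> (avg ?s \<otimes>\<^bsub>dc_algebra\<^esub> avg ?s)) z =
      of_nat CARD('f) * ((\<Sum>w\<in>?U. avg (?s * w * ?s) z) / of_nat (card ?U))"
    by (simp add: dc_algebra_simps monoid_algebra_simps average_mult)
  also have "\<dots> = of_nat CARD('f) * (\<Sum>w\<in>?U. G (w $$ (k, Suc k))) / of_nat (card ?U)"
    using swU by simp
  also have "\<dots> = G 0 + (\<Sum>a\<in>UNIV - {0}. G a)" unfolding main using cU by simp
  also have "\<dots> = (avg (1\<^sub>m n) \<oplus>\<^bsub>dc_algebra\<^esub> finsum dc_algebra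
      (\<lambda>a. avg (multrow_mat n k (- 1 / a) * (multrow_mat n (Suc k) a * ?s))) (UNIV - {0})) z"
    by (subst finsum_dc_algebra)
      (auto simp: dc_algebra_simps monoid_algebra_simps G0 Ga mat_closed[of _ n] intro!: avg_closed sum.cong)
  finally show "(of_nat CARD('f) \<odot>\<^bsub>dc_algebra\<^esub> (avg ?s \<otimes>\<^bsub>dc_algebra\<^esub> avg ?s)) z =
    (avg (1\<^sub>m n) \<oplus>\<^bsub>dc_algebra\<^esub> finsum dc_algebra
      (\<lambda>a. avg (multrow_mat n k (- 1 / a) * (multrow_mat n (Suc k) a * ?s))) (UNIV - {0})) z" .
qed

text \<open>\<open>F_i^e E_i T_i\<close> is, up to a scalar, a sum over exponents \<open>m\<close>
  of torus elements with entries \<open>g^(e+m)\<close> and \<open>g^(-m)\<close>, each times the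
  reflection. Since \<open>g^e = -1\<close>, the substitution \<open>a = g^(-m)\<close> makes it the
  sum in \<open>avg_sw_square\<close>.\<close>

lemma quadratic:
  assumes i: "i \<in> {1..<n}"
  shows "alg_gen (GenT i) \<otimes>\<^bsub>dc_algebra\<^esub> alg_gen (GenT i) = of_nat CARD('f) \<odot>\<^bsub>dc_algebra\<^esub> \<one>\<^bsub>dc_algebra\<^esub>
    \<oplus>\<^bsub>dc_algebra\<^esub> (of_nat CARD('f) - 1) \<odot>\<^bsub>dc_algebra\<^esub> (alg_gen (GenF i) [^]\<^bsub>dc_algebra\<^esub> (((CARD('f) - 1)\<^sup>2 - (CARD('f) - 1)) div 2)
      \<otimes>\<^bsub>dc_algebra\<^esub> ry_E (CARD('f) - 1) dc_algebra (\<lambda>i. alg_gen (GenF i)) i \<otimes>\<^bsub>dc_algebra\<^esub> alg_gen (GenT i))"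
proof -
  define k where "k = i - 1"
  have k: "Suc k < n" "i = Suc k" using i by (auto simp: k_def)
  define d where "d = CARD('f) - 1"
  define e where "e = (d\<^sup>2 - d) div 2"
  let ?s = "sw n k :: 'f mat"
  let ?D = "\<lambda>a. multrow_mat n k a :: 'f mat" and ?E = "\<lambda>a. multrow_mat n (Suc k) a :: 'f mat"
  have d: "d > 0" using q_ge_2 by (simp add: d_def)
  have gd: "g ^ d = 1" using finite_field_power_card[OF g_nonzero] by (simp add: d_def)
  have ge: "g ^ e = - 1" using primitive_half[OF g odd_card d_def] by (simp add: e_def)
  define c where "c = (1 / of_nat d :: 'k)"
  \<comment> \<open>\<open>u - 1 = d\<close> cancels the denominator of \<open>E_i\<close>; the
    remaining \<open>q\<close> is the coefficient of the reflection in
    \<open>alg_gen\<close>.\<close>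
  have uc: "(of_nat CARD('f) - 1) * (c * of_nat CARD('f)) = of_nat CARD('f)"
    using q_ge_2 by (simp add: c_def d_def of_nat_diff)
  define w where "w m = ?D (g ^ (e + m)) * (?E (g ^ (d - m)) * ?s)" for m
  define v where "v m = avg (?D (g ^ m)) \<otimes>\<^bsub>dc_algebra\<^esub> avg (?E (g ^ (d - m)))" for m
  have v: "v m \<in> carrier dc_algebra" for m by (simp add: v_def)
  have wc: "w m \<in> carrier_mat n n" for m by (simp add: w_def mat_closed[of _ n])
  have summand: "avg (?D (g ^ e)) \<otimes>\<^bsub>dc_algebra\<^esub> v m \<otimes>\<^bsub>dc_algebra\<^esub> avg ?s = avg (w m)" for m
  proof -
    have "avg (?D (g ^ e)) \<otimes>\<^bsub>dc_algebra\<^esub> v m \<otimes>\<^bsub>dc_algebra\<^esub> avg ?s =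
        (avg (?D (g ^ e)) \<otimes>\<^bsub>dc_algebra\<^esub> avg (?D (g ^ m))) \<otimes>\<^bsub>dc_algebra\<^esub>
          (avg (?E (g ^ (d - m))) \<otimes>\<^bsub>dc_algebra\<^esub> avg ?s)"
      by (simp add: v_def B.m_assoc)
    also have "avg (?D (g ^ e)) \<otimes>\<^bsub>dc_algebra\<^esub> avg (?D (g ^ m)) = avg (?D (g ^ (e + m)))"
      using g_nonzero k by (subst avg_mult) (auto simp: torus_torus power_add intro: compatible_torus)
    also have "avg (?E (g ^ (d - m))) \<otimes>\<^bsub>dc_algebra\<^esub> avg ?s = avg (?E (g ^ (d - m)) * ?s)"
      using g_nonzero k by (intro avg_mult compatible_torus) auto
    also have "avg (?D (g ^ (e + m))) \<otimes>\<^bsub>dc_algebra\<^esub> avg (?E (g ^ (d - m)) * ?s) = avg (w m)"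
      unfolding w_def using g_nonzero k by (intro avg_mult compatible_torus) (auto simp: mat_closed[of _ n])
    finally show ?thesis .
  qed
  have "(of_nat CARD('f) - 1) \<odot>\<^bsub>dc_algebra\<^esub> (alg_gen (GenF i) [^]\<^bsub>dc_algebra\<^esub> e
      \<otimes>\<^bsub>dc_algebra\<^esub> ry_E d dc_algebra (\<lambda>i. alg_gen (GenF i)) i \<otimes>\<^bsub>dc_algebra\<^esub> alg_gen (GenT i)) =
      (of_nat CARD('f) - 1) \<odot>\<^bsub>dc_algebra\<^esub> (avg (?D (g ^ e)) \<otimes>\<^bsub>dc_algebra\<^esub>
        (c \<odot>\<^bsub>dc_algebra\<^esub> finsum dc_algebra v {..<d}) \<otimes>\<^bsub>dc_algebra\<^esub> (of_nat CARD('f) \<odot>\<^bsub>dc_algebra\<^esub> avg ?s))"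
    using k g_nonzero by (simp add: ry_E_def avg_torus_pow v_def[abs_def] c_def)
  also have "\<dots> = of_nat CARD('f) \<odot>\<^bsub>dc_algebra\<^esub> (avg (?D (g ^ e)) \<otimes>\<^bsub>dc_algebra\<^esub> finsum dc_algebra v {..<d}
      \<otimes>\<^bsub>dc_algebra\<^esub> avg ?s)"
    using v by (simp add: B.smult_mult_left B.smult_mult_right B.smult_smult uc)
      (simp add: uc mult.assoc mult.commute)
  also have "avg (?D (g ^ e)) \<otimes>\<^bsub>dc_algebra\<^esub> finsum dc_algebra v {..<d} \<otimes>\<^bsub>dc_algebra\<^esub> avg ?s =
      finsum dc_algebra (\<lambda>m. avg (w m)) {..<d}"
    using v by (simp add: B.finsum_rdistr B.finsum_ldistr summand)
  also have "\<dots> = finsum dc_algebra (\<lambda>a. avg (?D (- 1 / a) * (?E a * ?s))) (UNIV - {0})"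
  proof
    fix z
    have inj: "bij_betw (\<lambda>m. g ^ m) {..<d} (UNIV - {0})" using g by (simp add: primitive_def d_def)
    have "(\<Sum>m<d. avg (w m) z) = (\<Sum>m<d. avg (?D (g ^ e * g ^ m) * (?E (1 / g ^ m) * ?s)) z)"
    proof (rule sum.cong[OF refl])
      fix m assume "m \<in> {..<d}"
      then have "g ^ (d - m) = 1 / g ^ m"
        using gd g_nonzero by (simp add: power_diff)
      then show "avg (w m) z = avg (?D (g ^ e * g ^ m) * (?E (1 / g ^ m) * ?s)) z"
        by (simp add: w_def power_add)
    qed
    also have "\<dots> = (\<Sum>x\<in>UNIV - {0}. avg (?D (g ^ e * x) * (?E (1 / x) * ?s)) z)"
      by (rule sum.reindex_bij_betw[OF inj])
    also have "\<dots> = (\<Sum>a\<in>UNIV - {0}. avg (?D (- 1 / a) * (?E a * ?s)) z)"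
      by (rule sum.reindex_bij_witness[of _ "\<lambda>a. 1 / a" "\<lambda>a. 1 / a"]) (auto simp: ge)
    finally show "finsum dc_algebra (\<lambda>m. avg (w m)) {..<d} z =
        finsum dc_algebra (\<lambda>a. avg (?D (- 1 / a) * (?E a * ?s))) (UNIV - {0}) z"
      by (subst (1 2) finsum_dc_algebra) (auto simp: wc mat_closed[of _ n] intro!: avg_closed)
  qed
  finally have rhs: "(of_nat CARD('f) - 1) \<odot>\<^bsub>dc_algebra\<^esub> (alg_gen (GenF i) [^]\<^bsub>dc_algebra\<^esub> e
      \<otimes>\<^bsub>dc_algebra\<^esub> ry_E d dc_algebra (\<lambda>i. alg_gen (GenF i)) i \<otimes>\<^bsub>dc_algebra\<^esub> alg_gen (GenT i)) =
    of_nat CARD('f) \<odot>\<^bsub>dc_algebra\<^esub> finsum dc_algebra (\<lambda>a. avg (?D (- 1 / a) * (?E a * ?s))) (UNIV - {0})" .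
  have "alg_gen (GenT i) \<otimes>\<^bsub>dc_algebra\<^esub> alg_gen (GenT i) =
      of_nat CARD('f) \<odot>\<^bsub>dc_algebra\<^esub> (of_nat CARD('f) \<odot>\<^bsub>dc_algebra\<^esub> (avg ?s \<otimes>\<^bsub>dc_algebra\<^esub> avg ?s))"
    using k by (simp add: B.smult_mult_left B.smult_mult_right)
  also have "\<dots> = of_nat CARD('f) \<odot>\<^bsub>dc_algebra\<^esub> avg (1\<^sub>m n) \<oplus>\<^bsub>dc_algebra\<^esub> of_nat CARD('f) \<odot>\<^bsub>dc_algebra\<^esub>
      finsum dc_algebra (\<lambda>a. avg (?D (- 1 / a) * (?E a * ?s))) (UNIV - {0})"
    unfolding avg_sw_square[OF k(1)]
    by (rule B.smult_r_distr) (auto intro!: B.finsum_closed avg_closed simp: mat_closed[of _ n])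
  finally show ?thesis
    unfolding rhs[unfolded e_def d_def] dc_algebra_simps(5) .
qed

text \<open>Each further reflection satisfies the condition in \<open>avg_sw_monom\<close>, so the
  product stays a multiple of a single average, that of a cycle.\<close>

lemma foldr_gens:
  assumes "1 \<le> m" "m \<le> n"
  shows "foldr (\<lambda>i x. alg_gen (GenT i) \<otimes>\<^bsub>dc_algebra\<^esub> x) [m..<n] \<one>\<^bsub>dc_algebra\<^esub> =
    of_nat CARD('f) ^ (n - m) \<odot>\<^bsub>dc_algebra\<^esub>
      avg (monom n (\<lambda>i. if i = m - 1 then n - 1 else if m \<le> i then i - 1 else i) (\<lambda>_. 1))"
  using assms(2,1)
proof (induction m rule: inc_induct)
  case base
  have "monom n (\<lambda>i. if i = n - 1 then n - 1 else if n \<le> i then i - 1 else i) (\<lambda>_. 1) = (1\<^sub>m n :: 'f mat)"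
    unfolding one_monom by (rule monom_cong) auto
  then show ?case by (simp add: B.smult_one dc_algebra_simps(5))
next
  case (step m)
  let ?z = "\<lambda>m i. if i = m - 1 then n - 1 else if m \<le> i then i - 1 else i"
  have k: "Suc (m - 1) < n" "Suc (m - 1) = m" using step by auto
  have "avg (sw n (m - 1)) \<otimes>\<^bsub>dc_algebra\<^esub> avg (monom n (?z (Suc m)) (\<lambda>_. 1)) =
      avg (monom n (\<lambda>i. ?z (Suc m) (transpose (m - 1) (Suc (m - 1)) i)) (\<lambda>_. 1))"
    by (rule avg_sw_monom[OF k(1)]) (use step k in \<open>auto split: if_splits\<close>)
  also have "monom n (\<lambda>i. ?z (Suc m) (transpose (m - 1) (Suc (m - 1)) i)) (\<lambda>_. 1) =
      (monom n (?z m) (\<lambda>_. 1) :: 'f mat)"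
    by (rule monom_cong) (use step k in \<open>auto simp: transpose_def\<close>)
  finally have e: "avg (sw n (m - 1)) \<otimes>\<^bsub>dc_algebra\<^esub> avg (monom n (?z (Suc m)) (\<lambda>_. 1)) =
      avg (monom n (?z m) (\<lambda>_. 1))" .
  have "[m..<n] = m # [Suc m..<n]" using step by (simp add: upt_conv_Cons)
  then have "foldr (\<lambda>i x. alg_gen (GenT i) \<otimes>\<^bsub>dc_algebra\<^esub> x) [m..<n] \<one>\<^bsub>dc_algebra\<^esub> =
      alg_gen (GenT m) \<otimes>\<^bsub>dc_algebra\<^esub> (of_nat CARD('f) ^ (n - Suc m) \<odot>\<^bsub>dc_algebra\<^esub> avg (monom n (?z (Suc m)) (\<lambda>_. 1)))"
    using step by simp
  also have "\<dots> = (of_nat CARD('f) * of_nat CARD('f) ^ (n - Suc m)) \<odot>\<^bsub>dc_algebra\<^esub> avg (monom n (?z m) (\<lambda>_. 1))"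
    using e by (simp add: B.smult_mult_left B.smult_mult_right B.smult_smult mult.commute)
  also have "of_nat CARD('f) * of_nat CARD('f) ^ (n - Suc m) = (of_nat CARD('f) :: 'k) ^ (n - m)"
    using step by (metis Suc_diff_Suc power_Suc)
  finally show ?case .
qed

text \<open>Apart from the quadratic relation, each side is a power of \<open>q\<close> times one
  average, because the products that occur are compatible. What is left is an identity of monomial
  matrices.\<close>

theorem relations:
  assumes "(X, Y) \<in> ry_relations (CARD('f) - 1) n (of_nat CARD('f)) dc_algebra
    (\<lambda>i. alg_gen (GenT i)) (\<lambda>i. alg_gen (GenF i)) (alg_gen GenN)"
  shows "X = Y"
  using assms
proof (cases rule: ry_relations.cases)
  case (braid i j)
  define k l where "k = i - 1" and "l = j - 1"
  have kl: "Suc k < n" "Suc l < n" "k = Suc l \<or> l = Suc k" "i = Suc k" "j = Suc l"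
    using braid by (auto simp: k_def l_def)
  have e: "avg (sw n k) \<otimes>\<^bsub>dc_algebra\<^esub> (avg (sw n l) \<otimes>\<^bsub>dc_algebra\<^esub> avg (sw n k)) =
      avg (monom n (\<lambda>i. transpose k (Suc k) (transpose l (Suc l) (transpose k (Suc k) i))) (\<lambda>_. 1))"
    if "Suc k < n" "Suc l < n" "k = Suc l \<or> l = Suc k" for k l
    by (subst avg_sw_sw, (use that in auto)[3], subst avg_sw_monom[OF that(1)])
      (use that in \<open>auto simp: transpose_eq_iff transpose_def split: if_splits\<close>)
  have "monom n (\<lambda>i. transpose k (Suc k) (transpose l (Suc l) (transpose k (Suc k) i))) (\<lambda>_. 1) =
      (monom n (\<lambda>i. transpose l (Suc l) (transpose k (Suc k) (transpose l (Suc l) i))) (\<lambda>_. 1) :: 'f mat)"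
    by (rule monom_cong) (use kl(3) in \<open>auto simp: transpose_def\<close>)
  then have "avg (sw n k) \<otimes>\<^bsub>dc_algebra\<^esub> (avg (sw n l) \<otimes>\<^bsub>dc_algebra\<^esub> avg (sw n k)) =
      avg (sw n l) \<otimes>\<^bsub>dc_algebra\<^esub> (avg (sw n k) \<otimes>\<^bsub>dc_algebra\<^esub> avg (sw n l))"
    using e[of k l] e[of l k] kl by auto
  then show ?thesis
    using braid(1,2) kl by (simp add: B.smult_mult_left B.smult_mult_right B.m_assoc)
next
  case (T_comm i j)
  define k l where "k = i - 1" and "l = j - 1"
  have kl: "Suc k < n" "Suc l < n" "Suc k < l \<or> Suc l < k" "i = Suc k" "j = Suc l"
    using T_comm by (auto simp: k_def l_def)
  have "monom n (\<lambda>i. transpose l (Suc l) (transpose k (Suc k) i)) (\<lambda>_. 1) =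
      (monom n (\<lambda>i. transpose k (Suc k) (transpose l (Suc l) i)) (\<lambda>_. 1) :: 'f mat)"
    by (rule monom_cong) (use kl(3) in \<open>auto simp: transpose_def\<close>)
  then have "avg (sw n k) \<otimes>\<^bsub>dc_algebra\<^esub> avg (sw n l) = avg (sw n l) \<otimes>\<^bsub>dc_algebra\<^esub> avg (sw n k)"
    using avg_sw_sw[of k l] avg_sw_sw[of l k] kl by auto
  then show ?thesis
    using T_comm(1,2) kl by (simp add: B.smult_mult_left B.smult_mult_right)
next
  case (F_pow i)
  then have "i - 1 < n" by auto
  moreover have "multrow_mat n (i - 1) 1 = (1\<^sub>m n :: 'f mat)" by (rule eq_matI) auto
  ultimately show ?thesis
    using F_pow avg_torus_pow[OF g_nonzero, of "i - 1" "CARD('f) - 1"]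
    by (simp add: dc_algebra_simps(5) finite_field_power_card[OF g_nonzero] del: One_nat_def)
next
  case (F_comm i j)
  have "multrow_mat n (i - 1) g * multrow_mat n (j - 1) g =
      multrow_mat n (j - 1) g * (multrow_mat n (i - 1) g :: 'f mat)"
    unfolding torus_monom by (subst (1 2) monom_mult) (auto intro!: monom_cong)
  then show ?thesis
    using F_comm g_nonzero by (subst F_comm(1), subst F_comm(2)) (auto simp: avg_mult compatible_torus)
next
  case (T_quadratic i)
  then show ?thesis using quadratic[of i] by simp
next
  case (T_F i j)
  define k where "k = i - 1"
  have k: "Suc k < n" "i = Suc k" using T_F by (auto simp: k_def)
  define j' where "j' = transpose i (i + 1) j - 1"
  have j: "j - 1 < n" "j' < n" using T_F by (auto simp: j'_def transpose_def)
  have "sw n k * multrow_mat n (j - 1) g = (multrow_mat n j' g * sw n k :: 'f mat)"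
    unfolding torus_monom sw_monom[OF k(1)]
    by (subst (1 2) monom_mult)
      (use T_F(4) k in \<open>auto intro!: monom_cong simp: transpose_less j'_def transpose_def\<close>)
  then have "avg (sw n k) \<otimes>\<^bsub>dc_algebra\<^esub> avg (multrow_mat n (j - 1) g) =
      avg (multrow_mat n j' g) \<otimes>\<^bsub>dc_algebra\<^esub> avg (sw n k)"
    using j g_nonzero by (simp add: avg_mult compatible_torus compatible_torus_right)
  then show ?thesis
    using T_F(1,2) k by (simp add: B.smult_mult_left B.smult_mult_right j'_def)
next
  case (F_N i)
  have "multrow_mat n (i - 1) g * shift_mat n 1 = (shift_mat n 1 * multrow_mat n i g :: 'f mat)"
    unfolding torus_monom shift_monom
    by (subst (1 2) monom_mult) (use F_N in \<open>auto intro!: monom_cong split: if_splits\<close>)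
  moreover have "compatible n (multrow_mat n (i - 1) g) (shift_mat n 1 :: 'f mat)"
    using F_N g_nonzero by (intro compatible_torus) auto
  ultimately show ?thesis
    using F_N compatible_shift[of "multrow_mat n i g" n] by (simp add: avg_mult)
next
  case N_F1
  have "shift_mat n 1 * multrow_mat n 0 g = (shift_mat n 1 :: 'f mat)"
    unfolding torus_monom shift_monom
    by (subst monom_mult) (auto intro!: monom_cong split: if_splits)
  then show ?thesis
    using N_F1 compatible_shift[of "multrow_mat n 0 g" n] by (simp add: avg_mult)
next
  case Fn_N
  have "multrow_mat n (n - 1) g * shift_mat n 1 = (shift_mat n 1 :: 'f mat)"
    unfolding torus_monom shift_monom
    by (subst monom_mult) (auto intro!: monom_cong split: if_splits)
  moreover have "compatible n (multrow_mat n (n - 1) g) (shift_mat n 1 :: 'f mat)"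
    using n g_nonzero by (intro compatible_torus) auto
  ultimately show ?thesis using Fn_N by (simp add: avg_mult)
next
  case (Npow_T i)
  define k where "k = i - 1"
  have k: "Suc k < n" "i = Suc k" using Npow_T by (auto simp: k_def)
  \<comment> \<open>Columns \<open>k\<close> and \<open>k + 1\<close> of \<open>N^(i+1)\<close>
    vanish, so the exchange changes nothing and the condition for compatibility is vacuous. The
    factor \<open>u\<close> is the coefficient of the reflection.\<close>
  have "shift_mat n (i + 1) * sw n k = (shift_mat n (i + 1) :: 'f mat)"
    unfolding sw_monom[OF k(1)] shift_monom
    by (subst monom_mult) (use k in \<open>auto intro!: monom_cong split: if_splits simp: transpose_def\<close>)
  moreover have "compatible n (shift_mat n (i + 1) :: 'f mat) (sw n k)"
    by (rule compatible_good_right[OF _ shift_rook k(1)])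
      (use k in \<open>auto simp: shift_monom intro!: good_right_monom\<close>)
  ultimately have "avg (shift_mat n (i + 1)) \<otimes>\<^bsub>dc_algebra\<^esub> avg (sw n k) = avg (shift_mat n (i + 1))"
    by (simp add: avg_mult)
  then show ?thesis
    using Npow_T(1,2) k avg_shift_pow[of "i + 1"] by (simp add: B.smult_mult_right del: B.nat_pow_Suc)
next
  case (T_Npow i)
  define k where "k = i - 1"
  have k: "Suc k < n" "i = Suc k" using T_Npow by (auto simp: k_def)
  \<comment> \<open>The same with rows: \<open>k\<close> and \<open>k + 1\<close> are zero rows of
    \<open>N^(n-i+1)\<close>.\<close>
  have "sw n k * shift_mat n (n - i + 1) = (shift_mat n (n - i + 1) :: 'f mat)"
    unfolding shift_monom sw_monom_mult[OF k(1)]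
    by (rule monom_cong) (use k in \<open>auto simp: transpose_def\<close>)
  moreover have "compatible n (sw n k) (shift_mat n (n - i + 1) :: 'f mat)"
    by (rule compatible_good[OF _ shift_rook k(1)])
      (use k in \<open>auto simp: shift_monom intro!: good_monom\<close>)
  ultimately have "avg (sw n k) \<otimes>\<^bsub>dc_algebra\<^esub> avg (shift_mat n (n - i + 1)) = avg (shift_mat n (n - i + 1))"
    by (simp add: avg_mult)
  then show ?thesis
    using T_Npow(1,2) k avg_shift_pow[of "n - i + 1"] by (simp add: B.smult_mult_left del: B.nat_pow_Suc)
next
  case (T_N i)
  define k where "k = i - 1"
  have k: "Suc k < n" "Suc (Suc k) < n" "i = Suc k" using T_N by (auto simp: k_def)
  have "sw n k * shift_mat n 1 = (shift_mat n 1 * sw n (Suc k) :: 'f mat)"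
    unfolding shift_monom sw_monom_mult[OF k(1)] sw_monom[OF k(2)]
    by (subst monom_mult) (use k in \<open>auto intro!: monom_cong split: if_splits simp: transpose_def\<close>)
  moreover have "compatible n (sw n k) (shift_mat n 1 :: 'f mat)"
    by (rule compatible_shift_right) simp
  moreover have "compatible n (shift_mat n 1) (sw n (Suc k) :: 'f mat)"
    by (rule compatible_shift) simp
  ultimately have "avg (sw n k) \<otimes>\<^bsub>dc_algebra\<^esub> avg (shift_mat n 1) =
      avg (shift_mat n 1) \<otimes>\<^bsub>dc_algebra\<^esub> avg (sw n (Suc k))"
    by (simp add: avg_mult)
  then show ?thesis using T_N(1,2) k by (simp add: B.smult_mult_left B.smult_mult_right)
next
  case N_T_N
  \<comment> \<open>\<open>N\<close> shifts by one, the cycle undoes the shift and the second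
    \<open>N\<close> shifts again; the row of the cycle that wraps around is never reached behind an
    \<open>N\<close>.\<close>
  let ?c = "monom n (\<lambda>i. if i = 0 then n - 1 else if 1 \<le> i then i - 1 else i) (\<lambda>_. 1) :: 'f mat"
  have f: "foldr (\<lambda>i x. alg_gen (GenT i) \<otimes>\<^bsub>dc_algebra\<^esub> x) [1..<n] \<one>\<^bsub>dc_algebra\<^esub> =
      of_nat CARD('f) ^ (n - 1) \<odot>\<^bsub>dc_algebra\<^esub> avg ?c"
    using foldr_gens[of 1] n by simp
  have "avg (shift_mat n 1) \<otimes>\<^bsub>dc_algebra\<^esub> avg ?c = avg (shift_mat n 1 * ?c)"
    by (intro avg_mult compatible_shift) auto
  moreover have "avg (shift_mat n 1 * ?c) \<otimes>\<^bsub>dc_algebra\<^esub> avg (shift_mat n 1) =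
      avg (shift_mat n 1 * ?c * shift_mat n 1)"
    by (intro avg_mult compatible_shift_right) (auto simp: mat_closed[of _ n])
  moreover have "shift_mat n 1 * ?c * shift_mat n 1 = shift_mat n 1"
    unfolding shift_monom
    by (subst monom_mult, (simp split: if_splits; fail), subst monom_mult)
      (use n in \<open>auto intro!: monom_cong split: if_splits\<close>)
  ultimately have "avg (shift_mat n 1) \<otimes>\<^bsub>dc_algebra\<^esub> avg ?c \<otimes>\<^bsub>dc_algebra\<^esub> avg (shift_mat n 1) =
      avg (shift_mat n 1)"
    by simp
  then show ?thesis
    unfolding N_T_N f by (simp add: B.smult_mult_left B.smult_mult_right)
qed

end

section \<open>Normal words as names of rook matrices, and their values\<close>

section \<open>Normal words and rook matrices\<close>

text \<open>The row permutation of \<open>run m a\<close>; matrix indices start at \<open>0\<close>, generator indices at \<open>1\<close>.\<close>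

definition run_perm :: "nat \<Rightarrow> nat \<Rightarrow> nat \<Rightarrow> nat" where
  "run_perm m a i = (if i = m - 1 then a - 1 else if a - 1 \<le> i \<and> i < m - 1 then i + 1 else i)"

lemma run_perm_bij:
  assumes "1 \<le> a" "a \<le> m" "m \<le> n"
  shows "bij_betw (run_perm m a) {..<n} {..<n}"
  by (rule bij_betw_byWitness[where f' = "\<lambda>i. if i = a - 1 then m - 1 else if a \<le> i \<and> i < m then i - 1 else i"])
    (use assms in \<open>auto simp: run_perm_def\<close>)

context framed_rook
begin

fun mat_gen :: "ry_gen \<Rightarrow> 'f mat" where
  "mat_gen (GenT i) = sw n (i - 1)"
| "mat_gen (GenF i) = multrow_mat n (i - 1) g"
| "mat_gen GenN = shift_mat n 1"

definition word_mat :: "ry_gen list \<Rightarrow> 'f mat" where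
  "word_mat w = word_eval (ring_mat TYPE('f) n ()) mat_gen w"

lemma mat_gen_carrier [simp]: "mat_gen x \<in> carrier_mat n n"
  by (cases x) auto

lemma word_mat_Nil [simp]: "word_mat [] = 1\<^sub>m n"
  and word_mat_Cons: "word_mat (x # w) = mat_gen x * word_mat w"
  by (simp_all add: word_mat_def ring_mat_simps)

lemma word_mat_carrier [simp]: "word_mat w \<in> carrier_mat n n"
  by (induction w) (auto simp: word_mat_Cons mat_closed[of _ n])

lemma word_mat_dim [simp]: "dim_row (word_mat w) = n" "dim_col (word_mat w) = n"
  by (rule carrier_matD[OF word_mat_carrier])+

lemma word_mat_append: "word_mat (v @ w) = word_mat v * word_mat w"
  by (induction v) (auto simp: word_mat_Cons mat_assoc[of _ n] left_mult_one_mat[of _ n n])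

lemma word_mat_N: "word_mat (replicate k GenN) = shift_mat n k"
proof (induction k)
  case (Suc k)
  then have "word_mat (replicate (Suc k) GenN) = shift_mat n 1 * shift_mat n k"
    by (simp add: word_mat_Cons)
  then show ?case unfolding shift_shift by simp
qed (simp add: shift_zero)

lemma word_mat_F: "word_mat (replicate b (GenF j)) = multrow_mat n (j - 1) (g ^ b)"
proof (induction b)
  case 0
  show ?case by (simp add: torus_monom one_monom[symmetric])
qed (simp add: word_mat_Cons torus_torus)

lemma word_mat_run:
  "1 \<le> a \<Longrightarrow> a \<le> m \<Longrightarrow> m \<le> n \<Longrightarrow> word_mat (run m a) = monom n (run_perm m a) (\<lambda>_. 1)"
proof (induction m)
  case (Suc m)
  show ?case
  proof (cases "a = Suc m")
    case True
    then show ?thesis unfolding one_monom[of n] by (simp add: one_monom run_perm_def cong: if_cong)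
      (rule monom_cong, auto)
  next
    case False
    then have k: "Suc (m - 1) < n" "Suc (m - 1) = m" "a \<le> m" using Suc.prems by auto
    have "word_mat (run (Suc m) a) = sw n (m - 1) * monom n (run_perm m a) (\<lambda>_. 1)"
      using Suc False by (simp add: run_Suc word_mat_Cons)
    also have "\<dots> = monom n (run_perm (Suc m) a) (\<lambda>_. 1)"
      unfolding sw_monom_mult[OF k(1)]
      by (rule monom_cong) (use k Suc.prems in \<open>auto simp: run_perm_def transpose_def\<close>)
    finally show ?thesis .
  qed
qed simp

lemma run_index:
  assumes "1 \<le> a" "a \<le> m" "m \<le> n" "A \<in> carrier_mat n n" "i < n" "j < n"
  shows "(word_mat (run m a) * A) $$ (i, j) = A $$ (run_perm m a i, j)"
proof -
  have "run_perm m a i < n" using assms by (auto simp: run_perm_def)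
  then show ?thesis using assms by (simp add: word_mat_run monom_mult_index)
qed

lemma word_mat_T:
  assumes "set l \<subseteq> GenT ` {1..<m}" "m \<le> n"
  shows "\<exists>\<pi>. bij_betw \<pi> {..<n} {..<n} \<and> (\<forall>i\<ge>m. \<pi> i = i) \<and>
    (\<forall>A\<in>carrier_mat n n. \<forall>i<n. \<forall>j<n. (word_mat l * A) $$ (i, j) = A $$ (\<pi> i, j))"
  using assms(1)
proof (induction l)
  case Nil
  show ?case
    by (rule exI[of _ id], intro conjI bij_betw_id) (auto simp: left_mult_one_mat[of _ n n])
next
  case (Cons x l)
  then obtain \<pi> where \<pi>: "bij_betw \<pi> {..<n} {..<n}" "\<forall>i\<ge>m. \<pi> i = i"
    "\<forall>A\<in>carrier_mat n n. \<forall>i<n. \<forall>j<n. (word_mat l * A) $$ (i, j) = A $$ (\<pi> i, j)" by auto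
  from Cons.prems obtain k where k: "x = GenT (Suc k)" "Suc k < m"
    by (auto simp: image_iff) (metis Suc_le_D)
  have kn: "Suc k < n" using k assms(2) by simp
  have "bij_betw (transpose k (Suc k)) {..<n} {..<n}"
    by (rule bij_betw_byWitness[where f' = "transpose k (Suc k)"]) (use kn in \<open>auto simp: transpose_less\<close>)
  then have "bij_betw (\<pi> \<circ> transpose k (Suc k)) {..<n} {..<n}" using \<pi>(1) by (rule bij_betw_trans)
  moreover have "\<forall>i\<ge>m. (\<pi> \<circ> transpose k (Suc k)) i = i" using \<pi>(2) k by (auto simp: transpose_def)
  moreover have "(word_mat (x # l) * A) $$ (i, j) = A $$ ((\<pi> \<circ> transpose k (Suc k)) i, j)"
    if "A \<in> carrier_mat n n" "i < n" "j < n" for A i j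
  proof -
    have "(word_mat (x # l) * A) $$ (i, j) = (sw n k * (word_mat l * A)) $$ (i, j)"
      using that k by (simp add: word_mat_Cons mat_assoc[of _ n])
    also have "\<dots> = (word_mat l * A) $$ (transpose k (Suc k) i, j)"
      unfolding sw_monom[OF kn] using that transpose_less[OF kn]
      by (subst monom_mult_index) (auto simp: mat_closed[of _ n])
    finally show ?thesis using \<pi>(3) that transpose_less[OF kn] by simp
  qed
  ultimately show ?case by blast
qed

section \<open>The left word and the set of nonzero rows\<close>

subsection \<open>Left factors\<close>

text \<open>A stage in sorting the rows: among the first \<open>m\<close> the nonzero ones stand
  first, while the rows from \<open>m\<close> on are still untouched.\<close>

definition rows_ok :: "nat \<Rightarrow> nat \<Rightarrow> 'f mat \<Rightarrow> bool" where
  "rows_ok m r A \<longleftrightarrow> A \<in> carrier_mat n n \<and> (\<forall>i<r. \<exists>c<n. A $$ (i, c) \<noteq> 0) \<and>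
    (\<forall>i. r \<le> i \<longrightarrow> i < m \<longrightarrow> (\<forall>c<n. A $$ (i, c) = 0))"

lemma left_word_row:
  assumes "l \<in> left_words m r" "m \<le> n" "A \<in> carrier_mat n n" "m \<le> i" "i < n" "j < n"
  shows "(word_mat l * A) $$ (i, j) = A $$ (i, j)"
proof -
  obtain \<pi> where "\<forall>i\<ge>m. \<pi> i = i"
    "\<forall>A\<in>carrier_mat n n. \<forall>i<n. \<forall>j<n. (word_mat l * A) $$ (i, j) = A $$ (\<pi> i, j)"
    using word_mat_T[OF set_left_words[OF assms(1)] assms(2)] by blast
  then show ?thesis using assms by simp
qed

lemma rows_ok_run:
  assumes "rows_ok (Suc m) (Suc r) A" "Suc m \<le> n" "r \<le> m"
  shows "rows_ok m r (word_mat (run (Suc m) (Suc r)) * A)"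
    and "\<exists>c<n. (word_mat (run (Suc m) (Suc r)) * A) $$ (m, c) \<noteq> 0"
proof -
  have A: "A \<in> carrier_mat n n" "\<forall>i<Suc r. \<exists>c<n. A $$ (i, c) \<noteq> 0"
    "\<forall>i. Suc r \<le> i \<longrightarrow> i < Suc m \<longrightarrow> (\<forall>c<n. A $$ (i, c) = 0)"
    using assms(1) unfolding rows_ok_def by blast+
  have idx: "(word_mat (run (Suc m) (Suc r)) * A) $$ (i, j) = A $$ (run_perm (Suc m) (Suc r) i, j)"
    if "i < n" "j < n" for i j
    using run_index[of "Suc r" "Suc m" A i j] assms A(1) that by simp
  show "rows_ok m r (word_mat (run (Suc m) (Suc r)) * A)"
    unfolding rows_ok_def
  proof (intro conjI allI impI)
    fix i assume i: "i < r"
    then have "run_perm (Suc m) (Suc r) i = i" using assms(3) by (simp add: run_perm_def)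
    then show "\<exists>c<n. (word_mat (run (Suc m) (Suc r)) * A) $$ (i, c) \<noteq> 0"
      using A(2)[rule_format, of i] i idx assms by auto
  next
    fix i c assume i: "r \<le> i" "i < m" "c < n"
    then have "run_perm (Suc m) (Suc r) i = Suc i" by (simp add: run_perm_def)
    then show "(word_mat (run (Suc m) (Suc r)) * A) $$ (i, c) = 0"
      using A(3) i idx assms(2) by simp
  qed (simp add: A(1) mat_closed[of _ n])
  have "run_perm (Suc m) (Suc r) m = r" by (simp add: run_perm_def)
  then show "\<exists>c<n. (word_mat (run (Suc m) (Suc r)) * A) $$ (m, c) \<noteq> 0"
    using A(2)[rule_format, of r] idx assms(2) by auto
qed

text \<open>Row \<open>m\<close> of the product is nonzero exactly when the word ends with a run of
  level \<open>m + 1\<close>. The matrix therefore determines the last run, and removing it leads to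
  level \<open>m\<close>.\<close>

lemma left_words_unique:
  assumes "l \<in> left_words m r" "l' \<in> left_words m r'" "m \<le> n" "rows_ok m r A" "rows_ok m r' A'"
    and "word_mat l * A = word_mat l' * A'"
  shows "r = r' \<and> l = l' \<and> A = A'"
  using assms
proof (induction m arbitrary: r r' l l' A A')
  case 0
  then have "r = 0" "r' = 0" "l = []" "l' = []" by (cases r; cases r'; auto)+
  then show ?case using 0 by (simp add: rows_ok_def left_mult_one_mat[of _ n n])
next
  case (Suc m)
  have m: "m < n" using Suc.prems(3) by simp
  have weak: "rows_ok m r A" if "rows_ok (Suc m) r A" for r A using that by (auto simp: rows_ok_def)
  have zero: "\<forall>c<n. (word_mat l * A) $$ (m, c) = 0"
    if "l \<in> left_words m r" "rows_ok (Suc m) r A" for l r A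
    using left_word_row[OF that(1) _ _ order_refl m] that left_words_le[OF that(1)] m
    by (auto simp: rows_ok_def)
  have nonzero: "\<exists>c<n. (word_mat l * A) $$ (m, c) \<noteq> 0"
    if "l = l0 @ run (Suc m) (Suc r0)" "l0 \<in> left_words m r0" "rows_ok (Suc m) (Suc r0) A" for l l0 r0 A
  proof -
    have c: "A \<in> carrier_mat n n" using that(3) by (simp add: rows_ok_def)
    have "word_mat l * A = word_mat l0 * (word_mat (run (Suc m) (Suc r0)) * A)"
      using c by (simp add: that(1) word_mat_append mat_assoc[of _ n])
    then show ?thesis
      using rows_ok_run(2)[OF that(3)] left_words_le[OF that(2)] m c
        left_word_row[OF that(2) _ _ order_refl m, of "word_mat (run (Suc m) (Suc r0)) * A"]
      by (auto simp: mat_closed[of _ n])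
  qed
  from Suc.prems(1) consider (a) "l \<in> left_words m r"
    | (b) r0 l0 where "r = Suc r0" "l0 \<in> left_words m r0" "l = l0 @ run (Suc m) (Suc r0)"
    unfolding left_words_Suc by blast
  then show ?case
  proof cases
    case a
    have z: "\<forall>c<n. (word_mat l * A) $$ (m, c) = 0" using zero[OF a] Suc.prems by blast
    from Suc.prems(2) consider (a') "l' \<in> left_words m r'"
      | (b') r1 l1 where "r' = Suc r1" "l1 \<in> left_words m r1" "l' = l1 @ run (Suc m) (Suc r1)"
      unfolding left_words_Suc by blast
    then show ?thesis
    proof cases
      case a'
      then show ?thesis
        using m by (intro Suc.IH[OF a a' _ weak[OF Suc.prems(4)] weak[OF Suc.prems(5)] Suc.prems(6)]) simp
    next
      case (b' r1 l1)
      then show ?thesis using nonzero[OF b'(3,2)] z Suc.prems by auto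
    qed
  next
    case (b r0 l0)
    obtain c where nz: "c < n" "(word_mat l * A) $$ (m, c) \<noteq> 0" using nonzero[OF b(3,2)] Suc.prems b(1) by blast
    from Suc.prems(2) consider (a') "l' \<in> left_words m r'"
      | (b') r1 l1 where "r' = Suc r1" "l1 \<in> left_words m r1" "l' = l1 @ run (Suc m) (Suc r1)"
      unfolding left_words_Suc by blast
    then show ?thesis
    proof cases
      case a'
      then show ?thesis using zero[OF a'] nz Suc.prems by auto
    next
      case (b' r1 l1)
      have c: "A \<in> carrier_mat n n" "A' \<in> carrier_mat n n" using Suc.prems by (auto simp: rows_ok_def)
      note le = left_words_le[OF b(2)] left_words_le[OF b'(2)]
      have ok: "rows_ok (Suc m) (Suc r0) A" "rows_ok (Suc m) (Suc r1) A'" using Suc.prems b(1) b'(1) by auto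
      have "word_mat l0 * (word_mat (run (Suc m) (Suc r0)) * A) = word_mat l1 * (word_mat (run (Suc m) (Suc r1)) * A')"
        using Suc.prems(6) c by (simp add: b(3) b'(3) word_mat_append mat_assoc[of _ n])
      then have IH: "r0 = r1 \<and> l0 = l1 \<and>
          word_mat (run (Suc m) (Suc r0)) * A = word_mat (run (Suc m) (Suc r1)) * A'"
        using rows_ok_run(1)[OF ok(1)] rows_ok_run(1)[OF ok(2)] le m
        by (intro Suc.IH[OF b(2) b'(2)]) auto
      have "A = A'"
      proof (rule eq_matI)
        fix i j assume "i < dim_row A'" "j < dim_col A'"
        then have ij: "i < n" "j < n" using c by auto
        have "i \<in> run_perm (Suc m) (Suc r0) ` {..<n}"
          using run_perm_bij[of "Suc r0" "Suc m" n] le(1) m ij(1) by (simp add: bij_betw_def)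
        then obtain i' where i': "i' < n" "i = run_perm (Suc m) (Suc r0) i'" by auto
        have "word_mat (run (Suc m) (Suc r0)) * A = word_mat (run (Suc m) (Suc r0)) * A'"
          using IH by metis
        then have "(word_mat (run (Suc m) (Suc r0)) * A) $$ (i', j) = (word_mat (run (Suc m) (Suc r0)) * A') $$ (i', j)"
          by (rule arg_cong)
        then show "A $$ (i, j) = A' $$ (i, j)"
          using run_index[of "Suc r0" "Suc m" A i' j] run_index[of "Suc r0" "Suc m" A' i' j] c le m i' ij by simp
      qed (use c in auto)
      then show ?thesis using IH b b' by simp
    qed
  qed
qed

text \<open>Sorting by insertion: a nonzero row at position \<open>m\<close> is carried up to
  position \<open>r\<close>, and the run records the move.\<close>

lemma left_words_exist:
  assumes "m \<le> n" "A \<in> carrier_mat n n"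
  shows "\<exists>r l B. l \<in> left_words m r \<and> rows_ok m r B \<and> A = word_mat l * B"
  using assms(1)
proof (induction m)
  case 0
  show ?case
    by (rule exI[of _ 0], rule exI[of _ "[]"], rule exI[of _ A])
      (use assms(2) in \<open>auto simp: rows_ok_def left_mult_one_mat[of _ n n]\<close>)
next
  case (Suc m)
  then have m: "m < n" by simp
  obtain r l B where B: "l \<in> left_words m r" "rows_ok m r B" "A = word_mat l * B"
    using Suc by auto
  have c: "B \<in> carrier_mat n n" using B(2) by (simp add: rows_ok_def)
  have r: "r \<le> m" using left_words_le[OF B(1)] .
  show ?case
  proof (cases "\<forall>c<n. B $$ (m, c) = 0")
    case True
    then have "rows_ok (Suc m) r B" using B(2) by (auto simp: rows_ok_def less_Suc_eq)
    moreover have "l \<in> left_words (Suc m) r" using B(1) left_words_mono by blast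
    ultimately show ?thesis using B(3) by blast
  next
    case False
    \<comment> \<open>The inverse of the row permutation of the run.\<close>
    define \<rho> where "\<rho> i = (if i = r then m else if r < i \<and> i < Suc m then i - 1 else i)" for i
    define C where "C = mat n n (\<lambda>(i, j). B $$ (\<rho> i, j))"
    have C: "C \<in> carrier_mat n n" by (simp add: C_def)
    have \<rho>: "\<rho> (run_perm (Suc m) (Suc r) i) = i" for i using r by (auto simp: \<rho>_def run_perm_def)
    have lt: "run_perm (Suc m) (Suc r) i < n" if "i < n" for i using that m r by (auto simp: run_perm_def)
    have "word_mat (run (Suc m) (Suc r)) * C = B"
    proof (rule eq_matI)
      fix i j assume "i < dim_row B" "j < dim_col B"
      then have ij: "i < n" "j < n" using c by auto
      then show "(word_mat (run (Suc m) (Suc r)) * C) $$ (i, j) = B $$ (i, j)"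
        using run_index[of "Suc r" "Suc m" C i j] r m C lt[OF ij(1)] by (simp add: C_def \<rho>)
    qed (use c C in auto)
    then have "A = word_mat (l @ run (Suc m) (Suc r)) * C"
      using B(3) C by (simp add: word_mat_append mat_assoc[of _ n])
    moreover have "rows_ok (Suc m) (Suc r) C"
      unfolding rows_ok_def
    proof (intro conjI allI impI)
      fix i assume "i < Suc r"
      then have "\<rho> i = (if i = r then m else i)" "i < n" using m r by (auto simp: \<rho>_def)
      moreover from this have "\<exists>c<n. B $$ (\<rho> i, c) \<noteq> 0"
        using False B(2) \<open>i < Suc r\<close> by (cases "i = r") (auto simp: rows_ok_def)
      ultimately show "\<exists>c<n. C $$ (i, c) \<noteq> 0" by (auto simp: C_def)
    next
      fix i c assume "Suc r \<le> i" "i < Suc m" "c < n"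
      then show "C $$ (i, c) = 0" using B(2) m by (auto simp: C_def \<rho>_def rows_ok_def)
    qed (rule C)
    moreover have "l @ run (Suc m) (Suc r) \<in> left_words (Suc m) (Suc r)" using B(1) by simp
    ultimately show ?thesis by blast
  qed
qed

section \<open>The right word and the columns and weights of the nonzero rows\<close>

subsection \<open>Right factors\<close>

text \<open>The matrices reached from \<open>N^k\<close> after \<open>j\<close> moves of columns:
  the rows from \<open>j\<close> on have not been touched yet. For \<open>j = n - k\<close> every
  nonzero row has been.\<close>

definition right_mats :: "nat \<Rightarrow> nat \<Rightarrow> 'f mat set" where
  "right_mats k j = {monom n \<pi> \<alpha> | \<pi> \<alpha>. (\<forall>i<j. \<pi> i < k + j \<and> \<alpha> i \<noteq> 0) \<and> inj_on \<pi> {..<j} \<and>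
    (\<forall>i. j \<le> i \<longrightarrow> i < n - k \<longrightarrow> \<pi> i = i + k \<and> \<alpha> i = 1) \<and> (\<forall>i\<ge>n - k. \<alpha> i = 0)}"

text \<open>At this stage column \<open>k + j\<close> is met by row \<open>j\<close> alone, so the
  torus factor changes a single weight, and the run then carries that column to position
  \<open>a - 1\<close>.\<close>

lemma right_step:
  assumes "1 \<le> a" "a \<le> Suc (k + j)" "Suc (k + j) \<le> n"
    and "\<forall>i<j. \<pi> i < k + j \<and> \<alpha> i \<noteq> 0"
    and "\<forall>i. j \<le> i \<longrightarrow> i < n - k \<longrightarrow> \<pi> i = i + k \<and> \<alpha> i = 1" and "\<forall>i\<ge>n - k. \<alpha> i = 0"
  shows "monom n \<pi> \<alpha> * multrow_mat n (k + j) c = monom n \<pi> (\<alpha>(j := c))"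
    and "monom n \<pi> (\<alpha>(j := c)) * word_mat (run (Suc (k + j)) a) =
      monom n (\<lambda>i. run_perm (Suc (k + j)) a (\<pi> i)) (\<alpha>(j := c))"
proof -
  have lt: "\<pi> i < n" if "i < n" "\<alpha> i \<noteq> 0 \<or> i = j" for i
    using assms that by (cases "i < j"; cases "i < n - k") force+
  have j: "\<pi> j = k + j" "\<alpha> j = 1" "j < n - k" using assms by auto
  have ne: "\<pi> i \<noteq> k + j" if "i < n" "\<alpha> i \<noteq> 0" "i \<noteq> j" for i
    using assms that by (cases "i < j"; cases "i < n - k") force+
  show "monom n \<pi> \<alpha> * multrow_mat n (k + j) c = monom n \<pi> (\<alpha>(j := c))"
  proof -
    have "monom n \<pi> \<alpha> * multrow_mat n (k + j) c =
        monom n \<pi> (\<lambda>i. \<alpha> i * (if \<pi> i = k + j then c else 1))"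
      unfolding torus_monom by (rule monom_mult) (use lt in auto)
    also have "\<dots> = monom n \<pi> (\<alpha>(j := c))"
    proof (rule monom_cong)
      fix i assume "i < n"
      then show "\<alpha> i * (if \<pi> i = k + j then c else 1) = (\<alpha>(j := c)) i \<and>
          (\<alpha> i * (if \<pi> i = k + j then c else 1) \<noteq> 0 \<longrightarrow> \<pi> i = \<pi> i)"
        using j ne[of i] by (cases "i = j"; cases "\<alpha> i = 0") auto
    qed
    finally show ?thesis .
  qed
  show "monom n \<pi> (\<alpha>(j := c)) * word_mat (run (Suc (k + j)) a) =
      monom n (\<lambda>i. run_perm (Suc (k + j)) a (\<pi> i)) (\<alpha>(j := c))"
    unfolding word_mat_run[OF assms(1-3)]
    by (subst monom_mult) (use lt in \<open>auto split: if_splits intro!: monom_cong\<close>)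
qed

lemma monom_eqD:
  assumes "monom n \<pi> \<alpha> = monom n \<pi>' \<alpha>'" "i < n" "\<pi> i < n" "\<pi>' i < n" "\<alpha> i \<noteq> 0"
  shows "\<alpha> i = \<alpha>' i" "\<pi> i = \<pi>' i"
proof -
  have "monom n \<pi> \<alpha> $$ (i, \<pi> i) = monom n \<pi>' \<alpha>' $$ (i, \<pi> i)" using assms(1) by simp
  then show "\<alpha> i = \<alpha>' i" "\<pi> i = \<pi>' i" using assms(2-5) by (auto simp: monom_index split: if_splits)
qed

lemma g_pow_inj: "b < CARD('f) - 1 \<Longrightarrow> b' < CARD('f) - 1 \<Longrightarrow> g ^ b = g ^ b' \<Longrightarrow> b = b'"
  using g by (auto simp: primitive_def bij_betw_def inj_on_def)

lemma g_pow_surj: "c \<noteq> 0 \<Longrightarrow> \<exists>b<CARD('f) - 1. g ^ b = c"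
proof -
  assume "c \<noteq> 0"
  then have "c \<in> (\<lambda>b. g ^ b) ` {..<CARD('f) - 1}" using g by (simp add: primitive_def bij_betw_def)
  then show ?thesis by auto
qed

lemma right_words_mat:
  assumes "k + j \<le> n" "w \<in> right_words (CARD('f) - 1) k j"
  shows "shift_mat n k * word_mat w \<in> right_mats k j"
  using assms
proof (induction j arbitrary: w)
  case 0
  then show ?case
    unfolding right_mats_def shift_monom
    by (intro CollectI exI[where x = "\<lambda>i. i + k"] exI[where x = "\<lambda>i. if i + k < n then 1 else 0"])
      (auto simp: right_mult_one_mat[of _ n n])
next
  case (Suc j)
  let ?m = "Suc (k + j)"
  from Suc.prems obtain v a b where w: "v \<in> right_words (CARD('f) - 1) k j" "1 \<le> a" "a \<le> ?m"
    "w = v @ replicate b (GenF ?m) @ run ?m a" by auto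
  have m: "?m \<le> n" using Suc.prems by simp
  from Suc.IH[OF _ w(1)] m obtain \<pi> \<alpha> where p: "shift_mat n k * word_mat v = monom n \<pi> \<alpha>"
    "\<forall>i<j. \<pi> i < k + j \<and> \<alpha> i \<noteq> 0" "inj_on \<pi> {..<j}"
    "\<forall>i. j \<le> i \<longrightarrow> i < n - k \<longrightarrow> \<pi> i = i + k \<and> \<alpha> i = 1" "\<forall>i\<ge>n - k. \<alpha> i = 0"
    unfolding right_mats_def by auto
  have "shift_mat n k * word_mat w = (shift_mat n k * word_mat v) * multrow_mat n (k + j) (g ^ b) * word_mat (run ?m a)"
    by (simp add: w(4) word_mat_append word_mat_F mat_assoc[of _ n] mat_closed[of _ n])
  also have "\<dots> = monom n (\<lambda>i. run_perm ?m a (\<pi> i)) (\<alpha>(j := g ^ b))"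
    using right_step[OF w(2,3) m p(2,4,5)] by (simp add: p(1))
  finally have eq: "shift_mat n k * word_mat w = monom n (\<lambda>i. run_perm ?m a (\<pi> i)) (\<alpha>(j := g ^ b))" .
  have pj: "\<pi> j = k + j" using p(4) m by auto
  have inj: "inj_on (run_perm ?m a) {..<n}" using run_perm_bij[OF w(2,3) m] by (rule bij_betw_imp_inj_on)
  have "inj_on \<pi> {..<Suc j}"
  proof (rule inj_onI)
    fix x y assume xy: "x \<in> {..<Suc j}" "y \<in> {..<Suc j}" "\<pi> x = \<pi> y"
    have less: "\<pi> i < \<pi> j" if "i < j" for i using p(2) pj that by simp
    consider "x < j" "y < j" | "x < j" "y = j" | "x = j" "y < j" | "x = j" "y = j"
      using xy by fastforce
    then show "x = y"
      by cases (use xy(3) less[of x] less[of y] inj_onD[OF p(3) xy(3)] in auto)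
  qed
  moreover have "\<pi> i < n" if "i < Suc j" for i
    using p(2)[rule_format, of i] pj m that by (cases "i = j") auto
  ultimately have "inj_on (\<lambda>i. run_perm ?m a (\<pi> i)) {..<Suc j}"
    using inj by (auto simp: inj_on_def)
  moreover have "run_perm ?m a (\<pi> i) < k + Suc j \<and> (\<alpha>(j := g ^ b)) i \<noteq> 0" if "i < Suc j" for i
    using that p(2) pj w(2,3) g_nonzero by (cases "i = j") (force simp: run_perm_def)+
  moreover have "run_perm ?m a (\<pi> i) = i + k \<and> (\<alpha>(j := g ^ b)) i = 1" if "Suc j \<le> i" "i < n - k" for i
    using that p(4) by (auto simp: run_perm_def)
  moreover have "(\<alpha>(j := g ^ b)) i = 0" if "i \<ge> n - k" for i using that p(5) m by auto
  ultimately show ?case unfolding eq right_mats_def by blast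
qed

text \<open>Row \<open>j\<close> of the product displays the column \<open>a - 1\<close> and the
  weight \<open>g ^ b\<close> of the last factor. Once these are known, the factor can be stripped
  off.\<close>

lemma right_words_unique:
  assumes "k + j \<le> n" "w \<in> right_words (CARD('f) - 1) k j" "w' \<in> right_words (CARD('f) - 1) k j"
    and "shift_mat n k * word_mat w = shift_mat n k * word_mat w'"
  shows "w = w'"
  using assms
proof (induction j arbitrary: w w')
  case (Suc j)
  let ?m = "Suc (k + j)"
  have m: "?m \<le> n" using Suc.prems by simp
  have data: "\<exists>v a b \<pi> \<alpha>. v \<in> right_words (CARD('f) - 1) k j \<and> 1 \<le> a \<and> a \<le> ?m \<and> b < CARD('f) - 1 \<and>
    w = v @ replicate b (GenF ?m) @ run ?m a \<and> shift_mat n k * word_mat v = monom n \<pi> \<alpha> \<and>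
    (\<forall>i<j. \<pi> i < k + j \<and> \<alpha> i \<noteq> 0) \<and> (\<forall>i. j \<le> i \<longrightarrow> i < n - k \<longrightarrow> \<pi> i = i + k \<and> \<alpha> i = 1) \<and>
    (\<forall>i\<ge>n - k. \<alpha> i = 0) \<and>
    shift_mat n k * word_mat w = monom n (\<lambda>i. run_perm ?m a (\<pi> i)) (\<alpha>(j := g ^ b))"
    if wr: "w \<in> right_words (CARD('f) - 1) k (Suc j)" for w
  proof -
    from wr obtain v a b where w: "v \<in> right_words (CARD('f) - 1) k j" "1 \<le> a" "a \<le> ?m" "b < CARD('f) - 1"
      "w = v @ replicate b (GenF ?m) @ run ?m a" by auto
    from right_words_mat[OF _ w(1)] m obtain \<pi> \<alpha> where p: "shift_mat n k * word_mat v = monom n \<pi> \<alpha>"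
      "\<forall>i<j. \<pi> i < k + j \<and> \<alpha> i \<noteq> 0"
      "\<forall>i. j \<le> i \<longrightarrow> i < n - k \<longrightarrow> \<pi> i = i + k \<and> \<alpha> i = 1" "\<forall>i\<ge>n - k. \<alpha> i = 0"
      unfolding right_mats_def by auto
    have "shift_mat n k * word_mat w = (shift_mat n k * word_mat v) * multrow_mat n (k + j) (g ^ b) * word_mat (run ?m a)"
      by (simp add: w(5) word_mat_append word_mat_F mat_assoc[of _ n] mat_closed[of _ n])
    also have "\<dots> = monom n (\<lambda>i. run_perm ?m a (\<pi> i)) (\<alpha>(j := g ^ b))"
      using right_step[OF w(2,3) m p(2,3,4)] by (simp add: p(1))
    finally show ?thesis using w p by blast
  qed
  obtain v a b \<pi> \<alpha> where 1: "v \<in> right_words (CARD('f) - 1) k j" "1 \<le> a" "a \<le> ?m" "b < CARD('f) - 1"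
    "w = v @ replicate b (GenF ?m) @ run ?m a" "shift_mat n k * word_mat v = monom n \<pi> \<alpha>"
    "\<forall>i<j. \<pi> i < k + j \<and> \<alpha> i \<noteq> 0" "\<forall>i. j \<le> i \<longrightarrow> i < n - k \<longrightarrow> \<pi> i = i + k \<and> \<alpha> i = 1"
    "\<forall>i\<ge>n - k. \<alpha> i = 0"
    "shift_mat n k * word_mat w = monom n (\<lambda>i. run_perm ?m a (\<pi> i)) (\<alpha>(j := g ^ b))"
    using data[OF Suc.prems(2)] by blast
  obtain v' a' b' \<pi>' \<alpha>' where 2: "v' \<in> right_words (CARD('f) - 1) k j" "1 \<le> a'" "a' \<le> ?m" "b' < CARD('f) - 1"
    "w' = v' @ replicate b' (GenF ?m) @ run ?m a'" "shift_mat n k * word_mat v' = monom n \<pi>' \<alpha>'"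
    "\<forall>i<j. \<pi>' i < k + j \<and> \<alpha>' i \<noteq> 0" "\<forall>i. j \<le> i \<longrightarrow> i < n - k \<longrightarrow> \<pi>' i = i + k \<and> \<alpha>' i = 1"
    "\<forall>i\<ge>n - k. \<alpha>' i = 0"
    "shift_mat n k * word_mat w' = monom n (\<lambda>i. run_perm ?m a' (\<pi>' i)) (\<alpha>'(j := g ^ b'))"
    using data[OF Suc.prems(3)] by blast
  have eq: "monom n (\<lambda>i. run_perm ?m a (\<pi> i)) (\<alpha>(j := g ^ b)) =
      monom n (\<lambda>i. run_perm ?m a' (\<pi>' i)) (\<alpha>'(j := g ^ b'))"
    using 1(10) 2(10) Suc.prems(4) by simp
  have pj: "\<pi> j = k + j" "\<pi>' j = k + j" "j < n" using 1(8) 2(8) m by auto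
  have lt1: "run_perm ?m a (\<pi> i) < n" if "i < Suc j" for i
    using that 1(2,3) 1(7)[rule_format, of i] pj m by (cases "i = j") (auto simp: run_perm_def)
  have lt2: "run_perm ?m a' (\<pi>' i) < n" if "i < Suc j" for i
    using that 2(2,3) 2(7)[rule_format, of i] pj m by (cases "i = j") (auto simp: run_perm_def)
  note lt = lt1 lt2
  have "g ^ b = g ^ b'" "a - 1 = a' - 1"
    using monom_eqD[OF eq pj(3) lt[of j]] g_nonzero pj by (simp_all add: run_perm_def)
  then have ab: "a = a'" "b = b'" using g_pow_inj[OF 1(4) 2(4)] 1(2) 2(2) by auto
  have inj: "inj_on (run_perm ?m a) {..<n}" using run_perm_bij[OF 1(2,3) m] by (rule bij_betw_imp_inj_on)
  have "monom n \<pi> \<alpha> = monom n \<pi>' \<alpha>'"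
  proof (rule monom_cong)
    fix i assume i: "i < n"
    show "\<alpha> i = \<alpha>' i \<and> (\<alpha> i \<noteq> 0 \<longrightarrow> \<pi> i = \<pi>' i)"
    proof (cases "i < j")
      case True
      have "(\<alpha>(j := g ^ b)) i \<noteq> 0" using True 1(7) by simp
      from monom_eqD[OF eq i lt[of i] this] True
      have "\<alpha> i = \<alpha>' i" "run_perm ?m a (\<pi> i) = run_perm ?m a (\<pi>' i)" using ab by auto
      moreover have "\<pi> i < n" "\<pi>' i < n" using True 1(7) 2(7) m by force+
      ultimately show ?thesis using inj by (auto simp: inj_on_def)
    next
      case False
      then show ?thesis using 1(8,9) 2(8,9) by (cases "i < n - k") auto
    qed
  qed
  then have "v = v'" using Suc.IH[of v v'] 1(1,6) 2(1,6) m by simp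
  then show ?case using 1(5) 2(5) ab by simp
qed simp

text \<open>The parameters \<open>a\<close> and \<open>b\<close> are read off row \<open>j\<close>;
  undoing the last factor then leaves a matrix of the previous stage.\<close>

lemma right_words_exist:
  assumes "k + j \<le> n" "A \<in> right_mats k j"
  shows "\<exists>w\<in>right_words (CARD('f) - 1) k j. A = shift_mat n k * word_mat w"
  using assms
proof (induction j arbitrary: A)
  case 0
  then obtain \<pi> \<alpha> where A: "A = monom n \<pi> \<alpha>" "\<forall>i<n - k. \<pi> i = i + k \<and> \<alpha> i = 1" "\<forall>i\<ge>n - k. \<alpha> i = 0"
    unfolding right_mats_def by auto
  have "A = shift_mat n k"
    unfolding A(1) shift_monom by (rule monom_cong) (use A(2,3) in auto)
  then show ?case by (simp add: right_mult_one_mat[of _ n n])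
next
  case (Suc j)
  let ?m = "Suc (k + j)"
  have m: "?m \<le> n" using Suc.prems by simp
  from Suc.prems(2) obtain \<pi> \<alpha> where A: "A = monom n \<pi> \<alpha>" "\<forall>i<Suc j. \<pi> i < k + Suc j \<and> \<alpha> i \<noteq> 0"
    "inj_on \<pi> {..<Suc j}" "\<forall>i. Suc j \<le> i \<longrightarrow> i < n - k \<longrightarrow> \<pi> i = i + k \<and> \<alpha> i = 1" "\<forall>i\<ge>n - k. \<alpha> i = 0"
    unfolding right_mats_def by blast
  define a where "a = Suc (\<pi> j)"
  have a: "1 \<le> a" "a \<le> ?m" using A(2) by (auto simp: a_def)
  obtain b where b: "b < CARD('f) - 1" "g ^ b = \<alpha> j" using g_pow_surj A(2) by blast
  \<comment> \<open>Column \<open>\<pi> j\<close> is taken out and the columns beyond it close the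
    gap; row \<open>j\<close> goes back to its place in \<open>N^k\<close>.\<close>
  define \<pi>0 where "\<pi>0 i = (if i < j then if \<pi> i < \<pi> j then \<pi> i else \<pi> i - 1 else i + k)" for i
  define \<alpha>0 where "\<alpha>0 = \<alpha>(j := 1)"
  have ne: "\<pi> i \<noteq> \<pi> j" if "i < j" for i using A(3) that by (auto simp: inj_on_def)
  have conds: "\<forall>i<j. \<pi>0 i < k + j \<and> \<alpha>0 i \<noteq> 0" "inj_on \<pi>0 {..<j}"
    "\<forall>i. j \<le> i \<longrightarrow> i < n - k \<longrightarrow> \<pi>0 i = i + k \<and> \<alpha>0 i = 1" "\<forall>i\<ge>n - k. \<alpha>0 i = 0"
  proof -
    show "\<forall>i<j. \<pi>0 i < k + j \<and> \<alpha>0 i \<noteq> 0"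
    proof (intro allI impI)
      fix i assume "i < j"
      then show "\<pi>0 i < k + j \<and> \<alpha>0 i \<noteq> 0"
        using A(2)[rule_format, of i] A(2)[rule_format, of j] ne[of i] by (auto simp: \<pi>0_def \<alpha>0_def)
    qed
    show "inj_on \<pi>0 {..<j}"
    proof (rule inj_onI)
      fix x y assume xy: "x \<in> {..<j}" "y \<in> {..<j}" "\<pi>0 x = \<pi>0 y"
      then have "\<pi> x = \<pi> y" using ne[of x] ne[of y] by (auto simp: \<pi>0_def split: if_splits)
      then show "x = y" using A(3) xy by (auto simp: inj_on_def)
    qed
    show "\<forall>i. j \<le> i \<longrightarrow> i < n - k \<longrightarrow> \<pi>0 i = i + k \<and> \<alpha>0 i = 1" using A(4) by (auto simp: \<pi>0_def \<alpha>0_def)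
    show "\<forall>i\<ge>n - k. \<alpha>0 i = 0" using A(5) m by (auto simp: \<alpha>0_def)
  qed
  then have "monom n \<pi>0 \<alpha>0 \<in> right_mats k j" unfolding right_mats_def by blast
  from Suc.IH[OF _ this] m obtain w where w: "w \<in> right_words (CARD('f) - 1) k j"
    "monom n \<pi>0 \<alpha>0 = shift_mat n k * word_mat w" by auto
  let ?w = "w @ replicate b (GenF ?m) @ run ?m a"
  have "?w \<in> right_words (CARD('f) - 1) k (Suc j)" using w(1) a b(1) by fastforce
  moreover have "A = shift_mat n k * word_mat ?w"
  proof -
    have "shift_mat n k * word_mat ?w = (shift_mat n k * word_mat w) * multrow_mat n (k + j) (g ^ b) * word_mat (run ?m a)"
      by (simp add: word_mat_append word_mat_F mat_assoc[of _ n] mat_closed[of _ n])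
    also have "\<dots> = monom n (\<lambda>i. run_perm ?m a (\<pi>0 i)) (\<alpha>0(j := g ^ b))"
      using right_step[OF a m conds(1,3,4)] by (simp add: w(2)[symmetric])
    also have "\<dots> = A"
      unfolding A(1)
    proof (rule monom_cong)
      fix i assume i: "i < n"
      show "(\<alpha>0(j := g ^ b)) i = \<alpha> i \<and> ((\<alpha>0(j := g ^ b)) i \<noteq> 0 \<longrightarrow> run_perm ?m a (\<pi>0 i) = \<pi> i)"
      proof (cases "i < Suc j")
        case True
        then show ?thesis
          using A(2)[rule_format, of i] A(2)[rule_format, of j] ne[of i] b(2)
          by (cases "i = j") (auto simp: \<alpha>0_def \<pi>0_def run_perm_def a_def)
      next
        case False
        then show ?thesis
          using A(4,5) by (cases "i < n - k") (auto simp: \<alpha>0_def \<pi>0_def run_perm_def)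
      qed
    qed
    finally show ?thesis by simp
  qed
  ultimately show ?case by blast
qed

end

context framed_rook
begin

section \<open>Normal words evaluate to the \<open>T_\<sigma>\<close>\<close>

subsection \<open>The evaluation of normal words\<close>

text \<open>Sums instead of averages: the \<open>q\<close> that a reflection carries in
  \<open>alg_gen\<close> equals the growth of the double coset in \<open>card_dc_sw\<close>, so
  reduced multiplications involve no scalars.\<close>

definition ind :: "'f mat \<Rightarrow> 'f mat \<Rightarrow> 'k" where
  "ind \<sigma> = (\<lambda>x. if x \<in> double_coset n \<sigma> then 1 else 0)"

abbreviation evB :: "ry_gen list \<Rightarrow> 'f mat \<Rightarrow> 'k" where "evB \<equiv> word_eval dc_algebra alg_gen"

lemma evB_closed [simp]: "evB w \<in> carrier dc_algebra"
  by (rule B.word_eval_closed) simp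

lemma evB_append: "evB (v @ w) = evB v \<otimes>\<^bsub>dc_algebra\<^esub> evB w"
  by (rule B.word_eval_append) simp

lemma ind_avg:
  "\<sigma> \<in> carrier_mat n n \<Longrightarrow> ind \<sigma> = of_nat (card (double_coset n \<sigma>)) \<odot>\<^bsub>dc_algebra\<^esub> avg \<sigma>"
  using card_dc_pos[of \<sigma> n] by (intro ext) (simp add: ind_def average_def dc_algebra_simps monoid_algebra_simps)

lemma ind_closed [simp]: "\<sigma> \<in> carrier_mat n n \<Longrightarrow> ind \<sigma> \<in> carrier dc_algebra"
  by (simp add: ind_avg B.smult_closed)

lemma sw_ind:
  assumes "good n k \<sigma>" "\<sigma> \<in> framed_rook_mats n" "Suc k < n" "c < n" "\<sigma> $$ (k, c) \<noteq> 0"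
  shows "alg_gen (GenT (Suc k)) \<otimes>\<^bsub>dc_algebra\<^esub> ind \<sigma> = ind (sw n k * \<sigma>)"
proof -
  note c = rook_carrier[OF assms(2)]
  have "avg (sw n k) \<otimes>\<^bsub>dc_algebra\<^esub> avg \<sigma> = avg (sw n k * \<sigma>)"
    using c by (intro avg_mult compatible_good[OF assms(1-3)]) simp_all
  then show ?thesis
    using c card_dc_sw[OF assms]
    by (simp add: ind_avg mat_closed[of _ n] B.smult_mult_left B.smult_mult_right
        B.smult_smult B.smult_closed mult.commute)
qed

lemma ind_sw:
  assumes "good_right n k \<sigma>" "\<sigma> \<in> framed_rook_mats n" "Suc k < n" "r < n" "\<sigma> $$ (r, Suc k) \<noteq> 0"
  shows "ind \<sigma> \<otimes>\<^bsub>dc_algebra\<^esub> alg_gen (GenT (Suc k)) = ind (\<sigma> * sw n k)"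
proof -
  note c = rook_carrier[OF assms(2)]
  have "avg \<sigma> \<otimes>\<^bsub>dc_algebra\<^esub> avg (sw n k) = avg (\<sigma> * sw n k)"
    using c by (intro avg_mult compatible_good_right[OF assms(1-3)]) simp_all
  then show ?thesis
    using c card_dc_sw_right[OF assms]
    by (simp add: ind_avg mat_closed[of _ n] B.smult_mult_left B.smult_mult_right
        B.smult_smult B.smult_closed mult.commute)
qed

lemma ind_torus:
  assumes "\<sigma> \<in> carrier_mat n n" "1 \<le> m" "m \<le> n"
  shows "ind \<sigma> \<otimes>\<^bsub>dc_algebra\<^esub> evB (replicate b (GenF m)) = ind (\<sigma> * multrow_mat n (m - 1) (g ^ b))"
proof -
  have nz: "g ^ b \<noteq> 0" using g_nonzero by simp
  have m: "m - 1 < n" using assms by simp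
  have "avg \<sigma> \<otimes>\<^bsub>dc_algebra\<^esub> avg (multrow_mat n (m - 1) (g ^ b)) = avg (\<sigma> * multrow_mat n (m - 1) (g ^ b))"
    using assms m nz by (intro avg_mult compatible_torus_right) simp_all
  then show ?thesis
    using assms card_dc_torus[OF nz m assms(1)]
    using avg_torus_pow[OF g_nonzero m, of b]
    by (simp add: B.word_eval_replicate ind_avg mat_closed[of _ n] B.smult_mult_left)
qed

lemma word_mat_rook: "set w \<subseteq> ry_gens n \<Longrightarrow> word_mat w \<in> framed_rook_mats n"
proof (induction w)
  case Nil
  show ?case by (simp add: one_monom) (rule monom_rook, simp)
next
  case (Cons x w)
  have "mat_gen x \<in> framed_rook_mats n"
  proof (cases x)
    case (GenT i)
    then have "Suc (i - 1) < n" "Suc (i - 1) = i" using Cons.prems by (auto simp: ry_gens_def)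
    then show ?thesis using rook_sw[of "i - 1" n] by (simp add: GenT)
  qed (simp_all add: rook_torus shift_rook)
  then show ?case using Cons by (simp add: word_mat_Cons rook_mult)
qed

text \<open>The nonzero row \<open>a - 1\<close> travels down past zero rows, so at each exchange
  \<open>good\<close> holds vacuously and the double coset grows by the factor
  \<open>q\<close>.\<close>

lemma run_ind:
  assumes "1 \<le> a" "a \<le> m" "m \<le> n" "A \<in> framed_rook_mats n" "c < n" "A $$ (a - 1, c) \<noteq> 0"
    and "\<And>i c. a \<le> i \<Longrightarrow> i < m \<Longrightarrow> c < n \<Longrightarrow> A $$ (i, c) = 0"
  shows "evB (run m a) \<otimes>\<^bsub>dc_algebra\<^esub> ind A = ind (word_mat (run m a) * A)"
  using assms(2,3,7)
proof (induction m)
  case (Suc m)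
  note c = rook_carrier[OF assms(4)]
  show ?case
  proof (cases "a = Suc m")
    case True
    then show ?thesis using c by (simp add: left_mult_one_mat[of _ n n])
  next
    case False
    then have k: "Suc (m - 1) < n" "Suc (m - 1) = m" "a \<le> m" using Suc.prems assms(1) by auto
    let ?W = "word_mat (run m a) * A"
    have set: "set (run m a) \<subseteq> ry_gens n" using Suc.prems k assms(1) by (auto simp: set_run ry_gens_def)
    have W: "?W \<in> framed_rook_mats n" by (rule rook_mult[OF word_mat_rook[OF set] assms(4)])
    have row: "?W $$ (i, j) = A $$ (run_perm m a i, j)" if "i < n" "j < n" for i j
      using run_index[of a m A i j] that c k assms(1) Suc.prems by simp
    have "good n (m - 1) ?W"
      unfolding good_def
    proof (intro allI impI)
      fix c' assume c': "c' < n" "?W $$ (Suc (m - 1), c') \<noteq> 0"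
      have "?W $$ (m, c') = 0" using row[of m c'] c' k Suc.prems by (simp add: run_perm_def)
      then show "\<exists>c<c'. ?W $$ (m - 1, c) \<noteq> 0" using c' k by simp
    qed
    moreover have "?W $$ (m - 1, c) \<noteq> 0" using row[of "m - 1" c] assms k by (simp add: run_perm_def)
    ultimately have "alg_gen (GenT m) \<otimes>\<^bsub>dc_algebra\<^esub> ind ?W = ind (sw n (m - 1) * ?W)"
      using sw_ind[OF _ W k(1) assms(5)] k by simp
    moreover have "evB (run m a) \<otimes>\<^bsub>dc_algebra\<^esub> ind A = ind ?W" using Suc k by simp
    ultimately show ?thesis
      using c k by (simp add: run_Suc word_mat_Cons B.m_assoc mat_assoc[of _ n])
  qed
qed (use assms in simp)

lemma left_words_ind:
  assumes "l \<in> left_words m r" "m \<le> n" "rows_ok m r A" "A \<in> framed_rook_mats n"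
  shows "evB l \<otimes>\<^bsub>dc_algebra\<^esub> ind A = ind (word_mat l * A)"
  using assms
proof (induction m arbitrary: r l A)
  case 0
  then have "l = []" by (cases r) auto
  then show ?case using rook_carrier[OF 0(4)] by (simp add: left_mult_one_mat[of _ n n])
next
  case (Suc m)
  note c = rook_carrier[OF Suc.prems(4)]
  from Suc.prems(1) consider (a) "l \<in> left_words m r"
    | (b) r0 l0 where "r = Suc r0" "l0 \<in> left_words m r0" "l = l0 @ run (Suc m) (Suc r0)"
    unfolding left_words_Suc by blast
  then show ?case
  proof cases
    case a
    have "rows_ok m r A" using Suc.prems(3) by (auto simp: rows_ok_def)
    then show ?thesis using Suc.IH[OF a] Suc.prems by simp
  next
    case (b r0 l0)
    note le = left_words_le[OF b(2)]
    let ?R = "run (Suc m) (Suc r0)"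
    have ok: "rows_ok (Suc m) (Suc r0) A" using Suc.prems b(1) by simp
    have set: "set ?R \<subseteq> ry_gens n" using Suc.prems(2) by (auto simp: set_run ry_gens_def)
    obtain c' where "c' < n" "A $$ (r0, c') \<noteq> 0" using ok unfolding rows_ok_def by blast
    then have "evB ?R \<otimes>\<^bsub>dc_algebra\<^esub> ind A = ind (word_mat ?R * A)"
      using ok le Suc.prems by (intro run_ind) (auto simp: rows_ok_def)
    moreover have "evB l0 \<otimes>\<^bsub>dc_algebra\<^esub> ind (word_mat ?R * A) = ind (word_mat l0 * (word_mat ?R * A))"
      using Suc.IH[OF b(2) _ rows_ok_run(1)[OF ok Suc.prems(2) le] rook_mult[OF word_mat_rook[OF set] Suc.prems(4)]]
        Suc.prems(2) by simp
    ultimately show ?thesis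
      using c by (simp add: b(3) evB_append word_mat_append B.m_assoc mat_assoc[of _ n])
  qed
qed

text \<open>Column \<open>m - 1\<close> travels to the left. By \<open>less\<close>, the entries it
  passes lie above its own entry in row \<open>j\<close>, which is the condition
  \<open>good_right\<close> at each step.\<close>

lemma monom_ind_run:
  assumes "1 \<le> a" "a \<le> m" "m \<le> n" "j < n" "\<alpha> j \<noteq> 0" "\<pi> j = m - 1"
    and lt: "\<And>i. i < n \<Longrightarrow> \<alpha> i \<noteq> 0 \<Longrightarrow> \<pi> i < n"
    and inj: "\<And>i i'. i < n \<Longrightarrow> i' < n \<Longrightarrow> \<alpha> i \<noteq> 0 \<Longrightarrow> \<alpha> i' \<noteq> 0 \<Longrightarrow> \<pi> i = \<pi> i' \<Longrightarrow> i = i'"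
    and less: "\<And>i. i < n \<Longrightarrow> \<alpha> i \<noteq> 0 \<Longrightarrow> \<pi> i < m - 1 \<Longrightarrow> i < j"
  shows "ind (monom n \<pi> \<alpha>) \<otimes>\<^bsub>dc_algebra\<^esub> evB (run m a) = ind (monom n (\<lambda>i. run_perm m a (\<pi> i)) \<alpha>)"
  using assms(2,1)
proof (induction a rule: inc_induct)
  case base
  have "monom n (\<lambda>i. run_perm m m (\<pi> i)) \<alpha> = monom n \<pi> \<alpha>"
    using base by (intro monom_cong) (auto simp: run_perm_def)
  then show ?case by simp
next
  case (step b)
  let ?\<pi> = "\<lambda>i. run_perm m (Suc b) (\<pi> i)"
  let ?W = "monom n ?\<pi> \<alpha>"
  have b: "1 \<le> b" "Suc b \<le> m" "Suc (b - 1) < n" "Suc (b - 1) = b" using step assms by auto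
  have bij: "bij_betw (run_perm m (Suc b)) {..<n} {..<n}" using run_perm_bij[of "Suc b" m n] b assms by simp
  have rp: "?\<pi> i < n" if "i < n" "\<alpha> i \<noteq> 0" for i
    using bij_betwE[OF bij] lt[OF that] by blast
  have W: "?W \<in> framed_rook_mats n"
  proof (rule monom_rook)
    fix i i' assume i: "i < n" "i' < n" "\<alpha> i \<noteq> 0" "\<alpha> i' \<noteq> 0" "?\<pi> i = ?\<pi> i'"
    then have "\<pi> i = \<pi> i'" using bij lt by (auto simp: bij_betw_def inj_on_def)
    then show "i = i'" using inj i by blast
  qed
  have "good_right n (b - 1) ?W"
  proof (rule good_right_monom[OF b(3)])
    fix r assume r: "r < n" "\<alpha> r \<noteq> 0" "?\<pi> r = b - 1"
    then have "\<pi> r < m - 1" using b by (auto simp: run_perm_def split: if_splits)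
    then have "r < j" using less r by blast
    then show "\<exists>r'>r. r' < n \<and> \<alpha> r' \<noteq> 0 \<and> ?\<pi> r' = Suc (b - 1)"
      using assms b by (intro exI[of _ j]) (simp add: run_perm_def)
  qed
  moreover have "?W $$ (j, Suc (b - 1)) \<noteq> 0"
    using assms b by (simp add: monom_index run_perm_def)
  ultimately have s: "ind ?W \<otimes>\<^bsub>dc_algebra\<^esub> alg_gen (GenT b) = ind (?W * sw n (b - 1))"
    using ind_sw[OF _ W b(3) assms(4)] b(4) by simp
  have "?W * sw n (b - 1) = monom n (\<lambda>i. run_perm m b (\<pi> i)) \<alpha>"
    unfolding sw_monom[OF b(3)]
    by (subst monom_mult) (use b rp in \<open>auto simp: run_perm_def transpose_def split: if_splits intro!: monom_cong\<close>)
  moreover have "evB (run m b) = evB (run m (Suc b)) \<otimes>\<^bsub>dc_algebra\<^esub> alg_gen (GenT b)"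
    using b by (simp add: run_snoc evB_append)
  ultimately show ?case
    using step.IH b s by (simp add: B.m_assoc[symmetric])
qed

lemma right_words_ind:
  assumes "k + j \<le> n" "w \<in> right_words (CARD('f) - 1) k j"
  shows "ind (shift_mat n k) \<otimes>\<^bsub>dc_algebra\<^esub> evB w = ind (shift_mat n k * word_mat w)"
  using assms
proof (induction j arbitrary: w)
  case 0
  then show ?case by (simp add: right_mult_one_mat[of _ n n])
next
  case (Suc j)
  let ?m = "Suc (k + j)"
  from Suc.prems obtain v a b where w: "v \<in> right_words (CARD('f) - 1) k j" "1 \<le> a" "a \<le> ?m"
    "w = v @ replicate b (GenF ?m) @ run ?m a" by auto
  have m: "?m \<le> n" using Suc.prems by simp
  from right_words_mat[OF _ w(1)] m obtain \<pi> \<alpha> where p: "shift_mat n k * word_mat v = monom n \<pi> \<alpha>"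
    "\<forall>i<j. \<pi> i < k + j \<and> \<alpha> i \<noteq> 0" "inj_on \<pi> {..<j}"
    "\<forall>i. j \<le> i \<longrightarrow> i < n - k \<longrightarrow> \<pi> i = i + k \<and> \<alpha> i = 1" "\<forall>i\<ge>n - k. \<alpha> i = 0"
    unfolding right_mats_def by auto
  let ?\<alpha> = "\<alpha>(j := g ^ b)"
  have pj: "\<pi> j = k + j" "j < n" using p(4) m by auto
  note st = right_step[OF w(2,3) m p(2,4,5)]
  \<comment> \<open>A row has either been assigned already, with a column below
    \<open>k + j\<close>, or its entry is still in the place it has in \<open>N^k\<close>.\<close>
  have dich: "i < j \<and> \<pi> i < k + j \<or> j \<le> i \<and> \<pi> i = i + k \<and> \<pi> i < n" if "i < n" "?\<alpha> i \<noteq> 0" for i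
    using that p(2,4,5) pj m by (cases "i < j"; cases "i < n - k"; cases "i = j") force+
  have "ind (monom n \<pi> ?\<alpha>) \<otimes>\<^bsub>dc_algebra\<^esub> evB (run ?m a) = ind (monom n (\<lambda>i. run_perm ?m a (\<pi> i)) ?\<alpha>)"
  proof (rule monom_ind_run[where j = j])
    fix i i' assume i: "i < n" "i' < n" "?\<alpha> i \<noteq> 0" "?\<alpha> i' \<noteq> 0" "\<pi> i = \<pi> i'"
    from dich[OF i(1,3)] dich[OF i(2,4)] show "i = i'"
      using p(3) i(5) by (auto simp: inj_on_def)
  next
    fix i assume i: "i < n" "?\<alpha> i \<noteq> 0"
    show "\<pi> i < n" using dich[OF i] m by auto
    show "i < j" if "\<pi> i < ?m - 1" using dich[OF i] that by auto
  qed (use w m pj g_nonzero in auto)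
  moreover have "ind (monom n \<pi> \<alpha>) \<otimes>\<^bsub>dc_algebra\<^esub> evB (replicate b (GenF ?m)) = ind (monom n \<pi> ?\<alpha>)"
    using ind_torus[of "monom n \<pi> \<alpha>" ?m b] m st(1)[of "g ^ b"] by simp
  moreover have "ind (shift_mat n k) \<otimes>\<^bsub>dc_algebra\<^esub> evB v = ind (monom n \<pi> \<alpha>)"
    using Suc.IH[OF _ w(1)] m p(1) by simp
  ultimately have "ind (shift_mat n k) \<otimes>\<^bsub>dc_algebra\<^esub> evB w = ind (monom n (\<lambda>i. run_perm ?m a (\<pi> i)) ?\<alpha>)"
    unfolding w(4) evB_append by (simp add: B.m_assoc[symmetric])
  moreover have "shift_mat n k * word_mat w = (shift_mat n k * word_mat v) * multrow_mat n (k + j) (g ^ b) * word_mat (run ?m a)"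
    by (simp add: w(4) word_mat_append word_mat_F mat_assoc[of _ n] mat_closed[of _ n])
  ultimately show ?case using st by (simp add: p(1))
qed

lemma normal_wordsE:
  assumes "w \<in> normal_words (CARD('f) - 1) n"
  obtains l r v where "r \<le> n" "l \<in> left_words n r" "v \<in> right_words (CARD('f) - 1) (n - r) r"
    "w = l @ replicate (n - r) GenN @ v" "rows_ok n r (shift_mat n (n - r) * word_mat v)"
    "word_mat w = word_mat l * (shift_mat n (n - r) * word_mat v)"
    "set l \<subseteq> ry_gens n" "set v \<subseteq> ry_gens n"
proof -
  from assms obtain l r v where w: "r \<le> n" "l \<in> left_words n r"
    "v \<in> right_words (CARD('f) - 1) (n - r) r" "w = l @ replicate (n - r) GenN @ v"
    unfolding normal_words_def by blast
  let ?B = "shift_mat n (n - r) * word_mat v"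
  from right_words_mat[OF _ w(3)] w(1) obtain \<pi> \<alpha> where p: "?B = monom n \<pi> \<alpha>"
    "\<forall>i<r. \<pi> i < n \<and> \<alpha> i \<noteq> 0" "\<forall>i\<ge>r. \<alpha> i = 0"
    unfolding right_mats_def by auto
  have ok: "rows_ok n r ?B"
    unfolding rows_ok_def p(1)
  proof (intro conjI allI impI)
    fix i assume "i < r"
    then show "\<exists>c<n. monom n \<pi> \<alpha> $$ (i, c) \<noteq> 0"
      using p(2) w(1) by (intro exI[of _ "\<pi> i"]) (simp add: monom_index)
  next
    fix i c assume "r \<le> i" "i < n" "c < n"
    then show "monom n \<pi> \<alpha> $$ (i, c) = 0" using p(3) by (simp add: monom_index)
  qed simp
  have "set l \<subseteq> ry_gens n" "set v \<subseteq> ry_gens n"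
    using set_left_words[OF w(2)] set_right_words[OF w(3)] w(1) by (auto simp: ry_gens_def)
  moreover have "word_mat w = word_mat l * ?B"
    unfolding w(4) word_mat_append word_mat_N by (simp add: mat_assoc[of _ n])
  ultimately show thesis using that[OF w ok] by blast
qed

lemma set_normal_words: "w \<in> normal_words (CARD('f) - 1) n \<Longrightarrow> set w \<subseteq> ry_gens n"
  by (erule normal_wordsE) (auto simp: ry_gens_def)

text \<open>For injectivity the rows recover the left word, after which the right word is
  determined. For surjectivity, sorting the rows of a rook matrix leaves a matrix in the domain of
  \<open>right_words_exist\<close>.\<close>

lemma word_mat_bij: "bij_betw word_mat (normal_words (CARD('f) - 1) n) (framed_rook_mats n)"
  unfolding bij_betw_def
proof (intro conjI inj_onI equalityI subsetI)
  fix w w' assume w: "w \<in> normal_words (CARD('f) - 1) n" "w' \<in> normal_words (CARD('f) - 1) n"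
    and eq: "word_mat w = word_mat w'"
  obtain l r v where 1: "r \<le> n" "l \<in> left_words n r" "v \<in> right_words (CARD('f) - 1) (n - r) r"
    "w = l @ replicate (n - r) GenN @ v" "rows_ok n r (shift_mat n (n - r) * word_mat v)"
    "word_mat w = word_mat l * (shift_mat n (n - r) * word_mat v)"
    using w(1) by (rule normal_wordsE)
  obtain l' r' v' where 2: "r' \<le> n" "l' \<in> left_words n r'" "v' \<in> right_words (CARD('f) - 1) (n - r') r'"
    "w' = l' @ replicate (n - r') GenN @ v'" "rows_ok n r' (shift_mat n (n - r') * word_mat v')"
    "word_mat w' = word_mat l' * (shift_mat n (n - r') * word_mat v')"
    using w(2) by (rule normal_wordsE)
  have "r = r' \<and> l = l' \<and> shift_mat n (n - r) * word_mat v = shift_mat n (n - r') * word_mat v'"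
    by (rule left_words_unique[OF 1(2) 2(2) order_refl 1(5) 2(5)]) (use eq 1(6) 2(6) in simp)
  then have "r = r'" "l = l'" "shift_mat n (n - r) * word_mat v = shift_mat n (n - r) * word_mat v'" by metis+
  moreover from this have "v = v'" using right_words_unique[OF _ 1(3), of v'] 1(1) 2(3) by simp
  ultimately show "w = w'" using 1(4) 2(4) by simp
next
  fix A assume "A \<in> word_mat ` normal_words (CARD('f) - 1) n"
  then show "A \<in> framed_rook_mats n" using word_mat_rook set_normal_words by blast
next
  fix A :: "'f mat" assume A: "A \<in> framed_rook_mats n"
  obtain r l B where B: "l \<in> left_words n r" "rows_ok n r B" "A = word_mat l * B"
    using left_words_exist[OF order_refl rook_carrier[OF A]] by blast
  have r: "r \<le> n" using left_words_le[OF B(1)] .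
  have c: "B \<in> carrier_mat n n" using B(2) by (simp add: rows_ok_def)
  obtain \<rho> where \<rho>: "bij_betw \<rho> {..<n} {..<n}"
    "\<forall>A\<in>carrier_mat n n. \<forall>i<n. \<forall>j<n. (word_mat l * A) $$ (i, j) = A $$ (\<rho> i, j)"
    using word_mat_T[OF set_left_words[OF B(1)] order_refl] by blast
  \<comment> \<open>\<open>B\<close> arises from \<open>A\<close> by permuting rows, so it inherits
    both rook conditions.\<close>
  have Bcol: "i = i'" if i: "i < n" "i' < n" "c < n" "B $$ (i, c) \<noteq> 0" "B $$ (i', c) \<noteq> 0" for i i' c
  proof -
    obtain k k' where k: "k < n" "k' < n" "i = \<rho> k" "i' = \<rho> k'"
      using bij_betw_imp_surj_on[OF \<rho>(1)] i(1,2) by (metis imageE lessThan_iff)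
    have "A $$ (k, c) \<noteq> 0" "A $$ (k', c) \<noteq> 0" using \<rho>(2) c i k B(3) by auto
    then show ?thesis using rook_col[OF A] k i(3) by blast
  qed
  have Brow: "c = c'" if i: "i < n" "c < n" "c' < n" "B $$ (i, c) \<noteq> 0" "B $$ (i, c') \<noteq> 0" for i c c'
  proof -
    obtain k where k: "k < n" "i = \<rho> k" using \<rho>(1) i(1) by (auto simp: bij_betw_def)
    have "A $$ (k, c) \<noteq> 0" "A $$ (k, c') \<noteq> 0" using \<rho>(2) c i k B(3) by auto
    then show ?thesis using rook_row[OF A] k i by blast
  qed
  have "\<forall>i. \<exists>c. i < r \<longrightarrow> c < n \<and> B $$ (i, c) \<noteq> 0" using B(2) unfolding rows_ok_def by blast
  then obtain \<pi> where \<pi>: "\<And>i. i < r \<Longrightarrow> \<pi> i < n \<and> B $$ (i, \<pi> i) \<noteq> 0" by metis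
  define \<alpha> where "\<alpha> i = (if i < r then B $$ (i, \<pi> i) else 0)" for i
  have "B = monom n \<pi> \<alpha>"
  proof (rule eq_matI)
    fix i j assume "i < dim_row (monom n \<pi> \<alpha>)" "j < dim_col (monom n \<pi> \<alpha>)"
    then have ij: "i < n" "j < n" by (auto simp: carrier_matD[OF monom_carrier])
    show "B $$ (i, j) = monom n \<pi> \<alpha> $$ (i, j)"
    proof (cases "i < r")
      case True
      then show ?thesis using ij \<pi>[of i] Brow[of i j "\<pi> i"] by (auto simp: monom_index \<alpha>_def)
    next
      case False
      then show ?thesis using ij B(2) by (simp add: monom_index \<alpha>_def rows_ok_def)
    qed
  qed (use c in \<open>simp_all add: monom_mat_def\<close>)
  moreover have "inj_on \<pi> {..<r}"
  proof (rule inj_onI)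
    fix x y assume "x \<in> {..<r}" "y \<in> {..<r}" "\<pi> x = \<pi> y"
    then show "x = y" using Bcol[of x y "\<pi> x"] \<pi>[of x] \<pi>[of y] r by simp
  qed
  ultimately have "B \<in> right_mats (n - r) r"
    unfolding right_mats_def using r \<pi> by (auto simp: \<alpha>_def intro!: exI[of _ \<pi>] exI[of _ \<alpha>])
  then obtain v where v: "v \<in> right_words (CARD('f) - 1) (n - r) r" "B = shift_mat n (n - r) * word_mat v"
    using right_words_exist[of "n - r" r B] r by auto
  have "A = word_mat (l @ replicate (n - r) GenN @ v)"
    unfolding word_mat_append word_mat_N using B(3) v(2) by simp
  moreover have "l @ replicate (n - r) GenN @ v \<in> normal_words (CARD('f) - 1) n"
    unfolding normal_words_def using r B(1) v(1) by blast
  ultimately show "A \<in> word_mat ` normal_words (CARD('f) - 1) n" by blast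
qed

end

text \<open>Distinct nonzero columns have disjoint supports, hence are independent; together with a
  zero column they would not be, so they are a maximal independent set. Each is named by the row of
  its entry.\<close>

lemma rook_rank:
  assumes A: "A \<in> framed_rook_mats n"
  shows "vec_space.rank n (A :: 'f::field mat) = card {i. i < n \<and> (\<exists>c<n. A $$ (i, c) \<noteq> 0)}"
proof -
  interpret vec_space "TYPE('f)" n .
  note c = rook_carrier[OF A]
  let ?R = "{i. i < n \<and> (\<exists>c<n. A $$ (i, c) \<noteq> 0)}"
  let ?S = "set (cols A) - {0\<^sub>v n}"
  have cols: "set (cols A) = col A ` {..<n}" using c by (auto simp: cols_def)
  have S: "?S \<subseteq> carrier_vec n" "finite ?S" using c by (auto simp: cols_def)
  have same: "v = v'" if v: "v \<in> ?S" "v' \<in> ?S" "i < n" "v $ i \<noteq> 0" "v' $ i \<noteq> 0" for v v' i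
  proof -
    obtain k k' where k: "k < n" "k' < n" "v = col A k" "v' = col A k'" using v(1,2) unfolding cols by auto
    then have "A $$ (i, k) \<noteq> 0" "A $$ (i, k') \<noteq> 0" using v c by auto
    then show ?thesis using rook_row[OF A, of i k k'] k v(3) by simp
  qed
  have nz: "\<exists>i<n. v $ i \<noteq> 0" if "v \<in> ?S" for v
    using that S(1) by (metis DiffD2 carrier_vecD eq_vecI index_zero_vec(1,2) insertI1 subsetD)
  have "lin_indpt ?S"
  proof (rule finite_lin_indpt2[OF S(2,1)])
    fix a assume a: "lincomb a ?S = 0\<^sub>v n"
    show "\<forall>v\<in>?S. a v = 0"
    proof
      fix v assume v: "v \<in> ?S"
      then obtain i where i: "i < n" "v $ i \<noteq> 0" using nz by blast
      have "0 = (\<Sum>x\<in>?S. a x * x $ i)" using lincomb_index[OF i(1) S(1), of a] i(1) by (simp add: a)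
      also have "\<dots> = (\<Sum>x\<in>{v}. a x * x $ i)"
      proof (rule sum.mono_neutral_right[OF S(2)])
        show "\<forall>x\<in>?S - {v}. a x * x $ i = 0" using same[OF _ v i(1) _ i(2)] by (metis Diff_iff mult_zero_right singletonI)
      qed (use v in simp)
      finally show "a v = 0" using i(2) by simp
    qed
  qed
  moreover have "T = ?S" if "?S \<subseteq> T" "T \<subseteq> set (cols A)" "lin_indpt T" for T
  proof -
    have "set (cols A) \<subseteq> carrier_vec n" using cols_dim[of A] c by simp
    moreover have "(UNIV :: 'f set) \<noteq> {0}" by (metis UNIV_I singletonD zero_neq_one)
    ultimately have "0\<^sub>v n \<notin> T" using zero_nin_lin_indpt[of T] that by (auto simp: class_ring_simps)
    then show ?thesis using that by blast
  qed
  ultimately have "maximal ?S (\<lambda>T. T \<subseteq> set (cols A) \<and> lin_indpt T)"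
    unfolding maximal_def by blast
  from rank_card_indpt[OF c this] have "rank A = card ?S" .
  also have "bij_betw (\<lambda>i. col A (SOME c. c < n \<and> A $$ (i, c) \<noteq> 0)) ?R ?S"
    unfolding bij_betw_def
  proof
    have some: "(SOME c. c < n \<and> A $$ (i, c) \<noteq> 0) = c" if "i < n" "c < n" "A $$ (i, c) \<noteq> 0" for i c
    proof (rule some_equality)
      show "c' = c" if "c' < n \<and> A $$ (i, c') \<noteq> 0" for c'
        using rook_row[OF A, of i c' c] that \<open>i < n\<close> \<open>c < n\<close> \<open>A $$ (i, c) \<noteq> 0\<close> by simp
    qed (use that in simp)
    show "inj_on (\<lambda>i. col A (SOME c. c < n \<and> A $$ (i, c) \<noteq> 0)) ?R"
    proof (rule inj_onI)
      fix i j assume "i \<in> ?R" "j \<in> ?R"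
        and e: "col A (SOME c. c < n \<and> A $$ (i, c) \<noteq> 0) = col A (SOME c. c < n \<and> A $$ (j, c) \<noteq> 0)"
      then obtain k l where k: "i < n" "k < n" "A $$ (i, k) \<noteq> 0" "j < n" "l < n" "A $$ (j, l) \<noteq> 0" by blast
      then have "col A k = col A l" using e some by simp
      then have "col A k $ j = col A l $ j" by simp
      then have "A $$ (j, k) \<noteq> 0" using k c by simp
      then show "i = j" using rook_col[OF A, of k i j] k by simp
    qed
    show "(\<lambda>i. col A (SOME c. c < n \<and> A $$ (i, c) \<noteq> 0)) ` ?R = ?S"
    proof (intro equalityI subsetI)
      fix v assume "v \<in> (\<lambda>i. col A (SOME c. c < n \<and> A $$ (i, c) \<noteq> 0)) ` ?R"
      then obtain i where "i \<in> ?R" and v: "v = col A (SOME c. c < n \<and> A $$ (i, c) \<noteq> 0)" by blast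
      then obtain k where i: "i < n" "k < n" "A $$ (i, k) \<noteq> 0" by blast
      have vk: "v = col A k" unfolding v some[OF i] ..
      then have "v $ i \<noteq> 0" using c i by simp
      then have "v \<noteq> 0\<^sub>v n" using i(1) by auto
      then show "v \<in> ?S" using i(2) vk unfolding cols by simp
    next
      fix v assume v: "v \<in> ?S"
      then obtain i where i: "i < n" "v $ i \<noteq> 0" using nz by blast
      from v obtain k where k: "k < n" "v = col A k" unfolding cols by auto
      then have "A $$ (i, k) \<noteq> 0" using i c by simp
      then show "v \<in> (\<lambda>i. col A (SOME c. c < n \<and> A $$ (i, c) \<noteq> 0)) ` ?R"
        using some[OF i(1) k(1)] i k by (intro image_eqI[of _ _ i]) auto
    qed
  qed
  then have "card ?S = card ?R" by (rule bij_betw_same_card[symmetric])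
  finally show ?thesis .
qed

context framed_rook
begin

definition k_basis :: "'f mat \<Rightarrow> 'f mat \<Rightarrow> 'k" where
  "k_basis \<sigma> = (\<lambda>x. of_rat (rook_basis n \<sigma> x))"

text \<open>The letters around \<open>N^(n-r)\<close> act on sums over double cosets without
  scalars. The one scalar therefore comes from \<open>N^(n-r)\<close> itself, whose average is
  \<open>q^(-r(r-1)/2)\<close> times the sum over its double coset, and this is the coefficient in
  \<open>T_\<sigma>\<close>.\<close>

lemma ev_normal_word:
  assumes "w \<in> normal_words (CARD('f) - 1) n"
  shows "evB w = k_basis (word_mat w)"
proof -
  obtain l r v where w: "r \<le> n" "l \<in> left_words n r" "v \<in> right_words (CARD('f) - 1) (n - r) r"
    "w = l @ replicate (n - r) GenN @ v" "rows_ok n r (shift_mat n (n - r) * word_mat v)"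
    "word_mat w = word_mat l * (shift_mat n (n - r) * word_mat v)" "set l \<subseteq> ry_gens n" "set v \<subseteq> ry_gens n"
    using assms by (rule normal_wordsE)
  let ?S = "shift_mat n (n - r) :: 'f mat" and ?e = "r * (r - 1) div 2"
  let ?c = "of_nat (CARD('f) ^ ?e) :: 'k"
  have c0: "?c \<noteq> 0" by simp
  have rook: "?S * word_mat v \<in> framed_rook_mats n" by (intro rook_mult shift_rook word_mat_rook w)
  have "evB (replicate (n - r) GenN) = avg ?S"
    by (simp add: B.word_eval_replicate del: One_nat_def) (rule avg_shift_pow)
  moreover have "ind ?S = ?c \<odot>\<^bsub>dc_algebra\<^esub> avg ?S"
    using card_dc_shift[of "n - r" n, where ?'f = 'f] w(1) by (simp add: ind_avg)
  ultimately have "?c \<odot>\<^bsub>dc_algebra\<^esub> evB w = evB l \<otimes>\<^bsub>dc_algebra\<^esub> (ind ?S \<otimes>\<^bsub>dc_algebra\<^esub> evB v)"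
    by (simp add: w(4) evB_append B.smult_mult_left B.smult_mult_right)
  also have "\<dots> = ind (word_mat w)"
    using right_words_ind[OF _ w(3)] left_words_ind[OF w(2) order_refl w(5) rook] w(1,6) by simp
  finally have "evB w = (1 / ?c) \<odot>\<^bsub>dc_algebra\<^esub> ind (word_mat w)"
    using c0 B.smult_smult[of "evB w" "1 / ?c" ?c] by (simp add: B.smult_one)
  moreover have "k_basis (word_mat w) = (1 / ?c) \<odot>\<^bsub>dc_algebra\<^esub> ind (word_mat w)"
  proof -
    have W: "word_mat w \<in> framed_rook_mats n" using word_mat_rook set_normal_words assms by blast
    \<comment> \<open>The left word only permutes rows, so the rank is the number \<open>r\<close>
      of nonzero rows of the sorted matrix.\<close>
    obtain \<rho> where \<rho>: "bij_betw \<rho> {..<n} {..<n}"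
      "\<forall>A\<in>carrier_mat n n. \<forall>i<n. \<forall>j<n. (word_mat l * A) $$ (i, j) = A $$ (\<rho> i, j)"
      using word_mat_T[OF set_left_words[OF w(2)] order_refl] by blast
    have "{i. i < n \<and> (\<exists>c<n. word_mat w $$ (i, c) \<noteq> 0)} =
        {i. i < n \<and> (\<exists>c<n. (?S * word_mat v) $$ (\<rho> i, c) \<noteq> 0)}"
      using \<rho>(2) rook_carrier[OF rook] w(6) by auto
    also have "\<dots> = {i. i < n \<and> \<rho> i < r}"
    proof -
      have "(\<exists>c<n. (?S * word_mat v) $$ (\<rho> i, c) \<noteq> 0) \<longleftrightarrow> \<rho> i < r" if "i < n" for i
        using w(5) bij_betwE[OF \<rho>(1)] that unfolding rows_ok_def by (meson leI lessThan_iff)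
      then show ?thesis by blast
    qed
    also have "card \<dots> = card {..<r}"
    proof (rule bij_betw_same_card[of \<rho>], unfold bij_betw_def, intro conjI equalityI subsetI)
      show "inj_on \<rho> {i. i < n \<and> \<rho> i < r}"
        using bij_betw_imp_inj_on[OF \<rho>(1)] by (rule inj_on_subset) auto
      fix x assume "x \<in> {..<r}"
      then have "x \<in> \<rho> ` {..<n}" "x < r" using \<rho>(1) w(1) by (auto simp: bij_betw_def)
      then show "x \<in> \<rho> ` {i. i < n \<and> \<rho> i < r}" by auto
    qed auto
    finally have rank: "vec_space.rank n (word_mat w) = r" using rook_rank[OF W] by simp
    \<comment> \<open>The divisions are exact because \<open>r (r - 1)\<close> is even, so the sign
      can be taken out without a rounding error.\<close>
    have "int r * (1 - int r) div 2 = - int ?e"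
    proof -
      have "even (r * (r - 1))" by (cases r) auto
      then obtain m where m: "r * (r - 1) = 2 * m" by (rule evenE)
      have "int r * (1 - int r) = - int (r * (r - 1))" by (cases r) (simp_all add: algebra_simps)
      then show ?thesis unfolding m by simp
    qed
    then have "(of_nat CARD('f) :: rat) powi (int r * (1 - int r) div 2) = 1 / of_nat (CARD('f) ^ ?e)"
      by (simp add: power_int_minus divide_inverse)
    then have "k_basis (word_mat w) x = (if x \<in> double_coset n (word_mat w) then 1 / ?c else 0)" for x
      unfolding k_basis_def rook_basis_def rank Let_def by (simp add: of_rat_divide of_rat_power)
    then show ?thesis by (intro ext) (simp add: ind_def dc_algebra_simps monoid_algebra_simps)
  qed
  ultimately show ?thesis by simp
qed

end

section \<open>Linear and integral combinations of the \<open>T_\<sigma>\<close>\<close>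

section \<open>The span of the double coset sums\<close>

lemma monoid_algebra_induct [consumes 1, case_names zero add]:
  fixes f :: "'a \<Rightarrow> 'k::comm_ring_1"
  assumes f: "f \<in> carrier (monoid_algebra G)"
    and zero: "P (\<lambda>_. 0)"
    and add: "\<And>f c g. f \<in> carrier (monoid_algebra G) \<Longrightarrow> P f \<Longrightarrow> g \<in> carrier G \<Longrightarrow>
      P (\<lambda>y. f y + c * basis_elt g y)"
  shows "P f"
proof -
  have "P f" if "finite F" "F \<subseteq> carrier G" "{x. f x \<noteq> 0} \<subseteq> F" for F f
    using that
  proof (induction F arbitrary: f rule: finite_induct)
    case empty
    then have "f = (\<lambda>_. 0)" by auto
    then show ?case using zero by simp
  next
    case (insert x F)
    define h where "h = f(x := 0)"
    have "{y. h y \<noteq> 0} \<subseteq> F" using insert.prems by (auto simp: h_def split: if_splits)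
    moreover from this have "h \<in> carrier (monoid_algebra G)"
      using insert.prems insert.hyps(1) by (auto simp: monoid_algebra_simps intro: finite_subset)
    ultimately have "P (\<lambda>y. h y + f x * basis_elt x y)" using insert by (intro add) auto
    moreover have "(\<lambda>y. h y + f x * basis_elt x y) = f" by (auto simp: basis_elt_apply h_def)
    ultimately show ?case by simp
  qed
  then show ?thesis using f by (auto simp: monoid_algebra_simps)
qed

context framed_rook
begin

definition lin :: "('f mat \<Rightarrow> 'k) \<Rightarrow> 'f mat \<Rightarrow> 'k" where
  "lin c = (\<lambda>z. \<Sum>\<sigma>\<in>framed_rook_mats n. c \<sigma> * k_basis \<sigma> z)"

lemma k_basis_word:
  assumes "\<sigma> \<in> framed_rook_mats n"
  obtains w where "w \<in> normal_words (CARD('f) - 1) n" "k_basis \<sigma> = evB w" "\<sigma> = word_mat w"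
  using assms word_mat_bij ev_normal_word unfolding bij_betw_def by (metis imageE)

lemma k_basis_closed [simp]: "\<sigma> \<in> framed_rook_mats n \<Longrightarrow> k_basis \<sigma> \<in> carrier dc_algebra"
  by (erule k_basis_word) simp

lemma lin_finsum:
  "lin c = (\<Oplus>\<^bsub>dc_algebra\<^esub>\<sigma>\<in>framed_rook_mats n. c \<sigma> \<odot>\<^bsub>dc_algebra\<^esub> k_basis \<sigma>)"
  using finsum_dc_algebra[of "framed_rook_mats n" "\<lambda>\<sigma>. c \<sigma> \<odot>\<^bsub>dc_algebra\<^esub> k_basis \<sigma>"]
  by (simp add: finite_rook lin_def B.smult_closed) (simp add: dc_algebra_simps monoid_algebra_simps)

lemma lin_closed [simp]: "lin c \<in> carrier dc_algebra"
  unfolding lin_finsum by (intro B.finsum_closed) (auto intro: B.smult_closed)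

lemma k_basis_nonzero: "\<sigma> \<in> framed_rook_mats n \<Longrightarrow> k_basis \<sigma> \<sigma> \<noteq> 0"
  using dc_self[of \<sigma> n] rook_carrier[of \<sigma> n] q_ge_2
  by (simp add: k_basis_def rook_basis_def Let_def)

lemma k_basis_other:
  assumes "\<sigma> \<in> framed_rook_mats n" "\<tau> \<in> framed_rook_mats n" "\<sigma> \<noteq> \<tau>"
  shows "k_basis \<tau> \<sigma> = 0"
proof -
  have "\<sigma> \<notin> double_coset n \<tau>" using bruhat_unique[OF assms(2,1)] assms(3) by blast
  then show ?thesis by (simp add: k_basis_def rook_basis_def Let_def)
qed

text \<open>By \<open>bruhat_unique\<close> no other double coset of a rook matrix contains
  \<sigma>, so evaluation at \<sigma> isolates one coefficient. This is the form in which linear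
  independence is used.\<close>

lemma lin_at:
  assumes "\<sigma> \<in> framed_rook_mats n"
  shows "lin c \<sigma> = c \<sigma> * k_basis \<sigma> \<sigma>"
proof -
  have "lin c \<sigma> = (\<Sum>\<tau>\<in>{\<sigma>}. c \<tau> * k_basis \<tau> \<sigma>)"
    unfolding lin_def
  proof (rule sum.mono_neutral_right[OF finite_rook])
    show "\<forall>\<tau>\<in>framed_rook_mats n - {\<sigma>}. c \<tau> * k_basis \<tau> \<sigma> = 0"
      using k_basis_other[OF assms] by (metis Diff_iff mult_zero_right singletonI)
  qed (use assms in simp)
  then show ?thesis by simp
qed

lemma lin_eqD: "lin c = lin c' \<Longrightarrow> \<sigma> \<in> framed_rook_mats n \<Longrightarrow> c \<sigma> = c' \<sigma>"
  using lin_at[of \<sigma> c] lin_at[of \<sigma> c'] k_basis_nonzero[of \<sigma>] by simp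

lemma lin_add: "lin c \<oplus>\<^bsub>dc_algebra\<^esub> lin c' = lin (\<lambda>\<sigma>. c \<sigma> + c' \<sigma>)"
  by (simp add: dc_algebra_simps monoid_algebra_simps lin_def sum.distrib distrib_right)

lemma lin_smult: "a \<odot>\<^bsub>dc_algebra\<^esub> lin c = lin (\<lambda>\<sigma>. a * c \<sigma>)"
  by (simp add: dc_algebra_simps monoid_algebra_simps lin_def sum_distrib_left mult.assoc)

lemma lin_zero: "\<zero>\<^bsub>dc_algebra\<^esub> = lin (\<lambda>_. 0)"
  by (simp add: dc_algebra_simps monoid_algebra_simps lin_def)

lemma lin_a_inv: "\<ominus>\<^bsub>dc_algebra\<^esub> lin c = lin (\<lambda>\<sigma>. - c \<sigma>)"
  by (rule B.minus_equality) (simp_all add: lin_add lin_zero)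

lemma lin_minus: "lin c \<ominus>\<^bsub>dc_algebra\<^esub> lin c' = lin (\<lambda>\<sigma>. c \<sigma> - c' \<sigma>)"
  by (simp add: B.minus_eq lin_a_inv lin_add)

lemma lin_basis:
  assumes "\<sigma> \<in> framed_rook_mats n"
  shows "k_basis \<sigma> = lin (basis_elt \<sigma>)"
proof
  fix z
  have "lin (basis_elt \<sigma>) z = (\<Sum>\<tau>\<in>{\<sigma>}. basis_elt \<sigma> \<tau> * k_basis \<tau> z)"
    unfolding lin_def
    by (rule sum.mono_neutral_right) (use assms finite_rook in \<open>auto simp: basis_elt_apply\<close>)
  then show "k_basis \<sigma> z = lin (basis_elt \<sigma>) z" by (simp add: basis_elt_apply)
qed

abbreviation int_lin :: "('f mat \<Rightarrow> int) \<Rightarrow> 'f mat \<Rightarrow> 'k" where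
  "int_lin c \<equiv> lin (\<lambda>\<sigma>. of_int (c \<sigma>))"

lemma int_lin_basis: "\<sigma> \<in> framed_rook_mats n \<Longrightarrow> k_basis \<sigma> = int_lin (basis_elt \<sigma>)"
  unfolding lin_basis by (rule arg_cong[of _ _ lin]) (auto simp: basis_elt_apply)

lemma int_span_k_basis: "x \<in> int_span dc_algebra (k_basis ` framed_rook_mats n) \<longleftrightarrow> (\<exists>c. x = int_lin c)"
proof
  assume "x \<in> int_span dc_algebra (k_basis ` framed_rook_mats n)"
  then show "\<exists>c. x = int_lin c"
  proof induction
    case zero
    show ?case by (rule exI[of _ "\<lambda>_. 0"]) (simp add: lin_zero)
  next
    case (base x)
    then show ?case using int_lin_basis by blast
  next
    case (diff x y)
    then obtain c c' where "x = int_lin c" "y = int_lin c'" by blast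
    then show ?case by (intro exI[of _ "\<lambda>\<sigma>. c \<sigma> - c' \<sigma>"]) (simp add: lin_minus)
  qed
next
  let ?S = "k_basis ` framed_rook_mats n"
  have S: "?S \<subseteq> carrier dc_algebra" by auto
  assume "\<exists>c. x = int_lin c"
  then obtain c where x: "x = int_lin c" by blast
  have "of_int (c \<sigma>) \<odot>\<^bsub>dc_algebra\<^esub> k_basis \<sigma> \<in> int_span dc_algebra ?S" if "\<sigma> \<in> framed_rook_mats n" for \<sigma>
  proof -
    have b: "k_basis \<sigma> \<in> int_span dc_algebra ?S" using that by (intro int_span.base) simp
    have nat: "of_nat m \<odot>\<^bsub>dc_algebra\<^esub> k_basis \<sigma> \<in> int_span dc_algebra ?S" for m
      using B.int_span_add_pow[OF S b, of m] that by (simp add: B.smult_of_nat)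
    show ?thesis
    proof (cases "c \<sigma> \<ge> 0")
      case True
      then show ?thesis using nat[of "nat (c \<sigma>)"] by simp
    next
      case False
      have "\<ominus>\<^bsub>dc_algebra\<^esub> (of_nat (nat (- c \<sigma>)) \<odot>\<^bsub>dc_algebra\<^esub> k_basis \<sigma>) = of_int (c \<sigma>) \<odot>\<^bsub>dc_algebra\<^esub> k_basis \<sigma>"
        unfolding lin_basis[OF that] lin_smult lin_a_inv using False by simp
      then show ?thesis using B.int_span_minus[OF S nat[of "nat (- c \<sigma>)"]] by simp
    qed
  qed
  then show "x \<in> int_span dc_algebra ?S"
    unfolding x lin_finsum by (intro B.int_span_finsum[OF S finite_rook])
qed

text \<open>Straightening is carried out inside the algebra of matrices, where the normal words are
  the \<open>T_\<sigma>\<close>. Applied to concatenations of normal words it makes the structure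
  constants integers.\<close>

lemma ev_int_lin:
  assumes "set w \<subseteq> ry_gens n"
  shows "\<exists>c. evB w = int_lin c"
proof -
  interpret ry: ry_ring dc_algebra "CARD('f)" "CARD('f) - 1" n "total_gen dc_algebra n alg_gen"
    by (rule ry_ringI[OF B.k_algebra_axioms q_ge_2 n]) (simp, rule relations)
  have ev: "evB v = word_eval dc_algebra (total_gen dc_algebra n alg_gen) v" if "set v \<subseteq> ry_gens n" for v
    by (rule word_eval_cong) (use that in \<open>auto simp: total_gen_def\<close>)
  have "evB w \<in> int_span dc_algebra (word_eval dc_algebra (total_gen dc_algebra n alg_gen) `
      normal_words (CARD('f) - 1) n)"
    using ry.ev_normal_words[OF n assms] ev[OF assms] by simp
  also have "word_eval dc_algebra (total_gen dc_algebra n alg_gen) ` normal_words (CARD('f) - 1) n =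
      evB ` normal_words (CARD('f) - 1) n"
    by (rule image_cong[OF refl], rule ev[symmetric], rule set_normal_words)
  also have "\<dots> = k_basis ` word_mat ` normal_words (CARD('f) - 1) n"
    unfolding image_image by (rule image_cong[OF refl], rule ev_normal_word)
  also have "word_mat ` normal_words (CARD('f) - 1) n = framed_rook_mats n"
    using word_mat_bij by (simp add: bij_betw_def)
  finally show ?thesis unfolding int_span_k_basis .
qed

lemma one_int_lin: "\<exists>c. \<one>\<^bsub>dc_algebra\<^esub> = int_lin c"
  using ev_int_lin[of "[]"] by simp

text \<open>The empty word is normal, with \<open>r = n\<close>.\<close>

lemma one_k_basis: "\<one>\<^bsub>dc_algebra\<^esub> = k_basis (1\<^sub>m n)"
proof -
  have "[] \<in> right_words d 0 j" if "d > 0" for d j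
  proof (induction j)
    case (Suc j)
    then have "[] = [] @ replicate 0 (GenF (Suc (0 + j))) @ run (Suc (0 + j)) (Suc j) \<and>
        [] \<in> right_words d 0 j \<and> Suc j \<in> {1..Suc (0 + j)} \<and> 0 < d"
      using that by simp
    then show ?case unfolding right_words.simps by blast
  qed simp
  moreover have "CARD('f) - 1 > 0" using q_ge_2 by simp
  ultimately have "[] \<in> normal_words (CARD('f) - 1) n"
    unfolding normal_words_def using left_words_full[of n] by (auto intro!: exI[of _ n])
  from ev_normal_word[OF this] show ?thesis by simp
qed

lemma int_lin_mult: "\<exists>c''. int_lin c \<otimes>\<^bsub>dc_algebra\<^esub> int_lin c' = int_lin c''"
proof -
  let ?S = "k_basis ` framed_rook_mats n"
  have S: "?S \<subseteq> carrier dc_algebra" by auto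
  have basis: "k_basis \<sigma> \<otimes>\<^bsub>dc_algebra\<^esub> k_basis \<tau> \<in> int_span dc_algebra ?S"
    if \<sigma>: "\<sigma> \<in> framed_rook_mats n" and \<tau>: "\<tau> \<in> framed_rook_mats n" for \<sigma> \<tau>
  proof -
    obtain v w where v: "v \<in> normal_words (CARD('f) - 1) n" "k_basis \<sigma> = evB v"
      and w: "w \<in> normal_words (CARD('f) - 1) n" "k_basis \<tau> = evB w"
      using k_basis_word[OF \<sigma>] k_basis_word[OF \<tau>] by metis
    have "set (v @ w) \<subseteq> ry_gens n" using set_normal_words[OF v(1)] set_normal_words[OF w(1)] by simp
    from ev_int_lin[OF this] show ?thesis unfolding int_span_k_basis by (simp add: v(2) w(2) evB_append)
  qed
  have c: "int_lin c \<in> int_span dc_algebra ?S" "int_lin c' \<in> int_span dc_algebra ?S"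
    unfolding int_span_k_basis by blast+
  have "int_lin c \<otimes>\<^bsub>dc_algebra\<^esub> int_lin c' \<in> int_span dc_algebra ?S"
  proof (rule B.int_span_mult_left[OF S lin_closed c(2)])
    fix x assume x: "x \<in> ?S"
    show "int_lin c \<otimes>\<^bsub>dc_algebra\<^esub> x \<in> int_span dc_algebra ?S"
      by (rule B.int_span_mult_right[OF S _ c(1)]) (use x S basis in auto)
  qed
  then show ?thesis unfolding int_span_k_basis .
qed

end

lemma framed_rook_algebra_ring:
  assumes "framed_rook n (g :: 'f::{field,finite})"
  shows "ring (framed_rook_algebra n :: ('f mat \<Rightarrow> rat) ring)"
    and "\<one>\<^bsub>framed_rook_algebra n\<^esub> = (rook_basis n (1\<^sub>m n :: 'f mat))"
proof -
  \<comment> \<open>Over the rationals \<open>k_basis\<close> is \<open>rook_basis\<close> itself,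
    and the integral combinations form a subring of the corner.\<close>
  interpret framed_rook n g "TYPE(rat)" by fact
  let ?C = "{x. \<exists>c. x = int_lin c}"
  have basis: "k_basis = rook_basis n" by (intro ext) (simp add: k_basis_def)
  have "subring ?C dc_algebra"
  proof (rule B.subringI)
    show "?C \<subseteq> carrier dc_algebra" by auto
    show "\<one>\<^bsub>dc_algebra\<^esub> \<in> ?C" using one_int_lin by blast
    fix x y assume "x \<in> ?C" "y \<in> ?C"
    then obtain c c' where c: "x = int_lin c" "y = int_lin c'" by blast
    show "\<ominus>\<^bsub>dc_algebra\<^esub> x \<in> ?C" unfolding c by (auto simp: lin_a_inv intro!: exI[of _ "\<lambda>\<sigma>. - c \<sigma>"])
    show "x \<otimes>\<^bsub>dc_algebra\<^esub> y \<in> ?C" unfolding c using int_lin_mult by blast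
    show "x \<oplus>\<^bsub>dc_algebra\<^esub> y \<in> ?C" unfolding c
      by (auto simp: lin_add intro!: exI[of _ "\<lambda>\<sigma>. c \<sigma> + c' \<sigma>"])
  qed
  then have "ring (dc_algebra\<lparr>carrier := ?C\<rparr>)" by (rule B.subring_is_ring)
  then show "ring (framed_rook_algebra n :: ('f mat \<Rightarrow> rat) ring)"
    by (rule ring_carrier_cong)
      (auto simp: framed_rook_algebra_def matrix_monoid_algebra_def dc_algebra_simps lin_def basis
        one_k_basis[unfolded dc_algebra_simps])
qed (simp add: framed_rook_algebra_def)

section \<open>Quotients and isomorphisms that respect scalars\<close>

section \<open>Quotient algebras\<close>

text \<open>The two algebras of the theorem are never mapped to each other directly; each is
  identified with the span of the \<open>T_\<sigma>\<close>, and one identification is composed with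
  the inverse of the other.\<close>

lemma is_algebra_iso_common_target:
  assumes A: "ring A" and A': "ring A'" and f: "f \<in> ring_iso A C" and g: "g \<in> ring_iso A' C"
    and fs: "\<And>c x. x \<in> carrier A \<Longrightarrow> c \<odot>\<^bsub>A\<^esub> x \<in> carrier A \<and> f (c \<odot>\<^bsub>A\<^esub> x) = c \<odot>\<^bsub>C\<^esub> f x"
    and gs: "\<And>c x. x \<in> carrier A' \<Longrightarrow> c \<odot>\<^bsub>A'\<^esub> x \<in> carrier A' \<and> g (c \<odot>\<^bsub>A'\<^esub> x) = c \<odot>\<^bsub>C\<^esub> g x"
  shows "is_algebra_iso A A'"
proof -
  let ?g = "inv_into (carrier A') g"
  have iso: "?g \<circ> f \<in> ring_iso A A'"
    by (rule ring_iso_set_trans[OF f ring_iso_set_sym[OF A' g]])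
  have fC: "f x \<in> carrier C" if "x \<in> carrier A" for x
    using f that by (auto simp: ring_iso_def ring_hom_closed)
  have bij: "bij_betw g (carrier A') (carrier C)" using g by (simp add: ring_iso_def)
  have "(?g \<circ> f) (c \<odot>\<^bsub>A\<^esub> x) = c \<odot>\<^bsub>A'\<^esub> (?g \<circ> f) x" if x: "x \<in> carrier A" for c x
  proof -
    have gx: "?g (f x) \<in> carrier A'" "g (?g (f x)) = f x"
      using bij fC[OF x] by (auto simp: bij_betw_def inv_into_into f_inv_into_f)
    have "f (c \<odot>\<^bsub>A\<^esub> x) = g (c \<odot>\<^bsub>A'\<^esub> ?g (f x))"
      using fs[OF x] gs[OF gx(1)] gx(2) by simp
    moreover have "?g (g (c \<odot>\<^bsub>A'\<^esub> ?g (f x))) = c \<odot>\<^bsub>A'\<^esub> ?g (f x)"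
      using gs[OF gx(1)] by (intro bij_betw_inv_into_left[OF bij]) simp
    ultimately show ?thesis by simp
  qed
  then show ?thesis
    using iso unfolding is_algebra_iso_def algebra_iso_def by blast
qed

lemma (in k_algebra) ideal_smult:
  assumes "ideal I A" "x \<in> I"
  shows "c \<odot> x \<in> I"
proof -
  have "x \<in> carrier A" using assms by (rule ideal.Icarr)
  then have "c \<odot> x = (c \<odot> \<one>) \<otimes> x" by (simp add: smult_mult_left)
  then show ?thesis using ideal.I_l_closed[OF assms(1,2)] by simp
qed

text \<open>An ideal is stable under scalars, since \<open>c x = (c 1) x\<close>. Hence the union
  over representatives in \<open>quotient_algebra\<close> collapses to a single coset.\<close>

lemma (in k_algebra) quotient_smult:
  assumes I: "ideal I A" and a: "a \<in> carrier A"
  shows "c \<odot>\<^bsub>quotient_algebra A I\<^esub> (I +> a) = I +> (c \<odot> a)"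
proof -
  interpret I: ideal I A by (rule I)
  have "I +> (c \<odot> x) = I +> (c \<odot> a)" if x: "x \<in> I +> a" for x
  proof -
    have xc: "x \<in> carrier A" using a_r_coset_subset_G[OF I.a_subset a] x by blast
    have "I +> x = I +> a" using I.a_repr_independence'[OF x a] by simp
    then have "x \<ominus> a \<in> I" using quotient_eq_iff_same_a_r_cos[OF I xc a] by simp
    then have "c \<odot> (x \<ominus> a) \<in> I" by (rule ideal_smult[OF I])
    also have "c \<odot> (x \<ominus> a) = c \<odot> x \<ominus> c \<odot> a"
      using xc a by (simp add: minus_eq smult_r_distr smult_minus)
    finally show ?thesis using quotient_eq_iff_same_a_r_cos[OF I] xc a by simp
  qed
  moreover have "I +> a \<noteq> {}" using I.a_rcos_self[OF a] by blast
  ultimately have "(\<Union>x\<in>I +> a. I +> (c \<odot> x)) = I +> (c \<odot> a)" by (intro SUP_eq_const)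
  then show ?thesis by (simp add: quotient_algebra_def)
qed

lemma quotient_algebra_simps:
  "carrier (quotient_algebra A I) = carrier (A Quot I)" "mult (quotient_algebra A I) = mult (A Quot I)"
  "one (quotient_algebra A I) = one (A Quot I)" "zero (quotient_algebra A I) = zero (A Quot I)"
  "add (quotient_algebra A I) = add (A Quot I)"
  by (simp_all add: quotient_algebra_def)

lemma carrier_FactRing: "carrier (R Quot I) = (\<lambda>a. I +>\<^bsub>R\<^esub> a) ` carrier R"
  by (auto simp: FactRing_simps)

lemma ring_quotient_algebra: "ideal I A \<Longrightarrow> ring (quotient_algebra A I)"
  by (rule ring_carrier_cong[OF ideal.quotient_is_ring]) (simp_all add: quotient_algebra_simps)

lemma ring_hom_quotient_algebra:
  "Ring.ring_hom R (quotient_algebra A I) = Ring.ring_hom R (A Quot I)"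
  by (simp add: Ring.ring_hom_def quotient_algebra_simps)

lemma (in k_algebra) quotient_k_algebra:
  assumes I: "ideal I A"
  shows "k_algebra (quotient_algebra A I)"
proof -
  interpret I: ideal I A by (rule I)
  let ?Q = "quotient_algebra A I"
  note hom = ring_hom_memE[OF I.rcos_ring_hom[folded ring_hom_quotient_algebra]]
  note sm = quotient_smult[OF I]
  have rep: "\<exists>a\<in>carrier A. X = I +> a" if "X \<in> carrier ?Q" for X
    using that by (auto simp: quotient_algebra_simps carrier_FactRing)
  show ?thesis
  proof (rule k_algebra.intro[OF ring_quotient_algebra[OF I]], unfold_locales)
    fix X Y a b c
    assume "X \<in> carrier ?Q"
    then obtain x where x: "x \<in> carrier A" "X = I +> x" using rep by blast
    show "c \<odot>\<^bsub>?Q\<^esub> X \<in> carrier ?Q" using x hom(1) by (simp add: sm)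
    show "(a + b) \<odot>\<^bsub>?Q\<^esub> X = a \<odot>\<^bsub>?Q\<^esub> X \<oplus>\<^bsub>?Q\<^esub> b \<odot>\<^bsub>?Q\<^esub> X"
      using x by (simp add: sm smult_l_distr hom(3)[symmetric])
    show "a \<odot>\<^bsub>?Q\<^esub> (b \<odot>\<^bsub>?Q\<^esub> X) = (a * b) \<odot>\<^bsub>?Q\<^esub> X" using x by (simp add: sm smult_smult)
    show "1 \<odot>\<^bsub>?Q\<^esub> X = X" using x by (simp add: sm smult_one)
    assume "Y \<in> carrier ?Q"
    then obtain y where y: "y \<in> carrier A" "Y = I +> y" using rep by blast
    show "a \<odot>\<^bsub>?Q\<^esub> (X \<oplus>\<^bsub>?Q\<^esub> Y) = a \<odot>\<^bsub>?Q\<^esub> X \<oplus>\<^bsub>?Q\<^esub> a \<odot>\<^bsub>?Q\<^esub> Y"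
      using x y by (simp add: sm smult_r_distr hom(3)[symmetric])
    show "a \<odot>\<^bsub>?Q\<^esub> X \<otimes>\<^bsub>?Q\<^esub> Y = a \<odot>\<^bsub>?Q\<^esub> (X \<otimes>\<^bsub>?Q\<^esub> Y)"
      using x y by (simp add: sm smult_mult_left hom(2)[symmetric])
    show "X \<otimes>\<^bsub>?Q\<^esub> (a \<odot>\<^bsub>?Q\<^esub> Y) = a \<odot>\<^bsub>?Q\<^esub> (X \<otimes>\<^bsub>?Q\<^esub> Y)"
      using x y by (simp add: sm smult_mult_right hom(2)[symmetric])
  qed
qed

lemma quotient_k_algebra_hom:
  fixes A :: "('k::field_char_0, 'a) module"
  assumes "k_algebra A" "ideal I A"
  shows "k_algebra_hom A (quotient_algebra A I) (\<lambda>a. I +>\<^bsub>A\<^esub> a)"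
proof (intro k_algebra_hom.intro k_algebra_hom_axioms.intro)
  interpret k_algebra A by fact
  show "k_algebra A" "k_algebra (quotient_algebra A I)" using assms quotient_k_algebra by blast+
  show "(+>\<^bsub>A\<^esub>) I \<in> Ring.ring_hom A (quotient_algebra A I)"
    unfolding ring_hom_quotient_algebra by (rule ideal.rcos_ring_hom[OF assms(2)])
  show "I +>\<^bsub>A\<^esub> (c \<odot>\<^bsub>A\<^esub> x) = c \<odot>\<^bsub>quotient_algebra A I\<^esub> (I +>\<^bsub>A\<^esub> x)" if "x \<in> carrier A" for x c
    using quotient_smult[OF assms(2) that] ..
qed

section \<open>The presented algebra and its embedding into the algebra of matrices\<close>

section \<open>The presented algebra\<close>

lemma free_monoid: "monoid (free_monoid S)"
  by (rule monoidI) (auto simp: free_monoid_def)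

lemma ry_free_k_algebra: "k_algebra (ry_free n :: ('k::field_char_0, ry_gen list \<Rightarrow> 'k) module)"
  unfolding ry_free_def by (rule monoid_algebra_k_algebra[OF free_monoid])

lemma ry_free_basis: "w \<in> lists (ry_gens n) \<Longrightarrow> basis_elt w \<in> carrier (ry_free n)"
  unfolding ry_free_def by (rule basis_elt_closed) (simp add: free_monoid_def)

context framed_rook
begin

declare One_nat_def [simp del]

abbreviation Fr :: "('k, ry_gen list \<Rightarrow> 'k) module" where "Fr \<equiv> ry_free n"
abbreviation Rel :: "nat \<Rightarrow> (ry_gen list \<Rightarrow> 'k) set" where "Rel q \<equiv> ry_ideal (q - 1) n (of_nat q)"
abbreviation RY :: "nat \<Rightarrow> ('k, (ry_gen list \<Rightarrow> 'k) set) module" where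
  "RY q \<equiv> rook_yokonuma_hecke (q - 1) n (of_nat q)"

sublocale Fr: k_algebra Fr
  by (rule ry_free_k_algebra)

definition ry_hom :: "(ry_gen list \<Rightarrow> 'k) \<Rightarrow> 'f mat \<Rightarrow> 'k" where
  "ry_hom = lift_hom (\<lambda>x. x) evB"

sublocale ry: k_algebra_hom Fr dc_algebra ry_hom
proof
  show "ry_hom \<in> Ring.ring_hom Fr dc_algebra"
    unfolding ry_hom_def ry_free_def
    by (rule lift_hom_ring_hom[OF comm_ring_hom_id free_monoid B.k_algebra_axioms, where G' = "ring_mat TYPE('f) n ()"])
      (simp_all add: dc_algebra_simps[symmetric] dc_algebra_carrier free_monoid_def evB_append
        flip: dc_algebra_simps)
  show "ry_hom (c \<odot>\<^bsub>Fr\<^esub> x) = c \<odot>\<^bsub>dc_algebra\<^esub> ry_hom x" if "x \<in> carrier Fr" for c x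
  proof
    fix z
    have fin: "finite {w. x w \<noteq> 0}" using that by (simp add: ry_free_def monoid_algebra_simps)
    show "ry_hom (c \<odot>\<^bsub>Fr\<^esub> x) z = (c \<odot>\<^bsub>dc_algebra\<^esub> ry_hom x) z"
      unfolding ry_hom_def ry_free_def dc_algebra_simps monoid_algebra_simps
      by (subst (1 2) lift_hom_eq[OF comm_ring_hom_id fin]) (auto simp: sum_distrib_left mult.assoc)
  qed
qed

abbreviation "gen_elt x \<equiv> (basis_elt [x] :: ry_gen list \<Rightarrow> 'k)"

lemma ry_hom_basis: "ry_hom (basis_elt w) = evB w"
  unfolding ry_hom_def by (rule lift_hom_basis[OF comm_ring_hom_id])

lemma gen_elt_closed: "x \<in> ry_gens n \<Longrightarrow> gen_elt x \<in> carrier Fr"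
  by (rule ry_free_basis) simp

lemma relations_carrier:
  assumes "(l, r) \<in> ry_relations (CARD('f) - 1) n (of_nat CARD('f)) Fr
    (\<lambda>i. gen_elt (GenT i)) (\<lambda>i. gen_elt (GenF i)) (gen_elt GenN)"
  shows "l \<in> carrier Fr" "r \<in> carrier Fr" "ry_hom l = ry_hom r"
proof -
  note h = ry.ry_relations_hom[where gen = gen_elt, OF n gen_elt_closed assms]
  then show "l \<in> carrier Fr" "r \<in> carrier Fr" by blast+
  show "ry_hom l = ry_hom r"
    by (rule relations) (use h in \<open>simp add: ry_hom_basis\<close>)
qed

lemma relators_carrier:
  "{l \<ominus>\<^bsub>Fr\<^esub> r | l r. (l, r) \<in> ry_relations (CARD('f) - 1) n (of_nat CARD('f)) Fr
    (\<lambda>i. gen_elt (GenT i)) (\<lambda>i. gen_elt (GenF i)) (gen_elt GenN)} \<subseteq> carrier Fr"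
proof clarify
  fix l r assume "(l, r) \<in> ry_relations (CARD('f) - 1) n (of_nat CARD('f)) Fr
    (\<lambda>i. gen_elt (GenT i)) (\<lambda>i. gen_elt (GenF i)) (gen_elt GenN)"
  from relations_carrier(1,2)[OF this] show "l \<ominus>\<^bsub>Fr\<^esub> r \<in> carrier Fr" by simp
qed

lemma Rel_ideal: "ideal (Rel CARD('f)) Fr"
  unfolding ry_ideal_def by (rule Fr.genideal_ideal[OF relators_carrier])

lemma Rel_kernel: "Rel CARD('f) \<subseteq> a_kernel Fr dc_algebra ry_hom"
  unfolding ry_ideal_def
proof (rule Fr.genideal_minimal[OF ry.kernel_is_ideal], clarify)
  fix l r assume "(l, r) \<in> ry_relations (CARD('f) - 1) n (of_nat CARD('f)) Fr
    (\<lambda>i. gen_elt (GenT i)) (\<lambda>i. gen_elt (GenF i)) (gen_elt GenN)"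
  note lr = relations_carrier[OF this]
  then show "l \<ominus>\<^bsub>Fr\<^esub> r \<in> a_kernel Fr dc_algebra ry_hom"
    unfolding a_kernel_def' by (simp add: Fr.minus_eq B.r_neg)
qed

text \<open>A section of \<open>ry_hom\<close> over the span of the \<open>T_\<sigma>\<close>: the
  coefficient of \<sigma> is placed on the normal word of \<sigma>.\<close>

definition normal_form :: "('f mat \<Rightarrow> 'k) \<Rightarrow> ry_gen list \<Rightarrow> 'k" where
  "normal_form c = (\<lambda>w. if w \<in> normal_words (CARD('f) - 1) n then c (word_mat w) else 0)"

lemma finite_normal_words: "finite (normal_words (CARD('f) - 1) n)"
  using bij_betw_finite[OF word_mat_bij] finite_rook by blast

lemma normal_form_closed: "normal_form c \<in> carrier Fr"
proof -
  have "{w. normal_form c w \<noteq> 0} \<subseteq> normal_words (CARD('f) - 1) n" by (auto simp: normal_form_def)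
  then show ?thesis
    using finite_normal_words set_normal_words finite_subset
    by (auto simp: ry_free_def monoid_algebra_simps free_monoid_def normal_form_def)
qed

lemma ry_hom_normal_form: "ry_hom (normal_form c) = lin c"
proof
  fix z
  have "ry_hom (normal_form c) z = (\<Sum>w\<in>normal_words (CARD('f) - 1) n. normal_form c w * evB w z)"
    unfolding ry_hom_def
    by (rule lift_hom_eq[OF comm_ring_hom_id finite_normal_words]) (auto simp: normal_form_def)
  also have "\<dots> = (\<Sum>w\<in>normal_words (CARD('f) - 1) n. c (word_mat w) * k_basis (word_mat w) z)"
    by (rule sum.cong) (auto simp: normal_form_def ev_normal_word)
  also have "\<dots> = lin c z"
    unfolding lin_def by (rule sum.reindex_bij_betw[OF word_mat_bij])
  finally show "ry_hom (normal_form c) z = lin c z" .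
qed

lemma Fr_minus: "x \<in> carrier Fr \<Longrightarrow> y \<in> carrier Fr \<Longrightarrow> x \<ominus>\<^bsub>Fr\<^esub> y = (\<lambda>w. x w - y w)"
  unfolding ry_free_def by (rule monoid_algebra_minus[OF free_monoid])

text \<open>Straightening is carried out in the quotient, which satisfies the relations by
  construction; the resulting combination of normal words is then lifted to the free
  algebra.\<close>

lemma word_normal_form:
  assumes "set w \<subseteq> ry_gens n"
  shows "\<exists>c. basis_elt w \<ominus>\<^bsub>Fr\<^esub> normal_form c \<in> Rel CARD('f)"
proof -
  let ?Q = "quotient_algebra Fr (Rel CARD('f))" and ?\<pi> = "\<lambda>x. Rel CARD('f) +>\<^bsub>Fr\<^esub> x"
  interpret \<pi>: k_algebra_hom Fr ?Q ?\<pi>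
    by (rule quotient_k_algebra_hom[OF Fr.k_algebra_axioms Rel_ideal])
  let ?gen = "total_gen ?Q n (\<lambda>x. ?\<pi> (gen_elt x))"
  interpret ry: ry_ring ?Q "CARD('f)" "CARD('f) - 1" n ?gen
  proof (rule ry_ringI[OF \<pi>.B.k_algebra_axioms q_ge_2 n])
    fix X Y assume "(X, Y) \<in> ry_relations (CARD('f) - 1) n (of_nat CARD('f)) ?Q
      (\<lambda>i. ?\<pi> (gen_elt (GenT i))) (\<lambda>i. ?\<pi> (gen_elt (GenF i))) (?\<pi> (gen_elt GenN))"
    from \<pi>.ry_relations_hom_preimage[where gen = gen_elt, OF n gen_elt_closed this]
    obtain l r where lr: "(l, r) \<in> ry_relations (CARD('f) - 1) n (of_nat CARD('f)) Fr
      (\<lambda>i. gen_elt (GenT i)) (\<lambda>i. gen_elt (GenF i)) (gen_elt GenN)" "X = ?\<pi> l" "Y = ?\<pi> r" by blast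
    have "l \<ominus>\<^bsub>Fr\<^esub> r \<in> Rel CARD('f)"
      unfolding ry_ideal_def
      by (rule subsetD[OF Fr.genideal_self[OF relators_carrier]]) (use lr(1) in blast)
    then show "X = Y"
      unfolding lr(2,3) using Fr.quotient_eq_iff_same_a_r_cos[OF Rel_ideal relations_carrier(1,2)[OF lr(1)]] by simp
  qed (use gen_elt_closed \<pi>.hom_closed in blast)
  have ev: "word_eval ?Q ?gen v = ?\<pi> (basis_elt v)" if "set v \<subseteq> ry_gens n" for v
    using that
  proof (induction v)
    case Nil
    have "?\<pi> \<one>\<^bsub>Fr\<^esub> = \<one>\<^bsub>?Q\<^esub>" by simp
    then show ?case by (simp add: ry_free_def monoid_algebra_simps free_monoid_def)
  next
    case (Cons x v)
    have "basis_elt (x # v) = gen_elt x \<otimes>\<^bsub>Fr\<^esub> basis_elt v"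
      unfolding ry_free_def basis_elt_mult by (simp add: free_monoid_def)
    moreover have "basis_elt v \<in> carrier Fr" "gen_elt x \<in> carrier Fr"
      using Cons.prems by (auto intro!: ry_free_basis)
    ultimately show ?case using Cons by (simp add: total_gen_def)
  qed
  have "?\<pi> (basis_elt w) \<in> int_span ?Q (word_eval ?Q ?gen ` normal_words (CARD('f) - 1) n)"
    using ry.ev_normal_words[OF n assms] ev[OF assms] by simp
  then have "\<exists>c. ?\<pi> (basis_elt w) = ?\<pi> (normal_form c)"
  proof induction
    case zero
    have "normal_form (\<lambda>_. 0) = \<zero>\<^bsub>Fr\<^esub>" by (auto simp: normal_form_def ry_free_def monoid_algebra_simps)
    then show ?case using \<pi>.hom_zero by metis
  next
    case (base X)
    then obtain v where v: "v \<in> normal_words (CARD('f) - 1) n" "X = word_eval ?Q ?gen v" by blast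
    have "basis_elt v = normal_form (basis_elt (word_mat v))"
      using v(1) inj_on_eq_iff[OF bij_betw_imp_inj_on[OF word_mat_bij], of _ v]
      by (auto simp: normal_form_def basis_elt_apply fun_eq_iff)
    then show ?case using v ev set_normal_words by metis
  next
    case (diff X Y)
    then obtain c c' where X: "X = ?\<pi> (normal_form c)" "Y = ?\<pi> (normal_form c')" by blast
    have "normal_form c \<ominus>\<^bsub>Fr\<^esub> normal_form c' = normal_form (\<lambda>\<sigma>. c \<sigma> - c' \<sigma>)"
      unfolding Fr_minus[OF normal_form_closed normal_form_closed] by (auto simp: normal_form_def)
    moreover have "X \<ominus>\<^bsub>?Q\<^esub> Y = ?\<pi> (normal_form c \<ominus>\<^bsub>Fr\<^esub> normal_form c')"
      unfolding X using normal_form_closed by (simp add: Fr.minus_eq \<pi>.B.minus_eq)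
    ultimately show ?case by auto
  qed
  moreover have "basis_elt w \<in> carrier Fr" using assms by (intro ry_free_basis) auto
  ultimately show ?thesis
    using Fr.quotient_eq_iff_same_a_r_cos[OF Rel_ideal _ normal_form_closed] by blast
qed

lemma ry_normal_form:
  assumes "x \<in> carrier Fr"
  shows "\<exists>c. x \<ominus>\<^bsub>Fr\<^esub> normal_form c \<in> Rel CARD('f)"
proof -
  interpret Rel: ideal "Rel CARD('f)" Fr by (rule Rel_ideal)
  have "\<exists>c. (\<lambda>w. x w - normal_form c w) \<in> Rel CARD('f)"
    using assms unfolding ry_free_def
  proof (induction rule: monoid_algebra_induct)
    case zero
    have "(\<lambda>w. 0) = \<zero>\<^bsub>Fr\<^esub>" by (simp add: ry_free_def monoid_algebra_simps)
    then have "(\<lambda>w. 0) \<in> Rel CARD('f)" using Rel.zero_closed by metis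
    then show ?case by (intro exI[of _ "\<lambda>_. 0"]) (simp add: normal_form_def)
  next
    case (add f a v)
    then have v: "set v \<subseteq> ry_gens n" "v \<in> lists (ry_gens n)" by (auto simp: free_monoid_def)
    obtain c where c: "(\<lambda>w. f w - normal_form c w) \<in> Rel CARD('f)" using add by blast
    obtain c' where "basis_elt v \<ominus>\<^bsub>Fr\<^esub> normal_form c' \<in> Rel CARD('f)" using word_normal_form[OF v(1)] by blast
    from Fr.ideal_smult[OF Rel_ideal this, of a]
    have "(\<lambda>w. a * (basis_elt v w - normal_form c' w)) \<in> Rel CARD('f)"
      unfolding Fr_minus[OF ry_free_basis[OF v(2)] normal_form_closed]
      by (simp add: ry_free_def monoid_algebra_simps)
    from Rel.a_closed[OF c this]
    have "(\<lambda>w. f w - normal_form c w + a * (basis_elt v w - normal_form c' w)) \<in> Rel CARD('f)"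
      by (simp add: ry_free_def monoid_algebra_simps)
    also have "(\<lambda>w. f w - normal_form c w + a * (basis_elt v w - normal_form c' w)) =
        (\<lambda>w. f w + a * basis_elt v w - normal_form (\<lambda>\<sigma>. c \<sigma> + a * c' \<sigma>) w)"
      by (auto simp: normal_form_def algebra_simps)
    finally show ?case by blast
  qed
  then show ?thesis using Fr_minus[OF assms normal_form_closed] by simp
qed

text \<open>Modulo the relators \<open>x\<close> is a normal form, which \<open>ry_hom\<close> sends
  to \<open>lin c\<close>. Linear independence makes \<open>c\<close> vanish on rook matrices, so
  \<open>x\<close> itself lies in the ideal.\<close>

lemma ry_kernel: "a_kernel Fr dc_algebra ry_hom = Rel CARD('f)"
proof (rule equalityI[OF subsetI Rel_kernel])
  interpret Rel: ideal "Rel CARD('f)" Fr by (rule Rel_ideal)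
  fix x assume "x \<in> a_kernel Fr dc_algebra ry_hom"
  then have x: "x \<in> carrier Fr" "ry_hom x = \<zero>\<^bsub>dc_algebra\<^esub>" unfolding a_kernel_def' by blast+
  obtain c where c: "x \<ominus>\<^bsub>Fr\<^esub> normal_form c \<in> Rel CARD('f)" using ry_normal_form[OF x(1)] by blast
  then have "ry_hom (x \<ominus>\<^bsub>Fr\<^esub> normal_form c) = \<zero>\<^bsub>dc_algebra\<^esub>"
    using Rel_kernel unfolding a_kernel_def' by blast
  then have "lin (\<lambda>\<sigma>. - c \<sigma>) = lin (\<lambda>_. 0)"
    using x normal_form_closed by (simp add: Fr.minus_eq ry_hom_normal_form lin_a_inv lin_zero lin_add)
  from lin_eqD[OF this] have "c \<sigma> = 0" if "\<sigma> \<in> framed_rook_mats n" for \<sigma> using that by simp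
  then have nf: "normal_form c = (\<lambda>_. 0)"
    using bij_betwE[OF word_mat_bij] by (auto simp: normal_form_def)
  have "x \<ominus>\<^bsub>Fr\<^esub> normal_form c = x" unfolding Fr_minus[OF x(1) normal_form_closed] by (simp add: nf)
  then show "x \<in> Rel CARD('f)" using c by simp
qed

lemma ry_image: "ry_hom ` carrier Fr = range lin"
proof (intro equalityI subsetI)
  fix y assume "y \<in> ry_hom ` carrier Fr"
  then obtain x where x: "x \<in> carrier Fr" "y = ry_hom x" by blast
  obtain c where c: "x \<ominus>\<^bsub>Fr\<^esub> normal_form c \<in> Rel CARD('f)" using ry_normal_form[OF x(1)] by blast
  then have "Rel CARD('f) +>\<^bsub>Fr\<^esub> x = Rel CARD('f) +>\<^bsub>Fr\<^esub> normal_form c"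
    using Fr.quotient_eq_iff_same_a_r_cos[OF Rel_ideal x(1) normal_form_closed] by simp
  then have "ry_hom x = ry_hom (normal_form c)"
    using ry.the_elem_simp[OF x(1)] ry.the_elem_simp[OF normal_form_closed] by (simp add: ry_kernel)
  then show "y \<in> range lin" by (simp add: x(2) ry_hom_normal_form)
next
  fix y assume "y \<in> range lin"
  then obtain c where "y = lin c" by blast
  then show "y \<in> ry_hom ` carrier Fr"
    using ry_hom_normal_form normal_form_closed by (intro image_eqI[of _ _ "normal_form c"]) simp_all
qed

definition span_algebra :: "('k, 'f mat \<Rightarrow> 'k) module" where
  "span_algebra = dc_algebra\<lparr>carrier := range lin\<rparr>"

theorem ry_iso:
  defines "\<phi> \<equiv> \<lambda>X. the_elem (ry_hom ` X)"
  shows "\<phi> \<in> ring_iso (RY CARD('f)) span_algebra"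
    and "\<And>c X. X \<in> carrier (RY CARD('f)) \<Longrightarrow>
      c \<odot>\<^bsub>RY CARD('f)\<^esub> X
        \<in> carrier (RY CARD('f)) \<and>
      \<phi> (c \<odot>\<^bsub>RY CARD('f)\<^esub> X) = c \<odot>\<^bsub>span_algebra\<^esub> \<phi> X"
proof -
  have "\<phi> \<in> ring_iso (Fr Quot (Rel CARD('f))) (dc_algebra\<lparr>carrier := range lin\<rparr>)"
    using ry.FactRing_iso_set_aux unfolding ry_kernel ry_image \<phi>_def .
  then show "\<phi> \<in> ring_iso (RY CARD('f)) span_algebra"
    by (simp add: ring_iso_def Ring.ring_hom_def rook_yokonuma_hecke_def quotient_algebra_simps span_algebra_def)
  fix c X assume "X \<in> carrier (RY CARD('f))"
  then obtain x where x: "x \<in> carrier Fr" "X = Rel CARD('f) +>\<^bsub>Fr\<^esub> x"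
    by (auto simp: rook_yokonuma_hecke_def quotient_algebra_simps carrier_FactRing)
  have \<phi>: "\<phi> (Rel CARD('f) +>\<^bsub>Fr\<^esub> y) = ry_hom y" if "y \<in> carrier Fr" for y
    using ry.the_elem_simp[OF that] unfolding ry_kernel \<phi>_def .
  show "c \<odot>\<^bsub>RY CARD('f)\<^esub> X
      \<in> carrier (RY CARD('f)) \<and>
    \<phi> (c \<odot>\<^bsub>RY CARD('f)\<^esub> X) = c \<odot>\<^bsub>span_algebra\<^esub> \<phi> X"
    using x Fr.quotient_smult[OF Rel_ideal x(1), of c]
    by (simp add: rook_yokonuma_hecke_def quotient_algebra_simps carrier_FactRing \<phi> ry.smult_hom
        span_algebra_def del: One_nat_def)
qed

end

section \<open>The tensor product of the field with \<open>H(M,U)\<close>\<close>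

section \<open>Extension of scalars\<close>

lemma pair_monoid_monoid:
  assumes "ring H"
  shows "monoid (pair_monoid H)"
proof -
  interpret ring H by fact
  show ?thesis by (rule monoidI) (auto simp: pair_monoid_def m_assoc mult.assoc)
qed

context framed_rook
begin

abbreviation H :: "('f mat \<Rightarrow> rat) ring" where "H \<equiv> framed_rook_algebra n"
abbreviation P :: "(int, 'k \<times> ('f mat \<Rightarrow> rat) \<Rightarrow> int) module" where "P \<equiv> pair_ring H"
abbreviation J :: "('k \<times> ('f mat \<Rightarrow> rat) \<Rightarrow> int) set" where "J \<equiv> Idl\<^bsub>P\<^esub> (biadditivity_relations H)"

definition rat_lin :: "('f mat \<Rightarrow> int) \<Rightarrow> 'f mat \<Rightarrow> rat" where
  "rat_lin c = (\<lambda>z. \<Sum>\<sigma>\<in>framed_rook_mats n. of_int (c \<sigma>) * rook_basis n \<sigma> z)"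

text \<open>The intended image of a pure tensor under the map to the span of the
  \<open>T_\<sigma>\<close>.\<close>

definition tens :: "'k \<times> ('f mat \<Rightarrow> rat) \<Rightarrow> 'f mat \<Rightarrow> 'k" where
  "tens = (\<lambda>(a, x) z. a * of_rat (x z))"

lemma H_simps: "carrier H = range rat_lin" "mult H = mult (mat_algebra n)" "add H = add (mat_algebra n)"
  "zero H = (\<lambda>_. 0)" "one H = rook_basis n (1\<^sub>m n)"
  by (auto simp: framed_rook_algebra_def matrix_monoid_algebra_def rat_lin_def monoid_algebra_simps)

sublocale H: ring H
  by (rule framed_rook_algebra_ring(1)[OF framed_rook_axioms])

sublocale P: ring P
  unfolding pair_ring_def by (rule monoid_algebra_ring[OF pair_monoid_monoid[OF H.ring_axioms]])

lemma tens_lin: "tens (a, rat_lin c) = lin (\<lambda>\<sigma>. a * of_int (c \<sigma>))"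
  by (intro ext) (simp add: tens_def rat_lin_def lin_def k_basis_def of_rat_sum of_rat_mult sum_distrib_left mult.assoc)

lemma H_support:
  assumes "x \<in> carrier H"
  shows "{z. x z \<noteq> 0} \<subseteq> carrier_mat n n"
proof
  fix z assume "z \<in> {z. x z \<noteq> 0}"
  moreover obtain c where "x = rat_lin c" using assms by (auto simp: H_simps)
  ultimately obtain \<sigma> where "\<sigma> \<in> framed_rook_mats n" "rook_basis n \<sigma> z \<noteq> 0"
    unfolding rat_lin_def by (auto elim!: sum.not_neutral_contains_not_neutral)
  then show "z \<in> carrier_mat n n"
    using dc_carrier[OF rook_carrier] by (auto simp: rook_basis_def Let_def split: if_splits)
qed

lemma tens_mult:
  assumes "x \<in> carrier H" "y \<in> carrier H"
  shows "tens (a * b, x \<otimes>\<^bsub>H\<^esub> y) = tens (a, x) \<otimes>\<^bsub>dc_algebra\<^esub> tens (b, y)"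
proof
  fix z
  have supp: "{z. tens (c, u) z \<noteq> 0} \<subseteq> carrier_mat n n" if "u \<in> carrier H" for c u
    using H_support[OF that] by (auto simp: tens_def)
  have "(x \<otimes>\<^bsub>H\<^esub> y) z = (\<Sum>u\<in>carrier_mat n n. \<Sum>v\<in>carrier_mat n n. if u * v = z then x u * y v else 0)"
    unfolding H_simps
    by (subst monoid_algebra_mult[OF finite_carrier_mat finite_carrier_mat])
      (use H_support assms in \<open>auto simp: ring_mat_simps\<close>)
  then have "tens (a * b, x \<otimes>\<^bsub>H\<^esub> y) z = (\<Sum>u\<in>carrier_mat n n. \<Sum>v\<in>carrier_mat n n.
      if u * v = z then tens (a, x) u * tens (b, y) v else 0)"
    by (simp add: tens_def of_rat_sum sum_distrib_left)
      (intro sum.cong refl, auto simp: tens_def of_rat_mult mult_ac)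
  also have "\<dots> = (tens (a, x) \<otimes>\<^bsub>dc_algebra\<^esub> tens (b, y)) z"
    unfolding dc_algebra_simps
    by (subst monoid_algebra_mult[OF finite_carrier_mat finite_carrier_mat supp[OF assms(1)] supp[OF assms(2)]])
      (simp add: ring_mat_simps)
  finally show "tens (a * b, x \<otimes>\<^bsub>H\<^esub> y) z = (tens (a, x) \<otimes>\<^bsub>dc_algebra\<^esub> tens (b, y)) z" .
qed

definition tens_hom :: "('k \<times> ('f mat \<Rightarrow> rat) \<Rightarrow> int) \<Rightarrow> 'f mat \<Rightarrow> 'k" where
  "tens_hom = lift_hom of_int tens"

lemma of_int_comm_ring_hom: "comm_ring_hom (of_int :: int \<Rightarrow> 'k)"
  by unfold_locales auto

lemma tens_hom_basis: "tens_hom (basis_elt p) = tens p"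
  unfolding tens_hom_def by (rule lift_hom_basis[OF of_int_comm_ring_hom])

lemma tens_one: "tens (a, \<one>\<^bsub>H\<^esub>) = a \<odot>\<^bsub>dc_algebra\<^esub> \<one>\<^bsub>dc_algebra\<^esub>"
  unfolding one_k_basis
  by (simp add: tens_def H_simps k_basis_def dc_algebra_simps monoid_algebra_simps)

lemma tens_closed: "x \<in> carrier H \<Longrightarrow> tens (a, x) \<in> carrier dc_algebra"
  by (auto simp: H_simps tens_lin)

lemma tens_hom_ring_hom: "tens_hom \<in> Ring.ring_hom P dc_algebra"
  unfolding tens_hom_def pair_ring_def
proof (rule lift_hom_ring_hom[OF of_int_comm_ring_hom pair_monoid_monoid[OF H.ring_axioms]
      B.k_algebra_axioms, where G' = "ring_mat TYPE('f) n ()"])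
  show "tens \<one>\<^bsub>pair_monoid H\<^esub> = \<one>\<^bsub>dc_algebra\<^esub>"
    using tens_one[of 1] by (simp add: pair_monoid_def B.smult_one)
qed (auto simp: dc_algebra_simps(1-4) dc_algebra_carrier pair_monoid_def tens_closed tens_mult)

sublocale tens: ring_hom_ring P dc_algebra tens_hom
  by (rule ring_hom_ringI2[OF P.ring_axioms B.ring_axioms tens_hom_ring_hom])

lemma P_basis: "x \<in> carrier H \<Longrightarrow> basis_elt (a, x) \<in> carrier P"
  unfolding pair_ring_def by (rule basis_elt_closed) (simp add: pair_monoid_def)

lemma P_simps: "f \<oplus>\<^bsub>P\<^esub> h = (\<lambda>y. f y + h y)" "\<zero>\<^bsub>P\<^esub> = (\<lambda>_. 0)"
  by (simp_all add: pair_ring_def monoid_algebra_simps)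

lemma P_minus: "f \<in> carrier P \<Longrightarrow> h \<in> carrier P \<Longrightarrow> f \<ominus>\<^bsub>P\<^esub> h = (\<lambda>y. f y - h y)"
  unfolding pair_ring_def by (rule monoid_algebra_minus[OF pair_monoid_monoid[OF H.ring_axioms]])

lemma minus_kernel:
  assumes "f \<in> carrier P" "h \<in> carrier P" "tens_hom f = tens_hom h"
  shows "f \<ominus>\<^bsub>P\<^esub> h \<in> a_kernel P dc_algebra tens_hom"
  using assms unfolding a_kernel_def' by (simp add: P.minus_eq B.r_neg)

lemma biadditivity_kernel: "biadditivity_relations H \<subseteq> a_kernel P dc_algebra tens_hom"
proof
  fix f :: "'k \<times> ('f mat \<Rightarrow> rat) \<Rightarrow> int" assume "f \<in> biadditivity_relations H"
  then show "f \<in> a_kernel P dc_algebra tens_hom"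
  proof cases
    case (left x a b)
    have "tens (a + b, x) = tens (a, x) \<oplus>\<^bsub>dc_algebra\<^esub> tens (b, x)"
      by (intro ext) (simp add: tens_def dc_algebra_simps monoid_algebra_simps distrib_right)
    then show ?thesis
      unfolding left(1) using P_basis[OF left(2)]
      by (intro minus_kernel P.a_closed) (simp_all add: tens_hom_basis)
  next
    case (right x y a)
    have "tens (a, x \<oplus>\<^bsub>H\<^esub> y) = tens (a, x) \<oplus>\<^bsub>dc_algebra\<^esub> tens (a, y)"
      by (intro ext) (simp add: tens_def H_simps dc_algebra_simps monoid_algebra_simps of_rat_add distrib_left)
    then show ?thesis
      unfolding right(1) using P_basis[OF right(2)] P_basis[OF right(3)] P_basis[OF H.a_closed[OF right(2,3)]]
      by (intro minus_kernel P.a_closed) (simp_all add: tens_hom_basis)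
  qed
qed

lemma biadditivity_carrier: "biadditivity_relations H \<subseteq> carrier P"
  using biadditivity_kernel unfolding a_kernel_def' by blast

lemma J_ideal: "ideal J P"
  by (rule P.genideal_ideal[OF biadditivity_carrier])

sublocale J: ideal J P
  by (rule J_ideal)

lemma J_kernel: "J \<subseteq> a_kernel P dc_algebra tens_hom"
  by (rule P.genideal_minimal[OF tens.kernel_is_ideal biadditivity_kernel])

lemma J_zero: "(\<lambda>_. 0) \<in> J"
  using J.zero_closed by (simp add: P_simps)

text \<open>Membership in \<open>J\<close> is phrased for pointwise expressions, so that the
  manipulations of tensors below become ring normalisation of integer valued functions.\<close>

lemma J_diff:
  assumes "f \<in> J" "h \<in> J"
  shows "(\<lambda>y. f y - h y) \<in> J"
proof -
  have "f \<ominus>\<^bsub>P\<^esub> h \<in> J" unfolding P.minus_eq using assms by (intro J.a_closed J.a_inv_closed)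
  then show ?thesis unfolding P_minus[OF J.Icarr[OF assms(1)] J.Icarr[OF assms(2)]] .
qed

lemma J_add: "f \<in> J \<Longrightarrow> h \<in> J \<Longrightarrow> (\<lambda>y. f y + h y) \<in> J"
  using J.a_closed[of f h] by (simp add: P_simps)

lemma J_minus: "f \<in> J \<Longrightarrow> (\<lambda>y. - f y) \<in> J"
  using J_diff[OF J_zero] by simp

lemma J_sum: "finite F \<Longrightarrow> (\<And>\<sigma>. \<sigma> \<in> F \<Longrightarrow> f \<sigma> \<in> J) \<Longrightarrow> (\<lambda>y. \<Sum>\<sigma>\<in>F. f \<sigma> y) \<in> J"
  by (induction rule: finite_induct) (auto simp: J_zero J_add)

lemma J_mult: "f \<in> J \<Longrightarrow> (\<lambda>y. k * f y) \<in> J"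
proof (induction k rule: int_induct[where k = 0])
  case base
  show ?case by (simp add: J_zero)
next
  case (step1 k)
  from J_add[OF step1.IH step1.prems] step1.prems show ?case by (simp add: algebra_simps)
next
  case (step2 k)
  from J_diff[OF step2.IH step2.prems] step2.prems show ?case by (simp add: algebra_simps)
qed

lemma J_left:
  assumes "x \<in> carrier H"
  shows "(\<lambda>y. basis_elt (a + b, x) y - basis_elt (a, x) y - basis_elt (b, x) y) \<in> J"
proof -
  have "basis_elt (a + b, x) \<ominus>\<^bsub>P\<^esub> (basis_elt (a, x) \<oplus>\<^bsub>P\<^esub> basis_elt (b, x)) \<in> J"
    by (rule subsetD[OF P.genideal_self[OF biadditivity_carrier]]) (rule biadditivity_relations.left[OF assms])
  then show ?thesis
    using P_minus[OF P_basis[OF assms] P.a_closed[OF P_basis[OF assms] P_basis[OF assms]], of "a + b" a b]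
    by (simp add: P_simps algebra_simps)
qed

lemma J_right:
  assumes "x \<in> carrier H" "x' \<in> carrier H"
  shows "(\<lambda>y. basis_elt (a, \<lambda>z. x z + x' z) y - basis_elt (a, x) y - basis_elt (a, x') y) \<in> J"
proof -
  have s: "x \<oplus>\<^bsub>H\<^esub> x' = (\<lambda>z. x z + x' z)" by (simp add: H_simps monoid_algebra_simps)
  have "basis_elt (a, x \<oplus>\<^bsub>H\<^esub> x') \<ominus>\<^bsub>P\<^esub> (basis_elt (a, x) \<oplus>\<^bsub>P\<^esub> basis_elt (a, x')) \<in> J"
    by (rule subsetD[OF P.genideal_self[OF biadditivity_carrier]]) (rule biadditivity_relations.right[OF assms])
  then show ?thesis
    using P_minus[OF P_basis[OF H.a_closed[OF assms]] P.a_closed[OF P_basis[OF assms(1)] P_basis[OF assms(2)]], of a a a]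
    by (simp add: P_simps s algebra_simps)
qed

text \<open>Additivity applied to \<open>0 + 0 = 0\<close>.\<close>

lemma J_zero_left: "x \<in> carrier H \<Longrightarrow> basis_elt (0, x) \<in> J"
  using J_minus[OF J_left[of x 0 0]] by simp

lemma J_zero_right: "basis_elt (a, \<lambda>_. 0) \<in> J"
  using J_minus[OF J_right[of "\<lambda>_. 0" "\<lambda>_. 0" a]] H.zero_closed by (simp add: H_simps(4))

lemma H_int_mult: "x \<in> carrier H \<Longrightarrow> (\<lambda>z. of_int k * x z) \<in> carrier H"
  by (auto simp: H_simps rat_lin_def sum_distrib_left mult.assoc[symmetric] of_int_mult[symmetric]
      simp del: of_int_mult)

text \<open>Integers move across the tensor sign. The induction leaves 0 in both directions, each
  step using one relation on either side of the tensor.\<close>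

lemma J_int_right:
  assumes x: "x \<in> carrier H"
  shows "(\<lambda>y. basis_elt (a, \<lambda>z. of_int k * x z) y - basis_elt (a * of_int k, x) y) \<in> J"
proof (induction k rule: int_induct[where k = 0])
  case base
  show ?case using J_diff[OF J_zero_right J_zero_left[OF x]] by simp
next
  case (step1 k)
  have e: "(\<lambda>z. of_int (k + 1) * x z) = (\<lambda>z. of_int k * x z + x z)" "a * of_int (k + 1) = a * of_int k + a"
    by (simp_all add: algebra_simps)
  from J_diff[OF J_add[OF J_right[OF H_int_mult[OF x, of k] x, of a] step1.IH] J_left[OF x, of "a * of_int k" a]]
  show ?case unfolding e by (simp add: algebra_simps)
next
  case (step2 k)
  have e: "(\<lambda>z. of_int k * x z) = (\<lambda>z. of_int (k - 1) * x z + x z)" "a * of_int k = a * of_int (k - 1) + a"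
    by (simp_all add: algebra_simps)
  from J_diff[OF J_add[OF step2.IH[unfolded e] J_left[OF x, of "a * of_int (k - 1)" a]]
      J_right[OF H_int_mult[OF x, of "k - 1"] x, of a]]
  show ?case by (simp add: algebra_simps)
qed

lemma J_int_left:
  assumes x: "x \<in> carrier H"
  shows "(\<lambda>y. k * basis_elt (a, x) y - basis_elt (of_int k * a, x) y) \<in> J"
proof (induction k rule: int_induct[where k = 0])
  case base
  show ?case using J_minus[OF J_zero_left[OF x]] by simp
next
  case (step1 k)
  have e: "of_int (k + 1) * a = of_int k * a + a" by (simp add: algebra_simps)
  from J_diff[OF step1.IH J_left[OF x, of "of_int k * a" a]]
  show ?case unfolding e by (simp add: algebra_simps)
next
  case (step2 k)
  have e: "of_int k * a = of_int (k - 1) * a + a" by (simp add: algebra_simps)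
  from J_add[OF step2.IH[unfolded e] J_left[OF x, of "of_int (k - 1) * a" a]]
  show ?case by (simp add: algebra_simps)
qed

text \<open>The sum of the pure tensors of \<open>c \<sigma>\<close> and \<open>T_\<sigma>\<close>.
  As a formal sum of pairs it is not additive in \<open>c\<close>; it becomes so modulo
  \<open>J\<close>.\<close>

definition tensor_normal :: "('f mat \<Rightarrow> 'k) \<Rightarrow> 'k \<times> ('f mat \<Rightarrow> rat) \<Rightarrow> int" where
  "tensor_normal c = (\<lambda>y. \<Sum>\<sigma>\<in>framed_rook_mats n. basis_elt (c \<sigma>, rook_basis n \<sigma>) y)"

lemma rook_basis_H:
  assumes "\<sigma> \<in> framed_rook_mats n"
  shows "rook_basis n \<sigma> \<in> carrier H"
proof -
  have "rook_basis n \<sigma> = rat_lin (basis_elt \<sigma>)"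
  proof
    fix z
    have "rat_lin (basis_elt \<sigma>) z = (\<Sum>\<tau>\<in>{\<sigma>}. of_int (basis_elt \<sigma> \<tau>) * rook_basis n \<tau> z)"
      unfolding rat_lin_def
      by (rule sum.mono_neutral_right) (use assms finite_rook in \<open>auto simp: basis_elt_apply\<close>)
    then show "rook_basis n \<sigma> z = rat_lin (basis_elt \<sigma>) z" by (simp add: basis_elt_apply)
  qed
  then show ?thesis by (simp add: H_simps)
qed

lemma tensor_normal_add:
  "(\<lambda>y. tensor_normal (\<lambda>\<sigma>. c \<sigma> + c' \<sigma>) y - tensor_normal c y - tensor_normal c' y) \<in> J"
proof -
  have "(\<lambda>y. \<Sum>\<sigma>\<in>framed_rook_mats n. basis_elt (c \<sigma> + c' \<sigma>, rook_basis n \<sigma>) y -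
      basis_elt (c \<sigma>, rook_basis n \<sigma>) y - basis_elt (c' \<sigma>, rook_basis n \<sigma>) y) \<in> J"
    by (rule J_sum[OF finite_rook], rule J_left[OF rook_basis_H])
  then show ?thesis by (simp add: tensor_normal_def sum_subtractf)
qed

lemma tensor_normal_mult: "(\<lambda>y. k * tensor_normal c y - tensor_normal (\<lambda>\<sigma>. of_int k * c \<sigma>) y) \<in> J"
proof -
  have "(\<lambda>y. \<Sum>\<sigma>\<in>framed_rook_mats n. k * basis_elt (c \<sigma>, rook_basis n \<sigma>) y -
      basis_elt (of_int k * c \<sigma>, rook_basis n \<sigma>) y) \<in> J"
    by (rule J_sum[OF finite_rook], rule J_int_left[OF rook_basis_H])
  then show ?thesis by (simp add: tensor_normal_def sum_subtractf sum_distrib_left)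
qed

text \<open>Additivity on the right splits the integral combination into its terms, and then the
  integers are moved to the left factor.\<close>

lemma tensor_normal_basis:
  "(\<lambda>y. basis_elt (a, rat_lin c) y - tensor_normal (\<lambda>\<sigma>. a * of_int (c \<sigma>)) y) \<in> J"
proof -
  have part: "(\<lambda>z. \<Sum>\<sigma>\<in>F. of_int (c \<sigma>) * rook_basis n \<sigma> z) \<in> carrier H"
    if "finite F" "F \<subseteq> framed_rook_mats n" for F
    using that
  proof (induction rule: finite_induct)
    case empty
    show ?case using H.zero_closed by (simp add: H_simps(4))
  next
    case (insert \<tau> F)
    then show ?case
      using H.a_closed[OF H_int_mult[OF rook_basis_H, of \<tau> "c \<tau>"]]
      by (simp add: H_simps(3) monoid_algebra_simps)
  qed
  have "(\<lambda>y. basis_elt (a, \<lambda>z. \<Sum>\<sigma>\<in>F. of_int (c \<sigma>) * rook_basis n \<sigma> z) y -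
      (\<Sum>\<sigma>\<in>F. basis_elt (a * of_int (c \<sigma>), rook_basis n \<sigma>) y)) \<in> J"
    if "finite F" "F \<subseteq> framed_rook_mats n" for F
    using that
  proof (induction rule: finite_induct)
    case empty
    show ?case using J_zero_right[of a] by simp
  next
    case (insert \<tau> F)
    note T = rook_basis_H[of \<tau>]
    have F: "F \<subseteq> framed_rook_mats n" and \<tau>: "\<tau> \<in> framed_rook_mats n" using insert.prems by auto
    from J_add[OF J_add[OF J_right[OF H_int_mult[OF T[OF \<tau>], of "c \<tau>"] part[OF insert.hyps(1) F], of a]
        J_int_right[OF T[OF \<tau>], of a "c \<tau>"]] insert.IH[OF F]]
    show ?case using insert.hyps by (simp add: algebra_simps)
  qed
  from this[OF finite_rook order_refl] show ?thesis by (simp add: tensor_normal_def rat_lin_def)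
qed

lemma tensor_normal_form:
  assumes "f \<in> carrier P"
  shows "\<exists>c. (\<lambda>y. f y - tensor_normal c y) \<in> J"
  using assms[unfolded pair_ring_def]
proof (induction rule: monoid_algebra_induct)
  case zero
  have "(\<lambda>y. tensor_normal (\<lambda>_. 0) y) \<in> J"
    unfolding tensor_normal_def by (rule J_sum[OF finite_rook J_zero_left[OF rook_basis_H]])
  from J_minus[OF this] show ?case by (intro exI[of _ "\<lambda>_. 0"]) simp
next
  case (add f k p)
  obtain c where c: "(\<lambda>y. f y - tensor_normal c y) \<in> J" using add by blast
  obtain a d where p: "p = (a, rat_lin d)" using add by (cases p) (auto simp: pair_monoid_def H_simps)
  let ?d = "\<lambda>\<sigma>. of_int k * (a * of_int (d \<sigma>))"
  \<comment> \<open>Four congruences are combined: the one for \<open>f\<close>, the normal form of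
    the pure tensor \<open>p\<close> multiplied by \<open>k\<close>, the passage of \<open>k\<close>
    into the coefficients, and the addition of the two coefficient functions.\<close>
  from J_diff[OF J_add[OF J_add[OF c J_mult[OF tensor_normal_basis[of a d], of k]] tensor_normal_mult[of k "\<lambda>\<sigma>. a * of_int (d \<sigma>)"]]
      tensor_normal_add[of c ?d]]
  have "(\<lambda>y. f y + k * basis_elt p y - tensor_normal (\<lambda>\<sigma>. c \<sigma> + ?d \<sigma>) y) \<in> J"
    by (simp add: p algebra_simps)
  then show ?case by blast
qed

lemma tens_hom_normal: "tensor_normal c \<in> carrier P" "tens_hom (tensor_normal c) = lin c"
proof -
  have "(\<lambda>y. \<Sum>\<sigma>\<in>F. basis_elt (c \<sigma>, rook_basis n \<sigma>) y) \<in> carrier P \<and>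
      tens_hom (\<lambda>y. \<Sum>\<sigma>\<in>F. basis_elt (c \<sigma>, rook_basis n \<sigma>) y) = (\<lambda>z. \<Sum>\<sigma>\<in>F. c \<sigma> * k_basis \<sigma> z)"
    if "finite F" "F \<subseteq> framed_rook_mats n" for F
    using that
  proof (induction rule: finite_induct)
    case empty
    show ?case using P.zero_closed tens.hom_zero by (simp add: P_simps dc_algebra_simps monoid_algebra_simps)
  next
    case (insert \<tau> F)
    let ?f = "\<lambda>y. \<Sum>\<sigma>\<in>F. basis_elt (c \<sigma>, rook_basis n \<sigma>) y"
    let ?b = "basis_elt (c \<tau>, rook_basis n \<tau>) :: 'k \<times> ('f mat \<Rightarrow> rat) \<Rightarrow> int"
    have b: "?b \<in> carrier P" using insert.prems by (intro P_basis rook_basis_H) simp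
    have f: "?f \<in> carrier P" using insert by simp
    have eq: "(\<lambda>y. \<Sum>\<sigma>\<in>insert \<tau> F. basis_elt (c \<sigma>, rook_basis n \<sigma>) y) = ?b \<oplus>\<^bsub>P\<^esub> ?f"
      using insert.hyps by (simp add: P_simps)
    have "tens_hom (?b \<oplus>\<^bsub>P\<^esub> ?f) = tens (c \<tau>, rook_basis n \<tau>) \<oplus>\<^bsub>dc_algebra\<^esub> tens_hom ?f"
      using b f by (simp add: tens_hom_basis)
    also have "\<dots> = (\<lambda>z. \<Sum>\<sigma>\<in>insert \<tau> F. c \<sigma> * k_basis \<sigma> z)"
      using insert by (simp add: dc_algebra_simps monoid_algebra_simps tens_def k_basis_def)
    finally show ?case using P.a_closed[OF b f] unfolding eq by simp
  qed
  from this[OF finite_rook order_refl]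
  show "tensor_normal c \<in> carrier P" "tens_hom (tensor_normal c) = lin c"
    unfolding tensor_normal_def lin_def by blast+
qed

lemma tens_coset:
  assumes "f \<in> carrier P"
  shows "\<exists>c. J +>\<^bsub>P\<^esub> f = J +>\<^bsub>P\<^esub> tensor_normal c \<and> tens_hom f = lin c"
proof -
  obtain c where "(\<lambda>y. f y - tensor_normal c y) \<in> J" using tensor_normal_form[OF assms] by blast
  then have c: "f \<ominus>\<^bsub>P\<^esub> tensor_normal c \<in> J" using P_minus[OF assms tens_hom_normal(1)] by simp
  then have "tens_hom (f \<ominus>\<^bsub>P\<^esub> tensor_normal c) = \<zero>\<^bsub>dc_algebra\<^esub>"
    using J_kernel unfolding a_kernel_def' by blast
  then have "tens_hom f \<ominus>\<^bsub>dc_algebra\<^esub> lin c = \<zero>\<^bsub>dc_algebra\<^esub>"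
    using assms tens_hom_normal by (simp add: P.minus_eq B.minus_eq)
  then have "tens_hom f = lin c" using assms by simp
  then show ?thesis using P.quotient_eq_iff_same_a_r_cos[OF J_ideal assms tens_hom_normal(1)] c by blast
qed

text \<open>The pattern of \<open>ry_kernel\<close>: the normal form of \<open>f\<close> maps to
  \<open>lin c\<close>, and when this is zero each of its summands is a tensor with left factor 0
  and lies in \<open>J\<close>.\<close>

lemma tens_kernel: "a_kernel P dc_algebra tens_hom = J"
proof (rule equalityI[OF subsetI J_kernel])
  fix f assume "f \<in> a_kernel P dc_algebra tens_hom"
  then have f: "f \<in> carrier P" "tens_hom f = \<zero>\<^bsub>dc_algebra\<^esub>" unfolding a_kernel_def' by blast+
  obtain c where c: "J +>\<^bsub>P\<^esub> f = J +>\<^bsub>P\<^esub> tensor_normal c" "tens_hom f = lin c"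
    using tens_coset[OF f(1)] by blast
  have "lin c = lin (\<lambda>_. 0)" using c(2) f(2) lin_zero by simp
  from lin_eqD[OF this] have z: "c \<sigma> = 0" if "\<sigma> \<in> framed_rook_mats n" for \<sigma> using that by simp
  have "(\<lambda>y. \<Sum>\<sigma>\<in>framed_rook_mats n. basis_elt (c \<sigma>, rook_basis n \<sigma>) y) \<in> J"
    by (rule J_sum[OF finite_rook]) (use z J_zero_left[OF rook_basis_H] in simp)
  then have nf: "tensor_normal c \<in> J" by (simp add: tensor_normal_def)
  have "f \<ominus>\<^bsub>P\<^esub> tensor_normal c \<in> J"
    using P.quotient_eq_iff_same_a_r_cos[OF J_ideal f(1) tens_hom_normal(1)] c(1) by simp
  then have "(\<lambda>y. f y - tensor_normal c y) \<in> J" using P_minus[OF f(1) tens_hom_normal(1)] by simp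
  from J_add[OF this nf] show "f \<in> J" by simp
qed

lemma tens_image: "tens_hom ` carrier P = range lin"
proof (intro equalityI subsetI)
  fix y assume "y \<in> tens_hom ` carrier P"
  then show "y \<in> range lin" using tens_coset by blast
next
  fix y assume "y \<in> range lin"
  then obtain c where "y = lin c" by blast
  then show "y \<in> tens_hom ` carrier P"
    using tens_hom_normal[of c] by (intro image_eqI[of _ _ "tensor_normal c"]) simp_all
qed

abbreviation KH :: "('k, ('k \<times> ('f mat \<Rightarrow> rat) \<Rightarrow> int) set) module" where "KH \<equiv> extend_scalars H"

lemma KH_simps: "carrier KH = carrier (P Quot J)" "mult KH = mult (P Quot J)" "one KH = one (P Quot J)"
  "zero KH = zero (P Quot J)" "add KH = add (P Quot J)"
  by (simp_all add: extend_scalars_def tensor_ring_def)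

theorem tensor_iso:
  defines "\<phi> \<equiv> \<lambda>X. the_elem (tens_hom ` X)"
  shows "\<phi> \<in> ring_iso KH span_algebra"
    and "\<And>c X. X \<in> carrier KH \<Longrightarrow> c \<odot>\<^bsub>KH\<^esub> X \<in> carrier KH \<and> \<phi> (c \<odot>\<^bsub>KH\<^esub> X) = c \<odot>\<^bsub>span_algebra\<^esub> \<phi> X"
proof -
  have iso: "\<phi> \<in> ring_iso (P Quot J) (dc_algebra\<lparr>carrier := range lin\<rparr>)"
    using tens.FactRing_iso_set_aux unfolding tens_kernel tens_image \<phi>_def .
  then show "\<phi> \<in> ring_iso KH span_algebra"
    by (simp add: ring_iso_def Ring.ring_hom_def KH_simps span_algebra_def)
  have \<phi>: "\<phi> (J +>\<^bsub>P\<^esub> f) = tens_hom f" if "f \<in> carrier P" for f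
    using tens.the_elem_simp[OF that] unfolding tens_kernel \<phi>_def .
  fix c X assume X: "X \<in> carrier KH"
  \<comment> \<open>The scalar \<open>c\<close> acts as multiplication by the pure tensor of
    \<open>c\<close> and 1, which is sent to \<open>c\<close> times the unit of the corner.\<close>
  let ?t = "J +>\<^bsub>P\<^esub> basis_elt (c, \<one>\<^bsub>H\<^esub>)"
  have t: "basis_elt (c, \<one>\<^bsub>H\<^esub>) \<in> carrier P" by (intro P_basis) simp
  have tQ: "?t \<in> carrier (P Quot J)" using t by (auto simp: carrier_FactRing)
  have s: "c \<odot>\<^bsub>KH\<^esub> X = ?t \<otimes>\<^bsub>P Quot J\<^esub> X"
    by (simp add: extend_scalars_def pure_tensor_def tensor_ring_def)
  have XQ: "X \<in> carrier (P Quot J)" using X by (simp add: KH_simps)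
  then obtain f where f: "f \<in> carrier P" "X = J +>\<^bsub>P\<^esub> f" by (auto simp: carrier_FactRing)
  interpret Q: ring "P Quot J" by (rule J.quotient_is_ring)
  have "\<phi> (?t \<otimes>\<^bsub>P Quot J\<^esub> X) = \<phi> ?t \<otimes>\<^bsub>dc_algebra\<^esub> \<phi> X"
    using iso tQ XQ by (simp add: ring_iso_def Ring.ring_hom_def)
  also have "\<dots> = (c \<odot>\<^bsub>dc_algebra\<^esub> \<one>\<^bsub>dc_algebra\<^esub>) \<otimes>\<^bsub>dc_algebra\<^esub> tens_hom f"
    by (simp add: f \<phi> t tens_hom_basis tens_one)
  also have "\<dots> = c \<odot>\<^bsub>dc_algebra\<^esub> \<phi> X"
    using f by (simp add: B.smult_mult_left \<phi>)
  finally show "c \<odot>\<^bsub>KH\<^esub> X \<in> carrier KH \<and> \<phi> (c \<odot>\<^bsub>KH\<^esub> X) = c \<odot>\<^bsub>span_algebra\<^esub> \<phi> X"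
    using tQ XQ by (simp add: s KH_simps span_algebra_def)
qed

theorem algebra_iso: "is_algebra_iso KH (RY CARD('f))"
proof (rule is_algebra_iso_common_target[OF _ _ tensor_iso(1) ry_iso(1)])
  show "ring KH" by (rule ring_carrier_cong[OF J.quotient_is_ring]) (simp_all add: KH_simps)
  show "ring (RY CARD('f))"
    unfolding rook_yokonuma_hecke_def by (rule ring_quotient_algebra[OF Rel_ideal])
qed (fact tensor_iso(2) ry_iso(2))+

end

theorem theorem4p7:
  fixes p e q n :: nat
  assumes "prime p" and "odd p" and "e \<ge> 1" and "q = p ^ e"
    and "CARD('f::{field,finite}) = q"
    and "n \<ge> 1"
  shows "is_algebra_iso
           (extend_scalars (framed_rook_algebra n :: ('f mat \<Rightarrow> rat) ring)
              :: ('k::field_char_0, ('k \<times> ('f mat \<Rightarrow> rat) \<Rightarrow> int) set) module)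
           (rook_yokonuma_hecke (q - 1) n (of_nat q :: 'k))"
proof -
  \<comment> \<open>Any primitive root will do; it decides which diagonal matrices the
    \<open>F_i\<close> are sent to.\<close>
  obtain g :: 'f where "primitive g" using primitive_exists by blast
  with assms have "framed_rook n g" by (simp add: framed_rook_def)
  then interpret framed_rook n g "TYPE('k)" .
  show ?thesis using algebra_iso assms(5) by simp
qed

end
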